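(* Let $\mathcal S$ be an embedded disk-type capillary surface of constant mean curvature $H$ (of arbitrary sign) with respect to a support configuration, with exactly $V=3$ vertices, satisfying the local graph property (Vertex Condition) at each vertex, as described in the context. Suppose that the support surface (after deleting or replacing planes not contacted by $\mathcal S$) is a cylinder: a cylindrical container whose side walls lie in three planes $\Pi_1,\Pi_2,\Pi_3$, no two of which are parallel, all parallel to a common generating direction, and which is closed at one end by a planar base covered by the liquid. Suppose $\mathcal S$ meets $\Pi_1,\Pi_2,\Pi_3$ in constant contact angles $\gamma_1,\gamma_2,\gamma_3$ such that each pair $(\gamma_j,\gamma_k)$, $j\ne k$, lies either in the interior of $\mathcal Q_{jk}$ or in the interior of one of the segments $\partial\mathcal Q_{jk}\cap\partial\mathcal D_{1,jk}^{\pm}$. Then $\mathcal S$ is metrically spherical, i.e. a portion of a round sphere (a portion of a plane if $H=0$).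
   Context: Support configuration. A finite collection of planes in $\mathbb R^3$, no three with a common line, together containing the boundary of an open connected region $\mathcal I$. Edges are the sets $\mathcal L_{jk}\cap\bar{\mathcal I}$, where $\mathcal L_{jk}=\Pi_j\cap\Pi_k$; faces are the components of $\partial\mathcal I$ minus the edges. The angle $2\alpha_{jk}$ between intersecting support planes, measured inside $\mathcal I$, satisfies $0<2\alpha_{jk}<\pi$. Deleting or replacing support planes which $\mathcal S$ does not contact does not change the conditions on $\mathcal S$. Here the three side walls bound an infinite prism with triangular cross section, and the drop (liquid) is the region of the prism between $\mathcal S$ and the base. Surface. $D$ is the closed unit disk, $v_1,v_2,v_3\in\partial D$, $A$ is the union of the three open arcs of $\partial D$ between consecutive $v_i$, $D_v=D\setminus\{v_1,v_2,v_3\}$. $\mathcal S=\phi(D_v)\subset\bar{\mathcal I}$ with $\phi$ a local homeomorphism (and $\mathcal S$ embedded); $\phi(\mathrm{int}\,D)\subset\mathcal I$; each arc is mapped into one face, as a differentiable curve (contact line); and $\mathcal S$ is locally a $C^2$ surface in its interior and up to the contact lines. $\mathcal S$ has constant mean curvature: $\Delta\vec x=2H\vec N$, where $\Delta$ is the intrinsic Laplacian and $\vec N$ the unit normal pointing out of the drop. The contact angle $\gamma_j\in(0,\pi)$ on $\Pi_j$ is constant and measured interior to the drop: $\vec N\cdot\vec n_j=-\cos\gamma_j$, where $\vec n_j$ is the unit normal of $\Pi_j$ pointing out of the prism. Local graph property (Vertex Condition). To each $v_i$ there is associated a pair $\Pi_j,\Pi_k$ of intersecting support planes, a neighborhood $B$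 of $v_i$ in $D$, a plane $\Pi$ orthogonal to $\Pi_j$ and $\Pi_k$, and a neighborhood $\mathcal N$ of $O_{jk}=\mathcal L_{jk}\cap\Pi$ in $\Pi\cap\bar{\mathcal I}$ such that $\phi(B\setminus\{v_i\})$ is the graph of a function over $\mathcal N\setminus\{O_{jk}\}$; no growth condition at $O_{jk}$ is imposed. The vertices lie in this sense on the three edges $\mathcal L_{12},\mathcal L_{23},\mathcal L_{31}$, one on each. For two vertices with the same plane pair (if any) the corresponding graph functions $u,u'$ are assumed to satisfy: $|u-u'|$ is bounded away from zero along some sequence of points tending to $O_{jk}$. Data sets. In $[0,\pi]^2$: $\mathcal Q_{jk}=\{|\gamma_j+\gamma_k-\pi|\le2\alpha_{jk},\ |\gamma_j-\gamma_k|\le\pi-2\alpha_{jk}\}$, and $\mathcal D^{\pm}_{1,jk}$ are the two components of $\{|\gamma_j+\gamma_k-\pi|>2\alpha_{jk}\}$. The interiors of the segments $\partial\mathcal Q_{jk}\cap\partial\mathcal D^{\pm}_{1,jk}$ are the sets where $|\gamma_j+\gamma_k-\pi|=2\alpha_{jk}$ and $|\gamma_j-\gamma_k|<\pi-2\alpha_{jk}$. *)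

theory Defs
  imports "HOL-Analysis.Analysis"
begin

section \<open>Support configurations\<close>

definition plane :: "real^3 \<Rightarrow> real \<Rightarrow> (real^3) set" where
  "plane a c = {x. a \<bullet> x = c}"

text \<open>For unit vectors \<open>a\<close>, \<open>a'\<close> this is the dihedral angle of the wedge
  \<open>{x. a \<bullet> x < c \<and> a' \<bullet> x < c'}\<close>, measured inside the wedge: the two vectors whose angle is taken are
  orthogonal to the edge, the first lies in the face with outer normal \<open>a\<close>, the second in
  the face with outer normal \<open>a'\<close>, and both point away from the edge into the bounding half planes.\<close>

definition dihedral_angle :: "real^3 \<Rightarrow> real^3 \<Rightarrow> real" where
  "dihedral_angle a a' =
     (let t = (a \<bullet> a') *\<^sub>R a - a'; t' = (a \<bullet> a') *\<^sub>R a' - a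
      in arccos ((t \<bullet> t') / (norm t * norm t')))"

definition support_configuration :: "(real^3) set set \<Rightarrow> (real^3) set \<Rightarrow> bool" where
  "support_configuration Ps I \<longleftrightarrow>
     finite Ps \<and> (\<forall>P\<in>Ps. affine P \<and> aff_dim P = 2) \<and>
     (\<forall>P\<in>Ps. \<forall>Q\<in>Ps. \<forall>R\<in>Ps. P \<noteq> Q \<and> Q \<noteq> R \<and> P \<noteq> R \<longrightarrow>
        \<not> (\<exists>L. affine L \<and> aff_dim L = 1 \<and> L \<subseteq> P \<inter> Q \<inter> R)) \<and>
     open I \<and> connected I \<and> I \<noteq> {} \<and> frontier I \<subseteq> \<Union>Ps"

definition edges :: "(real^3) set set \<Rightarrow> (real^3) set \<Rightarrow> (real^3) set set" where
  "edges Ps I = {P \<inter> Q \<inter> closure I | P Q. P \<in> Ps \<and> Q \<in> Ps \<and> P \<noteq> Q}"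

definition faces :: "(real^3) set set \<Rightarrow> (real^3) set \<Rightarrow> (real^3) set set" where
  "faces Ps I = components (frontier I - \<Union>(edges Ps I))"

subsection \<open>Triangular cylinder closed at one end by a plane\<close>

definition prism :: "(3 \<Rightarrow> real^3) \<Rightarrow> (3 \<Rightarrow> real) \<Rightarrow> (real^3) set" where
  "prism n c = {x. \<forall>j. n j \<bullet> x < c j}"

definition container ::
    "(3 \<Rightarrow> real^3) \<Rightarrow> (3 \<Rightarrow> real) \<Rightarrow> real^3 \<Rightarrow> real \<Rightarrow> (real^3) set" where
  "container n c m b = prism n c \<inter> {x. m \<bullet> x < b}"

definition container_planes ::
    "(3 \<Rightarrow> real^3) \<Rightarrow> (3 \<Rightarrow> real) \<Rightarrow> real^3 \<Rightarrow> real \<Rightarrow> (real^3) set set" where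
  "container_planes n c m b = insert (plane m b) (range (\<lambda>j. plane (n j) (c j)))"

text \<open>\<open>n j\<close> are the outer unit normals of the side walls, \<open>d\<close> is the generating direction, and
  \<open>plane m b\<close> contains the base, with outer unit normal \<open>m\<close>; the base may be oblique. Three pairwise nonparallel
  half planes with nonempty bounded intersection bound a triangle, so the last
  two conjuncts make the cross section triangular.\<close>

definition cylindrical_container ::
    "(3 \<Rightarrow> real^3) \<Rightarrow> (3 \<Rightarrow> real) \<Rightarrow> real^3 \<Rightarrow> real^3 \<Rightarrow> real \<Rightarrow> bool" where
  "cylindrical_container n c d m b \<longleftrightarrow>
     (\<forall>j. norm (n j) = 1) \<and> norm d = 1 \<and> (\<forall>j. n j \<bullet> d = 0) \<and>
     (\<forall>j k. j \<noteq> k \<longrightarrow> cross3 (n j) (n k) \<noteq> 0) \<and> norm m = 1 \<and> m \<bullet> d \<noteq> 0 \<and>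
     prism n c \<noteq> {} \<and> bounded (prism n c \<inter> plane d 0)"

section \<open>Surfaces of class C2 with boundary\<close>

definition partial :: "2 \<Rightarrow> (real^2 \<Rightarrow> 'a::real_normed_vector) \<Rightarrow> real^2 \<Rightarrow> 'a" where
  "partial i f w = frechet_derivative f (at w) (axis i 1)"

definition C2_on :: "(real^2) set \<Rightarrow> (real^2 \<Rightarrow> 'a::real_normed_vector) \<Rightarrow> bool" where
  "C2_on U f \<longleftrightarrow>
     (\<forall>w\<in>U. f differentiable (at w) \<and> (\<forall>i. partial i f differentiable (at w))) \<and>
     (\<forall>i j. continuous_on U (partial i (partial j f)))"

definition upper_half :: "(real^2) set" where
  "upper_half = {w. 0 \<le> w $ 2}"

text \<open>Local parametrization of a surface \<open>S\<close> whose boundary curves make up \<open>C\<close>. It is C2 up to the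
  boundary, in the sense that it extends to the open set \<open>U\<close>. If \<open>U\<close> lies in the open upper half
  plane, this is a chart around interior points.\<close>

definition C2_chart ::
    "(real^3) set \<Rightarrow> (real^3) set \<Rightarrow> (real^2) set \<Rightarrow> (real^2 \<Rightarrow> real^3) \<Rightarrow> bool" where
  "C2_chart S C U X \<longleftrightarrow>
     open U \<and> C2_on U X \<and> (\<forall>w\<in>U. inj (frechet_derivative X (at w))) \<and>
     (\<exists>Y. homeomorphism (U \<inter> upper_half) (X ` (U \<inter> upper_half)) X Y) \<and>
     openin (top_of_set S) (X ` (U \<inter> upper_half)) \<and>
     (\<forall>w \<in> U \<inter> upper_half. X w \<in> C \<longleftrightarrow> w $ 2 = 0)"

definition C2_surface_with_boundary :: "(real^3) set \<Rightarrow> (real^3) set \<Rightarrow> bool" where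
  "C2_surface_with_boundary S C \<longleftrightarrow>
     (\<forall>p\<in>S. \<exists>U X. C2_chart S C U X \<and> p \<in> X ` (U \<inter> upper_half))"

definition differentiable_curve :: "(real^3) set \<Rightarrow> bool" where
  "differentiable_curve K \<longleftrightarrow>
     (\<exists>g h. homeomorphism {0<..<1::real} K g h \<and>
        (\<forall>t\<in>{0<..<1}. g differentiable (at t) \<and> vector_derivative g (at t) \<noteq> 0))"

subsection \<open>Intrinsic Laplacian and mean curvature\<close>

definition metric_tensor :: "(real^2 \<Rightarrow> real^3) \<Rightarrow> real^2 \<Rightarrow> real^2^2" where
  "metric_tensor X w = (\<chi> i j. partial i X w \<bullet> partial j X w)"

text \<open>Laplace-Beltrami operator of the metric induced by \<open>X\<close>, in the coordinates given by \<open>X\<close>.\<close>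

definition laplace_beltrami ::
    "(real^2 \<Rightarrow> real^3) \<Rightarrow> (real^2 \<Rightarrow> 'a::real_normed_vector) \<Rightarrow> real^2 \<Rightarrow> 'a" where
  "laplace_beltrami X f w =
     (1 / sqrt (det (metric_tensor X w))) *\<^sub>R
       (\<Sum>i\<in>UNIV. partial i (\<lambda>y. sqrt (det (metric_tensor X y)) *\<^sub>R
          (\<Sum>j\<in>UNIV. (matrix_inv (metric_tensor X y) $ i $ j) *\<^sub>R partial j f y)) w)"

text \<open>The position vector, read in a chart \<open>X\<close>, is \<open>X\<close> itself.\<close>

definition constant_mean_curvature ::
    "(real^3) set \<Rightarrow> (real^3) set \<Rightarrow> (real^3 \<Rightarrow> real^3) \<Rightarrow> real \<Rightarrow> bool" where
  "constant_mean_curvature S C N H \<longleftrightarrow>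
     (\<forall>U X. C2_chart S C U X \<longrightarrow>
        (\<forall>w\<in>U. 0 < w $ 2 \<longrightarrow> laplace_beltrami X X w = (2 * H) *\<^sub>R N (X w)))"

text \<open>At boundary points the side of \<open>S\<close> is determined by continuity of \<open>N\<close>, because there the normal
  line need not run inside the container.\<close>

definition outward_unit_normal ::
    "(real^3) set \<Rightarrow> (real^3) set \<Rightarrow> (real^3) set \<Rightarrow> (real^3 \<Rightarrow> real^3) \<Rightarrow> bool" where
  "outward_unit_normal S C \<Omega> N \<longleftrightarrow>
     continuous_on S N \<and> (\<forall>p\<in>S. norm (N p) = 1) \<and>
     (\<forall>U X. C2_chart S C U X \<longrightarrow>
        (\<forall>w \<in> U \<inter> upper_half. \<forall>v. N (X w) \<bullet> frechet_derivative X (at w) v = 0)) \<and>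
     (\<forall>p \<in> S - C. \<forall>\<^sub>F t in at_right 0. p - t *\<^sub>R N p \<in> \<Omega> \<and> p + t *\<^sub>R N p \<notin> \<Omega>)"

section \<open>Capillary surfaces of disk type\<close>

text \<open>\<open>V\<close> is the set of vertices on the unit circle. An injective local homeomorphism onto its image
  is a homeomorphism onto its image, which is how embeddedness is expressed.\<close>

definition embedded_disk_type ::
    "(real^3) set set \<Rightarrow> (real^3) set \<Rightarrow> (real^2) set \<Rightarrow> (real^2 \<Rightarrow> real^3) \<Rightarrow> bool" where
  "embedded_disk_type Ps I V \<phi> \<longleftrightarrow>
     finite V \<and> V \<subseteq> sphere 0 1 \<and>
     (\<exists>\<psi>. homeomorphism (cball 0 1 - V) (\<phi> ` (cball 0 1 - V)) \<phi> \<psi>) \<and>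
     \<phi> ` (cball 0 1 - V) \<subseteq> closure I \<and> \<phi> ` ball 0 1 \<subseteq> I \<and>
     (\<forall>a \<in> components (sphere 0 1 - V).
        (\<exists>F \<in> faces Ps I. \<phi> ` a \<subseteq> F) \<and> differentiable_curve (\<phi> ` a)) \<and>
     C2_surface_with_boundary (\<phi> ` (cball 0 1 - V)) (\<phi> ` (sphere 0 1 - V))"

subsection \<open>Local graph property\<close>

definition nbhd_in :: "'a::topological_space set \<Rightarrow> 'a \<Rightarrow> 'a set \<Rightarrow> bool" where
  "nbhd_in X x A \<longleftrightarrow> A \<subseteq> X \<and> (\<exists>T. openin (top_of_set X) T \<and> x \<in> T \<and> T \<subseteq> A)"

text \<open>The surface is, near the vertex \<open>v\<close>, the graph of \<open>u\<close> over a neighborhood of \<open>q\<close> in the plane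
  \<open>plane e h\<close>, which is orthogonal to \<open>P\<close> and \<open>Q\<close> because \<open>e\<close> is a direction of both, and
  \<open>q\<close> is its intersection with \<open>P \<inter> Q\<close>. The neighborhood \<open>B\<close> has to stay away from the other vertices: if
  \<open>B\<close> reached them, then for a surface that is a graph as a whole every vertex
  would count as lying on each of the edges.\<close>

definition local_graph ::
    "(real^3) set \<Rightarrow> (real^2) set \<Rightarrow> (real^2 \<Rightarrow> real^3) \<Rightarrow> real^2 \<Rightarrow> (real^3) set \<Rightarrow> (real^3) set \<Rightarrow>
     real^3 \<Rightarrow> real \<Rightarrow> real^3 \<Rightarrow> (real^3 \<Rightarrow> real) \<Rightarrow> bool" where
  "local_graph I V \<phi> v P Q e h q u \<longleftrightarrow>
     norm e = 1 \<and> (\<forall>x\<in>P. x + e \<in> P) \<and> (\<forall>x\<in>Q. x + e \<in> Q) \<and> P \<inter> Q \<inter> plane e h = {q} \<and>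
     (\<exists>B A. nbhd_in (cball 0 1) v B \<and> closure B \<inter> V = {v} \<and>
        nbhd_in (plane e h \<inter> closure I) q A \<and>
        \<phi> ` (B - {v}) = (\<lambda>x. x + u x *\<^sub>R e) ` (A - {q}))"

definition vertex_on_edge ::
    "(real^3) set \<Rightarrow> (real^2) set \<Rightarrow> (real^2 \<Rightarrow> real^3) \<Rightarrow> real^2 \<Rightarrow> (real^3) set \<Rightarrow> (real^3) set \<Rightarrow> bool"
where
  "vertex_on_edge I V \<phi> v P Q \<longleftrightarrow> (\<exists>e h q u. local_graph I V \<phi> v P Q e h q u)"

definition vertex_condition ::
    "(real^3) set set \<Rightarrow> (real^3) set \<Rightarrow> (real^2) set \<Rightarrow> (real^2 \<Rightarrow> real^3) \<Rightarrow> bool" where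
  "vertex_condition Ps I V \<phi> \<longleftrightarrow>
     (\<forall>v\<in>V. \<exists>P\<in>Ps. \<exists>Q\<in>Ps. P \<noteq> Q \<and> vertex_on_edge I V \<phi> v P Q) \<and>
     (\<forall>v\<in>V. \<forall>v'\<in>V. \<forall>P\<in>Ps. \<forall>Q\<in>Ps. \<forall>e h q u u'.
        v \<noteq> v' \<and> P \<noteq> Q \<and> local_graph I V \<phi> v P Q e h q u \<and> local_graph I V \<phi> v' P Q e h q u' \<longrightarrow>
        (\<exists>x \<delta>. 0 < \<delta> \<and> x \<longlonglongrightarrow> q \<and>
           (\<forall>k::nat. x k \<in> (plane e h \<inter> closure I) - {q} \<and> \<delta> \<le> \<bar>u (x k) - u' (x k)\<bar>)))"

subsection \<open>The drop\<close>

text \<open>The drop is the part of \<open>I\<close> that is separated off by \<open>S\<close> and covers the base.\<close>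

definition drop_region ::
    "(real^3) set \<Rightarrow> (real^3) set \<Rightarrow> (real^3) set \<Rightarrow> (real^3) set \<Rightarrow> bool" where
  "drop_region I S base \<Omega> \<longleftrightarrow>
     S \<inter> base = {} \<and> \<Omega> \<in> components (I - S) \<and> base \<inter> closure I \<subseteq> closure \<Omega>"

section \<open>Admissible contact angles\<close>

text \<open>The opening angle of the wedge is \<open>2 * \<alpha>\<close>.\<close>

definition data_Q :: "real \<Rightarrow> (real \<times> real) set" where
  "data_Q \<alpha> = {(x, y). x \<in> {0..pi} \<and> y \<in> {0..pi} \<and>
     \<bar>x + y - pi\<bar> \<le> 2 * \<alpha> \<and> \<bar>x - y\<bar> \<le> pi - 2 * \<alpha>}"

text \<open>Union of the relative interiors of the two segments that the rectangle \<open>data_Q \<alpha>\<close> has in common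
  with the closures of the two components of \<open>{(x, y). \<bar>x + y - pi\<bar> > 2 * \<alpha>}\<close> in the square.\<close>

definition data_Q_D1_segments :: "real \<Rightarrow> (real \<times> real) set" where
  "data_Q_D1_segments \<alpha> = {(x, y). x \<in> {0..pi} \<and> y \<in> {0..pi} \<and>
     \<bar>x + y - pi\<bar> = 2 * \<alpha> \<and> \<bar>x - y\<bar> < pi - 2 * \<alpha>}"

section \<open>Metrically spherical surfaces\<close>

definition portion_of_sphere :: "(real^3) set \<Rightarrow> bool" where
  "portion_of_sphere S \<longleftrightarrow> (\<exists>a r. 0 < r \<and> S \<subseteq> sphere a r)"

definition portion_of_plane :: "(real^3) set \<Rightarrow> bool" where
  "portion_of_plane S \<longleftrightarrow> (\<exists>a c. a \<noteq> 0 \<and> S \<subseteq> plane a c)"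

section \<open>Consistency of the conventions\<close>

lemma dihedral_angle_eq:
  assumes "norm a = 1" "norm a' = 1" "cross3 a a' \<noteq> 0"
  shows "dihedral_angle a a' = pi - arccos (a \<bullet> a')"
    and "0 < dihedral_angle a a'" and "dihedral_angle a a' < pi"
proof -
  define s where "s = a \<bullet> a'"
  have aa: "a \<bullet> a = 1" "a' \<bullet> a' = 1" "a' \<bullet> a = s"
    using assms by (simp_all add: norm_eq_1 s_def inner_commute)
  have "(norm (cross3 a a'))\<^sup>2 + s\<^sup>2 = 1"
    using norm_cross_dot[of a a'] assms by (simp add: s_def)
  moreover have "(norm (cross3 a a'))\<^sup>2 > 0" using assms(3) by simp
  ultimately have s1: "s\<^sup>2 < 1" by linarith
  then have sb: "-1 < s" "s < 1" by (auto simp: abs_square_less_1)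
  define t where "t = s *\<^sub>R a - a'"
  define t' where "t' = s *\<^sub>R a' - a"
  have tt: "t \<bullet> t = 1 - s\<^sup>2" "t' \<bullet> t' = 1 - s\<^sup>2" "t \<bullet> t' = - s * (1 - s\<^sup>2)"
    by (simp_all add: t_def t'_def inner_diff_left inner_diff_right aa s_def[symmetric]
        power2_eq_square algebra_simps)
  have "norm t * norm t' = 1 - s\<^sup>2"
    using s1 by (simp add: norm_eq_sqrt_inner tt)
  then have "dihedral_angle a a' = arccos (- s)"
    using s1 by (simp add: dihedral_angle_def Let_def s_def[symmetric] t_def[symmetric]
        t'_def[symmetric] tt)
  also have "\<dots> = pi - arccos s" using sb by (simp add: arccos_minus)
  finally have eq: "dihedral_angle a a' = pi - arccos s" .
  show "dihedral_angle a a' = pi - arccos (a \<bullet> a')" using eq by (simp add: s_def)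
  show "0 < dihedral_angle a a'" "dihedral_angle a a' < pi"
    using eq arccos_lt_bounded[OF sb] by auto
qed

lemma parallel_if_orthogonal:
  fixes a a' w d :: "real^3"
  assumes "cross3 a a' \<noteq> 0" "a \<bullet> w = 0" "a' \<bullet> w = 0" "a \<bullet> d = 0" "a' \<bullet> d = 0" "d \<noteq> 0"
  shows "\<exists>s. w = s *\<^sub>R d"
proof -
  have *: "\<exists>r. z = r *\<^sub>R cross3 a a'" if "a \<bullet> z = 0" "a' \<bullet> z = 0" for z
  proof -
    have "cross3 (cross3 a a') z = 0"
      using that by (simp add: Lagrange cross_skew[of "cross3 a a'"] inner_commute)
    then have "collinear {0, cross3 a a', z}" by (simp add: cross_eq_0)
    then show ?thesis using assms(1) by (auto simp: collinear_lemma intro: exI[of _ 0])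
  qed
  obtain r where r: "w = r *\<^sub>R cross3 a a'" using * assms by blast
  obtain r' where r': "d = r' *\<^sub>R cross3 a a'" using * assms by blast
  have "r' \<noteq> 0" using r' assms(6) by auto
  then have "w = (r / r') *\<^sub>R d" using r r' by simp
  then show ?thesis ..
qed

lemma no_common_point_of_walls:
  assumes "cylindrical_container n c d m b"
  shows "\<not> (\<forall>j. y \<in> plane (n j) (c j))"
proof
  assume y: "\<forall>j. y \<in> plane (n j) (c j)"
  have d: "d \<bullet> d = 1" "\<And>j. n j \<bullet> d = 0" and bd: "bounded (prism n c \<inter> plane d 0)"
    using assms by (auto simp: cylindrical_container_def norm_eq_1)
  obtain x where x: "x \<in> prism n c" using assms by (auto simp: cylindrical_container_def)
  define x' where "x' = x - (d \<bullet> x) *\<^sub>R d"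
  define y' where "y' = y - (d \<bullet> y) *\<^sub>R d"
  have nx: "n j \<bullet> x' < c j" and ny: "n j \<bullet> y' = c j" for j
    using x y d by (simp_all add: x'_def y'_def prism_def plane_def inner_diff_right)
  have dx: "d \<bullet> x' = 0" "d \<bullet> y' = 0"
    using d by (simp_all add: x'_def y'_def inner_diff_right)
  have mem: "y' + t *\<^sub>R (x' - y') \<in> prism n c \<inter> plane d 0" if "t > 0" for t
  proof -
    have "n j \<bullet> (y' + t *\<^sub>R (x' - y')) < c j" for j
      using nx[of j] ny[of j] that by (simp add: inner_add_right inner_diff_right mult_pos_neg)
    then show ?thesis using dx by (simp add: prism_def plane_def inner_add_right inner_diff_right)
  qed
  obtain B where B: "\<And>z. z \<in> prism n c \<inter> plane d 0 \<Longrightarrow> norm z \<le> B"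
    using bd by (auto simp: bounded_iff)
  have ne: "x' - y' \<noteq> 0" using nx[of 1] ny[of 1] by auto
  define t where "t = (\<bar>B\<bar> + norm y' + 1) / norm (x' - y')"
  have "t > 0" using ne by (simp add: t_def add_nonneg_pos)
  have "norm (t *\<^sub>R (x' - y')) = \<bar>B\<bar> + norm y' + 1"
    using ne \<open>t > 0\<close> by (simp add: t_def)
  moreover have "norm (t *\<^sub>R (x' - y')) \<le> norm (y' + t *\<^sub>R (x' - y')) + norm y'"
    by (metis add_diff_cancel_left' norm_triangle_ineq4)
  ultimately show False using B[OF mem[OF \<open>t > 0\<close>]] by linarith
qed

lemma container_support_configuration:
  assumes cc: "cylindrical_container n c d m b"
  shows "support_configuration (container_planes n c m b) (container n c m b)"
proof -
  have n1: "norm (n j) = 1" and nd: "n j \<bullet> d = 0" and d1: "norm d = 1" and m1: "norm m = 1"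
    and md: "m \<bullet> d \<noteq> 0" and ne: "prism n c \<noteq> {}"
    and cr: "j \<noteq> k \<Longrightarrow> cross3 (n j) (n k) \<noteq> 0" for j k
    using cc by (auto simp: cylindrical_container_def)
  let ?Ps = "container_planes n c m b" and ?I = "container n c m b"
  have I_eq: "?I = (\<Inter>j. {x. n j \<bullet> x < c j}) \<inter> {x. m \<bullet> x < b}"
    by (auto simp: container_def prism_def)
  have fin: "finite ?Ps" by (simp add: container_planes_def)
  have pl: "affine (plane a e) \<and> aff_dim (plane a e) = 2" if "norm a = 1" for a e
  proof -
    have "a \<noteq> 0" using that by auto
    then show ?thesis by (simp add: plane_def affine_hyperplane)
  qed
  have planes: "\<forall>P\<in>?Ps. affine P \<and> aff_dim P = 2"
    using pl n1 m1 by (auto simp: container_planes_def)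
  have op: "open ?I"
    unfolding I_eq by (intro open_Int open_INT ballI open_halfspace_lt) simp
  have "convex ?I"
    unfolding I_eq by (intro convex_Int convex_INT convex_halfspace_lt)
  then have con: "connected ?I" by (rule convex_connected)
  have "?I \<noteq> {}"
  proof -
    obtain x where x: "x \<in> prism n c" using ne by blast
    define t where "t = (b - 1 - m \<bullet> x) / (m \<bullet> d)"
    have "m \<bullet> (x + t *\<^sub>R d) = b - 1" using md by (simp add: t_def inner_add_right)
    moreover have "x + t *\<^sub>R d \<in> prism n c" using x nd by (simp add: prism_def inner_add_right)
    ultimately have "x + t *\<^sub>R d \<in> ?I" by (simp add: container_def)
    then show ?thesis by blast
  qed
  moreover have "frontier ?I \<subseteq> \<Union>?Ps"
  proof
    fix x assume x: "x \<in> frontier ?I"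
    have "closed ((\<Inter>j. {x. n j \<bullet> x \<le> c j}) \<inter> {x. m \<bullet> x \<le> b})"
      by (intro closed_Int closed_INT ballI closed_halfspace_le)
    moreover have "?I \<subseteq> (\<Inter>j. {x. n j \<bullet> x \<le> c j}) \<inter> {x. m \<bullet> x \<le> b}"
      by (auto simp: I_eq less_imp_le)
    ultimately have "closure ?I \<subseteq> (\<Inter>j. {x. n j \<bullet> x \<le> c j}) \<inter> {x. m \<bullet> x \<le> b}"
      by (rule closure_minimal[rotated])
    moreover have "x \<in> closure ?I" "x \<notin> ?I"
      using x op by (auto simp: frontier_def interior_open)
    ultimately have le: "n j \<bullet> x \<le> c j" "m \<bullet> x \<le> b" and nmem: "x \<notin> ?I" for j
      by blast+
    have "(\<exists>j. n j \<bullet> x = c j) \<or> m \<bullet> x = b"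
    proof (rule ccontr)
      assume "\<not> ((\<exists>j. n j \<bullet> x = c j) \<or> m \<bullet> x = b)"
      then have "n j \<bullet> x < c j" "m \<bullet> x < b" for j
        using le(1)[of j] le(2) by (auto simp: less_le)
      then show False using nmem by (simp add: container_def prism_def)
    qed
    then show "x \<in> \<Union>?Ps" by (auto simp: container_planes_def plane_def)
  qed
  moreover have "\<not> (\<exists>L. affine L \<and> aff_dim L = 1 \<and> L \<subseteq> P \<inter> Q \<inter> R)"
    if PQR: "P \<in> ?Ps" "Q \<in> ?Ps" "R \<in> ?Ps" and dist: "P \<noteq> Q \<and> Q \<noteq> R \<and> P \<noteq> R" for P Q R
  proof
    assume "\<exists>L. affine L \<and> aff_dim L = 1 \<and> L \<subseteq> P \<inter> Q \<inter> R"
    then obtain L where L: "aff_dim L = 1" "L \<subseteq> P \<inter> Q \<inter> R" by blast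
    have "L \<noteq> {}" "\<And>y. L \<noteq> {y}" using L(1) by auto
    then obtain y z where yz: "y \<in> L" "z \<in> L" "y \<noteq> z" by blast
    have base: False
      if "j \<noteq> k" "L \<subseteq> plane (n j) (c j)" "L \<subseteq> plane (n k) (c k)" "L \<subseteq> plane m b" for j k
    proof -
      have "y \<in> plane (n j) (c j)" "z \<in> plane (n j) (c j)" "y \<in> plane (n k) (c k)"
        "z \<in> plane (n k) (c k)" "y \<in> plane m b" "z \<in> plane m b"
        using that yz by blast+
      then have w: "n j \<bullet> (z - y) = 0" "n k \<bullet> (z - y) = 0" "m \<bullet> (z - y) = 0"
        by (simp_all add: plane_def inner_diff_right)
      have "d \<noteq> 0" using d1 by auto
      have jk: "cross3 (n j) (n k) \<noteq> 0" using cr that(1) .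
      obtain s where s: "z - y = s *\<^sub>R d"
        using parallel_if_orthogonal[OF jk w(1,2) nd nd] \<open>d \<noteq> 0\<close> by blast
      then have "s = 0" using w(3) md by simp
      then show False using s yz(3) by simp
    qed
    consider "P = plane m b" | "Q = plane m b" | "R = plane m b"
      | "P \<noteq> plane m b" "Q \<noteq> plane m b" "R \<noteq> plane m b" by blast
    then show False
    proof cases
      case 1
      then obtain j k where "Q = plane (n j) (c j)" "R = plane (n k) (c k)" "j \<noteq> k"
        using PQR dist by (auto simp: container_planes_def)
      then show False using base[of j k] L(2) 1 by blast
    next
      case 2
      then obtain j k where "P = plane (n j) (c j)" "R = plane (n k) (c k)" "j \<noteq> k"
        using PQR dist by (auto simp: container_planes_def)
      then show False using base[of j k] L(2) 2 by blast
    next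
      case 3
      then obtain j k where "P = plane (n j) (c j)" "Q = plane (n k) (c k)" "j \<noteq> k"
        using PQR dist by (auto simp: container_planes_def)
      then show False using base[of j k] L(2) 3 by blast
    next
      case 4
      then obtain i j k where ijk: "P = plane (n i) (c i)" "Q = plane (n j) (c j)"
        "R = plane (n k) (c k)"
        using PQR by (auto simp: container_planes_def)
      then have "i \<noteq> j" "j \<noteq> k" "i \<noteq> k" using dist by auto
      then have "card {i, j, k} = CARD(3)" by simp
      then have "{i, j, k} = UNIV" by (intro card_subset_eq) auto
      then have all: "l \<in> {i, j, k}" for l by simp
      have "y \<in> plane (n i) (c i)" "y \<in> plane (n j) (c j)" "y \<in> plane (n k) (c k)"
        using ijk L(2) yz(1) by blast+
      then have "y \<in> plane (n l) (c l)" for l using all[of l] by auto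
      then show False using no_common_point_of_walls[OF cc] by blast
    qed
  qed
  ultimately show ?thesis
    using fin planes op con unfolding support_configuration_def by blast
qed

end

theory Submission
  imports Defs
begin

text \<open>Linear algebra on the three walls provides a number \<open>H0\<close> and a spherical (or planar) surface over the
  whole cross section, with upward unit normal \<open>W\<close>, that has mean curvature \<open>H0\<close> and the prescribed contact
  angles; the condition on the data makes it a graph. Let \<open>y\<close> be the height of \<open>S\<close> above this surface, with
  the opposite sign if \<open>H < H0\<close>. At a maximum point of \<open>y\<close> the normals \<open>N\<close> and \<open>W\<close> agree, and over a
  neighbourhood of the corners \<open>S\<close> is a single sheet by the local graph property. Hence on a level set \<open>y > t\<close>
  with \<open>t\<close> close to the supremum, \<open>S\<close> is a single sheet whose normal nowhere points downward.

  Extend \<open>h (y - t) (W - N)\<close>, with a suitable increasing \<open>h\<close> that vanishes on the negative axis, to a field on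
  the prism that does not depend on the vertical coordinate. Up to sign, its horizontal divergence is a sum of
  nonnegative terms, the boundary condition makes it tangential at the walls, and it is bounded near the
  corners, where nothing is known about \<open>S\<close>. So its total flux vanishes, and therefore \<open>N = W\<close> and
  \<open>H = H0\<close> where \<open>y > t\<close>. There \<open>y\<close> is locally constant, and by connectedness it is constant on \<open>S\<close>. Points with
  vertical tangent plane, where the field need not be differentiable, are treated by computing fluxes
  through the boundaries of triangles and subdividing as in Goursat's lemma.\<close>

section \<open>Flux of a vector field through triangles\<close>

text \<open>A corner has no length on the boundary of the cross section, so a flux argument
  tolerates a merely bounded field there, while a maximum principle would need growth conditions
  that are not assumed. The cap exists by a count: its unknowns are \<open>H0\<close> and the two
  horizontal components of \<open>y0\<close>, against three wall equations. The horizontal part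
  \<open>P\<close> of its normal is affine; the data give \<open>norm (P (q i)) \<le> 1\<close> at
  each corner, and convexity carries the bound over the triangle, with strict inequality away from
  the corners. On the segments the value \<open>1\<close> can be attained, so the cap itself may
  become vertical over a corner. The sign in \<open>y\<close> is chosen so that the term with
  \<open>H - H0\<close> enters the divergence nonnegatively. The cutoff \<open>h\<close> is bounded
  because \<open>S\<close> may be unbounded at the vertices, and it starts strictly above the level
  where the single sheet begins, so that the field vanishes near the edge of that sheet. Only
  inequalities are propagated: fluxes through concentric copies of the cross section increase with
  the copy and tend to zero at the walls, hence are nonpositive, while the divergence is
  nonnegative.\<close>

definition flux :: "real^3 \<Rightarrow> (real^3 \<Rightarrow> real^3) \<Rightarrow> real^3 \<Rightarrow> real^3 \<Rightarrow> real" where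
  "flux D Z A B = integral {0..1::real} (\<lambda>s. D \<bullet> cross3 (Z (A + s *\<^sub>R (B - A))) (B - A))"

text \<open>The integrand is the component of \<open>Z\<close> along
  \<open>cross3 (B - A) D\<close>, which points out of the projected triangle when
  \<open>orient D A B C\<close> is positive. For a field that is constant along \<open>D\<close>
  only projections along \<open>D\<close> matter, so the triangles need not lie in a horizontal
  plane.\<close>

definition tri_flux :: "real^3 \<Rightarrow> (real^3 \<Rightarrow> real^3) \<Rightarrow> real^3 \<Rightarrow> real^3 \<Rightarrow> real^3 \<Rightarrow> real" where
  "tri_flux D Z A B C = flux D Z A B + flux D Z B C + flux D Z C A"

abbreviation orient :: "real^3 \<Rightarrow> real^3 \<Rightarrow> real^3 \<Rightarrow> real^3 \<Rightarrow> real" where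
  "orient D A B C \<equiv> D \<bullet> cross3 (B - A) (C - A)"

lemmas cross_linear = cross_add_left cross_add_right cross_mult_left cross_mult_right
  Cross3.left_diff_distrib Cross3.right_diff_distrib

lemma triple_swap: "D \<bullet> cross3 a b = - (D \<bullet> cross3 b a)"
  by (subst cross_skew) simp

lemma abs_triple_le: "\<bar>D \<bullet> cross3 a b\<bar> \<le> norm D * norm a * norm b"
proof -
  have "norm (cross3 a b) \<le> norm a * norm b"
  proof (rule power2_le_imp_le)
    show "(norm (cross3 a b))\<^sup>2 \<le> (norm a * norm b)\<^sup>2"
      using norm_cross_dot[of a b] zero_le_power2[of "a \<bullet> b"] by linarith
  qed simp
  then have "norm D * norm (cross3 a b) \<le> norm D * (norm a * norm b)" by (intro mult_left_mono) auto
  then show ?thesis using Cauchy_Schwarz_ineq2[of D "cross3 a b"] by (simp add: mult.assoc)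
qed

lemma segment_param_mem:
  assumes "closed_segment A B \<subseteq> K" "s \<in> {0..1}"
  shows "A + s *\<^sub>R (B - A) \<in> K"
proof -
  have "A + s *\<^sub>R (B - A) = (1 - s) *\<^sub>R A + s *\<^sub>R B" by (simp add: algebra_simps)
  then show ?thesis using assms by (auto simp: closed_segment_def)
qed

lemma flux_integrand_continuous:
  assumes "continuous_on K Z" "closed_segment A B \<subseteq> K"
  shows "continuous_on {0..1} (\<lambda>s. D \<bullet> cross3 (Z (A + s *\<^sub>R (B - A))) (B - A))"
proof -
  have "continuous_on {0..1} (\<lambda>s. Z (A + s *\<^sub>R (B - A)))"
    using segment_param_mem[OF assms(2)]
    by (intro continuous_on_compose2[OF assms(1)] continuous_intros) auto
  then show ?thesis by (intro continuous_intros continuous_on_cross) auto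
qed

lemma flux_has_integral:
  assumes "continuous_on K Z" "closed_segment A B \<subseteq> K"
  shows "((\<lambda>s. D \<bullet> cross3 (Z (A + s *\<^sub>R (B - A))) (B - A)) has_integral flux D Z A B) {0..1}"
  unfolding flux_def
  by (intro integrable_integral integrable_continuous_real flux_integrand_continuous[OF assms])

lemma flux_reverse: "flux D Z B A = - flux D Z A B"
proof -
  let ?f = "\<lambda>s. D \<bullet> cross3 (Z (A + s *\<^sub>R (B - A))) (B - A)"
  have *: "B + s *\<^sub>R (A - B) = A + (1 - s) *\<^sub>R (B - A)" for s by (simp add: algebra_simps)
  have **: "cross3 u (A - B) = - cross3 u (B - A)" for u by (simp add: cross_linear)
  have "flux D Z B A = - integral {0..1} (\<lambda>s. ?f (1 - s))"
    unfolding flux_def * ** by simp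
  also have "integral {0..1} (\<lambda>s. ?f (1 - s)) = integral {-1..0} ((?f \<circ> (+) 1))"
    using Henstock_Kurzweil_Integration.integral_reflect_real[of 1 0 "\<lambda>s. ?f (1 - s)"] by (simp add: o_def)
  also have "\<dots> = integral {0..1} ?f"
    using integral_shift_Icc_real[of "-1" 0 ?f 1] by simp
  finally show ?thesis by (simp add: flux_def)
qed

lemma flux_split:
  assumes "continuous_on K Z" "closed_segment A B \<subseteq> K" "0 < t" "t < 1"
    and M: "M = A + t *\<^sub>R (B - A)"
  shows "flux D Z A B = flux D Z A M + flux D Z M B"
proof -
  let ?f = "\<lambda>s. D \<bullet> cross3 (Z (A + s *\<^sub>R (B - A))) (B - A)"
  have int: "?f integrable_on {0..1}"
    by (intro integrable_continuous_real flux_integrand_continuous[OF assms(1,2)])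
  have i1: "(?f has_integral integral {0..t} ?f) (cbox 0 t)"
    and i2: "(?f has_integral integral {t..1} ?f) (cbox t 1)"
    using int assms(3,4) by (auto intro!: integrable_integral integrable_on_subinterval[OF int])
  have im1: "(\<lambda>x. (1 / t) *\<^sub>R x + -((1 / t) *\<^sub>R 0)) ` cbox 0 t = {0..1}"
    using assms(3) image_affinity_atLeastAtMost[of "1/t" 0 0 t] by simp
  have im2: "(\<lambda>x. (1 / (1-t)) *\<^sub>R x + -((1 / (1-t)) *\<^sub>R t)) ` cbox t 1 = {0..1}"
    using assms(4) image_affinity_atLeastAtMost[of "1/(1-t)" "-t/(1-t)" t 1]
    by (simp add: field_simps)
  have "((\<lambda>x. ?f (t * x)) has_integral (1 / t) * integral {0..t} ?f) {0..1}"
    using has_integral_affinity[OF i1, of t 0, unfolded im1] assms(3) by simp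
  then have "integral {0..1} (\<lambda>x. ?f (t * x)) = (1 / t) * integral {0..t} ?f"
    by (rule integral_unique)
  moreover have "flux D Z A M = t * integral {0..1} (\<lambda>x. ?f (t * x))"
    unfolding flux_def M by (simp add: cross_linear ac_simps flip: integral_mult_right)
  ultimately have 1: "flux D Z A M = integral {0..t} ?f" using assms(3) by simp
  have "((\<lambda>x. ?f ((1-t) * x + t)) has_integral (1 / (1-t)) * integral {t..1} ?f) {0..1}"
    using has_integral_affinity[OF i2, of "1-t" t, unfolded im2] assms(4) by simp
  then have "integral {0..1} (\<lambda>x. ?f ((1-t) * x + t)) = (1 / (1-t)) * integral {t..1} ?f"
    by (rule integral_unique)
  moreover have "flux D Z M B = (1-t) * integral {0..1} (\<lambda>x. ?f ((1-t) * x + t))"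
  proof -
    have e: "M + s *\<^sub>R (B - M) = A + ((1 - t) * s + t) *\<^sub>R (B - A)" for s
      unfolding M by (simp add: algebra_simps)
    have "B - M = (1-t) *\<^sub>R (B - A)" unfolding M by (simp add: algebra_simps)
    then show ?thesis unfolding flux_def e
      by (simp add: cross_mult_right flip: integral_mult_right)
  qed
  ultimately have 2: "flux D Z M B = integral {t..1} ?f" using assms(4) by simp
  have "integral {0..t} ?f + integral {t..1} ?f = integral {0..1} ?f"
    using assms(3,4) int by (intro Henstock_Kurzweil_Integration.integral_combine) auto
  then show ?thesis unfolding 1 2 by (simp add: flux_def)
qed

section \<open>Subdivision of triangles\<close>

text \<open>Every side splits at its midpoint, and each side of the middle triangle is traversed
  once in either direction.\<close>

lemma tri_flux_medial:
  assumes K: "continuous_on K Z" "convex hull {A, B, C} \<subseteq> K"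
  defines "P \<equiv> (1/2) *\<^sub>R (A + B)" and "Q \<equiv> (1/2) *\<^sub>R (B + C)" and "R \<equiv> (1/2) *\<^sub>R (C + A)"
  shows "tri_flux D Z A B C
     = tri_flux D Z A P R + tri_flux D Z P B Q + tri_flux D Z R Q C + tri_flux D Z P Q R"
proof -
  have seg: "closed_segment X Y \<subseteq> K" if "X \<in> {A, B, C}" "Y \<in> {A, B, C}" for X Y
    using K(2) that hull_mono[of "{X,Y}" "{A,B,C}" convex] by (auto simp: segment_convex_hull)
  have half: "flux D Z X Y = flux D Z X ((1/2) *\<^sub>R (X + Y)) + flux D Z ((1/2) *\<^sub>R (X + Y)) Y"
    if "X \<in> {A, B, C}" "Y \<in> {A, B, C}" for X Y
    by (rule flux_split[OF K(1) seg[OF that], of "1/2"]) (simp_all add: vec_eq_iff field_simps)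
  have "flux D Z A B = flux D Z A P + flux D Z P B" "flux D Z B C = flux D Z B Q + flux D Z Q C"
    "flux D Z C A = flux D Z C R + flux D Z R A"
    unfolding P_def Q_def R_def by (rule half; simp)+
  then show ?thesis unfolding tri_flux_def
    using flux_reverse[of D Z P R] flux_reverse[of D Z Q P] flux_reverse[of D Z R Q] by simp
qed

text \<open>The local hypothesis of Goursat's argument, one-sided because only a sign is wanted. The
  error is measured against \<open>L\<^sup>2\<close>, the order of the area, so it is stable under
  division into four triangles of half the size. Requiring \<open>x\<close> in the triangle makes
  differentiability at the single point \<open>x\<close> sufficient.\<close>

definition outward_at :: "real^3 \<Rightarrow> (real^3 \<Rightarrow> real^3) \<Rightarrow> real^3 \<Rightarrow> bool" where
  "outward_at D Z x \<longleftrightarrow> (\<forall>e>0. \<exists>\<delta>>0. \<forall>A B C L. {A, B, C} \<subseteq> ball x \<delta> \<longrightarrow> x \<in> convex hull {A, B, C} \<longrightarrow>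
     0 \<le> orient D A B C \<longrightarrow> dist A B \<le> L \<longrightarrow> dist B C \<le> L \<longrightarrow> dist C A \<le> L \<longrightarrow>
     - e * L\<^sup>2 \<le> tri_flux D Z A B C)"

lemma hull3_subset_cball:
  fixes A B C x :: "'a::real_normed_vector"
  assumes "dist A B \<le> L" "dist B C \<le> L" "dist C A \<le> (L::real)" "x \<in> convex hull {A, B, C}"
  shows "convex hull {A, B, C} \<subseteq> cball x L"
proof -
  have L: "0 \<le> L" using assms(1) zero_le_dist order_trans by blast
  have *: "convex hull {A, B, C} \<subseteq> cball X L" if "X \<in> {A, B, C}" for X
    using that assms(1-3) L by (intro hull_minimal convex_cball) (auto simp: dist_commute)
  have "X \<in> cball x L" if "X \<in> {A, B, C}" for X
    using subsetD[OF *[OF that] assms(4)] by (simp add: dist_commute)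
  then show ?thesis by (intro hull_minimal convex_cball) blast
qed

lemma orient_medial:
  fixes A B C :: "real^3"
  defines "P \<equiv> (1/2) *\<^sub>R (A + B)" and "Q \<equiv> (1/2) *\<^sub>R (B + C)" and "R \<equiv> (1/2) *\<^sub>R (C + A)"
  shows "orient D A P R = orient D A B C / 4" "orient D P B Q = orient D A B C / 4"
    "orient D R Q C = orient D A B C / 4" "orient D P Q R = orient D A B C / 4"
  unfolding P_def Q_def R_def by (simp_all add: cross3_simps)

lemma dist_midpoint_half:
  fixes A B C :: "'a::real_normed_vector"
  shows "dist ((1/2) *\<^sub>R (A + B)) ((1/2) *\<^sub>R (A + C)) = dist B C / 2"
    "dist A ((1/2) *\<^sub>R (A + B)) = dist A B / 2"
proof -
  have "(1/2) *\<^sub>R (A + B) - (1/2) *\<^sub>R (A + C) = (1/2) *\<^sub>R (B - C)" by (simp add: algebra_simps)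
  then show "dist ((1/2) *\<^sub>R (A + B)) ((1/2) *\<^sub>R (A + C)) = dist B C / 2" by (simp add: dist_norm)
  have "A - (1/2) *\<^sub>R (A + B) = (1/2) *\<^sub>R (A - B)"
    by (simp add: algebra_simps flip: scaleR_add_left)
  then show "dist A ((1/2) *\<^sub>R (A + B)) = dist A B / 2" by (simp add: dist_norm)
qed

text \<open>If the flux is \<open>- c\<close> with positive \<open>c\<close>, one of the four medial
  triangles has flux at most \<open>- c / 4\<close>. Repetition gives nested triangles that shrink
  to a point \<open>x\<close>, with flux at most \<open>- c / 4^k\<close> and sides at most
  \<open>L / 2^k\<close>, contrary to \<open>outward_at D Z x\<close>.\<close>

lemma tri_flux_nonneg:
  assumes cont: "continuous_on (convex hull {A, B, C}) Z"
    and pos: "0 \<le> orient D A B C"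
    and loc: "\<And>x. x \<in> convex hull {A, B, C} \<Longrightarrow> outward_at D Z x"
  shows "0 \<le> tri_flux D Z A B C"
proof (rule ccontr)
  assume neg: "\<not> 0 \<le> tri_flux D Z A B C"
  define c where "c = - tri_flux D Z A B C"
  have c: "c > 0" using neg by (simp add: c_def)
  define L where "L = dist A B + dist B C + dist C A"
  have L0: "L \<ge> 0" by (simp add: L_def)
  define H where "H = (\<lambda>(a, b, c). convex hull {a, b, c :: real^3})"
  define P where "P = (\<lambda>k::nat. \<lambda>(a, b, c'). convex hull {a, b, c'} \<subseteq> convex hull {A, B, C} \<and>
     0 \<le> orient D a b c' \<and> dist a b \<le> L / 2^k \<and> dist b c' \<le> L / 2^k \<and> dist c' a \<le> L / 2^k \<and>
     tri_flux D Z a b c' \<le> - c / 4^k)"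
  have "\<exists>f. \<forall>k. P k (f k) \<and> H (f (Suc k)) \<subseteq> H (f k)"
  proof (rule dependent_nat_choice)
    show "\<exists>x. P 0 x"
      using pos by (intro exI[of _ "(A, B, C)"]) (simp add: P_def c_def L_def)
  next
    fix x k assume "P k x"
    then obtain a b g where x: "x = (a, b, g)" and Pk: "P k (a, b, g)" by (cases x) auto
    have sub: "convex hull {a, b, g} \<subseteq> convex hull {A, B, C}" and o: "0 \<le> orient D a b g"
      and d: "dist a b \<le> L / 2^k" "dist b g \<le> L / 2^k" "dist g a \<le> L / 2^k"
      and t: "tri_flux D Z a b g \<le> - c / 4^k"
      using Pk by (auto simp: P_def)
    define p where "p = (1/2) *\<^sub>R (a + b)"
    define q where "q = (1/2) *\<^sub>R (b + g)"
    define r where "r = (1/2) *\<^sub>R (g + a)"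
    have sum: "tri_flux D Z a b g
     = tri_flux D Z a p r + tri_flux D Z p b q + tri_flux D Z r q g + tri_flux D Z p q r"
      unfolding p_def q_def r_def by (rule tri_flux_medial[OF cont sub])
    have mid: "(1/2) *\<^sub>R (u + w) \<in> convex hull {a, b, g}"
      if "u \<in> convex hull {a, b, g}" "w \<in> convex hull {a, b, g}" for u w
      using convexD[OF convex_convex_hull that, of "1/2" "1/2"] by (simp add: scaleR_add_right)
    have abg: "a \<in> convex hull {a, b, g}" "b \<in> convex hull {a, b, g}" "g \<in> convex hull {a, b, g}"
      by (simp_all add: hull_inc)
    have pqr: "p \<in> convex hull {a, b, g}" "q \<in> convex hull {a, b, g}" "r \<in> convex hull {a, b, g}"
      unfolding p_def q_def r_def using mid abg by blast+
    have ors: "0 \<le> orient D a p r" "0 \<le> orient D p b q" "0 \<le> orient D r q g" "0 \<le> orient D p q r"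
      using o unfolding p_def q_def r_def orient_medial by auto
    have eqs: "dist a p = dist a b / 2" "dist p b = dist a b / 2" "dist r q = dist a b / 2"
      "dist b q = dist b g / 2" "dist q g = dist b g / 2" "dist p r = dist b g / 2"
      "dist g r = dist g a / 2" "dist r a = dist g a / 2" "dist q p = dist g a / 2"
      using dist_midpoint_half(2)[of a b] dist_midpoint_half(2)[of b a] dist_midpoint_half(1)[of g a b]
        dist_midpoint_half(2)[of b g] dist_midpoint_half(2)[of g b] dist_midpoint_half(1)[of a b g]
        dist_midpoint_half(2)[of g a] dist_midpoint_half(2)[of a g] dist_midpoint_half(1)[of b g a]
      unfolding p_def q_def r_def by (metis add.commute dist_commute)+
    have half: "L / 2^Suc k = (L / 2^k) / 2" by simp
    have ds: "dist a p \<le> L/2^Suc k" "dist p r \<le> L/2^Suc k" "dist r a \<le> L/2^Suc k"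
        "dist p b \<le> L/2^Suc k" "dist b q \<le> L/2^Suc k" "dist q p \<le> L/2^Suc k"
        "dist r q \<le> L/2^Suc k" "dist q g \<le> L/2^Suc k" "dist g r \<le> L/2^Suc k"
      unfolding eqs half by (intro divide_right_mono d; simp)+
    have hs: "convex hull {u, w, z} \<subseteq> convex hull {a, b, g}"
      if "u \<in> convex hull {a, b, g}" "w \<in> convex hull {a, b, g}" "z \<in> convex hull {a, b, g}" for u w z
      using that by (intro hull_minimal) auto
    have "\<exists>(u, w, z) \<in> {(a, p, r), (p, b, q), (r, q, g), (p, q, r)}. tri_flux D Z u w z \<le> - c / 4^Suc k"
    proof (rule ccontr)
      assume "\<not> ?thesis"
      then have "tri_flux D Z a p r > - c / 4^Suc k" "tri_flux D Z p b q > - c / 4^Suc k"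
        "tri_flux D Z r q g > - c / 4^Suc k" "tri_flux D Z p q r > - c / 4^Suc k" by auto
      moreover have "- c / 4^k = 4 * (- c / 4^Suc k)" by simp
      ultimately show False using sum t by linarith
    qed
    then obtain y where y: "y \<in> {(a, p, r), (p, b, q), (r, q, g), (p, q, r)}"
      "case y of (u, w, z) \<Rightarrow> tri_flux D Z u w z \<le> - c / 4^Suc k" by blast
    have PI: "P (Suc k) (u, w, z) \<and> H (u, w, z) \<subseteq> H x"
      if "u \<in> convex hull {a, b, g}" "w \<in> convex hull {a, b, g}" "z \<in> convex hull {a, b, g}"
        "0 \<le> orient D u w z" "dist u w \<le> L/2^Suc k" "dist w z \<le> L/2^Suc k" "dist z u \<le> L/2^Suc k"
        "tri_flux D Z u w z \<le> - c / 4^Suc k" for u w z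
      using that(4-8) hs[OF that(1-3)] sub unfolding P_def H_def x prod.case by blast
    have "P (Suc k) y \<and> H y \<subseteq> H x"
      using y(1)
    proof (elim insertE emptyE)
      assume "y = (a, p, r)"
      then show ?thesis using y(2) PI[OF abg(1) pqr(1,3)] ors ds by simp
    next
      assume "y = (p, b, q)"
      then show ?thesis using y(2) PI[OF pqr(1) abg(2) pqr(2)] ors ds by simp
    next
      assume "y = (r, q, g)"
      then show ?thesis using y(2) PI[OF pqr(3,2) abg(3)] ors ds by simp
    next
      assume "y = (p, q, r)"
      then show ?thesis using y(2) PI[OF pqr] ors ds by (simp add: dist_commute)
    qed
    then show "\<exists>y. P (Suc k) y \<and> H y \<subseteq> H x" ..
  qed
  then obtain f where f: "\<And>k. P k (f k)" "\<And>k. H (f (Suc k)) \<subseteq> H (f k)" by blast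
  have "\<Inter>(range (\<lambda>k. H (f k))) \<noteq> {}"
  proof (rule compact_nest)
    show "compact (H (f k))" for k
      by (cases "f k") (simp add: H_def finite_imp_compact_convex_hull)
    show "H (f k) \<noteq> {}" for k by (cases "f k") (simp add: H_def)
    show "H (f k) \<subseteq> H (f j)" if "j \<le> k" for j k
      using lift_Suc_antimono_le[where f = "\<lambda>k. H (f k)", OF f(2) that] .
  qed
  then obtain x where x: "\<And>k. x \<in> H (f k)" by blast
  have xH: "x \<in> convex hull {A, B, C}"
    using x[of 0] f(1)[of 0] by (auto simp: H_def P_def split: prod.splits)
  \<comment> \<open>Chosen so that \<open>e * L\<^sup>2 < c\<close>; the summand \<open>1\<close>
    keeps the denominator positive.\<close>
  define e where "e = c / (2 * (L\<^sup>2 + 1))"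
  have L1: "L\<^sup>2 + 1 > 0" by (simp add: add_nonneg_pos)
  have e: "e > 0" using c L1 by (simp add: e_def)
  obtain \<delta> where \<delta>: "\<delta> > 0" and loc': "\<And>A B C L. {A, B, C} \<subseteq> ball x \<delta> \<Longrightarrow> x \<in> convex hull {A, B, C} \<Longrightarrow>
     0 \<le> orient D A B C \<Longrightarrow> dist A B \<le> L \<Longrightarrow> dist B C \<le> L \<Longrightarrow> dist C A \<le> L \<Longrightarrow>
     - e * L\<^sup>2 \<le> tri_flux D Z A B C"
    using loc[OF xH] e unfolding outward_at_def by metis
  obtain k where k: "L / \<delta> < 2 ^ k" using real_arch_pow[of 2 "L/\<delta>"] by auto
  then have k: "L / 2^k < \<delta>" using \<delta> by (simp add: field_simps)
  obtain a b g where abg: "f k = (a, b, g)" by (cases "f k") auto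
  have Pk: "P k (a, b, g)" using f(1)[of k] abg by simp
  have xk: "x \<in> convex hull {a, b, g}" using x[of k] abg by (simp add: H_def)
  have "convex hull {a, b, g} \<subseteq> cball x (L / 2^k)"
    using Pk xk by (intro hull3_subset_cball) (auto simp: P_def)
  then have "{a, b, g} \<subseteq> ball x \<delta>"
    using k hull_subset[of "{a,b,g}" convex] by fastforce
  then have "- e * (L / 2^k)\<^sup>2 \<le> tri_flux D Z a b g"
    using loc'[of a b g "L/2^k"] Pk xk by (auto simp: P_def)
  also have "\<dots> \<le> - c / 4^k" using Pk by (simp add: P_def)
  finally have "c / 4^k \<le> e * (L\<^sup>2 / 4^k)"
    by (simp add: power_divide power2_eq_square flip: power_mult_distrib)
  then have "c \<le> e * L\<^sup>2" by (simp add: field_simps)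
  also have "\<dots> < c"
  proof -
    have "c * L\<^sup>2 < c * (2 * (L\<^sup>2 + 1))" using c L1
      by (intro mult_strict_left_mono) (auto simp: algebra_simps intro: add_nonneg_pos)
    then show ?thesis using L1 by (simp add: e_def pos_divide_less_eq)
  qed
  finally show False by simp
qed

section \<open>Fluxes of affine and of differentiable fields\<close>

lemma flux_add:
  assumes "continuous_on K Z" "continuous_on K Y" "closed_segment A B \<subseteq> K"
  shows "flux D (\<lambda>x. Z x + Y x) A B = flux D Z A B + flux D Y A B"
proof -
  have "((\<lambda>s. D \<bullet> cross3 (Z (A + s *\<^sub>R (B - A)) + Y (A + s *\<^sub>R (B - A))) (B - A))
      has_integral flux D Z A B + flux D Y A B) {0..1}"
    using has_integral_add[OF flux_has_integral[OF assms(1,3), of D] flux_has_integral[OF assms(2,3), of D]]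
    by (simp add: cross_add_left inner_add_right)
  then show ?thesis unfolding flux_def[of D "\<lambda>x. Z x + Y x"] by (rule integral_unique)
qed

text \<open>Along a segment the integrand is affine in the parameter, so the midpoint rule is
  exact.\<close>

lemma flux_affine:
  assumes "linear f"
  shows "flux D (\<lambda>y. u + f (y - x)) A B = D \<bullet> cross3 (u + f ((1/2) *\<^sub>R (A + B) - x)) (B - A)"
proof -
  define c0 where "c0 = D \<bullet> cross3 (u + f (A - x)) (B - A)"
  define c1 where "c1 = D \<bullet> cross3 (f (B - A)) (B - A)"
  have eq: "D \<bullet> cross3 (u + f (A + s *\<^sub>R (B - A) - x)) (B - A) = c0 + c1 * s" for s
  proof -
    have "A + s *\<^sub>R (B - A) - x = (A - x) + s *\<^sub>R (B - A)" by (simp add: algebra_simps)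
    then have "f (A + s *\<^sub>R (B - A) - x) = f (A - x) + s *\<^sub>R f (B - A)"
      using assms by (simp only: linear_add linear_scale)
    then show ?thesis
      unfolding c0_def c1_def
      by (simp only: cross_add_left cross_mult_left inner_add_right inner_scaleR_right mult.commute add.assoc)
  qed
  have der: "((\<lambda>s. c0 * s + c1 * s\<^sup>2 / 2) has_real_derivative c0 + c1 * s) (at s within {0..1})" for s
    by (auto intro!: derivative_eq_intros)
  have "((\<lambda>s. c0 + c1 * s) has_integral (c0 * 1 + c1 * 1\<^sup>2 / 2 - (c0 * 0 + c1 * 0\<^sup>2 / 2))) {0..1}"
    by (rule fundamental_theorem_of_calculus)
      (use der in \<open>auto simp: has_real_derivative_iff_has_vector_derivative\<close>)
  then have "flux D (\<lambda>y. u + f (y - x)) A B = c0 + c1 * (1/2)"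
    unfolding flux_def eq by (simp add: integral_unique)
  also have "\<dots> = D \<bullet> cross3 (u + f (A + (1/2) *\<^sub>R (B - A) - x)) (B - A)" by (simp only: eq)
  also have "A + (1/2) *\<^sub>R (B - A) = (1/2) *\<^sub>R (A + B)" by (simp add: vec_eq_iff field_simps)
  finally show ?thesis .
qed

text \<open>The hypothesis \<open>tr\<close> says that \<open>q\<close> is the trace of
  \<open>f\<close> on the quotient by \<open>D\<close>, expressed through the area form
  \<open>D \<bullet> cross3 a b\<close>. The claim is the divergence theorem for an affine field;
  the factor \<open>1/2\<close> appears because \<open>orient\<close> measures twice the
  area.\<close>

lemma tri_flux_affine:
  assumes f: "linear f"
    and tr: "\<And>a b. D \<bullet> cross3 (f a) b + D \<bullet> cross3 a (f b) = q * (D \<bullet> cross3 a b)"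
  shows "tri_flux D (\<lambda>y. u + f (y - x)) A B C = q / 2 * orient D A B C"
proof -
  define a where "a = A - x"
  define b where "b = B - x"
  define c where "c = C - x"
  have ABC: "A = x + a" "B = x + b" "C = x + c" by (simp_all add: a_def b_def c_def)
  have m: "(1/2) *\<^sub>R (x + a' + (x + b')) - x = (1/2) *\<^sub>R (a' + b')" for a' b'
    by (simp add: vec_eq_iff field_simps)
  note lin = linear_add[OF f] linear_diff[OF f] linear_scale[OF f]
  have t: "D \<bullet> cross3 a (f b) = q * (D \<bullet> cross3 a b) - D \<bullet> cross3 (f a) b" for a b
    using tr[of a b] by simp
  have e: "D \<bullet> cross3 (f b') a' = - (D \<bullet> cross3 a' (f b'))" for a' b' by (rule triple_swap)
  have "tri_flux D (\<lambda>y. u + f (y - x)) A B C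
     = (1/2) * ((D \<bullet> cross3 (f a) b + D \<bullet> cross3 a (f b)) + (D \<bullet> cross3 (f b) c + D \<bullet> cross3 b (f c))
        + (D \<bullet> cross3 (f c) a + D \<bullet> cross3 c (f a)))"
    unfolding tri_flux_def flux_affine[OF f] ABC m
    using e[of b a] e[of c b] e[of a c]
    by (simp add: lin cross_linear inner_add_right inner_diff_right algebra_simps)
  also have "\<dots> = q / 2 * (D \<bullet> cross3 a b + D \<bullet> cross3 b c + D \<bullet> cross3 c a)"
    unfolding tr by (simp add: algebra_simps)
  also have "D \<bullet> cross3 a b + D \<bullet> cross3 b c + D \<bullet> cross3 c a = orient D A B C"
    unfolding ABC using triple_swap[of D a c] triple_swap[of D b a]
    by (simp add: cross_linear inner_diff_right)
  finally show ?thesis .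
qed

text \<open>On a triangle that contains \<open>x\<close> and has sides at most \<open>L\<close> the
  remainder of the linearization is at most \<open>e' * L\<close>, and each edge has length at most
  \<open>L\<close>; together this is of the order of the area.\<close>

lemma tri_flux_approx:
  assumes der: "(Z has_derivative f) (at x)" and cont: "continuous_on (ball x r) Z" "r > 0"
    and tr: "\<And>a b. D \<bullet> cross3 (f a) b + D \<bullet> cross3 a (f b) = q * (D \<bullet> cross3 a b)"
    and e: "e > 0"
  shows "\<exists>\<delta>>0. \<forall>A B C L. {A, B, C} \<subseteq> ball x \<delta> \<longrightarrow> x \<in> convex hull {A, B, C} \<longrightarrow>
     dist A B \<le> L \<longrightarrow> dist B C \<le> L \<longrightarrow> dist C A \<le> L \<longrightarrow>
     \<bar>tri_flux D Z A B C - q / 2 * orient D A B C\<bar> \<le> e * L\<^sup>2"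
proof -
  have lin: "linear f" using der by (simp add: has_derivative_linear)
  \<comment> \<open>Three edges contribute, each with a factor \<open>norm D\<close>; the summand
    \<open>1\<close> covers \<open>D = 0\<close>.\<close>
  define e' where "e' = e / (3 * (norm D + 1))"
  have D1: "norm D + 1 > 0" by (simp add: add_nonneg_pos)
  have e': "e' > 0" using e D1 by (simp add: e'_def)
  obtain \<delta>' where \<delta>': "\<delta>' > 0" "\<And>y. norm (y - x) < \<delta>' \<Longrightarrow> norm (Z y - Z x - f (y - x)) \<le> e' * norm (y - x)"
    using der e' unfolding has_derivative_at_alt by blast
  define \<delta> where "\<delta> = min r \<delta>'"
  define R where "R = (\<lambda>y. Z x + f (y - x))"
  define E where "E = (\<lambda>y. Z y - R y)"
  have cR: "continuous_on (ball x \<delta>) R" unfolding R_def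
    by (intro continuous_intros bounded_linear.continuous_on[OF has_derivative_bounded_linear[OF der]])
  have cE: "continuous_on (ball x \<delta>) E" unfolding E_def
    by (intro continuous_on_diff cR continuous_on_subset[OF cont(1)]) (auto simp: \<delta>_def)
  have main: "\<bar>tri_flux D Z A B C - q / 2 * orient D A B C\<bar> \<le> e * L\<^sup>2"
    if sub: "{A, B, C} \<subseteq> ball x \<delta>" and x: "x \<in> convex hull {A, B, C}"
      and d: "dist A B \<le> L" "dist B C \<le> L" "dist C A \<le> L" for A B C L
  proof -
    have L: "L \<ge> 0" using d(1) zero_le_dist order_trans by blast
    have h1: "convex hull {A, B, C} \<subseteq> ball x \<delta>" using sub by (intro hull_minimal convex_ball)
    have h2: "convex hull {A, B, C} \<subseteq> cball x L" using d x by (rule hull3_subset_cball)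
    have E: "norm (E y) \<le> e' * L" if "y \<in> convex hull {A, B, C}" for y
    proof -
      have "norm (y - x) < \<delta>'" "norm (y - x) \<le> L"
        using subsetD[OF h1 that] subsetD[OF h2 that] by (auto simp: dist_norm norm_minus_commute \<delta>_def)
      then have "norm (Z y - Z x - f (y - x)) \<le> e' * L"
        using \<delta>'(2)[of y] e' mult_left_mono[of "norm (y - x)" L e'] by linarith
      then show ?thesis by (simp add: E_def R_def diff_diff_eq)
    qed
    have one: "\<bar>flux D Z P Q - flux D R P Q\<bar> \<le> norm D * e' * L\<^sup>2"
      if PQ: "P \<in> {A, B, C}" "Q \<in> {A, B, C}" "dist P Q \<le> L" for P Q
    proof -
      have seg: "closed_segment P Q \<subseteq> convex hull {A, B, C}"
        unfolding segment_convex_hull by (rule hull_mono) (use PQ(1,2) in auto)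
      have seg': "closed_segment P Q \<subseteq> ball x \<delta>" using seg h1 by blast
      have "flux D Z P Q = flux D (\<lambda>y. R y + E y) P Q" by (simp add: E_def)
      also have "\<dots> = flux D R P Q + flux D E P Q" by (rule flux_add[OF cR cE seg'])
      finally have "flux D Z P Q - flux D R P Q = flux D E P Q" by simp
      also have "\<bar>\<dots>\<bar> \<le> norm D * e' * L\<^sup>2 * measure lborel {0..1::real}"
      proof -
        have "norm (D \<bullet> cross3 (E (P + s *\<^sub>R (Q - P))) (Q - P)) \<le> norm D * e' * L\<^sup>2" if "s \<in> {0..1}" for s
        proof -
          have "norm D * norm (E (P + s *\<^sub>R (Q - P))) \<le> norm D * (e' * L)"
            by (intro mult_left_mono E segment_param_mem[OF seg that]) auto
          moreover have "norm (Q - P) \<le> L" using PQ(3) by (simp add: dist_norm norm_minus_commute)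
          ultimately have "norm D * norm (E (P + s *\<^sub>R (Q - P))) * norm (Q - P) \<le> (norm D * (e' * L)) * L"
            by (rule mult_mono) (use e' L in simp_all)
          then show ?thesis using abs_triple_le[of D "E (P + s *\<^sub>R (Q - P))" "Q - P"]
            by (simp add: power2_eq_square mult.assoc)
        qed
        moreover have "0 \<le> norm D * e' * L\<^sup>2" using e' by simp
        ultimately show ?thesis
          using has_integral_bound_real[OF _ _ flux_has_integral[OF cE seg', of D], of "norm D * e' * L\<^sup>2" "{}"]
          by (simp only: real_norm_def finite.emptyI Diff_empty)
      qed
      finally show ?thesis by simp
    qed
    have "tri_flux D R A B C = q / 2 * orient D A B C"
      unfolding R_def by (rule tri_flux_affine[OF lin tr])
    then have "\<bar>tri_flux D Z A B C - q / 2 * orient D A B C\<bar> \<le> 3 * (norm D * e' * L\<^sup>2)"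
      using one[of A B] one[of B C] one[of C A] d by (simp add: tri_flux_def)
    also have "\<dots> = (norm D / (norm D + 1)) * (e * L\<^sup>2)" using D1 by (simp add: e'_def field_simps)
    also have "\<dots> \<le> 1 * (e * L\<^sup>2)"
      using D1 e by (intro mult_right_mono) auto
    finally show ?thesis by simp
  qed
  have "\<delta> > 0" using \<delta>'(1) cont(2) by (simp add: \<delta>_def)
  then show ?thesis using main by blast
qed

lemma outward_at_differentiable:
  assumes "(Z has_derivative f) (at x)" "continuous_on (ball x r) Z" "r > 0"
    and "\<And>a b. D \<bullet> cross3 (f a) b + D \<bullet> cross3 a (f b) = q * (D \<bullet> cross3 a b)"
    and "0 \<le> q"
  shows "outward_at D Z x"
  unfolding outward_at_def
proof (intro allI impI)
  fix e :: real assume "e > 0"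
  from tri_flux_approx[OF assms(1-4) this] obtain \<delta> where \<delta>: "\<delta> > 0"
    "\<And>A B C L. {A, B, C} \<subseteq> ball x \<delta> \<Longrightarrow> x \<in> convex hull {A, B, C} \<Longrightarrow>
     dist A B \<le> L \<Longrightarrow> dist B C \<le> L \<Longrightarrow> dist C A \<le> L \<Longrightarrow>
     \<bar>tri_flux D Z A B C - q / 2 * orient D A B C\<bar> \<le> e * L\<^sup>2" by blast
  show "\<exists>\<delta>>0. \<forall>A B C L. {A, B, C} \<subseteq> ball x \<delta> \<longrightarrow> x \<in> convex hull {A, B, C} \<longrightarrow>
     0 \<le> orient D A B C \<longrightarrow> dist A B \<le> L \<longrightarrow> dist B C \<le> L \<longrightarrow> dist C A \<le> L \<longrightarrow>
     - e * L\<^sup>2 \<le> tri_flux D Z A B C"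
  proof (intro exI[of _ \<delta>] conjI \<delta> allI impI)
    fix A B C L
    assume *: "{A, B, C} \<subseteq> ball x \<delta>" "x \<in> convex hull {A, B, C}"
      "0 \<le> orient D A B C" "dist A B \<le> L" "dist B C \<le> L" "dist C A \<le> L"
    have "0 \<le> q / 2 * orient D A B C" using *(3) assms(5) by simp
    then show "- e * L\<^sup>2 \<le> tri_flux D Z A B C" using \<delta>(2)[OF *(1,2,4-6)] by linarith
  qed
qed

section \<open>Concentric copies of a triangle\<close>

text \<open>The difference of the two fluxes is the flux through a quadrilateral, which the diagonal
  from \<open>a'\<close> to \<open>b\<close> cuts into two triangles of nonnegative
  orientation.\<close>

lemma tri_flux_homothetic_mono:
  assumes cont: "continuous_on K Z" and hull: "convex hull {o', a, b} \<subseteq> K"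
    and out: "\<And>A B C. convex hull {A, B, C} \<subseteq> K \<Longrightarrow> 0 \<le> orient D A B C \<Longrightarrow> 0 \<le> tri_flux D Z A B C"
    and or: "0 \<le> orient D o' a b" and t: "0 < t" "t < 1"
  shows "tri_flux D Z o' (o' + t *\<^sub>R (a - o')) (o' + t *\<^sub>R (b - o')) \<le> tri_flux D Z o' a b"
proof -
  define a' where "a' = o' + t *\<^sub>R (a - o')"
  define b' where "b' = o' + t *\<^sub>R (b - o')"
  have in3: "o' \<in> convex hull {o', a, b}" "a \<in> convex hull {o', a, b}" "b \<in> convex hull {o', a, b}"
    by (simp_all add: hull_inc)
  have sub: "convex hull {u, v, w} \<subseteq> K"
    if "u \<in> convex hull {o', a, b}" "v \<in> convex hull {o', a, b}" "w \<in> convex hull {o', a, b}" for u v w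
  proof -
    have "convex hull {u, v, w} \<subseteq> convex hull {o', a, b}"
      by (rule hull_minimal) (simp_all add: that)
    then show ?thesis using hull by (rule order_trans)
  qed
  have seg: "closed_segment u v \<subseteq> convex hull {o', a, b}"
    if "u \<in> convex hull {o', a, b}" "v \<in> convex hull {o', a, b}" for u v
    using that by (simp add: closed_segment_subset)
  have a'b': "a' \<in> convex hull {o', a, b}" "b' \<in> convex hull {o', a, b}"
    unfolding a'_def b'_def using t
    by (intro segment_param_mem[OF seg[OF in3(1,2)]] segment_param_mem[OF seg[OF in3(1,3)]]; simp)+
  have sp: "flux D Z o' a = flux D Z o' a' + flux D Z a' a" "flux D Z o' b = flux D Z o' b' + flux D Z b' b"
    using hull seg[OF in3(1,2)] seg[OF in3(1,3)] unfolding a'_def b'_def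
    by (intro flux_split[OF cont _ t]; blast)+
  have o1: "orient D a' a b = (1 - t) * orient D o' a b"
    unfolding a'_def by (simp add: cross3_simps)
  have o2: "orient D a' b b' = t * (1 - t) * orient D o' a b"
    unfolding a'_def b'_def by (simp add: cross3_simps)
  have "0 \<le> tri_flux D Z a' a b" "0 \<le> tri_flux D Z a' b b'"
    using out[OF sub[OF a'b'(1) in3(2,3)]] out[OF sub[OF a'b'(1) in3(3) a'b'(2)]] o1 o2 or t by simp_all
  then have "0 \<le> tri_flux D Z o' a b - tri_flux D Z o' a' b'"
    using sp flux_reverse[of D Z b o'] flux_reverse[of D Z b' o'] flux_reverse[of D Z b a'] flux_reverse[of D Z b b']
      flux_reverse[of D Z b' a']
    unfolding tri_flux_def by simp
  then show ?thesis by (simp add: a'_def b'_def)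
qed

lemma tri_flux_star:
  "tri_flux D Z p q r = tri_flux D Z o' p q + tri_flux D Z o' q r + tri_flux D Z o' r p"
  unfolding tri_flux_def using flux_reverse[of D Z o' p] flux_reverse[of D Z o' q] flux_reverse[of D Z o' r] by simp

text \<open>Dominated convergence. A bound for \<open>Z\<close> suffices, and the limit is required
  only at relative interior points of the side, since the endpoints, the corners in the application,
  have measure zero. This is why the integrals are taken over the open interval.\<close>

lemma side_flux_tendsto_0:
  assumes cont: "continuous_on K Z" and bd: "\<And>x. x \<in> K \<Longrightarrow> norm (Z x) \<le> M"
    and seg: "\<And>r. 0 < r \<Longrightarrow> r < 1 \<Longrightarrow> closed_segment (o' + r *\<^sub>R (p - o')) (o' + r *\<^sub>R (q - o')) \<subseteq> K"
    and lim: "\<And>s. s \<in> {0<..<1} \<Longrightarrow>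
      ((\<lambda>r. D \<bullet> cross3 (Z (o' + r *\<^sub>R (p + s *\<^sub>R (q - p) - o'))) (q - p)) \<longlongrightarrow> 0) (at_left 1)"
    and r: "\<And>k::nat. 0 < r k \<and> r k < 1" "r \<longlonglongrightarrow> 1"
  shows "(\<lambda>k. flux D Z (o' + r k *\<^sub>R (p - o')) (o' + r k *\<^sub>R (q - o'))) \<longlonglongrightarrow> 0"
proof -
  define f where "f = (\<lambda>k s. D \<bullet> cross3 (Z (o' + r k *\<^sub>R (p + s *\<^sub>R (q - p) - o'))) (r k *\<^sub>R (q - p)))"
  have feq: "(\<lambda>s. D \<bullet> cross3 (Z ((o' + r k *\<^sub>R (p - o')) + s *\<^sub>R ((o' + r k *\<^sub>R (q - o')) - (o' + r k *\<^sub>R (p - o')))))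
      ((o' + r k *\<^sub>R (q - o')) - (o' + r k *\<^sub>R (p - o')))) = f k" for k
    unfolding f_def by (intro ext arg_cong2[where f=inner] refl arg_cong2[where f=cross3] arg_cong[where f=Z])
       (simp_all add: algebra_simps)
  have int: "f k integrable_on {0..1}" "flux D Z (o' + r k *\<^sub>R (p - o')) (o' + r k *\<^sub>R (q - o')) = integral {0..1} (f k)" for k
    using flux_has_integral[OF cont seg, of "r k" D] r(1)[of k] unfolding feq
    by (auto simp: has_integral_integrable_integral)
  have open_int: "f k integrable_on {0<..<1}" for k
    using int(1)[of k] integrable_on_open_interval[of "f k" 0 1] by simp
  have "(\<lambda>k. integral {0<..<1} (f k)) \<longlonglongrightarrow> integral {0<..<1::real} (\<lambda>s. 0::real)"
  proof (rule dominated_convergence(2))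
    show "f k integrable_on {0<..<1}" for k by (rule open_int)
    show "(\<lambda>s::real. norm D * M * norm (q - p)) integrable_on {0<..<1}"
      using integrable_on_open_interval[of "\<lambda>s::real. norm D * M * norm (q - p)" 0 1]
        integrable_const_ivl[of "norm D * M * norm (q - p)" 0 "1::real"] by simp
    fix k and s :: real assume s: "s \<in> {0<..<1}"
    let ?y = "o' + r k *\<^sub>R (p + s *\<^sub>R (q - p) - o')"
    have rk: "0 < r k" "r k < 1" using r(1) by auto
    have yeq: "?y = (o' + r k *\<^sub>R (p - o')) + s *\<^sub>R ((o' + r k *\<^sub>R (q - o')) - (o' + r k *\<^sub>R (p - o')))"
      by (simp add: algebra_simps)
    have "?y \<in> K" unfolding yeq by (rule segment_param_mem[OF seg[OF rk]]) (use s in auto)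
    then have Z: "norm (Z ?y) \<le> M" by (rule bd)
    then have M: "M \<ge> 0" using norm_ge_zero order_trans by blast
    have "\<bar>f k s\<bar> \<le> norm D * norm (Z ?y) * norm (r k *\<^sub>R (q - p))"
      unfolding f_def by (rule abs_triple_le)
    also have "\<dots> \<le> norm D * M * norm (q - p)"
      using rk Z M mult_left_le_one_le[of "norm (q - p)" "r k"] by (intro mult_mono) auto
    finally show "norm (f k s) \<le> norm D * M * norm (q - p)" by simp
  next
    fix s :: real assume s: "s \<in> {0<..<1}"
    have "filterlim r (at_left 1) sequentially"
      using r by (auto simp: filterlim_at intro!: always_eventually)
         (metis less_irrefl)
    then have "(\<lambda>k. D \<bullet> cross3 (Z (o' + r k *\<^sub>R (p + s *\<^sub>R (q - p) - o'))) (q - p)) \<longlonglongrightarrow> 0"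
      using filterlim_compose[OF lim[OF s]] by blast
    from tendsto_mult[OF r(2) this]
    show "(\<lambda>k. f k s) \<longlonglongrightarrow> 0" by (simp add: f_def cross_mult_right)
  qed
  moreover have "integral {0<..<1} (f k) = integral {0..1} (f k)" for k
    using integral_open_interval[of 0 1 "f k"] by simp
  ultimately show ?thesis using int(2) by simp
qed

text \<open>Split into three triangles with apex \<open>o'\<close>, the flux through the copy of
  ratio \<open>r\<close> is nondecreasing in \<open>r\<close> by
  \<open>tri_flux_homothetic_mono\<close>. It tends to zero as \<open>r\<close> approaches
  \<open>1\<close>, so no earlier value is positive.\<close>

lemma tri_flux_homothetic_nonpos:
  assumes cont: "continuous_on K Z" and bd: "\<And>x. x \<in> K \<Longrightarrow> norm (Z x) \<le> M"
    and out: "\<And>A B C. convex hull {A, B, C} \<subseteq> K \<Longrightarrow> 0 \<le> orient D A B C \<Longrightarrow> 0 \<le> tri_flux D Z A B C"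
    and conv: "convex K" and oK: "o' \<in> K"
    and inK: "\<And>r p. p \<in> {p1, p2, p3} \<Longrightarrow> 0 < r \<Longrightarrow> r < 1 \<Longrightarrow> o' + r *\<^sub>R (p - o') \<in> K"
    and ors: "0 \<le> orient D o' p1 p2" "0 \<le> orient D o' p2 p3" "0 \<le> orient D o' p3 p1"
    and lim: "\<And>p q s. (p, q) \<in> {(p1, p2), (p2, p3), (p3, p1)} \<Longrightarrow> s \<in> {0<..<1} \<Longrightarrow>
      ((\<lambda>r. D \<bullet> cross3 (Z (o' + r *\<^sub>R (p + s *\<^sub>R (q - p) - o'))) (q - p)) \<longlongrightarrow> 0) (at_left 1)"
    and t: "0 < t" "t < 1"
  shows "tri_flux D Z (o' + t *\<^sub>R (p1 - o')) (o' + t *\<^sub>R (p2 - o')) (o' + t *\<^sub>R (p3 - o')) \<le> 0"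
proof -
  define F where "F = (\<lambda>r. tri_flux D Z (o' + r *\<^sub>R (p1 - o')) (o' + r *\<^sub>R (p2 - o')) (o' + r *\<^sub>R (p3 - o')))"
  have seg: "closed_segment (o' + r *\<^sub>R (p - o')) (o' + r *\<^sub>R (q - o')) \<subseteq> K"
    if "0 < r" "r < 1" "p \<in> {p1, p2, p3}" "q \<in> {p1, p2, p3}" for r p q
    using inK that conv by (intro closed_segment_subset) auto
  define r where "r = (\<lambda>k::nat. 1 - (1 - t) / 2 * inverse (real (Suc k)))"
  have "(1 - t) / 2 * inverse (real (Suc k)) \<le> (1 - t) / 2 * 1" for k
    using t by (intro mult_left_mono) (auto simp: inverse_le_1_iff)
  moreover have "(1 - t) / 2 * 1 < 1 - t" using t by simp
  ultimately have rt: "t < r k" for k unfolding r_def by (smt (verit))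
  have r1: "r k < 1" for k unfolding r_def using t by simp
  have r: "0 < r k \<and> r k < 1" for k using rt[of k] r1[of k] t by simp
  have "(\<lambda>k::nat. 1 - (1 - t) / 2 * inverse (real (Suc k))) \<longlonglongrightarrow> 1 - (1 - t) / 2 * 0"
    by (intro tendsto_intros LIMSEQ_inverse_real_of_nat)
  then have rlim: "r \<longlonglongrightarrow> 1" by (simp add: r_def)
  have "(\<lambda>k. flux D Z (o' + r k *\<^sub>R (p - o')) (o' + r k *\<^sub>R (q - o'))) \<longlonglongrightarrow> 0"
    if "(p, q) \<in> {(p1, p2), (p2, p3), (p3, p1)}" for p q
    using that by (intro side_flux_tendsto_0[OF cont bd seg lim r rlim]) auto
  then have "(\<lambda>k. F (r k)) \<longlonglongrightarrow> 0 + 0 + 0"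
    unfolding F_def tri_flux_def by (intro tendsto_add) auto
  moreover have "F t \<le> F (r k)" for k
  proof -
    have *: "o' + t *\<^sub>R (p - o') = o' + (t / r k) *\<^sub>R ((o' + r k *\<^sub>R (p - o')) - o')" for p
      using r[of k] by simp
    have mono: "tri_flux D Z o' (o' + t *\<^sub>R (p - o')) (o' + t *\<^sub>R (q - o'))
       \<le> tri_flux D Z o' (o' + r k *\<^sub>R (p - o')) (o' + r k *\<^sub>R (q - o'))"
      if "p \<in> {p1, p2, p3}" "q \<in> {p1, p2, p3}" "0 \<le> orient D o' p q" for p q
    proof -
      let ?p = "o' + r k *\<^sub>R (p - o')" and ?q = "o' + r k *\<^sub>R (q - o')"
      have "convex hull {o', ?p, ?q} \<subseteq> K"
        by (rule hull_minimal) (use oK inK[OF that(1), of "r k"] inK[OF that(2), of "r k"] r[of k] conv in simp_all)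
      moreover have "orient D o' ?p ?q = r k * r k * orient D o' p q"
        by (simp add: cross_mult_left cross_mult_right)
      then have "0 \<le> orient D o' ?p ?q" using that(3) r[of k] by simp
      ultimately show ?thesis
        unfolding * using out t rt[of k] r[of k] by (intro tri_flux_homothetic_mono[OF cont]) simp_all
    qed
    show ?thesis unfolding F_def tri_flux_star[of _ _ "o' + _" _ _ o']
      using mono[OF _ _ ors(1)] mono[OF _ _ ors(2)] mono[OF _ _ ors(3)] by (intro add_mono) auto
  qed
  ultimately have "F t \<le> 0" using LIMSEQ_le_const[of "\<lambda>k. F (r k)" 0 "F t"] by auto
  then show ?thesis by (simp add: F_def)
qed

section \<open>Fields that are constant in one direction\<close>

lemma vec2_eq: "(w::real^2) = (w $ 1) *\<^sub>R axis 1 1 + (w $ 2) *\<^sub>R axis 2 1"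
  by (simp add: vec_eq_iff forall_2 axis_def)

text \<open>The direction \<open>d\<close> serves as a third coordinate next to the two parameters
  of a sheet that lines parallel to \<open>d\<close> meet at most once. The dimensions agree, so
  invariance of domain applies without any differentiability.\<close>

lemma lift_homeomorphism:
  fixes Y :: "real^2 \<Rightarrow> real^3"
  assumes "open U" "continuous_on U Y" "d \<noteq> 0"
    and inj: "\<And>w w' s. w \<in> U \<Longrightarrow> w' \<in> U \<Longrightarrow> Y w' = Y w + s *\<^sub>R d \<Longrightarrow> w' = w"
  obtains T g where "open T" "homeomorphism (U \<times> UNIV) T (\<lambda>(w, s). Y w + s *\<^sub>R d) g"
proof -
  let ?\<Psi> = "\<lambda>(w, s::real). Y w + s *\<^sub>R d"
  have o: "open (U \<times> (UNIV :: real set))" using assms(1) by (simp add: open_Times)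
  have c: "continuous_on (U \<times> UNIV) ?\<Psi>"
    unfolding case_prod_beta
    by (intro continuous_intros continuous_on_compose2[OF assms(2)]) auto
  have i: "inj_on ?\<Psi> (U \<times> UNIV)"
  proof (rule inj_onI, clarsimp)
    fix w s w' s' assume *: "w \<in> U" "w' \<in> U" "Y w + s *\<^sub>R d = Y w' + s' *\<^sub>R d"
    then have "Y w' = Y w + (s - s') *\<^sub>R d" by (simp add: algebra_simps)
    then have "w' = w" using inj * by blast
    then show "w = w' \<and> s = s'" using *(3) assms(3) by simp
  qed
  have D: "DIM(real^3) \<le> DIM((real^2) \<times> real)" by simp
  obtain g where g: "homeomorphism (U \<times> UNIV) (?\<Psi> ` (U \<times> UNIV)) ?\<Psi> g"
    using invariance_of_domain_homeomorphism[OF o c D i] by blast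
  show thesis
    using that[OF invariance_of_domain_gen[OF o c i D] g] .
qed

lemma cramer:
  fixes d :: "real^3"
  assumes "J = d \<bullet> cross3 a b" "J \<noteq> 0"
  shows "x = (d \<bullet> cross3 x b / J) *\<^sub>R a + (d \<bullet> cross3 a x / J) *\<^sub>R b + (x \<bullet> cross3 a b / J) *\<^sub>R d"
proof -
  have "J *\<^sub>R x = (d \<bullet> cross3 x b) *\<^sub>R a + (d \<bullet> cross3 a x) *\<^sub>R b + (x \<bullet> cross3 a b) *\<^sub>R d"
    unfolding assms(1) by (simp add: vec_eq_iff forall_3 cross3_simps)
  then have "(1/J) *\<^sub>R J *\<^sub>R x = (1/J) *\<^sub>R ((d \<bullet> cross3 x b) *\<^sub>R a + (d \<bullet> cross3 a x) *\<^sub>R b + (x \<bullet> cross3 a b) *\<^sub>R d)"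
    by simp
  then show ?thesis using assms(2) by (simp add: scaleR_add_right)
qed

text \<open>\<open>Z\<close> is \<open>\<xi>\<close> carried along \<open>d\<close>, that is,
  \<open>\<xi>\<close> composed with the first component of the inverse of the lift. Where the sheet
  is transversal to \<open>d\<close> that inverse has the derivative given by Cramer's rule, and the
  quotient by \<open>J\<close> is the trace modulo \<open>d\<close> in the basis of tangent vectors.
  The last conjunct, with \<open>\<xi>\<close> the surface itself, says that the foot of a moving
  point moves tangentially; \<open>vertical_foot\<close> uses it.\<close>

lemma lift_derivative_range:
  fixes Y \<xi> :: "real^2 \<Rightarrow> real^3"
  assumes U: "open U" "continuous_on U Y" "d \<noteq> 0"
    and inj: "\<And>w w' s. w \<in> U \<Longrightarrow> w' \<in> U \<Longrightarrow> Y w' = Y w + s *\<^sub>R d \<Longrightarrow> w' = w"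
    and w: "w \<in> U" and dY: "(Y has_derivative Y') (at w)" and dxi: "(\<xi> has_derivative \<xi>') (at w)"
    and J: "J = d \<bullet> cross3 (Y' (axis 1 1)) (Y' (axis 2 1))" "J \<noteq> 0"
    and Z: "\<And>w s. w \<in> U \<Longrightarrow> Z (Y w + s *\<^sub>R d) = \<xi> w"
    and D: "D = \<tau> *\<^sub>R d"
  shows "\<exists>f. (Z has_derivative f) (at (Y w + s *\<^sub>R d)) \<and>
    (\<forall>a b. D \<bullet> cross3 (f a) b + D \<bullet> cross3 a (f b) =
      (d \<bullet> cross3 (\<xi>' (axis 1 1)) (Y' (axis 2 1)) + d \<bullet> cross3 (Y' (axis 1 1)) (\<xi>' (axis 2 1))) / J
        * (D \<bullet> cross3 a b)) \<and> (\<forall>x. \<exists>v. f x = \<xi>' v)"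
proof -
  let ?\<Psi> = "\<lambda>(w, s::real). Y w + s *\<^sub>R d"
  obtain T g where T: "open T" and hom: "homeomorphism (U \<times> UNIV) T ?\<Psi> g"
    by (rule lift_homeomorphism[OF U inj])
  let ?p = "Y w + s *\<^sub>R d"
  have pT: "?p \<in> T"
    unfolding homeomorphism_image1[OF hom, symmetric] by (rule image_eqI[of _ _ "(w, s)"]) (simp_all add: w)
  have gp: "g ?p = (w, s)" using homeomorphism_apply1[OF hom, of "(w, s)"] w by simp
  define Y1 where "Y1 = Y' (axis 1 1)"
  define Y2 where "Y2 = Y' (axis 2 1)"
  define x1 where "x1 = \<xi>' (axis 1 1)"
  define x2 where "x2 = \<xi>' (axis 2 1)"
  have linY: "linear Y'" and linx: "linear \<xi>'" by (rule has_derivative_linear[OF dY], rule has_derivative_linear[OF dxi])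
  have Y'eq: "Y' v = (v $ 1) *\<^sub>R Y1 + (v $ 2) *\<^sub>R Y2" for v
  proof -
    have "Y' v = Y' ((v $ 1) *\<^sub>R axis 1 1 + (v $ 2) *\<^sub>R axis 2 1)" by (rule arg_cong[OF vec2_eq])
    then show ?thesis by (simp only: linear_add[OF linY] linear_scale[OF linY] Y1_def Y2_def)
  qed
  have J': "J = d \<bullet> cross3 Y1 Y2" using J by (simp add: Y1_def Y2_def)
  \<comment> \<open>Coordinates with respect to the basis \<open>Y1\<close>, \<open>Y2\<close>,
    \<open>d\<close>.\<close>
  define g' where "g' = (\<lambda>x. ((d \<bullet> cross3 x Y2 / J) *\<^sub>R (axis 1 1 :: real^2) + (d \<bullet> cross3 Y1 x / J) *\<^sub>R axis 2 1,
      x \<bullet> cross3 Y1 Y2 / J))"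
  have ling': "linear g'"
    unfolding g'_def
    by (rule linearI) (simp_all add: cross_linear inner_add_right inner_add_left scaleR_add_left add_divide_distrib scaleR_add_right)
  have d\<Psi>: "(?\<Psi> has_derivative (\<lambda>(v, t). Y' v + t *\<^sub>R d)) (at (g ?p))"
  proof -
    have 1: "((\<lambda>p. Y (fst p)) has_derivative (\<lambda>p. Y' (fst p))) (at (w, s))"
      by (rule has_derivative_compose[OF has_derivative_fst[OF has_derivative_ident]]) (simp add: dY)
    have 2: "((\<lambda>p. snd p *\<^sub>R d) has_derivative (\<lambda>p. snd p *\<^sub>R d)) (at (w, s))"
      by (rule has_derivative_scaleR_left[OF has_derivative_snd[OF has_derivative_ident]])
    show ?thesis unfolding gp case_prod_beta by (rule has_derivative_add[OF 1 2])
  qed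
  have "(g has_derivative g') (at ?p)"
  proof (rule has_derivative_inverse_basic[where f = ?\<Psi> and f' = "\<lambda>(v, t). Y' v + t *\<^sub>R d" and T = T])
    show "(?\<Psi> has_derivative (\<lambda>(v, t). Y' v + t *\<^sub>R d)) (at (g ?p))" by (rule d\<Psi>)
    show "bounded_linear g'" using ling' by (simp add: linear_conv_bounded_linear)
    show "g' \<circ> (\<lambda>(v, t). Y' v + t *\<^sub>R d) = id"
    proof
      fix vt :: "(real^2) \<times> real"
      obtain v t where vt: "vt = (v, t)" by (cases vt)
      let ?x = "Y' v + t *\<^sub>R d"
      have "d \<bullet> cross3 ?x Y2 = v $ 1 * J" "d \<bullet> cross3 Y1 ?x = v $ 2 * J" "?x \<bullet> cross3 Y1 Y2 = t * J"
        unfolding Y'eq J'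
        by (simp_all add: cross_linear inner_add_right inner_add_left dot_cross_self)
      then have "g' ?x = ((v $ 1) *\<^sub>R axis 1 1 + (v $ 2) *\<^sub>R axis 2 1, t)"
        using J(2) by (simp add: g'_def)
      then show "(g' \<circ> (\<lambda>(v, t). Y' v + t *\<^sub>R d)) vt = id vt" unfolding vt by (simp flip: vec2_eq)
    qed
    show "continuous (at ?p) g"
      using homeomorphism_cont2[OF hom] T pT by (simp add: continuous_on_eq_continuous_at)
    show "open T" "?p \<in> T" by fact+
    show "?\<Psi> (g z) = z" if "z \<in> T" for z by (rule homeomorphism_apply2[OF hom that])
  qed
  then have dg1: "((\<lambda>z. fst (g z)) has_derivative (\<lambda>x. fst (g' x))) (at ?p)"
    by (rule has_derivative_fst)
  have dxi': "(\<xi> has_derivative \<xi>') (at (fst (g ?p)))" using dxi gp by simp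
  define f where "f = (\<lambda>x. \<xi>' (fst (g' x)))"
  have "((\<lambda>z. \<xi> (fst (g z))) has_derivative f) (at ?p)"
    unfolding f_def by (rule has_derivative_compose[OF dg1 dxi'])
  then have df: "(Z has_derivative f) (at ?p)"
  proof (rule has_derivative_transform_within_open[OF _ T pT])
    fix z assume z: "z \<in> T"
    then obtain w' s' where gz: "g z = (w', s')" "w' \<in> U" "z = Y w' + s' *\<^sub>R d"
    proof -
      have "g z \<in> U \<times> UNIV" using homeomorphism_image2[OF hom] z by blast
      then show thesis using that[of "fst (g z)" "snd (g z)"] homeomorphism_apply2[OF hom z]
        by (simp add: case_prod_beta mem_Times_iff)
    qed
    then show "\<xi> (fst (g z)) = Z z" using Z by simp
  qed
  define \<alpha> where "\<alpha> = (\<lambda>x. d \<bullet> cross3 x Y2 / J)"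
  define \<beta> where "\<beta> = (\<lambda>x. d \<bullet> cross3 Y1 x / J)"
  define \<kappa> where "\<kappa> = (\<lambda>x. x \<bullet> cross3 Y1 Y2 / J)"
  have feq: "f x = \<alpha> x *\<^sub>R x1 + \<beta> x *\<^sub>R x2" for x
    using linx by (simp add: f_def g'_def linear_add linear_scale \<alpha>_def \<beta>_def x1_def x2_def)
  have xeq: "x = \<alpha> x *\<^sub>R Y1 + \<beta> x *\<^sub>R Y2 + \<kappa> x *\<^sub>R d" for x
    unfolding \<alpha>_def \<beta>_def \<kappa>_def by (rule cramer[OF J' J(2)])
  have br: "d \<bullet> cross3 u x = \<alpha> x * (d \<bullet> cross3 u Y1) + \<beta> x * (d \<bullet> cross3 u Y2)" for u x
    by (subst (1) xeq[of x]) (simp add: cross_linear inner_add_right dot_cross_self)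
  have br': "d \<bullet> cross3 x u = \<alpha> x * (d \<bullet> cross3 Y1 u) + \<beta> x * (d \<bullet> cross3 Y2 u)" for u x
    by (subst (1) xeq[of x]) (simp add: cross_linear inner_add_right dot_cross_self)
  have sw: "d \<bullet> cross3 Y2 Y1 = - J" "d \<bullet> cross3 Y2 x1 = - (d \<bullet> cross3 x1 Y2)" "d \<bullet> cross3 Y1 x1 = - (d \<bullet> cross3 x1 Y1)"
    "d \<bullet> cross3 Y1 x2 = - (d \<bullet> cross3 x2 Y1)" "d \<bullet> cross3 Y2 x2 = - (d \<bullet> cross3 x2 Y2)"
    unfolding J' by (rule triple_swap)+
  have ab: "d \<bullet> cross3 a b = (\<alpha> a * \<beta> b - \<beta> a * \<alpha> b) * J" for a b
    by (subst br', subst (1 2) br) (simp add: sw J'[symmetric] algebra_simps)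
  have "d \<bullet> cross3 (f a) b + d \<bullet> cross3 a (f b)
    = (\<alpha> a * \<beta> b - \<beta> a * \<alpha> b) * (d \<bullet> cross3 x1 Y2 + d \<bullet> cross3 Y1 x2)" for a b
    unfolding feq br[of _ b] br'[of a] by (simp add: cross_linear inner_add_right sw algebra_simps)
  then have key: "d \<bullet> cross3 (f a) b + d \<bullet> cross3 a (f b)
    = (d \<bullet> cross3 x1 Y2 + d \<bullet> cross3 Y1 x2) / J * (d \<bullet> cross3 a b)" for a b
    unfolding ab using J(2) by simp
  have "D \<bullet> cross3 (f a) b + D \<bullet> cross3 a (f b)
    = (d \<bullet> cross3 x1 Y2 + d \<bullet> cross3 Y1 x2) / J * (D \<bullet> cross3 a b)" for a b
    using arg_cong[OF key[of a b], of "\<lambda>z. \<tau> * z"] unfolding D by (simp add: algebra_simps)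
  then show ?thesis using df unfolding x1_def x2_def Y1_def Y2_def f_def by blast
qed

lemma lift_derivative:
  fixes Y \<xi> :: "real^2 \<Rightarrow> real^3"
  assumes U: "open U" "continuous_on U Y" "d \<noteq> 0"
    and inj: "\<And>w w' s. w \<in> U \<Longrightarrow> w' \<in> U \<Longrightarrow> Y w' = Y w + s *\<^sub>R d \<Longrightarrow> w' = w"
    and w: "w \<in> U" and dY: "(Y has_derivative Y') (at w)" and dxi: "(\<xi> has_derivative \<xi>') (at w)"
    and J: "J = d \<bullet> cross3 (Y' (axis 1 1)) (Y' (axis 2 1))" "J \<noteq> 0"
    and Z: "\<And>w s. w \<in> U \<Longrightarrow> Z (Y w + s *\<^sub>R d) = \<xi> w"
    and D: "D = \<tau> *\<^sub>R d"
  shows "\<exists>f. (Z has_derivative f) (at (Y w + s *\<^sub>R d)) \<and>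
    (\<forall>a b. D \<bullet> cross3 (f a) b + D \<bullet> cross3 a (f b) =
      (d \<bullet> cross3 (\<xi>' (axis 1 1)) (Y' (axis 2 1)) + d \<bullet> cross3 (Y' (axis 1 1)) (\<xi>' (axis 2 1))) / J
        * (D \<bullet> cross3 a b))"
proof -
  let ?q = "(d \<bullet> cross3 (\<xi>' (axis 1 1)) (Y' (axis 2 1)) + d \<bullet> cross3 (Y' (axis 1 1)) (\<xi>' (axis 2 1))) / J"
  have "\<exists>f. (Z has_derivative f) (at (Y w + s *\<^sub>R d)) \<and>
    (\<forall>a b. D \<bullet> cross3 (f a) b + D \<bullet> cross3 a (f b) = ?q * (D \<bullet> cross3 a b)) \<and> (\<forall>x. \<exists>v. f x = \<xi>' v)"
    by (rule lift_derivative_range[OF U inj w dY dxi J Z D])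
  then show ?thesis by blast
qed

lemma vector2_eq: "(vector [a, b] :: real^2) = a *\<^sub>R axis 1 1 + b *\<^sub>R axis 2 1"
  by (simp add: vec_eq_iff forall_2 axis_def)

lemma continuous_on_vector_2:
  fixes f g :: "'a::topological_space \<Rightarrow> real"
  assumes "continuous_on S f" "continuous_on S g"
  shows "continuous_on S (\<lambda>x. vector [f x, g x] :: real^2)"
  unfolding vector2_eq by (intro continuous_intros assms)

lemmas bounded_bilinear_cross3 = bilinear_cross[unfolded bilinear_conv_bounded_bilinear]

text \<open>The graph of \<open>\<psi>\<close> may have tangent planes parallel to \<open>d\<close>. Tilting it by \<open>\<epsilon>\<close> makes its projection along
  \<open>d\<close> a local diffeomorphism, and the fields of the tilted graphs converge to \<open>Z\<close>.\<close>

lemma tilt_tri_flux_nonneg: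
  fixes \<psi> :: "real^2 \<Rightarrow> real" and \<xi> :: "real^2 \<Rightarrow> real^3" and e k d :: "real^3"
  defines "Y \<equiv> \<lambda>\<epsilon> w. (w $ 1) *\<^sub>R e + (w $ 2) *\<^sub>R d + (\<psi> w - \<epsilon> * w $ 2) *\<^sub>R k"
  assumes on: "norm e = 1" "norm d = 1" "norm k = 1" "e \<bullet> d = 0" "e \<bullet> k = 0" "k \<bullet> d = 0" "e \<bullet> (cross3 k d) \<noteq> 0"
    and r: "r > 0" and Q: "Q = {w. \<bar>w $ 1 - a0\<bar> < r \<and> \<bar>w $ 2 - b0\<bar> < r}"
    and dpsi: "\<And>w. w \<in> Q \<Longrightarrow> (\<psi> has_derivative \<psi>' w) (at w)"
    and dxi: "\<And>w. w \<in> Q \<Longrightarrow> (\<xi> has_derivative \<xi>' w) (at w)"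
    and mono: "\<And>w w'. w \<in> Q \<Longrightarrow> w' \<in> Q \<Longrightarrow> w $ 1 = w' $ 1 \<Longrightarrow> w $ 2 < w' $ 2 \<Longrightarrow> \<psi> w' < \<psi> w"
    and \<epsilon>0: "\<epsilon>0 > 0"
    and pos: "\<And>w \<epsilon>. w \<in> Q \<Longrightarrow> 0 < \<epsilon> \<Longrightarrow> \<epsilon> < \<epsilon>0 \<Longrightarrow>
        0 \<le> (d \<bullet> cross3 (\<xi>' w (axis 1 1)) (d + (\<psi>' w (axis 2 1) - \<epsilon>) *\<^sub>R k)
           + d \<bullet> cross3 (e + \<psi>' w (axis 1 1) *\<^sub>R k) (\<xi>' w (axis 2 1))) / ((\<psi>' w (axis 2 1) - \<epsilon>) * (d \<bullet> cross3 e k))"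
    and neg: "\<And>w. w \<in> Q \<Longrightarrow> \<psi>' w (axis 2 1) \<le> 0"
    and Z: "\<And>w s. w \<in> Q \<Longrightarrow> Z (Y 0 w + s *\<^sub>R d) = \<xi> w"
    and D: "D = \<tau> *\<^sub>R d"
  shows "\<exists>\<delta>>0. \<forall>A B C. {A, B, C} \<subseteq> {x. \<bar>e \<bullet> x - a0\<bar> < \<delta> \<and> \<bar>k \<bullet> x - \<psi> (vector [a0, b0])\<bar> < \<delta>} \<longrightarrow>
     0 \<le> orient D A B C \<longrightarrow> 0 \<le> tri_flux D Z A B C"
proof -
  have inn: "e \<bullet> e = 1" "d \<bullet> d = 1" "k \<bullet> k = 1" "d \<bullet> e = 0" "k \<bullet> e = 0" "d \<bullet> k = 0"
    using on by (auto simp: norm_eq_1 inner_commute)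
  define c0 where "c0 = \<psi> (vector [a0, b0])"
  define r1 where "r1 = r / 2"
  have r1: "0 < r1" "r1 < r" using r by (auto simp: r1_def)
  have oQ: "open Q"
  proof -
    have "Q = box (vector [a0 - r, b0 - r]) (vector [a0 + r, b0 + r])"
      unfolding Q by (auto simp: mem_box_cart forall_2 abs_less_iff)
    then show ?thesis by (simp add: open_box)
  qed
  have cpsi: "continuous_on Q \<psi>" and cxi: "continuous_on Q \<xi>"
    using dpsi dxi by (auto intro!: continuous_at_imp_continuous_on has_derivative_continuous)
  have line: "continuous_on {a0-r<..<a0+r} (\<lambda>a. \<psi> (vector [a, b]))" if "\<bar>b - b0\<bar> < r" for b
    using that by (intro continuous_on_compose2[OF cpsi] continuous_on_vector_2 continuous_intros) (auto simp: Q)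
  have line2: "continuous_on {b0-r1..b0+r1} (\<lambda>b. \<psi> (vector [a, b]))" if "\<bar>a - a0\<bar> < r" for a
    using that r1 by (intro continuous_on_compose2[OF cpsi] continuous_on_vector_2 continuous_intros) (auto simp: Q abs_less_iff)
  have mono': "\<psi> (vector [a, b']) - \<epsilon> * b' < \<psi> (vector [a, b]) - \<epsilon> * b"
    if "\<bar>a - a0\<bar> < r" "\<bar>b - b0\<bar> < r" "\<bar>b' - b0\<bar> < r" "b < b'" "0 \<le> \<epsilon>" for a b b' \<epsilon>
  proof -
    have "\<psi> (vector [a, b']) < \<psi> (vector [a, b])" using that by (intro mono) (auto simp: Q)
    moreover have "\<epsilon> * b \<le> \<epsilon> * b'" using that by (intro mult_left_mono) auto
    ultimately show ?thesis by linarith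
  qed
  have "\<psi> (vector [a0, b0 + r1]) < c0" "c0 < \<psi> (vector [a0, b0 - r1])"
    unfolding c0_def using mono'[of a0 b0 "b0 + r1" 0] mono'[of a0 "b0 - r1" b0 0] r r1 by auto
  \<comment> \<open>The margin \<open>3 * \<mu>\<close> pays for three perturbations: of the first
    coordinate, of \<open>k \<bullet> x\<close>, and by the tilt
    \<open>\<epsilon> * b\<close>.\<close>
  then obtain \<mu> where mu: "\<mu> > 0" "\<psi> (vector [a0, b0 + r1]) < c0 - 3 * \<mu>" "c0 + 3 * \<mu> < \<psi> (vector [a0, b0 - r1])"
  proof -
    assume *: "\<psi> (vector [a0, b0 + r1]) < c0" "c0 < \<psi> (vector [a0, b0 - r1])"
    then obtain m where m: "m > 0" "m < (c0 - \<psi> (vector [a0, b0 + r1])) / 3"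
      "m < (\<psi> (vector [a0, b0 - r1]) - c0) / 3"
      using field_lbound_gt_zero[of "(c0 - \<psi> (vector [a0, b0 + r1])) / 3" "(\<psi> (vector [a0, b0 - r1]) - c0) / 3"]
      by auto
    show thesis by (rule that[of m]; use m in simp)
  qed
  have near: "\<exists>\<delta>>0. \<forall>a. \<bar>a - a0\<bar> < \<delta> \<longrightarrow> \<bar>\<psi> (vector [a, b]) - \<psi> (vector [a0, b])\<bar> < \<mu>" if "\<bar>b - b0\<bar> < r" for b
  proof -
    have "isCont (\<lambda>a. \<psi> (vector [a, b])) a0"
      using line[OF that] r by (auto simp: continuous_on_eq_continuous_at)
    then show ?thesis using mu(1) unfolding continuous_at_eps_delta by (auto simp: dist_real_def)
  qed
  obtain \<delta>1 where d1: "\<delta>1 > 0" "\<And>a. \<bar>a - a0\<bar> < \<delta>1 \<Longrightarrow> \<bar>\<psi> (vector [a, b0 + r1]) - \<psi> (vector [a0, b0 + r1])\<bar> < \<mu>"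
    using near[of "b0 + r1"] r1 by auto
  obtain \<delta>2 where d2: "\<delta>2 > 0" "\<And>a. \<bar>a - a0\<bar> < \<delta>2 \<Longrightarrow> \<bar>\<psi> (vector [a, b0 - r1]) - \<psi> (vector [a0, b0 - r1])\<bar> < \<mu>"
    using near[of "b0 - r1"] r1 by auto
  define \<delta> where "\<delta> = min (min \<delta>1 \<delta>2) (min \<mu> r1)"
  have \<delta>: "\<delta> > 0" using d1 d2 mu r1 by (simp add: \<delta>_def)
  define \<epsilon>1 where "\<epsilon>1 = min (\<epsilon>0 / 2) (\<mu> / (2 * (\<bar>b0\<bar> + r1 + 1)))"
  have \<epsilon>1: "\<epsilon>1 > 0" "\<epsilon>1 < \<epsilon>0" using \<epsilon>0 mu r1 by (auto simp: \<epsilon>1_def intro!: divide_pos_pos add_nonneg_pos)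
  have \<epsilon>b: "\<bar>\<epsilon> * b\<bar> < \<mu>" if "0 \<le> \<epsilon>" "\<epsilon> \<le> \<epsilon>1" "\<bar>b - b0\<bar> \<le> r1" for \<epsilon> b
  proof -
    have "\<bar>b\<bar> \<le> \<bar>b0\<bar> + r1 + 1" using that by linarith
    then have "\<epsilon> * \<bar>b\<bar> \<le> (\<mu> / (2 * (\<bar>b0\<bar> + r1 + 1))) * (\<bar>b0\<bar> + r1 + 1)"
      using that by (intro mult_mono) (auto simp: \<epsilon>1_def)
    also have "\<dots> = \<mu> / 2" using r1 by (simp add: field_simps)
    finally show ?thesis using mu that(1) by (simp add: abs_mult)
  qed
  define O' where "O' = {x. \<bar>e \<bullet> x - a0\<bar> < \<delta> \<and> \<bar>k \<bullet> x - c0\<bar> < \<delta>}"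
  \<comment> \<open>By monotonicity in the second coordinate the tilted height lies above
    \<open>k \<bullet> x\<close> at one end of the interval and below it at the other; the
    intermediate value theorem gives the point of the tilted graph on the line through
    \<open>x\<close>.\<close>
  have ex: "\<exists>b. \<bar>b - b0\<bar> < r1 \<and> \<psi> (vector [e \<bullet> x, b]) - \<epsilon> * b = k \<bullet> x"
    if x: "x \<in> O'" and eps: "0 \<le> \<epsilon>" "\<epsilon> \<le> \<epsilon>1" for x \<epsilon>
  proof -
    let ?f = "\<lambda>b. - (\<psi> (vector [e \<bullet> x, b]) - \<epsilon> * b)"
    have a: "\<bar>e \<bullet> x - a0\<bar> < r" using x r1 by (auto simp: O'_def \<delta>_def)
    have c: "continuous_on {b0-r1..b0+r1} ?f"
      by (intro continuous_intros line2 a)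
    have "\<bar>\<psi> (vector [e \<bullet> x, b0 + r1]) - \<psi> (vector [a0, b0 + r1])\<bar> < \<mu>"
      "\<bar>\<psi> (vector [e \<bullet> x, b0 - r1]) - \<psi> (vector [a0, b0 - r1])\<bar> < \<mu>" "\<bar>k \<bullet> x - c0\<bar> < \<mu>"
      using x by (auto simp: O'_def \<delta>_def intro!: d1(2) d2(2))
    then have l: "?f (b0 - r1) < - (k \<bullet> x)" "- (k \<bullet> x) < ?f (b0 + r1)"
      using mu \<epsilon>b[OF eps, of "b0 - r1"] \<epsilon>b[OF eps, of "b0 + r1"] r1 by (auto simp: abs_less_iff)
    then obtain b where b: "b0 - r1 \<le> b" "b \<le> b0 + r1" "?f b = - (k \<bullet> x)"
      using IVT'[of ?f "b0 - r1" "- (k \<bullet> x)" "b0 + r1"] c r1 by auto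
    then have "b \<noteq> b0 - r1" "b \<noteq> b0 + r1" using l by auto
    then show ?thesis using b by (intro exI[of _ b]) auto
  qed
  define wb where "wb = (\<lambda>\<epsilon> x. SOME b. \<bar>b - b0\<bar> < r1 \<and> \<psi> (vector [e \<bullet> x, b]) - \<epsilon> * b = k \<bullet> x)"
  define wf where "wf = (\<lambda>\<epsilon> x. vector [e \<bullet> x, wb \<epsilon> x] :: real^2)"
  have wb: "\<bar>wb \<epsilon> x - b0\<bar> < r1" "\<psi> (vector [e \<bullet> x, wb \<epsilon> x]) - \<epsilon> * wb \<epsilon> x = k \<bullet> x"
    if "x \<in> O'" "0 \<le> \<epsilon>" "\<epsilon> \<le> \<epsilon>1" for x \<epsilon>
    using someI_ex[OF ex[OF that]] by (auto simp: wb_def)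
  have wfQ: "wf \<epsilon> x \<in> Q" if "x \<in> O'" "0 \<le> \<epsilon>" "\<epsilon> \<le> \<epsilon>1" for x \<epsilon>
    using wb(1)[OF that] that(1) r1 by (auto simp: wf_def Q O'_def \<delta>_def)
  have basis: "x = (e \<bullet> x) *\<^sub>R e + (d \<bullet> x) *\<^sub>R d + (k \<bullet> x) *\<^sub>R k" for x
  proof -
    define y where "y = x - ((e \<bullet> x) *\<^sub>R e + (d \<bullet> x) *\<^sub>R d + (k \<bullet> x) *\<^sub>R k)"
    have y: "e \<bullet> y = 0" "d \<bullet> y = 0" "k \<bullet> y = 0"
      using inn on by (simp_all add: y_def inner_diff_right inner_add_right)
    have "y \<bullet> y = ((e \<bullet> cross3 y d / (e \<bullet> cross3 k d)) *\<^sub>R k + (e \<bullet> cross3 k y / (e \<bullet> cross3 k d)) *\<^sub>R d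
       + (y \<bullet> cross3 k d / (e \<bullet> cross3 k d)) *\<^sub>R e) \<bullet> y"
      by (rule arg_cong[OF cramer[OF refl on(7)], where f = "\<lambda>z. z \<bullet> y"])
    also have "\<dots> = 0" by (simp only: inner_add_left inner_scaleR_left y mult_zero_right add_0)
    finally have "y = 0" by simp
    then show ?thesis by (simp add: y_def)
  qed
  have YO: "e \<bullet> (Y \<epsilon> w + s *\<^sub>R d) = w $ 1" "k \<bullet> (Y \<epsilon> w + s *\<^sub>R d) = \<psi> w - \<epsilon> * w $ 2" for \<epsilon> w s
    using inn on unfolding Y_def by (simp_all add: inner_add_right)
  have O'_iff: "Y \<epsilon> w + s *\<^sub>R d \<in> O' \<longleftrightarrow> \<bar>w $ 1 - a0\<bar> < \<delta> \<and> \<bar>\<psi> w - \<epsilon> * w $ 2 - c0\<bar> < \<delta>" for \<epsilon> w s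
    unfolding O'_def mem_Collect_eq YO by (rule refl)
  have O'_iff0: "Y \<epsilon> w \<in> O' \<longleftrightarrow> Y \<epsilon> w + s *\<^sub>R d \<in> O'" for \<epsilon> w s
    using O'_iff[of \<epsilon> w s] O'_iff[of \<epsilon> w 0] unfolding scale_zero_left add_0_right by simp
  have Ywf: "x = Y \<epsilon> (wf \<epsilon> x) + (d \<bullet> x - wb \<epsilon> x) *\<^sub>R d" if "x \<in> O'" "0 \<le> \<epsilon>" "\<epsilon> \<le> \<epsilon>1" for x \<epsilon>
  proof -
    have "Y \<epsilon> (wf \<epsilon> x) + (d \<bullet> x - wb \<epsilon> x) *\<^sub>R d = (e \<bullet> x) *\<^sub>R e + (d \<bullet> x) *\<^sub>R d + (k \<bullet> x) *\<^sub>R k"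
      using wb(2)[OF that] by (simp add: Y_def wf_def algebra_simps)
    then show ?thesis using basis[of x] by (rule trans[rotated, OF sym])
  qed
  have uniq: "wf \<epsilon> (Y \<epsilon> w + s *\<^sub>R d) = w" if w: "w \<in> Q" and O': "Y \<epsilon> w + s *\<^sub>R d \<in> O'" and eps: "0 \<le> \<epsilon>" "\<epsilon> \<le> \<epsilon>1" for \<epsilon> w s
  proof -
    let ?b = "wb \<epsilon> (Y \<epsilon> w + s *\<^sub>R d)"
    have b: "\<bar>?b - b0\<bar> < r" "\<psi> (vector [w $ 1, ?b]) - \<epsilon> * ?b = \<psi> w - \<epsilon> * w $ 2"
      using wb[OF O' eps] r1 YO by auto
    have weq: "w = vector [w $ 1, w $ 2]" by (simp add: vec_eq_iff forall_2)
    have wQ: "\<bar>w $ 1 - a0\<bar> < r" "\<bar>w $ 2 - b0\<bar> < r" using w by (auto simp: Q)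
    have "\<psi> w = \<psi> (vector [w $ 1, w $ 2])" by (rule arg_cong[OF weq])
    then have "?b = w $ 2"
      using mono'[OF wQ(1) b(1) wQ(2) _ eps(1)] mono'[OF wQ(1,2) b(1) _ eps(1)] b(2) by (smt (verit))
    then have "wf \<epsilon> (Y \<epsilon> w + s *\<^sub>R d) = vector [w $ 1, w $ 2]" using YO by (simp add: wf_def)
    then show ?thesis by (rule trans[OF _ weq[symmetric]])
  qed
  have oO: "open O'"
    unfolding O'_def by (intro open_Collect_conj open_Collect_less continuous_intros)
  have cO: "convex O'"
  proof -
    have "O' = {x. e \<bullet> x < a0 + \<delta>} \<inter> {x. e \<bullet> x > a0 - \<delta>} \<inter> {x. k \<bullet> x < c0 + \<delta>} \<inter> {x. k \<bullet> x > c0 - \<delta>}"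
      by (auto simp: O'_def abs_less_iff)
    then show ?thesis by (simp add: convex_Int convex_halfspace_lt convex_halfspace_gt)
  qed
  define K where "K = cbox (vector [a0 - r1, b0 - r1] :: real^2) (vector [a0 + r1, b0 + r1])"
  have KQ: "K \<subseteq> Q" using r1 by (auto simp: K_def Q mem_box_cart forall_2 abs_less_iff)
  have wfK: "wf \<epsilon> x \<in> K" if "x \<in> O'" "0 \<le> \<epsilon>" "\<epsilon> \<le> \<epsilon>1" for x \<epsilon>
    using wb(1)[OF that] that(1) by (auto simp: wf_def K_def mem_box_cart forall_2 O'_def \<delta>_def abs_less_iff)
  have "compact (\<xi> ` K)"
    by (rule compact_continuous_image[OF continuous_on_subset[OF cxi KQ]]) (simp add: K_def)
  then obtain M where M: "\<And>w. w \<in> K \<Longrightarrow> norm (\<xi> w) \<le> M"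
    using compact_imp_bounded bounded_iff by (metis imageI)
  define Z' where "Z' = (\<lambda>\<epsilon> x. \<xi> (wf \<epsilon> x))"
  \<comment> \<open>For positive \<open>\<epsilon>\<close> the tilted height has derivative at most
    \<open>- \<epsilon>\<close> in the vertical coordinate, so the Jacobian does not vanish and
    \<open>lift_derivative\<close> applies.\<close>
  have der: "\<exists>f q. (Z' \<epsilon> has_derivative f) (at x) \<and> 0 \<le> q \<and>
     (\<forall>a b. D \<bullet> cross3 (f a) b + D \<bullet> cross3 a (f b) = q * (D \<bullet> cross3 a b))"
    if x: "x \<in> O'" and eps: "0 < \<epsilon>" "\<epsilon> \<le> \<epsilon>1" for \<epsilon> x
  proof -
    define U where "U = {w \<in> Q. Y \<epsilon> w \<in> O'}"
    have cY: "continuous_on Q (Y \<epsilon>)"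
      unfolding Y_def by (intro continuous_intros cpsi)
    have oU: "open U"
    proof -
      have "U = Q \<inter> Y \<epsilon> -` O'" unfolding U_def by blast
      then show ?thesis using continuous_open_preimage[OF cY oQ oO] by simp
    qed
    have YU: "Y \<epsilon> w + s *\<^sub>R d \<in> O'" if "w \<in> U" for w s
      using that O'_iff0[of \<epsilon> w s] unfolding U_def by blast
    let ?w = "wf \<epsilon> x" and ?s = "d \<bullet> x - wb \<epsilon> x"
    have eps': "0 \<le> \<epsilon>" using eps by simp
    have xeq: "x = Y \<epsilon> ?w + ?s *\<^sub>R d" by (rule Ywf[OF x eps' eps(2)])
    have wQ: "?w \<in> Q" by (rule wfQ[OF x eps' eps(2)])
    have "Y \<epsilon> ?w + ?s *\<^sub>R d \<in> O'" using x by (rule subst[OF xeq])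
    then have wU: "?w \<in> U" using wQ O'_iff0[of \<epsilon> ?w ?s] unfolding U_def by blast
    have inj: "w' = w" if "w \<in> U" "w' \<in> U" "Y \<epsilon> w' = Y \<epsilon> w + s *\<^sub>R d" for w w' s
    proof -
      have "wf \<epsilon> (Y \<epsilon> w + s *\<^sub>R d) = w" using uniq[OF _ YU eps' eps(2)] that(1) by (simp add: U_def)
      moreover have "wf \<epsilon> (Y \<epsilon> w' + 0 *\<^sub>R d) = w'" using uniq[OF _ YU eps' eps(2), of w' 0] that(2) by (simp add: U_def)
      ultimately show ?thesis using that(3) by simp
    qed
    define Y' where "Y' = (\<lambda>v. (v $ 1) *\<^sub>R e + (v $ 2) *\<^sub>R d + (\<psi>' ?w v - \<epsilon> * v $ 2) *\<^sub>R k)"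
    have dY: "(Y \<epsilon> has_derivative Y') (at ?w)"
      unfolding Y_def Y'_def
      by (intro has_derivative_add has_derivative_scaleR_left has_derivative_diff has_derivative_mult_right
          dpsi[OF wQ] bounded_linear.has_derivative[OF bounded_linear_vec_nth] has_derivative_ident)
    have Y'12: "Y' (axis 1 1) = e + \<psi>' ?w (axis 1 1) *\<^sub>R k" "Y' (axis 2 1) = d + (\<psi>' ?w (axis 2 1) - \<epsilon>) *\<^sub>R k"
      by (simp_all add: Y'_def axis_def)
    define J where "J = d \<bullet> cross3 (Y' (axis 1 1)) (Y' (axis 2 1))"
    have Jeq: "J = (\<psi>' ?w (axis 2 1) - \<epsilon>) * (d \<bullet> cross3 e k)"
      unfolding J_def Y'12 by (simp add: cross_linear inner_add_right dot_cross_self)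
    have "d \<bullet> cross3 e k = e \<bullet> cross3 k d"
      by (simp add: cross3_simps)
    then have J0: "J \<noteq> 0" unfolding Jeq using neg[OF wQ] eps on(7) by auto
    have ZY: "Z' \<epsilon> (Y \<epsilon> w + s *\<^sub>R d) = \<xi> w" if "w \<in> U" for w s
      unfolding Z'_def using uniq[OF _ YU[OF that] eps' eps(2)] that by (simp add: U_def)
    have d0: "d \<noteq> 0" using on(2) by auto
    have cYU: "continuous_on U (Y \<epsilon>)" by (rule continuous_on_subset[OF cY]) (auto simp: U_def)
    let ?q = "(d \<bullet> cross3 (\<xi>' ?w (axis 1 1)) (Y' (axis 2 1)) + d \<bullet> cross3 (Y' (axis 1 1)) (\<xi>' ?w (axis 2 1))) / J"
    have "0 \<le> ?q"
      unfolding Y'12 Jeq using eps \<epsilon>1 by (intro pos wQ) auto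
    moreover have "\<exists>f. (Z' \<epsilon> has_derivative f) (at (Y \<epsilon> ?w + ?s *\<^sub>R d)) \<and>
       (\<forall>a b. D \<bullet> cross3 (f a) b + D \<bullet> cross3 a (f b) = ?q * (D \<bullet> cross3 a b))"
      by (rule lift_derivative[OF oU cYU d0 inj wU dY dxi[OF wQ] J_def J0 ZY D])
    ultimately show ?thesis unfolding xeq[symmetric] by blast
  qed
  have Z'pos: "0 \<le> tri_flux D (Z' \<epsilon>) A B C"
    if "{A, B, C} \<subseteq> O'" "0 \<le> orient D A B C" "0 < \<epsilon>" "\<epsilon> \<le> \<epsilon>1" for A B C \<epsilon>
  proof (rule tri_flux_nonneg[OF _ that(2)])
    have cZ: "continuous_on O' (Z' \<epsilon>)"
      using der[OF _ that(3,4)] by (meson continuous_at_imp_continuous_on has_derivative_continuous)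
    have h: "convex hull {A, B, C} \<subseteq> O'" using that(1) cO by (rule hull_minimal)
    show "continuous_on (convex hull {A, B, C}) (Z' \<epsilon>)" by (rule continuous_on_subset[OF cZ h])
    fix x assume "x \<in> convex hull {A, B, C}"
    then have x: "x \<in> O'" using h by blast
    obtain \<rho> where rho: "\<rho> > 0" "ball x \<rho> \<subseteq> O'" using oO x openE by blast
    show "outward_at D (Z' \<epsilon>) x"
      using der[OF x that(3,4)] outward_at_differentiable[OF _ continuous_on_subset[OF cZ rho(2)] rho(1)] by metis
  qed
  define en where "en = (\<lambda>n. \<epsilon>1 * inverse (real (Suc n)))"
  have en: "0 < en n" "en n \<le> \<epsilon>1" for n
    using \<epsilon>1 by (auto simp: en_def inverse_le_1_iff intro!: mult_left_le)
  have "en \<longlonglongrightarrow> \<epsilon>1 * 0" unfolding en_def by (intro tendsto_intros LIMSEQ_inverse_real_of_nat)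
  then have en0: "en \<longlonglongrightarrow> 0" by simp
  have Zx: "Z x = \<xi> (wf 0 x)" if "x \<in> O'" for x
    using Z[OF wfQ[of x 0]] Ywf[of x 0] that \<epsilon>1 by (metis less_eq_real_def order_refl)
  \<comment> \<open>The root \<open>wb \<epsilon> x\<close> is trapped: at any \<open>y'\<close> on
    either side of \<open>wb 0 x\<close> the strict inequality that holds for
    \<open>\<epsilon> = 0\<close> persists for small \<open>\<epsilon>\<close>.\<close>
  have conv: "(\<lambda>n. Z' (en n) x) \<longlonglongrightarrow> Z x" if x: "x \<in> O'" for x
  proof -
    let ?a = "e \<bullet> x" and ?b = "wb 0 x"
    have a: "\<bar>?a - a0\<bar> < r" using x r1 by (auto simp: O'_def \<delta>_def)
    have b: "\<bar>?b - b0\<bar> < r1" "\<psi> (vector [?a, ?b]) = k \<bullet> x" using wb[OF x, of 0] \<epsilon>1 by auto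
    have "(\<lambda>n. wb (en n) x) \<longlonglongrightarrow> ?b"
    proof (rule order_tendstoI)
      fix y assume y: "y < ?b"
      define y' where "y' = max y (b0 - r1)"
      have y': "y' < ?b" "\<bar>y' - b0\<bar> < r" using y b(1) r1 by (auto simp: y'_def max_def)
      have g: "k \<bullet> x < \<psi> (vector [?a, y'])"
        using mono'[OF a y'(2), of ?b 0] b r1 y' by auto
      have "(\<lambda>n. \<psi> (vector [?a, y']) - en n * y') \<longlonglongrightarrow> \<psi> (vector [?a, y']) - 0 * y'"
        by (intro tendsto_intros en0)
      then have "\<forall>\<^sub>F n in sequentially. k \<bullet> x < \<psi> (vector [?a, y']) - en n * y'"
        using g by (intro order_tendstoD(1)) auto
      then show "\<forall>\<^sub>F n in sequentially. y < wb (en n) x"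
      proof eventually_elim
        case (elim n)
        have w: "\<bar>wb (en n) x - b0\<bar> < r" "\<psi> (vector [?a, wb (en n) x]) - en n * wb (en n) x = k \<bullet> x"
          using wb[OF x _ en(2)[of n]] en(1)[of n] r1 by auto
        have "y' < wb (en n) x"
          using mono'[OF a w(1) y'(2), of "en n"] elim w(2) en(1)[of n] by (smt (verit))
        then show ?case by (simp add: y'_def)
      qed
    next
      fix y assume y: "?b < y"
      define y' where "y' = min y (b0 + r1)"
      have y': "?b < y'" "\<bar>y' - b0\<bar> < r" using y b(1) r1 by (auto simp: y'_def min_def)
      have g: "\<psi> (vector [?a, y']) < k \<bullet> x"
        using mono'[OF a _ y'(2), of ?b 0] b r1 y' by auto
      have "(\<lambda>n. \<psi> (vector [?a, y']) - en n * y') \<longlonglongrightarrow> \<psi> (vector [?a, y']) - 0 * y'"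
        by (intro tendsto_intros en0)
      then have "\<forall>\<^sub>F n in sequentially. \<psi> (vector [?a, y']) - en n * y' < k \<bullet> x"
        using g by (intro order_tendstoD(2)) auto
      then show "\<forall>\<^sub>F n in sequentially. wb (en n) x < y"
      proof eventually_elim
        case (elim n)
        have w: "\<bar>wb (en n) x - b0\<bar> < r" "\<psi> (vector [?a, wb (en n) x]) - en n * wb (en n) x = k \<bullet> x"
          using wb[OF x _ en(2)[of n]] en(1)[of n] r1 by auto
        have "wb (en n) x < y'"
          using mono'[OF a y'(2) w(1), of "en n"] elim w(2) en(1)[of n] by (smt (verit))
        then show ?case by (simp add: y'_def)
      qed
    qed
    then have "(\<lambda>n. wf (en n) x) \<longlonglongrightarrow> wf 0 x"
      unfolding wf_def vector2_eq by (intro tendsto_intros)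
    moreover have "isCont \<xi> (wf 0 x)"
      using has_derivative_continuous[OF dxi[OF wfQ[OF x order_refl]]] \<epsilon>1 by simp
    ultimately show ?thesis unfolding Zx[OF x] Z'_def by (rule isCont_tendsto_compose[rotated])
  qed
  \<comment> \<open>All tilted fields are bounded by the same \<open>M\<close>, so the fluxes
    converge by dominated convergence.\<close>
  have fl: "(\<lambda>n. flux D (Z' (en n)) A B) \<longlonglongrightarrow> flux D Z A B" if "A \<in> O'" "B \<in> O'" for A B
    unfolding flux_def
  proof (rule dominated_convergence(2))
    have seg: "closed_segment A B \<subseteq> O'" using that cO by (simp add: closed_segment_subset)
    have mem: "A + s *\<^sub>R (B - A) \<in> O'" if "s \<in> {0..1}" for s using segment_param_mem[OF seg that] .
    fix n
    have "continuous_on O' (Z' (en n))"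
      using der[OF _ en] by (meson continuous_at_imp_continuous_on has_derivative_continuous)
    from flux_integrand_continuous[OF this seg]
    show "(\<lambda>s. D \<bullet> cross3 (Z' (en n) (A + s *\<^sub>R (B - A))) (B - A)) integrable_on {0..1}"
      by (rule integrable_continuous_real)
    show "(\<lambda>s::real. norm D * M * norm (B - A)) integrable_on {0..1}" by (rule integrable_const_ivl)
    fix s :: real assume s: "s \<in> {0..1}"
    have "norm (Z' (en n) (A + s *\<^sub>R (B - A))) \<le> M"
      unfolding Z'_def by (intro M wfK mem s en less_imp_le)
    then have "norm D * norm (Z' (en n) (A + s *\<^sub>R (B - A))) * norm (B - A) \<le> norm D * M * norm (B - A)"
      by (intro mult_right_mono mult_left_mono) auto
    then show "norm (D \<bullet> cross3 (Z' (en n) (A + s *\<^sub>R (B - A))) (B - A)) \<le> norm D * M * norm (B - A)"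
      using abs_triple_le[of D "Z' (en n) (A + s *\<^sub>R (B - A))" "B - A"] by simp
    show "(\<lambda>n. D \<bullet> cross3 (Z' (en n) (A + s *\<^sub>R (B - A))) (B - A))
        \<longlonglongrightarrow> D \<bullet> cross3 (Z (A + s *\<^sub>R (B - A))) (B - A)"
      by (intro tendsto_inner tendsto_const bounded_bilinear.tendsto[OF bounded_bilinear_cross3] conv mem s)
  qed
  have "0 \<le> tri_flux D Z A B C" if sub: "{A, B, C} \<subseteq> O'" and or: "0 \<le> orient D A B C" for A B C
  proof (rule LIMSEQ_le_const)
    show "(\<lambda>n. tri_flux D (Z' (en n)) A B C) \<longlonglongrightarrow> tri_flux D Z A B C"
      unfolding tri_flux_def using sub by (intro tendsto_add fl) auto
    show "\<exists>N. \<forall>n\<ge>N. 0 \<le> tri_flux D (Z' (en n)) A B C"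
      using Z'pos[OF sub or en] by blast
  qed
  then show ?thesis using \<delta> unfolding O'_def c0_def by blast
qed

section \<open>Mean curvature in a chart\<close>

lemma has_derivative_along_line:
  assumes "(f has_derivative f') (at (w + s *\<^sub>R u))"
  shows "((\<lambda>s. f (w + s *\<^sub>R u)) has_vector_derivative f' u) (at s)"
proof -
  have "((\<lambda>s. w + s *\<^sub>R u) has_derivative (\<lambda>h. h *\<^sub>R u)) (at s)"
    by (auto intro!: derivative_eq_intros)
  from has_derivative_compose[OF this assms]
  show ?thesis
    using linear_scale[OF has_derivative_linear[OF assms]] by (simp add: has_vector_derivative_def)
qed

lemma partial_has_derivative:
  assumes "C2_on U X" "w \<in> U"
  shows "(X has_derivative frechet_derivative X (at w)) (at w)"
    and "(partial i X has_derivative frechet_derivative (partial i X) (at w)) (at w)"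
  using assms frechet_derivative_works by (auto simp: C2_on_def)

text \<open>The mean value theorem is applied in direction \<open>i\<close> to a difference in
  direction \<open>j\<close>, then in direction \<open>j\<close>. The scalar product with
  \<open>v\<close> makes it available for vector values.\<close>

lemma second_difference:
  fixes X :: "real^2 \<Rightarrow> real^3"
  assumes C2: "C2_on U X" and sub: "\<And>s t. 0 \<le> s \<Longrightarrow> s \<le> h \<Longrightarrow> 0 \<le> t \<Longrightarrow> t \<le> h \<Longrightarrow> w + s *\<^sub>R axis i 1 + t *\<^sub>R axis j 1 \<in> U"
    and h: "0 < h"
  shows "\<exists>s t. 0 < s \<and> s < h \<and> 0 < t \<and> t < h \<and>
    v \<bullet> (X (w + h *\<^sub>R axis i 1 + h *\<^sub>R axis j 1) - X (w + h *\<^sub>R axis i 1) - X (w + h *\<^sub>R axis j 1) + X w)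
     = h * h * (v \<bullet> partial j (partial i X) (w + s *\<^sub>R axis i 1 + t *\<^sub>R axis j 1))"
proof -
  let ?e = "axis i 1 :: real^2" and ?f = "axis j 1 :: real^2"
  define g where "g = (\<lambda>s. v \<bullet> (X (w + s *\<^sub>R ?e + h *\<^sub>R ?f) - X (w + s *\<^sub>R ?e)))"
  have dg: "(g has_real_derivative v \<bullet> (partial i X (w + s *\<^sub>R ?e + h *\<^sub>R ?f) - partial i X (w + s *\<^sub>R ?e))) (at s)"
    if "0 \<le> s" "s \<le> h" for s
  proof -
    have "w + h *\<^sub>R ?f + s *\<^sub>R ?e \<in> U" "w + s *\<^sub>R ?e \<in> U"
      using sub[of s h] sub[of s 0] that h by (simp_all add: add_ac)
    from has_derivative_along_line[OF partial_has_derivative(1)[OF C2 this(1)]]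
      has_derivative_along_line[OF partial_has_derivative(1)[OF C2 this(2)]]
    have "((\<lambda>s. X (w + s *\<^sub>R ?e + h *\<^sub>R ?f)) has_vector_derivative partial i X (w + s *\<^sub>R ?e + h *\<^sub>R ?f)) (at s)"
      "((\<lambda>s. X (w + s *\<^sub>R ?e)) has_vector_derivative partial i X (w + s *\<^sub>R ?e)) (at s)"
      by (simp_all add: partial_def add_ac)
    from has_vector_derivative_diff[OF this]
    show ?thesis unfolding g_def has_real_derivative_iff_has_vector_derivative
      by (rule bounded_linear.has_vector_derivative[OF bounded_linear_inner_right])
  qed
  obtain s where s: "0 < s" "s < h"
    "g h - g 0 = (h - 0) * (v \<bullet> (partial i X (w + s *\<^sub>R ?e + h *\<^sub>R ?f) - partial i X (w + s *\<^sub>R ?e)))"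
    using MVT2[OF h dg] by auto
  define k where "k = (\<lambda>t. v \<bullet> partial i X (w + s *\<^sub>R ?e + t *\<^sub>R ?f))"
  have dk: "(k has_real_derivative v \<bullet> partial j (partial i X) (w + s *\<^sub>R ?e + t *\<^sub>R ?f)) (at t)"
    if "0 \<le> t" "t \<le> h" for t
  proof -
    have "w + s *\<^sub>R ?e + t *\<^sub>R ?f \<in> U" using sub[of s t] that s by simp
    from has_derivative_along_line[OF partial_has_derivative(2)[OF C2 this, of i]]
    show ?thesis unfolding k_def has_real_derivative_iff_has_vector_derivative partial_def[of j "partial i X"]
      by (rule bounded_linear.has_vector_derivative[OF bounded_linear_inner_right])
  qed
  obtain t where t: "0 < t" "t < h"
    "k h - k 0 = (h - 0) * (v \<bullet> partial j (partial i X) (w + s *\<^sub>R ?e + t *\<^sub>R ?f))"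
    using MVT2[OF h dk] by auto
  have "g h - g 0 = h * (k h - k 0)" using s(3) by (simp add: k_def inner_diff_right)
  also have "\<dots> = h * h * (v \<bullet> partial j (partial i X) (w + s *\<^sub>R ?e + t *\<^sub>R ?f))" using t(3) by simp
  finally have "v \<bullet> (X (w + h *\<^sub>R ?e + h *\<^sub>R ?f) - X (w + h *\<^sub>R ?e) - X (w + h *\<^sub>R ?f) + X w)
     = h * h * (v \<bullet> partial j (partial i X) (w + s *\<^sub>R ?e + t *\<^sub>R ?f))"
    by (simp add: g_def algebra_simps)
  then show ?thesis using s(1,2) t(1,2) by blast
qed

text \<open>The second difference is symmetric in \<open>i\<close> and \<open>j\<close>. Divided by
  the square of the step it tends to either mixed derivative, since both are continuous.\<close>

lemma partial_commute:
  fixes X :: "real^2 \<Rightarrow> real^3"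
  assumes C2: "C2_on U X" and U: "open U" "w \<in> U"
  shows "partial j (partial i X) w = partial i (partial j X) w"
proof -
  obtain \<rho> where rho: "\<rho> > 0" "ball w \<rho> \<subseteq> U" using U openE by blast
  have near: "dist w (w + s *\<^sub>R axis i 1 + t *\<^sub>R axis j 1) \<le> 2 * h" if "0 \<le> s" "s \<le> h" "0 \<le> t" "t \<le> h"
    for s t h and i j :: 2
    using that norm_triangle_ineq[of "s *\<^sub>R axis i (1::real)" "t *\<^sub>R axis j 1"]
    by (simp add: dist_norm norm_minus_commute add.assoc) (simp add: add.commute)
  have "v \<bullet> partial j (partial i X) w = v \<bullet> partial i (partial j X) w" for v
  proof -
    define h where "h = (\<lambda>n. \<rho> / 3 * inverse (real (Suc n)))"
    have h: "0 < h n" "2 * h n < \<rho>" for n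
    proof -
      show "0 < h n" using rho by (simp add: h_def)
      have "h n \<le> \<rho> / 3 * 1" unfolding h_def using rho by (intro mult_left_mono) (auto simp: inverse_le_1_iff)
      then show "2 * h n < \<rho>" using rho by simp
    qed
    have "h \<longlonglongrightarrow> \<rho> / 3 * 0" unfolding h_def by (intro tendsto_intros LIMSEQ_inverse_real_of_nat)
    then have h0: "h \<longlonglongrightarrow> 0" by simp
    have sub: "w + s *\<^sub>R axis i 1 + t *\<^sub>R axis j 1 \<in> U" if "0 \<le> s" "s \<le> h n" "0 \<le> t" "t \<le> h n" for s t n and i j :: 2
      by (rule subsetD[OF rho(2)]) (use order_le_less_trans[OF near[OF that] h(2)] in simp)
    have lim: "\<exists>p. (\<forall>n. \<exists>s t. 0 < s \<and> s < h n \<and> 0 < t \<and> t < h n \<and>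
       v \<bullet> (X (w + h n *\<^sub>R axis i 1 + h n *\<^sub>R axis j 1) - X (w + h n *\<^sub>R axis i 1) - X (w + h n *\<^sub>R axis j 1) + X w)
          = h n * h n * (v \<bullet> partial j (partial i X) (p n))) \<and> (\<lambda>n. v \<bullet> partial j (partial i X) (p n)) \<longlonglongrightarrow> v \<bullet> partial j (partial i X) w"
      for i j :: 2
    proof -
      have "\<forall>n. \<exists>p. (\<exists>s t. 0 < s \<and> s < h n \<and> 0 < t \<and> t < h n \<and> p = w + s *\<^sub>R axis i 1 + t *\<^sub>R axis j 1) \<and>
        v \<bullet> (X (w + h n *\<^sub>R axis i 1 + h n *\<^sub>R axis j 1) - X (w + h n *\<^sub>R axis i 1) - X (w + h n *\<^sub>R axis j 1) + X w)
          = h n * h n * (v \<bullet> partial j (partial i X) p)"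
      proof
        fix n
        have "\<exists>s t. 0 < s \<and> s < h n \<and> 0 < t \<and> t < h n \<and>
          v \<bullet> (X (w + h n *\<^sub>R axis i 1 + h n *\<^sub>R axis j 1) - X (w + h n *\<^sub>R axis i 1) - X (w + h n *\<^sub>R axis j 1) + X w)
          = h n * h n * (v \<bullet> partial j (partial i X) (w + s *\<^sub>R axis i 1 + t *\<^sub>R axis j 1))"
          by (rule second_difference[OF C2 sub h(1)])
        then show "\<exists>p. (\<exists>s t. 0 < s \<and> s < h n \<and> 0 < t \<and> t < h n \<and> p = w + s *\<^sub>R axis i 1 + t *\<^sub>R axis j 1) \<and>
          v \<bullet> (X (w + h n *\<^sub>R axis i 1 + h n *\<^sub>R axis j 1) - X (w + h n *\<^sub>R axis i 1) - X (w + h n *\<^sub>R axis j 1) + X w)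
          = h n * h n * (v \<bullet> partial j (partial i X) p)" by blast
      qed
      then obtain p where p: "\<And>n. \<exists>s t. 0 < s \<and> s < h n \<and> 0 < t \<and> t < h n \<and> p n = w + s *\<^sub>R axis i 1 + t *\<^sub>R axis j 1"
        "\<And>n. v \<bullet> (X (w + h n *\<^sub>R axis i 1 + h n *\<^sub>R axis j 1) - X (w + h n *\<^sub>R axis i 1) - X (w + h n *\<^sub>R axis j 1) + X w)
          = h n * h n * (v \<bullet> partial j (partial i X) (p n))"
        by metis
      have dle: "dist (p n) w \<le> 2 * h n" for n
        using p(1)[of n] near by (metis dist_commute less_imp_le)
      have lim0: "(\<lambda>n. 2 * h n) \<longlonglongrightarrow> 0" using tendsto_mult[OF tendsto_const h0, of 2] by simp
      have "(\<lambda>n. dist (p n) w) \<longlonglongrightarrow> 0"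
        by (rule Lim_null_comparison[OF always_eventually lim0]) (simp add: dle)
      then have plim: "p \<longlonglongrightarrow> w" by (rule tendsto_dist_iff[THEN iffD2])
      have ct: "isCont (partial j (partial i X)) w"
        using C2 U by (auto simp: C2_on_def continuous_on_eq_continuous_at)
      have "(\<lambda>n. v \<bullet> partial j (partial i X) (p n)) \<longlonglongrightarrow> v \<bullet> partial j (partial i X) w"
        by (rule tendsto_inner[OF tendsto_const isCont_tendsto_compose[OF ct plim]])
      then show ?thesis using p by blast
    qed
    obtain p q where p: "\<And>n. v \<bullet> (X (w + h n *\<^sub>R axis i 1 + h n *\<^sub>R axis j 1) - X (w + h n *\<^sub>R axis i 1) - X (w + h n *\<^sub>R axis j 1) + X w)
          = h n * h n * (v \<bullet> partial j (partial i X) (p n))"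
        "(\<lambda>n. v \<bullet> partial j (partial i X) (p n)) \<longlonglongrightarrow> v \<bullet> partial j (partial i X) w"
      and q: "\<And>n. v \<bullet> (X (w + h n *\<^sub>R axis j 1 + h n *\<^sub>R axis i 1) - X (w + h n *\<^sub>R axis j 1) - X (w + h n *\<^sub>R axis i 1) + X w)
          = h n * h n * (v \<bullet> partial i (partial j X) (q n))"
        "(\<lambda>n. v \<bullet> partial i (partial j X) (q n)) \<longlonglongrightarrow> v \<bullet> partial i (partial j X) w"
      using lim[of i j] lim[of j i] by metis
    have "v \<bullet> partial j (partial i X) (p n) = v \<bullet> partial i (partial j X) (q n)" for n
    proof -
      have "h n * h n * (v \<bullet> partial j (partial i X) (p n)) = h n * h n * (v \<bullet> partial i (partial j X) (q n))"
        unfolding p(1)[symmetric] q(1)[symmetric] by (simp add: algebra_simps)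
      then show ?thesis using h(1)[of n] by simp
    qed
    then show ?thesis using p(2) q(2) LIMSEQ_unique by simp
  qed
  then show ?thesis by (metis inner_commute vector_eq_ldot)
qed

lemma matrix_inv_2:
  fixes A :: "real^2^2"
  assumes "det A \<noteq> 0"
  shows "matrix_inv A $ 1 $ 1 = A $ 2 $ 2 / det A" "matrix_inv A $ 1 $ 2 = - A $ 1 $ 2 / det A"
    "matrix_inv A $ 2 $ 1 = - A $ 2 $ 1 / det A" "matrix_inv A $ 2 $ 2 = A $ 1 $ 1 / det A"
proof -
  define \<delta> where "\<delta> = det A"
  have \<delta>: "A$1$1 * A$2$2 = \<delta> + A$1$2 * A$2$1" "\<delta> \<noteq> 0" using assms by (simp_all add: \<delta>_def det_2)
  define B :: "real^2^2" where "B = (\<chi> i j. (if i = 1 then (if j = 1 then A$2$2 else - A$1$2) else (if j = 1 then - A$2$1 else A$1$1)) / \<delta>)"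
  have inv: "A ** matrix_inv A = mat 1" "matrix_inv A ** A = mat 1"
    using assms someI_ex[of "\<lambda>A'. A ** A' = mat 1 \<and> A' ** A = mat 1"] invertible_det_nz[of A]
    unfolding matrix_inv_def invertible_def by blast+
  have 1: "(2::2) \<noteq> 1" by simp
  have "A ** B = mat 1"
    using \<delta> by (simp add: vec_eq_iff forall_2 matrix_matrix_mult_def sum_2 B_def mat_def 1 field_simps)
  then have "matrix_inv A = B"
    using inv by (metis matrix_mul_assoc matrix_mul_lid matrix_mul_rid)
  then show "matrix_inv A $ 1 $ 1 = A $ 2 $ 2 / det A" "matrix_inv A $ 1 $ 2 = - A $ 1 $ 2 / det A"
    "matrix_inv A $ 2 $ 1 = - A $ 2 $ 1 / det A" "matrix_inv A $ 2 $ 2 = A $ 1 $ 1 / det A"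
    by (simp_all add: B_def 1 \<delta>_def)
qed

section \<open>The unit normal in a chart and the Laplacian of the position vector\<close>

definition chart_normal :: "(real^2 \<Rightarrow> real^3) \<Rightarrow> real^2 \<Rightarrow> real^3" where
  "chart_normal X w = sgn (cross3 (partial 1 X w) (partial 2 X w))"

text \<open>Quotient rule for a vector divided by its norm. It is kept explicit because the
  continuity of this derivative is needed later for local bounds.\<close>

definition chart_normal_deriv :: "(real^2 \<Rightarrow> real^3) \<Rightarrow> real^2 \<Rightarrow> real^2 \<Rightarrow> real^3" where
  "chart_normal_deriv X w v =
     (let c = cross3 (partial 1 X w) (partial 2 X w);
          c' = cross3 (frechet_derivative (partial 1 X) (at w) v) (partial 2 X w)
             + cross3 (partial 1 X w) (frechet_derivative (partial 2 X) (at w) v)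
      in (1 / norm c) *\<^sub>R c' - ((c \<bullet> c') / norm c ^ 3) *\<^sub>R c)"

lemma cross_partial_nonzero:
  assumes "C2_on U X" "w \<in> U" "inj (frechet_derivative X (at w))"
  shows "cross3 (partial 1 X w) (partial 2 X w) \<noteq> 0"
proof
  let ?f = "frechet_derivative X (at w)"
  have two: "(2::2) \<noteq> 1" by simp
  have lin: "linear ?f" using partial_has_derivative(1)[OF assms(1,2)] by (rule has_derivative_linear)
  have inj: "v = 0" if "?f v = 0" for v
    using that assms(3) linear_0[OF lin] by (metis injD)
  have ax: "axis 1 1 \<noteq> (0::real^2)" "axis 2 1 \<noteq> (0::real^2)" by (simp_all add: axis_eq_0_iff)
  assume "cross3 (partial 1 X w) (partial 2 X w) = 0"
  then have "collinear {0, ?f (axis 1 1), ?f (axis 2 1)}" by (simp add: cross_eq_0 partial_def)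
  then consider "?f (axis 1 1) = 0" | "?f (axis 2 1) = 0" | c where "?f (axis 2 1) = c *\<^sub>R ?f (axis 1 1)"
    by (auto simp: collinear_lemma)
  then show False
  proof cases
    case 1 then show ?thesis using inj ax by blast
  next
    case 2 then show ?thesis using inj ax by blast
  next
    case (3 c)
    then have "?f (axis 2 1 - c *\<^sub>R axis 1 1) = 0" by (simp add: linear_diff[OF lin] linear_scale[OF lin])
    then have "axis 2 1 - c *\<^sub>R axis 1 1 = (0::real^2)" by (rule inj)
    then have "(axis 2 1 - c *\<^sub>R axis 1 1 :: real^2) $ 2 = (0::real^2) $ 2" by simp
    then show ?thesis by (simp add: axis_def two)
  qed
qed

lemma has_derivative_cross3:
  assumes "(f has_derivative f') (at w)" "(g has_derivative g') (at w)"
  shows "((\<lambda>w. cross3 (f w) (g w)) has_derivative (\<lambda>v. cross3 (f w) (g' v) + cross3 (f' v) (g w))) (at w)"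
  by (rule bounded_bilinear.FDERIV[OF bounded_bilinear_cross3 assms])

lemma has_derivative_sgn:
  fixes f :: "'a::real_normed_vector \<Rightarrow> 'b::real_inner"
  assumes f: "(f has_derivative f') (at w)" and "f w \<noteq> 0"
  shows "((\<lambda>w. sgn (f w)) has_derivative
      (\<lambda>v. (1 / norm (f w)) *\<^sub>R f' v - ((f w \<bullet> f' v) / norm (f w) ^ 3) *\<^sub>R f w)) (at w)"
proof -
  have "((\<lambda>w. norm (f w)) has_derivative (\<lambda>v. f' v \<bullet> sgn (f w))) (at w)"
    by (rule has_derivative_compose[OF f has_derivative_norm[OF assms(2)]])
  from has_derivative_scaleR[OF Deriv.has_derivative_inverse[OF _ this] f]
  have "((\<lambda>w. inverse (norm (f w)) *\<^sub>R f w) has_derivative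
     (\<lambda>v. inverse (norm (f w)) *\<^sub>R f' v + (- (inverse (norm (f w)) * (f' v \<bullet> sgn (f w)) * inverse (norm (f w)))) *\<^sub>R f w)) (at w)"
    using assms(2) by simp
  moreover have "inverse (norm (f w)) * (f' v \<bullet> sgn (f w)) * inverse (norm (f w)) = (f w \<bullet> f' v) / norm (f w) ^ 3" for v
    by (simp add: sgn_div_norm field_simps power3_eq_cube inner_commute)
  ultimately show ?thesis by (simp add: sgn_div_norm divide_inverse)
qed

lemma chart_normal_has_derivative:
  assumes C2: "C2_on U X" and "w \<in> U" "inj (frechet_derivative X (at w))"
  shows "(chart_normal X has_derivative chart_normal_deriv X w) (at w)"
proof -
  have "((\<lambda>w. sgn (cross3 (partial 1 X w) (partial 2 X w))) has_derivative chart_normal_deriv X w) (at w)"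
    using has_derivative_sgn[OF has_derivative_cross3[OF partial_has_derivative(2)[OF C2 assms(2)] partial_has_derivative(2)[OF C2 assms(2)], of 1 2]
      cross_partial_nonzero[OF assms]]
    unfolding chart_normal_deriv_def Let_def by (simp add: add.commute)
  then show ?thesis unfolding chart_normal_def[abs_def] .
qed

lemma continuous_on_chart_normal_deriv:
  assumes C2: "C2_on U X" and inj: "\<And>w. w \<in> U \<Longrightarrow> inj (frechet_derivative X (at w))"
  shows "continuous_on U (\<lambda>w. chart_normal_deriv X w (axis i 1))"
proof -
  have c1: "continuous_on U (partial j X)" for j
    using C2 by (auto simp: C2_on_def intro!: continuous_at_imp_continuous_on differentiable_imp_continuous_within)
  have c2: "continuous_on U (partial k (partial j X))" for j k
    using C2 by (auto simp: C2_on_def)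
  have nz: "norm (cross3 (partial 1 X w) (partial 2 X w)) \<noteq> 0" if "w \<in> U" for w
    using cross_partial_nonzero[OF C2 that inj[OF that]] by simp
  show ?thesis
    unfolding chart_normal_deriv_def Let_def partial_def[of i "partial _ X", symmetric]
    using nz by (intro continuous_intros continuous_on_cross c1 c2) auto
qed

lemma det_metric_tensor:
  "det (metric_tensor X w) = (norm (cross3 (partial 1 X w) (partial 2 X w)))\<^sup>2"
  unfolding norm_cross unfolding power2_norm_eq_inner
  by (simp add: metric_tensor_def det_2 power2_eq_square inner_commute)

text \<open>The two vectors whose partial derivatives the Laplacian sums are the rotated tangent
  vectors \<open>cross3 (partial 2 X y) n\<close> and \<open>cross3 n (partial 1 X y)\<close> with
  \<open>n = chart_normal X y\<close>. On differentiation the only second derivatives of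
  \<open>X\<close> that occur explicitly are the mixed ones, and they cancel by symmetry, which
  leaves derivatives of the normal.\<close>

lemma laplace_beltrami_position:
  assumes C2: "C2_on U X" and U: "open U" "w \<in> U" and inj: "\<And>w. w \<in> U \<Longrightarrow> inj (frechet_derivative X (at w))"
  shows "norm (cross3 (partial 1 X w) (partial 2 X w)) *\<^sub>R laplace_beltrami X X w =
    - cross3 (chart_normal_deriv X w (axis 1 1)) (partial 2 X w) - cross3 (partial 1 X w) (chart_normal_deriv X w (axis 2 1))"
proof -
  let ?c = "\<lambda>y. cross3 (partial 1 X y) (partial 2 X y)"
  have nz: "?c y \<noteq> 0" if "y \<in> U" for y by (rule cross_partial_nonzero[OF C2 that inj[OF that]])
  have sq: "sqrt (det (metric_tensor X y)) = norm (?c y)" for y by (simp add: det_metric_tensor)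
  define E where "E = (\<lambda>i y. norm (?c y) *\<^sub>R (\<Sum>j\<in>UNIV. (matrix_inv (metric_tensor X y) $ i $ j) *\<^sub>R partial j X y))"
  have two: "(2::2) \<noteq> 1" by simp
  have E: "E 1 y = cross3 (partial 2 X y) (chart_normal X y)" "E 2 y = cross3 (chart_normal X y) (partial 1 X y)"
    if y: "y \<in> U" for y
  proof -
    let ?n = "norm (?c y)"
    have n: "?n \<noteq> 0" using nz[OF y] by simp
    have d: "det (metric_tensor X y) = ?n * ?n" by (simp add: det_metric_tensor power2_eq_square)
    have d0: "det (metric_tensor X y) \<noteq> 0" using n d by simp
    have cn: "chart_normal X y = (1 / ?n) *\<^sub>R ?c y" by (simp add: chart_normal_def sgn_div_norm divide_inverse)
    have mt: "metric_tensor X y $ i $ j = partial i X y \<bullet> partial j X y" for i j by (simp add: metric_tensor_def)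
    show "E 1 y = cross3 (partial 2 X y) (chart_normal X y)"
      unfolding E_def sum_2 matrix_inv_2[OF d0] d mt cn cross_mult_right Lagrange
      using n by (simp add: scaleR_add_right scaleR_diff_right field_simps inner_commute)
    have e: "cross3 (?c y) (partial 1 X y)
        = (partial 1 X y \<bullet> partial 1 X y) *\<^sub>R partial 2 X y - (partial 1 X y \<bullet> partial 2 X y) *\<^sub>R partial 1 X y"
      by (subst cross_skew) (simp add: Lagrange)
    show "E 2 y = cross3 (chart_normal X y) (partial 1 X y)"
      unfolding E_def sum_2 matrix_inv_2[OF d0] d mt cn cross_mult_left e
      using n by (simp add: scaleR_add_right scaleR_diff_right field_simps inner_commute)
  qed
  note dn = chart_normal_has_derivative[OF C2 U(2) inj[OF U(2)]]
  note dX = partial_has_derivative(2)[OF C2 U(2)]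
  have d1: "(E 1 has_derivative (\<lambda>v. cross3 (partial 2 X w) (chart_normal_deriv X w v)
      + cross3 (frechet_derivative (partial 2 X) (at w) v) (chart_normal X w))) (at w)"
    by (rule has_derivative_transform_within_open[OF has_derivative_cross3[OF dX dn] U]) (simp add: E)
  have d2: "(E 2 has_derivative (\<lambda>v. cross3 (chart_normal X w) (frechet_derivative (partial 1 X) (at w) v)
      + cross3 (chart_normal_deriv X w v) (partial 1 X w))) (at w)"
    by (rule has_derivative_transform_within_open[OF has_derivative_cross3[OF dn dX] U]) (simp add: E)
  have p1: "partial 1 (E 1) w = cross3 (partial 2 X w) (chart_normal_deriv X w (axis 1 1))
      + cross3 (partial 1 (partial 2 X) w) (chart_normal X w)"
    unfolding partial_def[of 1 "E 1"] frechet_derivative_at[OF d1, symmetric] by (simp add: partial_def[of 1 "partial 2 X"])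
  have p2: "partial 2 (E 2) w = cross3 (chart_normal X w) (partial 2 (partial 1 X) w)
      + cross3 (chart_normal_deriv X w (axis 2 1)) (partial 1 X w)"
    unfolding partial_def[of 2 "E 2"] frechet_derivative_at[OF d2, symmetric] by (simp add: partial_def[of 2 "partial 1 X"])
  have "laplace_beltrami X X w = (1 / norm (?c w)) *\<^sub>R (partial 1 (E 1) w + partial 2 (E 2) w)"
    unfolding laplace_beltrami_def sq sum_2 E_def by simp
  then have "norm (?c w) *\<^sub>R laplace_beltrami X X w = partial 1 (E 1) w + partial 2 (E 2) w"
    using nz[OF U(2)] by simp
  also have "\<dots> = - cross3 (chart_normal_deriv X w (axis 1 1)) (partial 2 X w) - cross3 (partial 1 X w) (chart_normal_deriv X w (axis 2 1))"
    unfolding p1 p2 partial_commute[OF C2 U, of 2 1]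
    using cross_skew[of "partial 2 X w" "chart_normal_deriv X w (axis 1 1)"]
      cross_skew[of "partial 1 X w" "chart_normal_deriv X w (axis 2 1)"]
      cross_skew[of "partial 1 (partial 2 X) w" "chart_normal X w"] by simp
  finally show ?thesis .
qed

text \<open>The left side is bilinear and alternating in \<open>a\<close> and \<open>b\<close>,
  hence determined by its value at the two coordinate vectors.\<close>

lemma alternating_2:
  fixes f g :: "real^2 \<Rightarrow> real^3"
  assumes "linear f" "linear g"
  shows "cross3 (g a) (f b) + cross3 (f a) (g b)
     = (a $ 1 * b $ 2 - a $ 2 * b $ 1) *\<^sub>R (cross3 (g (axis 1 1)) (f (axis 2 1)) + cross3 (f (axis 1 1)) (g (axis 2 1)))"
proof -
  have ex: "h v = (v $ 1) *\<^sub>R h (axis 1 1) + (v $ 2) *\<^sub>R h (axis 2 1)" if "linear h" for h :: "real^2 \<Rightarrow> real^3" and v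
  proof -
    have "h v = h ((v $ 1) *\<^sub>R axis 1 1 + (v $ 2) *\<^sub>R axis 2 1)" by (rule arg_cong[OF vec2_eq])
    then show ?thesis by (simp only: linear_add[OF that] linear_scale[OF that])
  qed
  have sk: "cross3 (f (axis 2 1)) (g (axis 1 1)) = - cross3 (g (axis 1 1)) (f (axis 2 1))"
    "cross3 (g (axis 2 1)) (f (axis 1 1)) = - cross3 (f (axis 1 1)) (g (axis 2 1))"
    "cross3 (g (axis 1 1)) (f (axis 1 1)) = - cross3 (f (axis 1 1)) (g (axis 1 1))"
    "cross3 (g (axis 2 1)) (f (axis 2 1)) = - cross3 (f (axis 2 1)) (g (axis 2 1))"
    by (rule cross_skew)+
  show ?thesis
    unfolding ex[OF assms(1), of a] ex[OF assms(1), of b] ex[OF assms(2), of a] ex[OF assms(2), of b]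
    by (simp add: cross_linear sk scaleR_add_right scaleR_diff_left scaleR_diff_right algebra_simps)
qed

lemma C2_chart_facts:
  assumes "C2_chart S C U X"
  shows "open U" "C2_on U X" "\<And>w. w \<in> U \<Longrightarrow> inj (frechet_derivative X (at w))"
    "\<And>w. w \<in> U \<Longrightarrow> 0 \<le> w $ 2 \<Longrightarrow> X w \<in> S" "continuous_on U X"
    "\<And>w. w \<in> U \<Longrightarrow> 0 \<le> w $ 2 \<Longrightarrow> X w \<in> C \<longleftrightarrow> w $ 2 = 0"
proof -
  show "open U" and C2: "C2_on U X" and "\<And>w. w \<in> U \<Longrightarrow> inj (frechet_derivative X (at w))"
    and "\<And>w. w \<in> U \<Longrightarrow> 0 \<le> w $ 2 \<Longrightarrow> X w \<in> C \<longleftrightarrow> w $ 2 = 0"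
    using assms by (auto simp: C2_chart_def upper_half_def)
  have "X ` (U \<inter> upper_half) \<subseteq> S" using assms openin_imp_subset unfolding C2_chart_def by blast
  then show "\<And>w. w \<in> U \<Longrightarrow> 0 \<le> w $ 2 \<Longrightarrow> X w \<in> S" by (auto simp: upper_half_def)
  show "continuous_on U X"
    using C2 by (auto simp: C2_on_def intro!: continuous_at_imp_continuous_on differentiable_imp_continuous_within)
qed

lemma parallel_if_orthogonal_to_both:
  fixes u a b :: "real^3"
  assumes "u \<bullet> a = 0" "u \<bullet> b = 0" "cross3 a b \<noteq> 0"
  shows "u = (u \<bullet> sgn (cross3 a b)) *\<^sub>R sgn (cross3 a b)"
proof -
  let ?c = "cross3 a b"
  have "cross3 u ?c = 0" using assms(1,2) by (simp add: Lagrange)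
  then have "(?c \<bullet> ?c) *\<^sub>R u = (?c \<bullet> u) *\<^sub>R ?c" using Lagrange[of ?c u ?c] by simp
  then have "(1 / (?c \<bullet> ?c)) *\<^sub>R (?c \<bullet> ?c) *\<^sub>R u = (1 / (?c \<bullet> ?c)) *\<^sub>R (?c \<bullet> u) *\<^sub>R ?c" by simp
  then have "u = ((?c \<bullet> u) / (?c \<bullet> ?c)) *\<^sub>R ?c" using assms(3) by simp
  moreover have "?c \<bullet> ?c = norm ?c * norm ?c" by (simp add: dot_square_norm power2_eq_square)
  ultimately show ?thesis by (simp add: sgn_div_norm inner_commute divide_inverse mult.assoc mult.left_commute)
qed

text \<open>The coefficient of \<open>N\<close> along the chart normal is continuous with values
  \<open>1\<close> and \<open>-1\<close> only, hence constant on a ball.\<close>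

lemma normal_eq_chart_normal:
  assumes chart: "C2_chart S C U X" and N: "continuous_on S N" "\<And>p. p \<in> S \<Longrightarrow> norm (N p) = 1"
    and orth: "\<And>w v. w \<in> U \<Longrightarrow> 0 \<le> w $ 2 \<Longrightarrow> N (X w) \<bullet> frechet_derivative X (at w) v = 0"
    and w0: "w0 \<in> U" "0 < w0 $ 2"
  obtains \<rho> s where "\<rho> > 0" "ball w0 \<rho> \<subseteq> U" "\<And>w. w \<in> ball w0 \<rho> \<Longrightarrow> 0 < w $ 2" "s * s = (1::real)"
    "\<And>w. w \<in> ball w0 \<rho> \<Longrightarrow> N (X w) = s *\<^sub>R chart_normal X w"
proof -
  note ch = C2_chart_facts[OF chart]
  have op: "open (U \<inter> {w. 0 < w $ 2})"
    using ch(1) by (intro open_Int open_Collect_less continuous_intros) auto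
  have "w0 \<in> U \<inter> {w. 0 < w $ 2}" using w0 by simp
  then obtain \<rho> where rho: "\<rho> > 0" "ball w0 \<rho> \<subseteq> U \<inter> {w. 0 < w $ 2}" by (rule openE[OF op])
  let ?B = "ball w0 \<rho>"
  have B: "w \<in> U" "0 < w $ 2" if "w \<in> ?B" for w using that rho(2) by auto
  define f where "f = (\<lambda>w. N (X w) \<bullet> chart_normal X w)"
  have Nf: "N (X w) = f w *\<^sub>R chart_normal X w" if "w \<in> ?B" for w
    unfolding f_def chart_normal_def
    using orth[of w] B[OF that] cross_partial_nonzero[OF ch(2) B(1)[OF that] ch(3)[OF B(1)[OF that]]]
    by (intro parallel_if_orthogonal_to_both) (auto simp: partial_def)
  have nn: "norm (chart_normal X w) = 1" if "w \<in> ?B" for w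
    using cross_partial_nonzero[OF ch(2) B(1)[OF that] ch(3)[OF B(1)[OF that]]] by (simp add: chart_normal_def norm_sgn)
  have f1: "f w \<in> {1, -1}" if "w \<in> ?B" for w
  proof -
    have "norm (N (X w)) = 1" using N(2) ch(4) B[OF that] by simp
    then have "\<bar>f w\<bar> = 1" using Nf[OF that] nn[OF that] by (metis mult.right_neutral norm_scaleR)
    then show ?thesis by auto
  qed
  have cf: "continuous_on ?B f" unfolding f_def
  proof (intro continuous_on_inner)
    show "continuous_on ?B (\<lambda>w. N (X w))"
      using ch(4) B by (intro continuous_on_compose2[OF N(1)] continuous_on_subset[OF ch(5)]) (auto simp: less_imp_le)
    show "continuous_on ?B (chart_normal X)"
      using has_derivative_continuous[OF chart_normal_has_derivative[OF ch(2) _ ch(3)]] B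
      by (auto intro!: continuous_at_imp_continuous_on)
  qed
  have "f ` ?B \<subseteq> {1, -1}" using f1 by blast
  then have "finite (f ` ?B)" by (rule finite_subset) simp
  then have "f constant_on ?B"
    using continuous_finite_range_constant[of ?B f] cf by simp
  then obtain s where s: "\<And>w. w \<in> ?B \<Longrightarrow> f w = s" unfolding constant_on_def by blast
  have "s * s = 1" using f1[of w0] s[of w0] rho(1) by auto
  then show thesis using that[of \<rho> s] rho B Nf s by auto
qed

text \<open>The mean curvature equation as an identity of alternating forms. It holds for arbitrary
  pairs of directions and does not see the sign between \<open>N\<close> and the chart normal; its
  scalar product with \<open>d\<close> is the horizontal divergence of \<open>N\<close>.\<close>

lemma mean_curvature_identity:
  assumes chart: "C2_chart S C U X" and N: "continuous_on S N" "\<And>p. p \<in> S \<Longrightarrow> norm (N p) = 1"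
    and orth: "\<And>w v. w \<in> U \<Longrightarrow> 0 \<le> w $ 2 \<Longrightarrow> N (X w) \<bullet> frechet_derivative X (at w) v = 0"
    and cmc: "constant_mean_curvature S C N H"
    and w0: "w0 \<in> U" "0 < w0 $ 2"
  obtains \<rho> N' where "\<rho> > 0" "ball w0 \<rho> \<subseteq> U" "\<And>w. w \<in> ball w0 \<rho> \<Longrightarrow> 0 < w $ 2"
    "\<And>w. w \<in> ball w0 \<rho> \<Longrightarrow> ((\<lambda>w. N (X w)) has_derivative N' w) (at w)"
    "\<And>w a b. w \<in> ball w0 \<rho> \<Longrightarrow> cross3 (N' w a) (frechet_derivative X (at w) b) + cross3 (frechet_derivative X (at w) a) (N' w b)
      = (- 2 * H) *\<^sub>R cross3 (frechet_derivative X (at w) a) (frechet_derivative X (at w) b)"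
    "\<And>i. continuous_on (ball w0 \<rho>) (\<lambda>w. N' w (axis i 1))"
proof -
  note ch = C2_chart_facts[OF chart]
  obtain \<rho> s where rho: "\<rho> > 0" "ball w0 \<rho> \<subseteq> U" "\<And>w. w \<in> ball w0 \<rho> \<Longrightarrow> 0 < w $ 2" and s: "s * s = 1"
    and Ns: "\<And>w. w \<in> ball w0 \<rho> \<Longrightarrow> N (X w) = s *\<^sub>R chart_normal X w"
    using normal_eq_chart_normal[OF chart N orth w0] by blast
  let ?B = "ball w0 \<rho>"
  have BU: "w \<in> U" if "w \<in> ?B" for w using that rho(2) by auto
  define N' where "N' = (\<lambda>w v. s *\<^sub>R chart_normal_deriv X w v)"
  have dN: "((\<lambda>w. N (X w)) has_derivative N' w) (at w)" if "w \<in> ?B" for w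
    unfolding N'_def
    by (rule has_derivative_transform_within_open[OF has_derivative_scaleR_right[OF
         chart_normal_has_derivative[OF ch(2) BU[OF that] ch(3)[OF BU[OF that]]]] open_ball that]) (simp add: Ns)
  have id: "cross3 (N' w a) (frechet_derivative X (at w) b) + cross3 (frechet_derivative X (at w) a) (N' w b)
      = (- 2 * H) *\<^sub>R cross3 (frechet_derivative X (at w) a) (frechet_derivative X (at w) b)" if w: "w \<in> ?B" for w a b
  proof -
    let ?f = "frechet_derivative X (at w)"
    let ?c = "cross3 (partial 1 X w) (partial 2 X w)"
    have c0: "?c \<noteq> 0" by (rule cross_partial_nonzero[OF ch(2) BU[OF w] ch(3)[OF BU[OF w]]])
    have linf: "linear ?f" using partial_has_derivative(1)[OF ch(2) BU[OF w]] by (rule has_derivative_linear)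
    have linN: "linear (N' w)" using dN[OF w] by (rule has_derivative_linear)
    have "laplace_beltrami X X w = (2 * H) *\<^sub>R N (X w)"
      using cmc chart BU[OF w] rho(3)[OF w] unfolding constant_mean_curvature_def by blast
    then have "norm ?c *\<^sub>R ((2 * H) *\<^sub>R (s *\<^sub>R chart_normal X w)) =
      - cross3 (chart_normal_deriv X w (axis 1 1)) (partial 2 X w) - cross3 (partial 1 X w) (chart_normal_deriv X w (axis 2 1))"
      using laplace_beltrami_position[OF ch(2,1) BU[OF w] ch(3)] Ns[OF w] by simp
    moreover have "norm ?c *\<^sub>R chart_normal X w = ?c" using c0 by (simp add: chart_normal_def sgn_div_norm)
    then have "norm ?c *\<^sub>R ((2 * H) *\<^sub>R (s *\<^sub>R chart_normal X w)) = (2 * H * s) *\<^sub>R ?c"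
      by (metis (no_types, opaque_lifting) mult.commute scaleR_scaleR)
    ultimately have "(2 * H * s) *\<^sub>R ?c =
      - cross3 (chart_normal_deriv X w (axis 1 1)) (partial 2 X w) - cross3 (partial 1 X w) (chart_normal_deriv X w (axis 2 1))"
      by simp
    \<comment> \<open>Multiplication by \<open>s\<close> removes the unknown sign, since
      \<open>s * s = 1\<close>.\<close>
    then have "s *\<^sub>R ((2 * H * s) *\<^sub>R ?c) = s *\<^sub>R (
      - cross3 (chart_normal_deriv X w (axis 1 1)) (partial 2 X w) - cross3 (partial 1 X w) (chart_normal_deriv X w (axis 2 1)))"
      by simp
    moreover have "s *\<^sub>R ((2 * H * s) *\<^sub>R ?c) = (2 * H) *\<^sub>R ?c"
      using s by (simp add: mult.left_commute)
    ultimately have c: "s *\<^sub>R (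
      - cross3 (chart_normal_deriv X w (axis 1 1)) (partial 2 X w) - cross3 (partial 1 X w) (chart_normal_deriv X w (axis 2 1)))
      = (2 * H) *\<^sub>R ?c" by simp
    have "cross3 (N' w (axis 1 1)) (?f (axis 2 1)) + cross3 (?f (axis 1 1)) (N' w (axis 2 1)) = - (s *\<^sub>R (
      - cross3 (chart_normal_deriv X w (axis 1 1)) (partial 2 X w) - cross3 (partial 1 X w) (chart_normal_deriv X w (axis 2 1))))"
      by (simp add: N'_def partial_def cross_linear scaleR_diff_right)
    then have basis: "cross3 (N' w (axis 1 1)) (?f (axis 2 1)) + cross3 (?f (axis 1 1)) (N' w (axis 2 1)) = (- 2 * H) *\<^sub>R ?c"
      unfolding c by simp
    have "cross3 (?f a) (?f b) + cross3 (?f a) (?f b) = (a $ 1 * b $ 2 - a $ 2 * b $ 1) *\<^sub>R (?c + ?c)"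
      using alternating_2[OF linf linf, of a b] by (simp add: partial_def)
    then have "2 *\<^sub>R cross3 (?f a) (?f b) = (a $ 1 * b $ 2 - a $ 2 * b $ 1) *\<^sub>R 2 *\<^sub>R ?c"
      unfolding scaleR_2 .
    then have "2 *\<^sub>R cross3 (?f a) (?f b) = 2 *\<^sub>R (a $ 1 * b $ 2 - a $ 2 * b $ 1) *\<^sub>R ?c"
      by (simp only: scaleR_left_commute)
    then have "cross3 (?f a) (?f b) = (a $ 1 * b $ 2 - a $ 2 * b $ 1) *\<^sub>R ?c"
      by (simp only: scaleR_cancel_left) simp
    then show ?thesis using alternating_2[OF linf linN, of a b] basis by simp
  qed
  have "continuous_on ?B (\<lambda>w. N' w (axis i 1))" for i
    unfolding N'_def
    by (intro continuous_intros continuous_on_subset[OF continuous_on_chart_normal_deriv[OF ch(2,3)] rho(2)])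
  then show thesis using that[OF rho dN id] by blast
qed

section \<open>The comparison sphere over a triangular cross section\<close>

lemma mod3_simps:
  fixes i :: 3
  shows "i + 1 + 1 = i + 2" "i + 2 + 1 = i" "i + 1 + 2 = i" "i + 2 + 2 = i + 1"
    "i \<noteq> i + 1" "i \<noteq> i + 2" "i + 1 \<noteq> i + 2" "i + 1 \<noteq> i" "i + 2 \<noteq> i" "i + 2 \<noteq> i + 1"
  using exhaust_3[of i] by auto

lemma UNIV_3_shift: "(UNIV :: 3 set) = {i, i + 1, i + 2}"
proof -
  have "card {i, i + 1, i + 2} = CARD(3)" using mod3_simps[of i] by simp
  then show ?thesis by (intro card_subset_eq[symmetric]) auto
qed

lemma cases_3_shift:
  fixes i j :: 3
  obtains "j = i" | "j = i + 1" | "j = i + 2"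
  using UNIV_3_shift[of i] by blast

lemma sum_3_shift: "sum f (UNIV :: 3 set) = f i + f (i + 1) + f (i + 2)" for f :: "3 \<Rightarrow> 'a::comm_monoid_add"
  by (subst UNIV_3_shift[of i]) (simp add: mod3_simps add.assoc)

text \<open>The horizontal vector \<open>p\<close> is determined by its components along
  \<open>a\<close> and \<open>b\<close>. With \<open>u = s - cos x * cos y\<close> this gives
  \<open>(norm p)\<^sup>2 * (1 - s\<^sup>2) = (1 - s\<^sup>2) - ((sin x * sin y)\<^sup>2 -
  u\<^sup>2)\<close>, and the data condition becomes
  \<open>cos (x + y) \<le> s < cos (x - y)\<close>, which bounds \<open>\<bar>u\<bar>\<close> by
  \<open>sin x * sin y\<close>. In the interior the bound is strict. A unit vector \<open>p\<close>
  therefore forces a segment, where \<open>u = - (sin x * sin y)\<close>; then the two normals lie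
  on different sides of \<open>p\<close>.\<close>

lemma corner_gradient_bound:
  fixes p a b d :: "real^3"
  assumes n: "norm a = 1" "norm b = 1" "cross3 a b \<noteq> 0" and d: "norm d = 1" "a \<bullet> d = 0" "b \<bullet> d = 0" "p \<bullet> d = 0"
    and p: "p \<bullet> a = - cos x" "p \<bullet> b = - cos y" and xy: "0 < x" "x < pi" "0 < y" "y < pi"
    and Q: "(x, y) \<in> interior (data_Q (dihedral_angle a b / 2)) \<union> data_Q_D1_segments (dihedral_angle a b / 2)"
  shows "norm p \<le> 1" and "norm p = 1 \<Longrightarrow> (d \<bullet> cross3 p a) * (d \<bullet> cross3 p b) < 0"
proof -
  define s where "s = a \<bullet> b"
  have aa: "a \<bullet> a = 1" "b \<bullet> b = 1" "b \<bullet> a = s" "d \<bullet> d = 1" using n d by (auto simp: norm_eq_1 s_def inner_commute)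
  have nc: "(norm (cross3 a b))\<^sup>2 = 1 - s\<^sup>2" using norm_cross[of a b] n by (simp add: s_def)
  have ncpos: "(norm (cross3 a b))\<^sup>2 > 0" using n(3) by simp
  then have s1: "s\<^sup>2 < 1" using nc by linarith
  then have sb: "-1 < s" "s < 1" by (auto simp: abs_square_less_1)
  define \<theta> where "\<theta> = arccos s"
  have th: "cos \<theta> = s" "0 < \<theta>" "\<theta> < pi" using sb arccos_lt_bounded[OF sb] by (auto simp: \<theta>_def cos_arccos)
  \<comment> \<open>\<open>\<theta>\<close> is the angle between the outer normals, so the opening
    angle of the wedge is \<open>pi - \<theta>\<close>.\<close>
  have da: "2 * (dihedral_angle a b / 2) = pi - \<theta>" using dihedral_angle_eq(1)[OF n] by (simp add: \<theta>_def s_def)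
  let ?A = "\<bar>x + y - pi\<bar> < pi - \<theta> \<and> \<bar>x - y\<bar> < \<theta>"
  let ?B = "\<bar>x + y - pi\<bar> = pi - \<theta> \<and> \<bar>x - y\<bar> < \<theta>"
  have AB: "?A \<or> ?B"
    using Q
  proof
    assume "(x, y) \<in> interior (data_Q (dihedral_angle a b / 2))"
    then obtain e where e: "e > 0" "ball (x, y) e \<subseteq> data_Q (dihedral_angle a b / 2)"
      by (auto simp: mem_interior)
    have mem: "(x + u, y + v) \<in> data_Q (dihedral_angle a b / 2)" if "\<bar>u\<bar> \<le> e / 4" "\<bar>v\<bar> \<le> e / 4" for u v
    proof -
      have "dist (x, y) (x + u, y + v) \<le> \<bar>u\<bar> + \<bar>v\<bar>"
        using sqrt_sum_squares_le_sum_abs[of u v] by (simp add: dist_Pair_Pair dist_real_def)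
      then show ?thesis using that e by (intro subsetD[OF e(2)]) auto
    qed
    have "\<bar>x + y - pi + 2 * (e/4)\<bar> \<le> pi - \<theta>" "\<bar>x + y - pi - 2 * (e/4)\<bar> \<le> pi - \<theta>"
      "\<bar>x - y + 2 * (e/4)\<bar> \<le> \<theta>" "\<bar>x - y - 2 * (e/4)\<bar> \<le> \<theta>"
      using mem[of "e/4" "e/4"] mem[of "-e/4" "-e/4"] mem[of "e/4" "-e/4"] mem[of "-e/4" "e/4"] e(1) da
      unfolding data_Q_def by (auto simp: algebra_simps)
    then have ?A using e(1) by linarith
    then show ?thesis ..
  next
    assume "(x, y) \<in> data_Q_D1_segments (dihedral_angle a b / 2)"
    then have ?B using da unfolding data_Q_D1_segments_def by auto
    then show ?thesis ..
  qed
  have le: "\<theta> \<le> x + y" "x + y \<le> 2 * pi - \<theta>" "\<bar>x - y\<bar> < \<theta>" using AB by auto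
  have c1: "cos (x + y) \<le> s"
  proof (cases "x + y \<le> pi")
    case True
    then show ?thesis using le th cos_monotone_0_pi_le[of \<theta> "x + y"] by auto
  next
    case False
    then have "cos (2 * pi - (x + y)) \<le> cos \<theta>" using le th xy by (intro cos_monotone_0_pi_le) auto
    then show ?thesis using th by (simp add: cos_2pi_minus)
  qed
  have c1s: "cos (x + y) < s" if ?A
  proof (cases "x + y \<le> pi")
    case True
    then show ?thesis using that th cos_monotone_0_pi[of \<theta> "x + y"] by auto
  next
    case False
    then have "cos (2 * pi - (x + y)) < cos \<theta>" using that th xy by (intro cos_monotone_0_pi) auto
    then show ?thesis using th by (simp add: cos_2pi_minus)
  qed
  have c1e: "cos (x + y) = s" if ?B
  proof -
    have "x + y = \<theta> \<or> x + y = 2 * pi - \<theta>" using that by linarith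
    then show ?thesis using th by (auto simp: cos_2pi_minus)
  qed
  have c2: "s < cos (x - y)"
  proof -
    have "cos \<theta> < cos \<bar>x - y\<bar>" using le th by (intro cos_monotone_0_pi) auto
    then show ?thesis using th by simp
  qed
  have ss: "sin x > 0" "sin y > 0" using xy by (auto intro: sin_gt_zero)
  define u where "u = s - cos x * cos y"
  have u1: "- (sin x * sin y) \<le> u" "u < sin x * sin y" using c1 c2 by (auto simp: u_def cos_add cos_diff)
  have u2: "- (sin x * sin y) < u" if ?A using c1s[OF that] by (simp add: u_def cos_add)
  have e1: "cross3 p (cross3 a b) = (- cos y) *\<^sub>R a - (- cos x) *\<^sub>R b" unfolding Lagrange p by simp
  have 1: "(norm (cross3 p (cross3 a b)))\<^sup>2 = (cos x)\<^sup>2 + (cos y)\<^sup>2 - 2 * cos x * cos y * s"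
    unfolding e1 power2_norm_eq_inner
    by (simp add: inner_diff_left inner_diff_right inner_add_left inner_add_right aa s_def[symmetric] power2_eq_square algebra_simps)
  have pc: "p \<bullet> cross3 a b = 0"
  proof -
    have "cross3 d (cross3 a b) = 0" using d by (simp add: Lagrange inner_commute)
    then have "(d \<bullet> d) *\<^sub>R cross3 a b = (d \<bullet> cross3 a b) *\<^sub>R d" using Lagrange[of d d "cross3 a b"] by simp
    then have e: "cross3 a b = (d \<bullet> cross3 a b) *\<^sub>R d" using aa by simp
    have "p \<bullet> cross3 a b = p \<bullet> ((d \<bullet> cross3 a b) *\<^sub>R d)" by (rule arg_cong[OF e])
    then show ?thesis using d by simp
  qed
  have 2: "(norm (cross3 p (cross3 a b)))\<^sup>2 = (norm p)\<^sup>2 * (1 - s\<^sup>2)"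
    using norm_cross[of p "cross3 a b"] pc nc by simp
  have 3: "(norm p)\<^sup>2 * (1 - s\<^sup>2) = (1 - s\<^sup>2) - ((sin x * sin y)\<^sup>2 - u\<^sup>2)"
    using 1 2 unfolding u_def power_mult_distrib sin_squared_eq by (simp add: power2_eq_square algebra_simps)
  have "\<bar>u\<bar> \<le> sin x * sin y" using u1 by auto
  then have "u\<^sup>2 \<le> (sin x * sin y)\<^sup>2" using abs_le_square_iff[of u "sin x * sin y"] ss by simp
  then have "(norm p)\<^sup>2 * (1 - s\<^sup>2) \<le> 1 * (1 - s\<^sup>2)" using 3 by simp
  then have "(norm p)\<^sup>2 \<le> 1" using s1 by (simp add: mult_le_cancel_right)
  then show "norm p \<le> 1" by (simp add: abs_square_le_1)
  assume p1: "norm p = 1"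
  have "\<not> ?A"
  proof
    assume ?A
    then have "\<bar>u\<bar> < sin x * sin y" using u1 u2 by auto
    then have "\<bar>u\<bar>\<^sup>2 < (sin x * sin y)\<^sup>2" by (intro power_strict_mono) auto
    then have "u\<^sup>2 < (sin x * sin y)\<^sup>2" by simp
    then show False using 3 p1 by simp
  qed
  then have B: ?B using AB by blast
  have pp: "p \<bullet> p = 1" using p1 by (simp add: norm_eq_1)
  \<comment> \<open>Decomposition in the horizontal orthonormal frame \<open>p\<close>,
    \<open>cross3 p d\<close>; applied to both normals it expresses \<open>a \<bullet> b\<close>
    through the product in the claim.\<close>
  have e: "v = (p \<bullet> v) *\<^sub>R p - (d \<bullet> cross3 p v) *\<^sub>R cross3 p d" if "v \<bullet> d = 0" for v
  proof -
    have "cross3 p v = (d \<bullet> cross3 p v) *\<^sub>R d"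
    proof -
      have "cross3 d (cross3 p v) = 0" using d that by (simp add: Lagrange inner_commute)
      then have "(d \<bullet> d) *\<^sub>R cross3 p v = (d \<bullet> cross3 p v) *\<^sub>R d" using Lagrange[of d d "cross3 p v"] by simp
      then show ?thesis using aa by simp
    qed
    then have "cross3 p (cross3 p v) = (d \<bullet> cross3 p v) *\<^sub>R cross3 p d"
      by (metis cross_mult_right)
    moreover have "cross3 p (cross3 p v) = (p \<bullet> v) *\<^sub>R p - v" using pp by (simp add: Lagrange)
    ultimately show ?thesis by (simp add: algebra_simps)
  qed
  have pd: "cross3 p d \<bullet> cross3 p d = 1" "p \<bullet> cross3 p d = 0" "cross3 p d \<bullet> p = 0"
    using norm_cross[of p d] p1 d by (simp_all add: dot_cross_self power2_norm_eq_inner)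
  have "s = ((p \<bullet> a) *\<^sub>R p - (d \<bullet> cross3 p a) *\<^sub>R cross3 p d) \<bullet> ((p \<bullet> b) *\<^sub>R p - (d \<bullet> cross3 p b) *\<^sub>R cross3 p d)"
    unfolding s_def by (rule arg_cong2[where f=inner]) (rule e, fact)+
  also have "\<dots> = (p \<bullet> a) * (p \<bullet> b) + (d \<bullet> cross3 p a) * (d \<bullet> cross3 p b)"
    by (simp add: inner_diff_left inner_diff_right pd pp)
  finally have "(d \<bullet> cross3 p a) * (d \<bullet> cross3 p b) = u" using p by (simp add: u_def)
  also have "\<dots> = - (sin x * sin y)" using c1e[OF B] by (simp add: u_def cos_add)
  finally show "(d \<bullet> cross3 p a) * (d \<bullet> cross3 p b) < 0" using ss by simp
qed

section \<open>The triangular cross section\<close>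

text \<open>Indices are taken modulo 3: \<open>q i\<close> is a point on the line where walls
  \<open>i\<close> and \<open>i + 1\<close> meet, and wall \<open>i + 2\<close> is opposite to it.
  The three points may have different heights along \<open>d\<close>.\<close>

locale triangular_prism =
  fixes n :: "3 \<Rightarrow> real^3" and c :: "3 \<Rightarrow> real" and d :: "real^3" and q :: "3 \<Rightarrow> real^3"
  assumes n1: "norm (n j) = 1" and nd: "n j \<bullet> d = 0" and d1: "norm d = 1"
    and indep: "j \<noteq> k \<Longrightarrow> cross3 (n j) (n k) \<noteq> 0"
    and q_on: "n i \<bullet> q i = c i" "n (i + 1) \<bullet> q i = c (i + 1)" and q_in: "n (i + 2) \<bullet> q i < c (i + 2)"
begin

definition hor :: "real^3 \<Rightarrow> real^3" where "hor x = x - (d \<bullet> x) *\<^sub>R d"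

text \<open>\<open>q (j + 1)\<close> is the corner opposite to wall \<open>j\<close>, so this is an
  altitude of the cross section.\<close>

definition gap :: "3 \<Rightarrow> real" where "gap j = c j - n j \<bullet> q (j + 1)"

text \<open>Barycentric coordinate, for the corner \<open>q i\<close>, of the projection along
  \<open>d\<close>: the distance to the opposite wall divided by the altitude.\<close>

definition bary :: "3 \<Rightarrow> real^3 \<Rightarrow> real" where "bary i x = (c (i + 2) - n (i + 2) \<bullet> x) / gap (i + 2)"

lemma dd: "d \<bullet> d = 1" using d1 by (simp add: norm_eq_1)
lemma d_nz: "d \<noteq> 0" using d1 by auto
lemma dn: "d \<bullet> n j = 0" using nd by (simp add: inner_commute)
lemma nn: "n j \<bullet> n j = 1" using n1 by (simp add: norm_eq_1)
lemma gap_pos: "gap j > 0" using q_in[of "j + 1"] by (simp add: gap_def mod3_simps)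

lemma linear_hor: "linear hor"
  by (rule linearI) (simp_all add: hor_def inner_add_right algebra_simps)

lemma hor_simps: "hor (x + y) = hor x + hor y" "hor (x - y) = hor x - hor y" "hor (s *\<^sub>R x) = s *\<^sub>R hor x"
  "hor d = 0" "d \<bullet> hor x = 0" "n j \<bullet> hor x = n j \<bullet> x" "hor (hor x) = hor x" "hor x \<bullet> d = 0"
  by (simp_all add: hor_def inner_add_right inner_diff_right inner_diff_left dd nd dn algebra_simps inner_commute)

lemma hor_eq_iff: "hor x = hor y \<longleftrightarrow> (\<exists>s. x = y + s *\<^sub>R d)"
proof
  assume "hor x = hor y"
  then have "x = y + (d \<bullet> x - d \<bullet> y) *\<^sub>R d" by (simp add: hor_def algebra_simps)
  then show "\<exists>s. x = y + s *\<^sub>R d" ..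
qed (auto simp: hor_simps)

lemma q_plane: "n j \<bullet> q i = (if j = i + 2 then c j - gap j else c j)"
  using q_on[of i] by (cases rule: cases_3_shift[of j i]) (auto simp: mod3_simps gap_def)

text \<open>The weights are proportional to the side lengths, so this is the closing of the boundary
  polygon turned by a right angle. In the proof the sum is orthogonal to \<open>d\<close> and to
  every side, hence parallel to two independent normals.\<close>

lemma normals_sum: "(\<Sum>j\<in>UNIV. (1 / gap j) *\<^sub>R n j) = 0"
proof -
  define v where "v = (\<Sum>j\<in>UNIV. (1 / gap j) *\<^sub>R n j)"
  have vd: "d \<bullet> v = 0" by (simp add: v_def inner_sum_right dn)
  have g: "gap j \<noteq> 0" for j using gap_pos[of j] by simp
  have v\<tau>: "(q (i + 1) - q i) \<bullet> v = 0" for i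
    unfolding v_def sum_3_shift[of _ i]
    by (simp add: inner_add_right inner_diff_left inner_diff_right inner_commute[of _ "n _"] q_plane mod3_simps g)
  have par: "\<exists>s. v = s *\<^sub>R n (i + 1)" for i
  proof (rule parallel_if_orthogonal)
    show "cross3 d (q (i + 1) - q i) \<noteq> 0"
    proof
      assume 0: "cross3 d (q (i + 1) - q i) = 0"
      have "n (i + 2) \<bullet> cross3 d (cross3 d (q (i + 1) - q i)) = - (n (i + 2) \<bullet> (q (i + 1) - q i))"
        by (simp add: Lagrange inner_diff_right dd nd)
      then show False using 0 g[of "i+2"] by (simp add: inner_diff_right q_plane mod3_simps)
    qed
    show "d \<bullet> v = 0" "(q (i + 1) - q i) \<bullet> v = 0" "d \<bullet> n (i + 1) = 0" by (fact vd v\<tau> dn)+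
    show "(q (i + 1) - q i) \<bullet> n (i + 1) = 0"
      by (simp add: inner_diff_left inner_diff_right inner_commute[of _ "n _"] q_plane mod3_simps)
    show "n (i + 1) \<noteq> 0" using n1[of "i + 1"] by auto
  qed
  obtain s t where st: "v = s *\<^sub>R n (0 + 1)" "v = t *\<^sub>R n (1 + 1)" using par by meson
  have "cross3 v v = (s * t) *\<^sub>R cross3 (n (0 + 1)) (n (1 + 1))"
    by (subst st(1), subst st(2)) (simp add: cross_mult_left cross_mult_right)
  then have "s * t = 0" using indep[of "0 + 1" "1 + 1"] by simp
  then have "v = 0" using st by auto
  then show ?thesis by (simp add: v_def)
qed

text \<open>By \<open>normals_sum\<close> the sum has no linear part, and its constant value can be
  read off at a corner.\<close>

lemma bary_sum: "(\<Sum>i\<in>UNIV. bary i x) = 1"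
proof -
  have g: "gap j \<noteq> 0" for j using gap_pos[of j] by simp
  have eq: "(\<Sum>i\<in>UNIV. bary i x) = (\<Sum>j\<in>UNIV. c j / gap j) - (\<Sum>j\<in>UNIV. (1 / gap j) *\<^sub>R n j) \<bullet> x" for x
  proof -
    fix k :: 3
    show ?thesis
      unfolding sum_3_shift[of "\<lambda>i. bary i x" k] sum_3_shift[of "\<lambda>j. c j / gap j" k] sum_3_shift[of "\<lambda>j. (1 / gap j) *\<^sub>R n j" k]
      by (simp add: bary_def mod3_simps diff_divide_distrib inner_add_left)
  qed
  have "(\<Sum>i\<in>UNIV. bary i (q k)) = 1" for k
    unfolding sum_3_shift[of _ k] bary_def by (simp add: q_plane mod3_simps g)
  then show ?thesis using eq[of x] eq[of "q 0"] normals_sum by simp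
qed

lemma bary_expansion: "\<exists>s. x = (\<Sum>i\<in>UNIV. bary i x *\<^sub>R q i) + s *\<^sub>R d"
proof -
  have g: "gap j \<noteq> 0" for j using gap_pos[of j] by simp
  let ?y = "x - (\<Sum>i\<in>UNIV. bary i x *\<^sub>R q i)"
  have ny: "n j \<bullet> ?y = 0" for j
  proof -
    have "n j \<bullet> (\<Sum>i\<in>UNIV. bary i x *\<^sub>R q i) = (bary j x + bary (j + 1) x + bary (j + 2) x) * c j - bary (j + 1) x * gap j"
      unfolding sum_3_shift[of _ j] by (simp add: inner_add_right q_plane mod3_simps algebra_simps)
    also have "bary j x + bary (j + 1) x + bary (j + 2) x = 1"
      using bary_sum[of x] unfolding sum_3_shift[of _ j] by simp
    also have "bary (j + 1) x * gap j = c j - n j \<bullet> x" using g by (simp add: bary_def mod3_simps)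
    finally show ?thesis by (simp add: inner_diff_right)
  qed
  have "cross3 (n 0) (n 1) \<noteq> 0" by (rule indep) simp
  from parallel_if_orthogonal[OF this ny ny nd nd d_nz]
  obtain s where "?y = s *\<^sub>R d" by blast
  then have "x = (\<Sum>i\<in>UNIV. bary i x *\<^sub>R q i) + s *\<^sub>R d" by (simp add: algebra_simps)
  then show ?thesis ..
qed

lemma bary_nonneg: "(\<And>j. n j \<bullet> x \<le> c j) \<Longrightarrow> 0 \<le> bary i x"
  using gap_pos[of "i + 2"] by (simp add: bary_def)

lemma bary_pos: "n (i + 2) \<bullet> x < c (i + 2) \<Longrightarrow> 0 < bary i x"
  using gap_pos[of "i + 2"] by (simp add: bary_def)

lemma norm_hor_le: "norm (hor x) \<le> norm x"
proof -
  have "x \<bullet> x = hor x \<bullet> hor x + (d \<bullet> x)\<^sup>2"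
    by (simp add: hor_def inner_diff_left inner_diff_right dd power2_eq_square inner_commute)
  then have "hor x \<bullet> hor x \<le> x \<bullet> x" by simp
  then show ?thesis by (simp add: norm_le)
qed

lemma hor_bounded:
  obtains R where "\<And>x. (\<And>j. n j \<bullet> x \<le> c j) \<Longrightarrow> norm (hor x) \<le> R"
proof
  fix x assume x: "\<And>j. n j \<bullet> x \<le> c j"
  obtain s where "x = (\<Sum>i\<in>UNIV. bary i x *\<^sub>R q i) + s *\<^sub>R d" using bary_expansion by blast
  then have "hor x = hor ((\<Sum>i\<in>UNIV. bary i x *\<^sub>R q i) + s *\<^sub>R d)" by (rule arg_cong)
  also have "\<dots> = (\<Sum>i\<in>UNIV. bary i x *\<^sub>R hor (q i))"
    by (simp add: hor_simps linear_sum[OF linear_hor] linear_scale[OF linear_hor])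
  finally have e: "hor x = (\<Sum>i\<in>UNIV. bary i x *\<^sub>R hor (q i))" .
  have "norm (hor x) \<le> (\<Sum>i\<in>UNIV. norm (bary i x *\<^sub>R hor (q i)))" unfolding e by (rule norm_sum)
  also have "\<dots> \<le> (\<Sum>i\<in>UNIV. 1 * norm (q i))"
  proof (rule sum_mono)
    fix i
    have "bary i x \<le> (\<Sum>i\<in>UNIV. bary i x)" using bary_nonneg[OF x] by (intro member_le_sum) auto
    then have "\<bar>bary i x\<bar> \<le> 1" using bary_sum[of x] bary_nonneg[OF x, of i] by simp
    then show "norm (bary i x *\<^sub>R hor (q i)) \<le> 1 * norm (q i)"
      unfolding norm_scaleR by (intro mult_mono norm_hor_le) auto
  qed
  finally show "norm (hor x) \<le> (\<Sum>i\<in>UNIV. norm (q i))" by simp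
qed

text \<open>Signed length of the side on wall \<open>i + 1\<close>: a side turned by a right angle
  in the horizontal plane is a multiple of the normal of its wall.\<close>

definition side_coeff :: "3 \<Rightarrow> real" where "side_coeff i = n (i + 1) \<bullet> cross3 (q (i + 1) - q i) d"

lemma side_cross: "cross3 (q (i + 1) - q i) d = side_coeff i *\<^sub>R n (i + 1)"
proof -
  let ?u = "cross3 (q (i + 1) - q i) d"
  have "cross3 (n (i + 1)) ?u = 0"
    by (simp add: Lagrange nd inner_diff_right q_plane mod3_simps)
  then have "(n (i + 1) \<bullet> n (i + 1)) *\<^sub>R ?u = (n (i + 1) \<bullet> ?u) *\<^sub>R n (i + 1)"
    using Lagrange[of "n (i + 1)" "n (i + 1)" ?u] by simp
  then show ?thesis by (simp add: nn side_coeff_def)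
qed

text \<open>Side length times altitude is twice the signed area, whichever side is taken. Hence all
  \<open>side_coeff i\<close> have the same sign.\<close>

lemma side_coeff_gap: "side_coeff i * gap (i + 1) = d \<bullet> cross3 (q 1 - q 0) (q 2 - q 1)"
proof -
  have 1: "side_coeff i * gap (i + 1) = d \<bullet> cross3 (q (i + 1) - q i) (q (i + 2) - q (i + 1))"
  proof -
    have "d \<bullet> cross3 (q (i + 1) - q i) (q (i + 2) - q (i + 1)) = - (cross3 (q (i + 1) - q i) d \<bullet> (q (i + 2) - q (i + 1)))"
      by (simp add: cross3_simps)
    also have "\<dots> = - side_coeff i * (n (i + 1) \<bullet> (q (i + 2) - q (i + 1)))"
      unfolding side_cross by simp
    also have "n (i + 1) \<bullet> (q (i + 2) - q (i + 1)) = - gap (i + 1)"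
      by (simp add: inner_diff_right q_plane mod3_simps)
    finally show ?thesis by simp
  qed
  have "d \<bullet> cross3 (q (i + 1) - q i) (q (i + 2) - q (i + 1)) = orient d (q i) (q (i + 1)) (q (i + 2))" for i
    by (simp add: cross3_simps)
  moreover have "orient d (q i) (q (i + 1)) (q (i + 2)) = orient d (q 0) (q 1) (q 2)"
    using exhaust_3[of i]
  proof (elim disjE)
    assume "i = 1"
    moreover have "q 3 = q 0" by (rule arg_cong[where f = q]) simp
    ultimately show ?thesis by (simp add: cross3_simps)
  next
    assume "i = 2"
    moreover have "q 3 = q 0" "q 4 = q 1" by (rule arg_cong[where f = q], simp)+
    ultimately show ?thesis by (simp add: cross3_simps)
  next
    assume "i = 3"
    moreover have "q 3 = q 0" "q 4 = q 1" "q 5 = q 2" by (rule arg_cong[where f = q], simp)+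
    ultimately show ?thesis by simp
  qed
  moreover have "d \<bullet> cross3 (q 1 - q 0) (q 2 - q 1) = orient d (q 0) (q 1) (q 2)"
    by (simp add: cross3_simps)
  ultimately show ?thesis using 1 by simp
qed

lemma side_coeff_nz: "side_coeff i \<noteq> 0"
proof
  assume "side_coeff i = 0"
  then have 0: "cross3 (q (i + 1) - q i) d = 0" using side_cross[of i] by simp
  have "n (i + 2) \<bullet> cross3 d (cross3 (q (i + 1) - q i) d) = n (i + 2) \<bullet> (q (i + 1) - q i)"
    by (simp add: Lagrange inner_diff_right dd nd)
  then show False using 0 gap_pos[of "i+2"] by (simp add: inner_diff_right q_plane mod3_simps)
qed

text \<open>Orientation of the corners as seen along \<open>d\<close>. With
  \<open>side_sign *\<^sub>R d\<close> in place of \<open>d\<close> the flux density on every side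
  is a positive multiple of the outward component.\<close>

definition side_sign :: real where "side_sign = sgn (d \<bullet> cross3 (q 1 - q 0) (q 2 - q 1))"

lemma side_sign_coeff: "side_sign * side_coeff i = \<bar>side_coeff i\<bar>" "side_sign \<noteq> 0"
proof -
  have "sgn (side_coeff i * gap (i + 1)) = side_sign" by (simp add: side_coeff_gap side_sign_def)
  then have "side_sign = sgn (side_coeff i)" using gap_pos by (simp add: sgn_mult)
  then show "side_sign * side_coeff i = \<bar>side_coeff i\<bar>" "side_sign \<noteq> 0"
    using side_coeff_nz[of i] by (auto simp: sgn_if)
qed

lemma side_triple: "(side_sign *\<^sub>R d) \<bullet> cross3 z (q (i + 1) - q i) = \<bar>side_coeff i\<bar> * (n (i + 1) \<bullet> z)"
proof -
  have "(side_sign *\<^sub>R d) \<bullet> cross3 z (q (i + 1) - q i) = side_sign * (cross3 (q (i + 1) - q i) d \<bullet> z)"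
    by (simp add: cross3_simps)
  also have "\<dots> = (side_sign * side_coeff i) * (n (i + 1) \<bullet> z)" unfolding side_cross by simp
  finally show ?thesis by (simp add: side_sign_coeff)
qed

lemma orient_side:
  assumes "\<And>j. n j \<bullet> x < c j"
  shows "0 < orient (side_sign *\<^sub>R d) x (q i) (q (i + 1))"
proof -
  have "orient (side_sign *\<^sub>R d) x (q i) (q (i + 1)) = (side_sign *\<^sub>R d) \<bullet> cross3 (q i - x) (q (i + 1) - q i)"
    by (simp add: cross3_simps)
  also have "\<dots> = \<bar>side_coeff i\<bar> * (c (i + 1) - n (i + 1) \<bullet> x)"
    unfolding side_triple by (simp add: inner_diff_right q_plane mod3_simps)
  finally show ?thesis using side_coeff_nz[of i] assms[of "i + 1"] by simp
qed

text \<open>The relation \<open>normals_sum\<close> eliminates \<open>y0\<close> and yields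
  \<open>H0\<close>, because the \<open>c j\<close> with weights \<open>1 / gap j\<close> add up to
  \<open>1\<close>. Two equations then fix \<open>y0\<close>, and the third follows from the same
  relation.\<close>

lemma cap_exists:
  fixes F :: "3 \<Rightarrow> real"
  obtains H0 y0 where "y0 \<bullet> d = 0" "\<And>j. n j \<bullet> y0 - H0 * c j = F j"
proof -
  fix i :: 3
  have g: "gap j \<noteq> 0" for j using gap_pos[of j] by simp
  define H0 where "H0 = - (\<Sum>j\<in>UNIV. F j / gap j)"
  define r where "r = (\<lambda>j. F j + H0 * c j)"
  have cs: "(\<Sum>j\<in>UNIV. c j / gap j) = 1"
  proof -
    have "(\<Sum>j\<in>UNIV. c j / gap j) = (\<Sum>j\<in>UNIV. (c j - n j \<bullet> 0) / gap j)" by simp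
    also have "\<dots> = (\<Sum>j\<in>UNIV. bary j 0)"
      unfolding sum_3_shift[of _ i] bary_def by (simp add: mod3_simps)
    finally show ?thesis using bary_sum[of 0] by simp
  qed
  have rs: "(\<Sum>j\<in>UNIV. r j / gap j) = 0"
  proof -
    have "(\<Sum>j\<in>UNIV. r j / gap j) = (\<Sum>j\<in>UNIV. F j / gap j) + H0 * (\<Sum>j\<in>UNIV. c j / gap j)"
      by (simp add: r_def add_divide_distrib sum.distrib sum_distrib_left)
    then show ?thesis unfolding cs by (simp add: H0_def)
  qed
  define k where "k = cross3 (n i) (n (i + 1))"
  have kk: "k \<bullet> k \<noteq> 0" using indep[of i "i + 1"] by (simp add: k_def mod3_simps)
  \<comment> \<open>Combination of the dual basis of \<open>n i\<close> and \<open>n (i + 1)\<close>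
    in the horizontal plane.\<close>
  define y0 where "y0 = (1 / (k \<bullet> k)) *\<^sub>R (r i *\<^sub>R cross3 (n (i + 1)) k + r (i + 1) *\<^sub>R cross3 k (n i))"
  have e: "n i \<bullet> cross3 (n (i + 1)) k = k \<bullet> k" "n (i + 1) \<bullet> cross3 k (n i) = k \<bullet> k"
    "n i \<bullet> cross3 k (n i) = 0" "n (i + 1) \<bullet> cross3 (n (i + 1)) k = 0"
    using cross_triple[of "n i" "n (i + 1)" k] cross_triple[of "n (i + 1)" k "n i"] cross_triple[of k "n i" "n (i + 1)"]
    by (auto simp: k_def inner_commute dot_cross_self)
  have y1: "n i \<bullet> y0 = r i" "n (i + 1) \<bullet> y0 = r (i + 1)"
    unfolding y0_def using kk by (simp_all add: inner_add_right e)
  have "0 = (\<Sum>j\<in>UNIV. (1 / gap j) *\<^sub>R n j) \<bullet> y0" by (simp add: normals_sum)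
  also have "\<dots> = (n i \<bullet> y0) / gap i + (n (i + 1) \<bullet> y0) / gap (i + 1) + (n (i + 2) \<bullet> y0) / gap (i + 2)"
    unfolding sum_3_shift[of _ i] by (simp add: inner_add_left)
  also have "\<dots> = (\<Sum>j\<in>UNIV. r j / gap j) + ((n (i + 2) \<bullet> y0) - r (i + 2)) / gap (i + 2)"
    unfolding sum_3_shift[of _ i] by (simp add: y1 diff_divide_distrib)
  finally have y2: "n (i + 2) \<bullet> y0 = r (i + 2)" using rs g by simp
  have "n j \<bullet> y0 = r j" for j
    using y1 y2 by (cases rule: cases_3_shift[of j i]) auto
  then have "n j \<bullet> y0 - H0 * c j = F j" for j by (simp add: r_def)
  moreover have "y0 \<bullet> d = 0"
  proof -
    have "cross3 (n (i + 1)) k \<bullet> d = 0" "cross3 k (n i) \<bullet> d = 0"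
      unfolding k_def by (simp_all add: Lagrange inner_diff_left nd cross_skew[of "cross3 _ _" "n i"])
    then show ?thesis by (simp add: y0_def inner_add_left)
  qed
  ultimately show thesis using that by blast
qed

end

section \<open>The cap and the height above it\<close>

locale spherical_cap = triangular_prism +
  fixes \<gamma> :: "3 \<Rightarrow> real" and H0 :: real and y0 :: "real^3"
  assumes y0d: "y0 \<bullet> d = 0" and y0_wall: "n j \<bullet> y0 - H0 * c j = - cos (\<gamma> j)"
    and \<gamma>: "0 < \<gamma> j" "\<gamma> j < pi"
    and data: "j \<noteq> k \<Longrightarrow> (\<gamma> j, \<gamma> k) \<in> interior (data_Q (dihedral_angle (n j) (n k) / 2))
                 \<union> data_Q_D1_segments (dihedral_angle (n j) (n k) / 2)"
begin

text \<open>Horizontal part of the unit normal \<open>W\<close>. For \<open>H0 \<noteq> 0\<close> a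
  sphere with centre \<open>a\<close> has normal \<open>H0 *\<^sub>R (a - x)\<close>, so
  \<open>y0\<close> is \<open>H0\<close> times the horizontal part of the centre; for
  \<open>H0 = 0\<close> the normal of a plane is constant.\<close>

definition P :: "real^3 \<Rightarrow> real^3" where "P x = y0 - H0 *\<^sub>R hor x"
definition om :: "real^3 \<Rightarrow> real" where "om x = sqrt (1 - P x \<bullet> P x)"
definition W :: "real^3 \<Rightarrow> real^3" where "W x = P x + om x *\<^sub>R d"
text \<open>Height along \<open>d\<close> above a fixed copy of the cap. In both cases the level
  sets are vertical translates of the cap and the derivative along \<open>d\<close> is
  \<open>1\<close>.\<close>

definition height :: "real^3 \<Rightarrow> real" where
  "height x = (if H0 = 0 then (W x \<bullet> x) / om x else d \<bullet> x + om x / H0)"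

lemma P_d: "P x \<bullet> d = 0" "d \<bullet> P x = 0"
  by (simp_all add: P_def inner_diff_left inner_diff_right y0d hor_simps inner_commute[of d y0])

lemma P_normal: "n j \<bullet> P x = - cos (\<gamma> j) + H0 * (c j - n j \<bullet> x)"
  using y0_wall[of j] by (simp add: P_def inner_diff_right hor_simps algebra_simps)

lemma P_bary: "P x = (\<Sum>i\<in>UNIV. bary i x *\<^sub>R P (q i))"
proof -
  obtain s where "x = (\<Sum>i\<in>UNIV. bary i x *\<^sub>R q i) + s *\<^sub>R d" using bary_expansion by blast
  then have "hor x = hor ((\<Sum>i\<in>UNIV. bary i x *\<^sub>R q i) + s *\<^sub>R d)" by (rule arg_cong)
  also have "\<dots> = (\<Sum>i\<in>UNIV. bary i x *\<^sub>R hor (q i))"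
    by (simp add: hor_simps linear_sum[OF linear_hor] linear_scale[OF linear_hor])
  finally have "P x = (\<Sum>i\<in>UNIV. bary i x) *\<^sub>R y0 - H0 *\<^sub>R (\<Sum>i\<in>UNIV. bary i x *\<^sub>R hor (q i))"
    by (simp add: P_def bary_sum)
  also have "\<dots> = (\<Sum>i\<in>UNIV. bary i x *\<^sub>R P (q i))"
    by (simp add: P_def scaleR_diff_right sum_subtractf scaleR_sum_right scaleR_sum_left mult.commute)
  finally show ?thesis .
qed

lemma P_corner: "norm (P (q i)) \<le> 1"
  "norm (P (q i)) = 1 \<Longrightarrow> (d \<bullet> cross3 (P (q i)) (n i)) * (d \<bullet> cross3 (P (q i)) (n (i + 1))) < 0"
proof -
  have pn: "P (q i) \<bullet> n i = - cos (\<gamma> i)" "P (q i) \<bullet> n (i + 1) = - cos (\<gamma> (i + 1))"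
    using P_normal[of i "q i"] P_normal[of "i + 1" "q i"] q_on[of i] by (simp_all add: inner_commute)
  have ne: "i \<noteq> i + 1" by (simp add: mod3_simps)
  show "norm (P (q i)) \<le> 1"
    "norm (P (q i)) = 1 \<Longrightarrow> (d \<bullet> cross3 (P (q i)) (n i)) * (d \<bullet> cross3 (P (q i)) (n (i + 1))) < 0"
    by (rule corner_gradient_bound[OF n1 n1 indep[OF ne] d1 nd nd P_d(1) pn \<gamma>(1,2) \<gamma>(1,2) data[OF ne]]; assumption)+
qed

text \<open>If \<open>H0 = 0\<close> then \<open>P\<close> is constant; were it a unit vector, then at every corner its two walls would lie on
  different sides of it, which is impossible for three walls.\<close>

lemma P_lt_1:
  assumes x: "\<And>j. n j \<bullet> x \<le> c j" and one: "\<And>j k. j \<noteq> k \<Longrightarrow> n j \<bullet> x < c j \<or> n k \<bullet> x < c k"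
  shows "norm (P x) < 1"
proof (cases "H0 = 0")
  case True
  then have Py: "P z = y0" for z unfolding P_def unfolding True by simp
  show ?thesis
  proof (rule ccontr)
    assume "\<not> norm (P x) < 1"
    then have "norm y0 = 1" using P_corner(1)[of 0] Py by simp
    then have neg: "(d \<bullet> cross3 y0 (n i)) * (d \<bullet> cross3 y0 (n (i + 1))) < 0" for i using P_corner(2)[of i] Py by simp
    fix i :: 3
    define A where "A = d \<bullet> cross3 y0 (n i)"
    define B where "B = d \<bullet> cross3 y0 (n (i + 1))"
    define C where "C = d \<bullet> cross3 y0 (n (i + 2))"
    have "A * B < 0" "B * C < 0" "C * A < 0"
      using neg[of i] neg[of "i + 1"] neg[of "i + 2"] by (simp_all add: A_def B_def C_def mod3_simps)
    then show False by (auto simp: mult_less_0_iff)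
  qed
next
  case False
  have b0: "0 \<le> bary i x" for i by (rule bary_nonneg[OF x])
  have le: "norm (P x) \<le> 1"
  proof -
    have "norm (P x) \<le> (\<Sum>i\<in>UNIV. norm (bary i x *\<^sub>R P (q i)))" by (subst P_bary) (rule norm_sum)
    also have "\<dots> \<le> (\<Sum>i\<in>UNIV. bary i x)"
      using b0 P_corner(1) by (intro sum_mono) (auto intro!: mult_left_le)
    finally show ?thesis by (simp add: bary_sum)
  qed
  show ?thesis
  proof (rule ccontr)
    assume "\<not> norm (P x) < 1"
    then have "norm (P x) = 1" using le by simp
    then have 1: "P x \<bullet> P x = 1" by (simp add: norm_eq_1)
    have u: "P x \<bullet> P (q i) \<le> 1" for i
      using norm_cauchy_schwarz[of "P x" "P (q i)"] \<open>norm (P x) = 1\<close> P_corner(1)[of i] by simp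
    have "P x \<bullet> P x = P x \<bullet> (\<Sum>i\<in>UNIV. bary i x *\<^sub>R P (q i))" by (rule arg_cong[OF P_bary])
    then have "(\<Sum>i\<in>UNIV. bary i x * (1 - P x \<bullet> P (q i))) = 0"
      using 1 bary_sum[of x] by (simp add: inner_sum_right right_diff_distrib sum_subtractf)
    \<comment> \<open>Equality in a convex combination of points of the unit ball: a corner with
      positive weight must carry the value \<open>P x\<close> itself. There are two such corners,
      and an affine \<open>P\<close> with \<open>H0 \<noteq> 0\<close> distinguishes them.\<close>
    then have z: "bary i x * (1 - P x \<bullet> P (q i)) = 0" for i
      using b0 u by (subst (asm) sum_nonneg_eq_0_iff) auto
    have eq: "P (q i) = P x" if "bary i x > 0" for i
    proof -
      have "P x \<bullet> P (q i) = 1" using z[of i] that by simp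
      moreover have "P (q i) \<bullet> P (q i) \<le> 1" using P_corner(1)[of i] by (simp add: norm_le_square)
      ultimately have "(P (q i) - P x) \<bullet> (P (q i) - P x) \<le> 0"
        using 1 by (simp add: inner_diff_left inner_diff_right inner_commute)
      then have "(P (q i) - P x) \<bullet> (P (q i) - P x) = 0"
        using inner_ge_zero[of "P (q i) - P x"] by linarith
      then show ?thesis by simp
    qed
    have "\<exists>i. bary i x > 0 \<and> bary (i + 1) x > 0"
    proof -
      fix i :: 3
      consider "n (i + 2) \<bullet> x < c (i + 2)" "n i \<bullet> x < c i" | "n i \<bullet> x < c i" "n (i + 1) \<bullet> x < c (i + 1)"
        | "n (i + 1) \<bullet> x < c (i + 1)" "n (i + 2) \<bullet> x < c (i + 2)"
        using one[OF mod3_simps(5)[of i]] one[OF mod3_simps(7)[of i]] one[OF mod3_simps(6)[of i]] by blast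
      then show ?thesis
      proof cases
        case 1 then show ?thesis using bary_pos[of i x] bary_pos[of "i + 1" x] by (auto simp: mod3_simps)
      next
        case 2 then show ?thesis using bary_pos[of "i + 1" x] bary_pos[of "i + 2" x]
          by (intro exI[of _ "i + 1"]) (auto simp: mod3_simps)
      next
        case 3 then show ?thesis using bary_pos[of "i + 2" x] bary_pos[of i x]
          by (intro exI[of _ "i + 2"]) (auto simp: mod3_simps)
      qed
    qed
    then obtain i where "P (q i) = P (q (i + 1))" using eq by metis
    then have "n (i + 2) \<bullet> P (q i) = n (i + 2) \<bullet> P (q (i + 1))" by simp
    then have "H0 * (c (i + 2) - n (i + 2) \<bullet> q i) = 0"
      unfolding P_normal by (simp add: q_plane mod3_simps)
    then show False using False gap_pos[of "i + 2"] by (simp add: q_plane mod3_simps)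
  qed
qed

lemma om_shift: "om (x + s *\<^sub>R d) = om x" and W_shift: "W (x + s *\<^sub>R d) = W x"
  by (simp_all add: P_def om_def W_def hor_simps)

lemma om_pos: "norm (P x) < 1 \<Longrightarrow> 0 < om x"
  by (simp add: om_def) (simp add: norm_eq_sqrt_inner)

lemma om_sq: "norm (P x) \<le> 1 \<Longrightarrow> om x * om x = 1 - P x \<bullet> P x"
  by (simp add: om_def norm_le_square)

lemma W_d: "W x \<bullet> d = om x" "d \<bullet> W x = om x"
  by (simp_all add: W_def inner_add_left inner_add_right P_d dd)

lemma W_norm: "norm (P x) \<le> 1 \<Longrightarrow> W x \<bullet> W x = 1"
  using om_sq[of x] by (simp add: W_def inner_add_left inner_add_right P_d dd)

lemma W_wall: "n j \<bullet> x = c j \<Longrightarrow> n j \<bullet> W x = - cos (\<gamma> j)"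
  by (simp add: W_def inner_add_right nd P_normal)

lemma height_shift: "norm (P x) < 1 \<Longrightarrow> height (x + s *\<^sub>R d) = height x + s"
proof -
  assume "norm (P x) < 1"
  then have o: "om x \<noteq> 0" using om_pos by fastforce
  have 1: "(W x \<bullet> (x + s *\<^sub>R d)) / om x = (W x \<bullet> x) / om x + s"
    using o by (simp add: inner_add_right W_d add_divide_distrib)
  have 2: "d \<bullet> (x + s *\<^sub>R d) + om x / H0 = d \<bullet> x + om x / H0 + s" by (simp add: inner_add_right dd)
  show ?thesis unfolding height_def om_shift W_shift 1 2 by simp
qed

lemma has_derivative_hor: "(hor has_derivative hor) (at x)"
  by (rule linear_imp_has_derivative[OF linear_hor])

lemma P_has_derivative: "(P has_derivative (\<lambda>v. - (H0 *\<^sub>R hor v))) (at x)"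
  unfolding P_def[abs_def] using has_derivative_hor[of x] by (auto intro!: derivative_eq_intros)

lemma om_has_derivative:
  assumes "norm (P x) < 1"
  shows "(om has_derivative (\<lambda>v. H0 * (P x \<bullet> v) / om x)) (at x)"
proof -
  have pos: "0 < 1 - P x \<bullet> P x" using om_pos[OF assms] by (simp add: om_def)
  have 1: "((\<lambda>x. 1 - P x \<bullet> P x) has_derivative (\<lambda>v. 2 * H0 * (P x \<bullet> v))) (at x)"
    using P_has_derivative[of x]
    by (auto intro!: derivative_eq_intros simp: inner_commute hor_def inner_diff_right P_d)
  have "(sqrt has_derivative (\<lambda>h. inverse (sqrt (1 - P x \<bullet> P x)) / 2 * h)) (at (1 - P x \<bullet> P x))"
    using DERIV_real_sqrt[OF pos] unfolding has_field_derivative_def .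
  from has_derivative_compose[OF 1 this]
  have "(om has_derivative (\<lambda>v. inverse (sqrt (1 - P x \<bullet> P x)) / 2 * (2 * H0 * (P x \<bullet> v)))) (at x)"
    unfolding om_def[abs_def] .
  moreover have "inverse (sqrt (1 - P x \<bullet> P x)) / 2 * (2 * H0 * (P x \<bullet> v)) = H0 * (P x \<bullet> v) / om x" for v
    unfolding om_def by (simp add: field_simps)
  ultimately show ?thesis by simp
qed

lemma W_has_derivative:
  assumes "norm (P x) < 1"
  shows "(W has_derivative (\<lambda>v. - (H0 *\<^sub>R hor v) + (H0 * (P x \<bullet> v) / om x) *\<^sub>R d)) (at x)"
  unfolding W_def[abs_def]
  by (intro has_derivative_add P_has_derivative has_derivative_scaleR_left om_has_derivative assms)

text \<open>\<open>W\<close> is normal to the level sets, and division by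
  \<open>om x = W x \<bullet> d\<close> normalizes the derivative along \<open>d\<close> to
  \<open>1\<close>.\<close>

lemma height_has_derivative:
  assumes "norm (P x) < 1"
  shows "(height has_derivative (\<lambda>v. (W x \<bullet> v) / om x)) (at x)"
proof (cases "H0 = 0")
  case True
  have "P z = y0" for z unfolding P_def unfolding True by simp
  then have Wz: "W z = W x" "om z = om x" for z unfolding W_def om_def by simp_all
  have "height z = (W x \<bullet> z) / om x" for z
    by (simp only: height_def if_P[OF True] Wz[of z])
  then have "height = (\<lambda>z. (W x \<bullet> z) / om x)" by (rule ext)
  moreover have "((\<lambda>z. (W x \<bullet> z) / om x) has_derivative (\<lambda>v. (W x \<bullet> v) / om x)) (at x)"
    by (auto intro!: derivative_eq_intros simp: divide_inverse)
  ultimately show ?thesis by simp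
next
  case False
  have o: "om x \<noteq> 0" using om_pos[OF assms] by simp
  have "((\<lambda>z. d \<bullet> z + om z / H0) has_derivative (\<lambda>v. d \<bullet> v + (H0 * (P x \<bullet> v) / om x) / H0)) (at x)"
    using om_has_derivative[OF assms] False by (auto intro!: derivative_eq_intros)
  moreover have "d \<bullet> v + (H0 * (P x \<bullet> v) / om x) / H0 = (W x \<bullet> v) / om x" for v
    using False o by (simp add: W_def inner_add_left field_simps)
  moreover have "height = (\<lambda>z. d \<bullet> z + om z / H0)" using False by (auto simp: height_def)
  ultimately show ?thesis by simp
qed

text \<open>Modulo \<open>d\<close> the derivative of \<open>W\<close> is \<open>- H0\<close> times
  the identity of the horizontal plane, which has trace \<open>- 2 * H0\<close>.\<close>

lemma W_divergence:
  fixes x a b :: "real^3"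
  defines "f \<equiv> \<lambda>v. - (H0 *\<^sub>R hor v) + (H0 * (P x \<bullet> v) / om x) *\<^sub>R d"
  shows "d \<bullet> cross3 (f a) b + d \<bullet> cross3 a (f b) = - 2 * H0 * (d \<bullet> cross3 a b)"
  unfolding f_def hor_def
  by (simp add: cross_linear inner_add_right inner_diff_right dot_cross_self algebra_simps)

text \<open>Converts a bound for the height above the cap into a bound for
  \<open>d \<bullet> x\<close>; in \<open>max_normal\<close> this keeps \<open>S\<close> away from
  the open end of the prism.\<close>

lemma height_bound:
  obtains K where "\<And>x. (\<And>j. n j \<bullet> x \<le> c j) \<Longrightarrow> norm (P x) < 1 \<Longrightarrow> \<bar>height x - d \<bullet> x\<bar> \<le> K"
proof (cases "H0 = 0")
  case True
  obtain R where R: "\<And>x. (\<And>j. n j \<bullet> x \<le> c j) \<Longrightarrow> norm (hor x) \<le> R" using hor_bounded by blast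
  show thesis
  proof (rule that)
    fix x assume x: "\<And>j. n j \<bullet> x \<le> c j" and lt: "norm (P x) < 1"
    have o: "om x > 0" by (rule om_pos[OF lt])
    have W: "W x = y0 + sqrt (1 - y0 \<bullet> y0) *\<^sub>R d" "om x = sqrt (1 - y0 \<bullet> y0)"
    proof -
      have "P x = y0" unfolding P_def unfolding True by simp
      then show "W x = y0 + sqrt (1 - y0 \<bullet> y0) *\<^sub>R d" "om x = sqrt (1 - y0 \<bullet> y0)"
        unfolding W_def om_def by simp_all
    qed
    have "height x - d \<bullet> x = (y0 \<bullet> hor x) / sqrt (1 - y0 \<bullet> y0)"
      using o W unfolding height_def if_P[OF True] W
      by (simp add: inner_add_left hor_def inner_diff_right y0d field_simps)
    moreover have "\<bar>y0 \<bullet> hor x\<bar> \<le> norm y0 * R"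
      using Cauchy_Schwarz_ineq2[of y0 "hor x"] mult_left_mono[OF R[OF x], of "norm y0"] by simp
    ultimately show "\<bar>height x - d \<bullet> x\<bar> \<le> norm y0 * R / sqrt (1 - y0 \<bullet> y0)"
      using o W by (simp add: divide_right_mono)
  qed
next
  case False
  show thesis
  proof (rule that)
    fix x assume lt: "norm (P x) < 1"
    have "om x \<le> 1" "0 \<le> om x" using om_pos[OF lt] by (simp_all add: om_def)
    then show "\<bar>height x - d \<bullet> x\<bar> \<le> 1 / \<bar>H0\<bar>"
      using False by (simp add: height_def abs_divide divide_right_mono)
  qed
qed

text \<open>For \<open>H0 \<noteq> 0\<close> the vector from a point of the level set to the fixed
  centre is \<open>(1 / H0) *\<^sub>R W x\<close>, of constant length; for \<open>H0 = 0\<close> the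
  normal \<open>W\<close> is constant.\<close>

lemma height_level_set:
  assumes "\<And>x. x \<in> S \<Longrightarrow> norm (P x) < 1" "\<And>x. x \<in> S \<Longrightarrow> height x = k"
  shows "(H0 \<noteq> 0 \<longrightarrow> portion_of_sphere S) \<and> (H0 = 0 \<longrightarrow> portion_of_plane S)"
proof (intro conjI impI)
  assume H: "H0 \<noteq> 0"
  have "S \<subseteq> sphere ((1 / H0) *\<^sub>R y0 + k *\<^sub>R d) (1 / \<bar>H0\<bar>)"
  proof
    fix x assume x: "x \<in> S"
    have k: "d \<bullet> x + om x / H0 = k" using assms(2)[OF x] H by (simp add: height_def)
    have "((1 / H0) *\<^sub>R y0 + k *\<^sub>R d) - x = (1 / H0) *\<^sub>R W x"
      using H unfolding k[symmetric]
      by (simp add: W_def P_def hor_def scaleR_add_right scaleR_diff_right scaleR_add_left algebra_simps)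
    moreover have "norm (W x) = 1" using W_norm[of x] assms(1)[OF x] by (simp add: norm_eq_1)
    ultimately show "x \<in> sphere ((1 / H0) *\<^sub>R y0 + k *\<^sub>R d) (1 / \<bar>H0\<bar>)"
      by (simp add: dist_norm)
  qed
  then show "portion_of_sphere S" unfolding portion_of_sphere_def using H by (intro exI[of _ _]) auto
next
  assume H: "H0 = 0"
  define w where "w = y0 + sqrt (1 - y0 \<bullet> y0) *\<^sub>R d"
  have "P x = y0" for x unfolding P_def unfolding H by simp
  then have Ww: "W x = w" "om x = w \<bullet> d" for x
    unfolding W_def om_def w_def by (simp_all add: inner_add_left y0d dd)
  show "portion_of_plane S"
  proof (cases "S = {}")
    case True
    then show ?thesis unfolding portion_of_plane_def by (intro exI[of _ d]) (auto simp: d_nz)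
  next
    case False
    then obtain x where x: "x \<in> S" by blast
    have o: "w \<bullet> d > 0" using om_pos[OF assms(1)[OF x]] Ww by simp
    have "S \<subseteq> plane w (k * (w \<bullet> d))"
    proof
      fix z assume "z \<in> S"
      then have "(W z \<bullet> z) / om z = k" using assms(2)[of z] unfolding height_def if_P[OF H] by simp
      then show "z \<in> plane w (k * (w \<bullet> d))" using o unfolding Ww by (simp add: plane_def field_simps)
    qed
    moreover have "w \<noteq> 0" using o by auto
    ultimately show ?thesis unfolding portion_of_plane_def by blast
  qed
qed

end

section \<open>Position of the surface over the cross section\<close>

text \<open>By \<open>md\<close> the direction \<open>d\<close> points away from the base, so that
  "above" and "below" refer to \<open>d\<close>. The corner \<open>q i\<close> is the foot of the
  local graph at the vertex \<open>v i\<close>.\<close>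

locale capillary_drop = spherical_cap n c d q \<gamma> H0 y0
  for n :: "3 \<Rightarrow> real^3" and c d q \<gamma> H0 y0 +
  fixes m :: "real^3" and b :: real and V :: "(real^2) set" and v :: "3 \<Rightarrow> real^2" and \<phi> :: "real^2 \<Rightarrow> real^3"
    and I S C \<Omega> :: "(real^3) set" and N :: "real^3 \<Rightarrow> real^3" and H :: real
  assumes md: "m \<bullet> d < 0"
    and I: "I = container n c m b"
    and S: "S = \<phi> ` (cball 0 1 - V)"
    and C: "C = \<phi> ` (sphere 0 1 - V)"
    and disk: "embedded_disk_type (container_planes n c m b) I V \<phi>"
    and vertices: "V = range v" "inj v"
    and graph: "\<exists>e h u. local_graph I V \<phi> (v i) (plane (n i) (c i)) (plane (n (i + 1)) (c (i + 1))) e h (q i) u"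
    and drop: "drop_region I S (plane m b) \<Omega>"
    and normal: "outward_unit_normal S C \<Omega> N"
    and cmc: "constant_mean_curvature S C N H"
    and contact_angle: "p \<in> C \<inter> plane (n j) (c j) \<Longrightarrow> N p \<bullet> n j = - cos (\<gamma> j)"
begin

abbreviation "D0 \<equiv> cball 0 1 - V :: (real^2) set"

lemma disk_facts: "finite V" "V \<subseteq> sphere 0 1" "\<exists>\<psi>. homeomorphism D0 S \<phi> \<psi>"
    "S \<subseteq> closure I" "\<phi> ` ball 0 1 \<subseteq> I"
    "a \<in> components (sphere 0 1 - V) \<Longrightarrow> \<exists>F \<in> faces (container_planes n c m b) I. \<phi> ` a \<subseteq> F"
    "C2_surface_with_boundary S C"
  using disk unfolding embedded_disk_type_def S C by blast+

lemma phi_cont: "continuous_on D0 \<phi>" and phi_inj: "inj_on \<phi> D0"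
  using disk_facts(3) unfolding homeomorphism_def by (auto intro: inj_on_inverseI)

lemma I_iff: "x \<in> I \<longleftrightarrow> (\<forall>j. n j \<bullet> x < c j) \<and> m \<bullet> x < b"
  by (auto simp: I container_def prism_def)

lemma I_eq: "I = (\<Inter>j. {x. n j \<bullet> x < c j}) \<inter> {x. m \<bullet> x < b}"
  by (auto simp: I_iff)

lemma I_open: "open I" and I_convex: "convex I"
  unfolding I_eq by (intro open_Int open_INT ballI open_halfspace_lt convex_Int convex_INT convex_halfspace_lt; simp)+

lemma closure_I: "x \<in> closure I \<Longrightarrow> n j \<bullet> x \<le> c j" "x \<in> closure I \<Longrightarrow> m \<bullet> x \<le> b"
proof -
  have "closed ((\<Inter>j. {x. n j \<bullet> x \<le> c j}) \<inter> {x. m \<bullet> x \<le> b})"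
    by (intro closed_Int closed_INT ballI closed_halfspace_le)
  then have "closure I \<subseteq> (\<Inter>j. {x. n j \<bullet> x \<le> c j}) \<inter> {x. m \<bullet> x \<le> b}"
    by (intro closure_minimal) (auto simp: I_eq less_imp_le)
  then show "x \<in> closure I \<Longrightarrow> n j \<bullet> x \<le> c j" "x \<in> closure I \<Longrightarrow> m \<bullet> x \<le> b" by auto
qed

lemma S_base: "S \<inter> plane m b = {}"
  using drop by (simp add: drop_region_def)

lemma S_base': "p \<in> S \<Longrightarrow> m \<bullet> p < b"
  using S_base closure_I(2)[of p] disk_facts(4) by (force simp: plane_def less_le)

lemma planes_distinct: "j \<noteq> k \<Longrightarrow> plane (n j) (c j) \<noteq> plane (n k) (c k)"
proof
  assume jk: "j \<noteq> k" and e: "plane (n j) (c j) = plane (n k) (c k)"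
  obtain i where i: "{j, k} = {i, i + 1}"
    using cases_3_shift[of k j] jk mod3_simps[of j] mod3_simps[of k]
    by (metis insert_commute)
  have "q (i + 1) \<in> plane (n (i + 1)) (c (i + 1))" "q (i + 1) \<notin> plane (n i) (c i)"
    using gap_pos[of i] by (simp_all add: plane_def q_plane mod3_simps)
  then show False using e i by (metis doubleton_eq_iff)
qed

lemma C_subset: "C \<subseteq> S" unfolding C S by auto

text \<open>Contact lines run in faces, and the faces are what remains of the boundary once the
  edges are removed.\<close>

lemma C_frontier:
  assumes "p \<in> C"
  shows "p \<in> frontier I" "j \<noteq> k \<Longrightarrow> \<not> (n j \<bullet> p = c j \<and> n k \<bullet> p = c k)"
proof -
  obtain y where y: "y \<in> sphere 0 1 - V" "p = \<phi> y" using assms by (auto simp: C)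
  obtain a where a: "a \<in> components (sphere 0 1 - V)" "y \<in> a"
    using y(1) Union_components[of "sphere 0 1 - V"] by blast
  obtain F where F: "F \<in> faces (container_planes n c m b) I" "\<phi> ` a \<subseteq> F" using disk_facts(6)[OF a(1)] by blast
  have pF: "p \<in> frontier I - \<Union>(edges (container_planes n c m b) I)"
    using F a y in_components_subset unfolding faces_def by blast
  then show "p \<in> frontier I" by blast
  show "\<not> (n j \<bullet> p = c j \<and> n k \<bullet> p = c k)" if "j \<noteq> k"
  proof
    assume "n j \<bullet> p = c j \<and> n k \<bullet> p = c k"
    then have "p \<in> plane (n j) (c j) \<inter> plane (n k) (c k) \<inter> closure I"
      using pF by (auto simp: plane_def frontier_def)
    moreover have "plane (n j) (c j) \<inter> plane (n k) (c k) \<inter> closure I \<in> edges (container_planes n c m b) I"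
      using planes_distinct[OF that] unfolding edges_def container_planes_def by blast
    ultimately show False using pF by blast
  qed
qed

lemma C_wall:
  assumes "p \<in> C"
  obtains j where "n j \<bullet> p = c j" "\<And>k. k \<noteq> j \<Longrightarrow> n k \<bullet> p < c k"
proof -
  have p: "p \<notin> I" "p \<in> closure I" using C_frontier(1)[OF assms] I_open by (auto simp: frontier_def interior_open)
  have "m \<bullet> p < b" using S_base' assms C_subset by blast
  then obtain j where j: "\<not> n j \<bullet> p < c j" using p(1) unfolding I_iff by blast
  then have e: "n j \<bullet> p = c j" using closure_I(1)[OF p(2), of j] by simp
  have "n k \<bullet> p < c k" if "k \<noteq> j" for k
    using closure_I(1)[OF p(2), of k] C_frontier(2)[OF assms that] e by (auto simp: less_le)
  then show thesis using that e by blast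
qed

lemma S_not_C: "p \<in> S - C \<Longrightarrow> p \<in> I"
proof -
  assume "p \<in> S - C"
  then obtain y where "y \<in> cball 0 1 - V" "p = \<phi> y" "y \<notin> sphere 0 1" unfolding S C by blast
  then have "y \<in> ball 0 1" by (auto simp: less_le)
  then show "p \<in> I" using disk_facts(5) \<open>p = \<phi> y\<close> by blast
qed

lemma C_iff: "y \<in> D0 \<Longrightarrow> \<phi> y \<in> C \<longleftrightarrow> norm y = 1"
proof -
  assume y: "y \<in> D0"
  have "norm y = 1" if yC: "\<phi> y \<in> C"
  proof -
    obtain y' where y': "y' \<in> sphere 0 1 - V" "\<phi> y = \<phi> y'" using yC unfolding C by blast
    then have "y' \<in> D0" by auto
    then have "y = y'" using phi_inj y y'(2) by (simp add: inj_on_def)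
    then show ?thesis using y' by simp
  qed
  moreover have "\<phi> y \<in> C" if "norm y = 1" using that y unfolding C by auto
  ultimately show ?thesis by blast
qed

lemma S_walls:
  assumes "p \<in> S"
  shows "n j \<bullet> p \<le> c j" "j \<noteq> k \<Longrightarrow> n j \<bullet> p < c j \<or> n k \<bullet> p < c k"
proof -
  show "n j \<bullet> p \<le> c j" using closure_I(1) assms disk_facts(4) by blast
  show "n j \<bullet> p < c j \<or> n k \<bullet> p < c k" if "j \<noteq> k"
  proof (cases "p \<in> C")
    case True
    then show ?thesis using C_wall that by metis
  next
    case False
    then show ?thesis using S_not_C[of p] assms by (auto simp: I_iff)
  qed
qed

lemma P_S: "p \<in> S \<Longrightarrow> norm (P p) < 1"
  using P_lt_1 S_walls by blast

lemma hor_q_not_S: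
  assumes "p \<in> S" shows "hor p \<noteq> hor (q i)"
proof
  assume "hor p = hor (q i)"
  then have "n j \<bullet> p = n j \<bullet> q i" for j using hor_simps(6)[of j p] hor_simps(6)[of j "q i"] by simp
  then have "n i \<bullet> p = c i" "n (i + 1) \<bullet> p = c (i + 1)" using q_on[of i] by simp_all
  then show False using S_walls(2)[OF assms, of i "i + 1"] mod3_simps(5)[of i] by simp
qed

lemma hor_q_inj: "hor (q i) = hor (q j) \<Longrightarrow> i = j"
proof (rule ccontr)
  assume e: "hor (q i) = hor (q j)" and ne: "i \<noteq> j"
  have "n (i + 2) \<bullet> q i = n (i + 2) \<bullet> q j" using e hor_simps(6)[of "i+2" "q i"] hor_simps(6)[of "i+2" "q j"] by simp
  then show False using gap_pos[of "i + 2"] ne by (auto simp: q_plane mod3_simps)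
qed

lemma v_sphere: "norm (v i) = 1" "v i \<in> V"
proof -
  show "v i \<in> V" using vertices(1) by blast
  then have "v i \<in> sphere 0 1" using disk_facts(2) by blast
  then show "norm (v i) = 1" by simp
qed

section \<open>Behaviour of the surface at the vertices\<close>

text \<open>A unit vector tangent to both walls is \<open>d\<close> or \<open>- d\<close>. The graph
  property therefore means that the horizontal projection is injective near \<open>v i\<close> and
  that its image contains a punctured neighbourhood of the corner in the cross section.\<close>

lemma graph_data:
  obtains B r0 \<rho>0 where "r0 > 0" "\<rho>0 > 0" "cball 0 1 \<inter> ball (v i) r0 \<subseteq> B" "B \<subseteq> cball 0 1" "closure B \<inter> V = {v i}"
    "\<And>y y'. y \<in> B - {v i} \<Longrightarrow> y' \<in> B - {v i} \<Longrightarrow> hor (\<phi> y) = hor (\<phi> y') \<Longrightarrow> y = y'"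
    "\<And>x. x \<in> closure I \<Longrightarrow> d \<bullet> x = d \<bullet> q i \<Longrightarrow> x \<noteq> q i \<Longrightarrow> dist x (q i) < \<rho>0 \<Longrightarrow> \<exists>y\<in>B - {v i}. hor (\<phi> y) = hor x"
    "\<And>y. y \<in> B - {v i} \<Longrightarrow> \<exists>x\<in>closure I. d \<bullet> x = d \<bullet> q i \<and> x \<noteq> q i \<and> hor x = hor (\<phi> y)"
    "q i \<in> closure I"
proof -
  obtain e h u where lg: "local_graph I V \<phi> (v i) (plane (n i) (c i)) (plane (n (i + 1)) (c (i + 1))) e h (q i) u"
    using graph by blast
  let ?P = "plane (n i) (c i)" and ?Q = "plane (n (i + 1)) (c (i + 1))"
  have e1: "norm e = 1" and eP: "\<forall>x\<in>?P. x + e \<in> ?P" and eQ: "\<forall>x\<in>?Q. x + e \<in> ?Q"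
    and qh: "?P \<inter> ?Q \<inter> plane e h = {q i}"
    using lg unfolding local_graph_def by blast+
  obtain B A where BA: "nbhd_in (cball 0 1) (v i) B" "closure B \<inter> V = {v i}"
    "nbhd_in (plane e h \<inter> closure I) (q i) A" "\<phi> ` (B - {v i}) = (\<lambda>x. x + u x *\<^sub>R e) ` (A - {q i})"
    using lg unfolding local_graph_def by blast
  have "n i \<bullet> (q i + e) = c i" "n (i + 1) \<bullet> (q i + e) = c (i + 1)"
    using eP eQ q_on[of i] by (auto simp: plane_def)
  then have ne: "n i \<bullet> e = 0" "n (i + 1) \<bullet> e = 0" using q_on[of i] by (simp_all add: inner_add_right)
  obtain s where s: "e = s *\<^sub>R d"
    using parallel_if_orthogonal[OF indep[OF mod3_simps(5)[of i]] ne nd nd d_nz] by blast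
  have s0: "s \<noteq> 0" using e1 s by auto
  have "e \<bullet> q i = h" using qh by (auto simp: plane_def)
  then have pl: "x \<in> plane e h \<longleftrightarrow> d \<bullet> x = d \<bullet> q i" for x using s s0 by (auto simp: plane_def)
  obtain T where T: "openin (top_of_set (cball 0 1)) T" "v i \<in> T" "T \<subseteq> B" using BA(1) unfolding nbhd_in_def by blast
  obtain r0 where r0: "r0 > 0" "cball 0 1 \<inter> ball (v i) r0 \<subseteq> T"
    using T(1,2) unfolding openin_contains_ball by (metis inf_commute)
  obtain T' where T': "openin (top_of_set (plane e h \<inter> closure I)) T'" "q i \<in> T'" "T' \<subseteq> A"
    using BA(3) unfolding nbhd_in_def by blast
  obtain \<rho>0 where \<rho>0: "\<rho>0 > 0" "(plane e h \<inter> closure I) \<inter> ball (q i) \<rho>0 \<subseteq> T'"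
    using T'(1,2) unfolding openin_contains_ball by (metis inf_commute)
  have A: "A \<subseteq> plane e h \<inter> closure I" using BA(3) unfolding nbhd_in_def by blast
  have B: "B \<subseteq> cball 0 1" using BA(1) unfolding nbhd_in_def by blast
  have hu: "hor (x + u x *\<^sub>R e) = hor x" for x by (simp add: s hor_simps)
  have y_ex: "\<exists>x\<in>A - {q i}. \<phi> y = x + u x *\<^sub>R e" if "y \<in> B - {v i}" for y
    using BA(4) that by blast
  have BV: "y \<in> D0" if "y \<in> B - {v i}" for y
    using that B BA(2) closure_subset[of B] by blast
  show thesis
  proof (rule that[OF r0(1) \<rho>0(1) _ B BA(2)])
    show "cball 0 1 \<inter> ball (v i) r0 \<subseteq> B" using r0(2) T(3) by blast
    show "y = y'" if y: "y \<in> B - {v i}" "y' \<in> B - {v i}" "hor (\<phi> y) = hor (\<phi> y')" for y y'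
    proof -
      obtain x where x: "x \<in> A" "\<phi> y = x + u x *\<^sub>R e" using y_ex[OF y(1)] by blast
      obtain x' where x': "x' \<in> A" "\<phi> y' = x' + u x' *\<^sub>R e" using y_ex[OF y(2)] by blast
      have "hor x = hor x'" using y(3) unfolding x(2) x'(2) hu .
      moreover have "d \<bullet> x = d \<bullet> x'" using A x(1) x'(1) pl by (metis IntD1 subsetD)
      ultimately have "x = x'" by (simp add: hor_def)
      then have "\<phi> y = \<phi> y'" using x x' by simp
      then show "y = y'" using phi_inj BV y(1,2) by (metis inj_onD)
    qed
    show "\<exists>y\<in>B - {v i}. hor (\<phi> y) = hor x"
      if x: "x \<in> closure I" "d \<bullet> x = d \<bullet> q i" "x \<noteq> q i" "dist x (q i) < \<rho>0" for x
    proof -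
      have "x \<in> A - {q i}" using x pl \<rho>0(2) T'(3) by (auto simp: dist_commute subset_eq)
      then obtain y where "y \<in> B - {v i}" "\<phi> y = x + u x *\<^sub>R e" using BA(4) by (metis (no_types, lifting) imageE image_eqI)
      then show ?thesis using hu[of x] by (intro bexI[of _ y]) simp_all
    qed
    show "\<exists>x\<in>closure I. d \<bullet> x = d \<bullet> q i \<and> x \<noteq> q i \<and> hor x = hor (\<phi> y)" if y: "y \<in> B - {v i}" for y
    proof -
      obtain x where x: "x \<in> A - {q i}" "\<phi> y = x + u x *\<^sub>R e" using y_ex[OF y] by blast
      have "x \<in> closure I" "d \<bullet> x = d \<bullet> q i" using x(1) A pl by blast+
      then show ?thesis using x hu[of x] by (intro bexI[of _ x]) simp_all
    qed
    show "q i \<in> closure I" using T'(1,2) openin_imp_subset by blast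
  qed
qed

text \<open>Inversion in the unit circle moves exterior points no further from a point of the
  circle, so balls centred on the circle are stable under the doubling in
  \<open>projection_open\<close>.\<close>

lemma inversion_dist:
  fixes a y :: "real^2"
  assumes "norm y = 1" "1 \<le> norm a"
  shows "dist (a /\<^sub>R (norm a)\<^sup>2) y \<le> dist a y"
proof -
  have na: "norm a > 0" using assms(2) by linarith
  have A: "a \<bullet> a > 0" using na by auto
  have yy: "y \<bullet> y = 1" using assms(1) by (simp add: norm_eq_1)
  have "(dist (a /\<^sub>R (norm a)\<^sup>2) y)\<^sup>2 = inverse (a \<bullet> a) * inverse (a \<bullet> a) * (a \<bullet> a) - 2 * inverse (a \<bullet> a) * (a \<bullet> y) + 1"
    unfolding dist_norm power2_norm_eq_inner
    by (simp add: inner_diff_left inner_diff_right inner_commute[of y a] yy algebra_simps)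
  also have "\<dots> = (a \<bullet> a - 2 * (a \<bullet> y) + 1) / (a \<bullet> a)" using A by (simp add: field_simps)
  also have "a \<bullet> a - 2 * (a \<bullet> y) + 1 = (dist a y)\<^sup>2"
    unfolding dist_norm power2_norm_eq_inner
    by (simp add: inner_diff_left inner_diff_right inner_commute[of y a] yy)
  also have "(dist a y)\<^sup>2 / (a \<bullet> a) = (dist a y)\<^sup>2 / (norm a)\<^sup>2" by (simp add: power2_norm_eq_inner)
  also have "\<dots> \<le> (dist a y)\<^sup>2 / 1" using assms(2) by (intro divide_left_mono) (auto simp: one_le_power)
  finally have "(dist (a /\<^sub>R (norm a)\<^sup>2) y)\<^sup>2 \<le> (dist a y)\<^sup>2" by simp
  then show ?thesis by (rule power2_le_imp_le) simp
qed

lemma dist_hor_shift: "dist (hor x + (d \<bullet> z) *\<^sub>R d) z = dist (hor x) (hor z)"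
  by (simp add: dist_norm hor_def algebra_simps)

text \<open>At a boundary point the disk is doubled by inversion in the unit circle and the surface by
  reflection in the wall, so that invariance of domain applies.\<close>

lemma projection_open:
  assumes y: "y \<in> D0" and r: "r > 0"
    and inj: "\<And>y1 y2. y1 \<in> ball y r \<inter> D0 \<Longrightarrow> y2 \<in> ball y r \<inter> D0 \<Longrightarrow> hor (\<phi> y1) = hor (\<phi> y2) \<Longrightarrow> y1 = y2"
  shows "\<exists>\<rho>>0. \<forall>x. (\<forall>j. n j \<bullet> x \<le> c j) \<longrightarrow> dist (hor x) (hor (\<phi> y)) < \<rho> \<longrightarrow>
     (\<exists>y'\<in>ball y r \<inter> D0. hor (\<phi> y') = hor x)"
proof -
  have "open (- V)" using disk_facts(1) by (simp add: finite_imp_closed open_Compl)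
  then obtain r1 where r1: "r1 > 0" "ball y r1 \<subseteq> - V" using y openE by blast
  show ?thesis
  proof (cases "norm y < 1")
    case True
    define r2 where "r2 = min (min r r1) (1 - norm y)"
    have r2: "r2 > 0" using r r1 True by (simp add: r2_def)
    have sub: "ball y r2 \<subseteq> ball y r \<inter> D0"
    proof
      fix z assume z: "z \<in> ball y r2"
      have "norm z \<le> norm y + dist y z" by (metis dist_norm norm_minus_commute norm_triangle_sub)
      then show "z \<in> ball y r \<inter> D0" using z r1 by (auto simp: r2_def)
    qed
    have "continuous_on (ball y r2) \<phi>" using sub by (intro continuous_on_subset[OF phi_cont]) blast
    moreover have "w' = w" if "w \<in> ball y r2" "w' \<in> ball y r2" "\<phi> w' = \<phi> w + s *\<^sub>R d" for w w' s
    proof -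
      have "hor (\<phi> w') = hor (\<phi> w)" using that(3) by (simp add: hor_simps)
      moreover have "w \<in> ball y r \<inter> D0" "w' \<in> ball y r \<inter> D0" using that(1,2) sub by blast+
      ultimately show ?thesis using inj by blast
    qed
    ultimately obtain T g where T: "open T" "homeomorphism (ball y r2 \<times> UNIV) T (\<lambda>(w, s). \<phi> w + s *\<^sub>R d) g"
      using lift_homeomorphism[OF open_ball _ d_nz, of y r2 \<phi>] by metis
    have im: "T = (\<lambda>(w, s). \<phi> w + s *\<^sub>R d) ` (ball y r2 \<times> UNIV)" using homeomorphism_image1[OF T(2)] by simp
    have "\<phi> y \<in> T" unfolding im using r2 by (intro image_eqI[of _ _ "(y, 0)"]) auto
    then obtain \<rho> where rho: "\<rho> > 0" "ball (\<phi> y) \<rho> \<subseteq> T" using T(1) openE by blast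
    have "\<exists>y'\<in>ball y r \<inter> D0. hor (\<phi> y') = hor x" if "dist (hor x) (hor (\<phi> y)) < \<rho>" for x
    proof -
      have "hor x + (d \<bullet> \<phi> y) *\<^sub>R d \<in> T"
        using rho(2) that dist_hor_shift[of x "\<phi> y"] by (auto simp: dist_commute subset_eq)
      then obtain p where p: "p \<in> ball y r2 \<times> (UNIV :: real set)"
        "hor x + (d \<bullet> \<phi> y) *\<^sub>R d = (\<lambda>(w, s). \<phi> w + s *\<^sub>R d) p" unfolding im by (elim imageE)
      define y' where "y' = fst p"
      define s where "s = snd p"
      have ys: "y' \<in> ball y r2" "hor x + (d \<bullet> \<phi> y) *\<^sub>R d = \<phi> y' + s *\<^sub>R d"
        using p by (auto simp: y'_def s_def case_prod_beta mem_Times_iff)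
      have "hor x = hor (\<phi> y')" using arg_cong[OF ys(2), of hor] by (simp add: hor_simps)
      moreover have "y' \<in> ball y r \<inter> D0" using ys(1) sub by blast
      ultimately show ?thesis by (intro bexI[of _ y']) simp_all
    qed
    then show ?thesis using rho(1) by blast
  next
    case False
    then have y1: "norm y = 1" using y by simp
    have yC: "\<phi> y \<in> C" using C_iff[OF y] y1 by simp
    obtain j where j: "n j \<bullet> \<phi> y = c j" "\<And>k. k \<noteq> j \<Longrightarrow> n k \<bullet> \<phi> y < c k" using C_wall[OF yC] by blast
    have "\<exists>r2>0. \<forall>z\<in>ball y r2 \<inter> D0. \<forall>k. k \<noteq> j \<longrightarrow> n k \<bullet> \<phi> z < c k"
    proof -
      have "\<forall>\<^sub>F z in at y within D0. \<forall>k\<in>UNIV - {j}. n k \<bullet> \<phi> z < c k"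
      proof (subst eventually_ball_finite_distrib, simp, intro ballI)
        fix k assume "k \<in> UNIV - {j}"
        moreover have "((\<lambda>z. n k \<bullet> \<phi> z) \<longlongrightarrow> n k \<bullet> \<phi> y) (at y within D0)"
          using phi_cont y by (intro tendsto_intros) (simp add: continuous_on_def)
        ultimately show "\<forall>\<^sub>F z in at y within D0. n k \<bullet> \<phi> z < c k" using j(2) by (intro order_tendstoD(2)) auto
      qed
      then obtain r2 where r2: "r2 > 0" "\<And>z. z \<in> D0 \<Longrightarrow> z \<noteq> y \<Longrightarrow> dist z y < r2 \<Longrightarrow> \<forall>k\<in>UNIV - {j}. n k \<bullet> \<phi> z < c k"
        unfolding eventually_at by blast
      have "n k \<bullet> \<phi> z < c k" if "z \<in> ball y r2 \<inter> D0" "k \<noteq> j" for z k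
      proof (cases "z = y")
        case True
        then show ?thesis using j(2) that(2) by simp
      next
        case False
        then have "\<forall>k\<in>UNIV - {j}. n k \<bullet> \<phi> z < c k" using that(1) by (intro r2(2)) (auto simp: dist_commute)
        then show ?thesis using that(2) by blast
      qed
      then show ?thesis using r2(1) by blast
    qed
    then obtain r2 where r2: "r2 > 0" "\<And>z k. z \<in> ball y r2 \<inter> D0 \<Longrightarrow> k \<noteq> j \<Longrightarrow> n k \<bullet> \<phi> z < c k" by blast
    define r3 where "r3 = min (min r r1) (min r2 1)"
    have r3: "r3 > 0" using r r1 r2 by (simp add: r3_def)
    let ?U = "ball y r3"
    define iv where "iv = (\<lambda>z::real^2. z /\<^sub>R (norm z)\<^sup>2)"
    define R where "R = (\<lambda>x. x - (2 * (n j \<bullet> x - c j)) *\<^sub>R n j)"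
    define F where "F = (\<lambda>z. if norm z \<le> 1 then \<phi> z else R (\<phi> (iv z)))"
    have U0: "z \<noteq> 0" if "z \<in> ?U" for z using that y1 by (auto simp: r3_def)
    have ivU: "iv z \<in> ?U" if "z \<in> ?U" "1 \<le> norm z" for z
      using inversion_dist[OF y1 that(2)] that(1) by (simp add: iv_def dist_commute)
    have niv: "norm (iv z) = 1 / norm z" for z
      by (cases "z = 0") (simp_all add: iv_def power2_eq_square divide_inverse)
    have inner: "z \<in> ball y r \<inter> D0" if "z \<in> ?U" "norm z \<le> 1" for z
      using that r1 by (auto simp: r3_def)
    have ivin: "iv z \<in> ball y r \<inter> D0" if "z \<in> ?U" "1 \<le> norm z" for z
      using inner[OF ivU[OF that]] that niv[of z] by (simp add: divide_le_eq_1)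
    have wall: "n j \<bullet> \<phi> z = c j" if z: "z \<in> ?U" "norm z = 1" for z
    proof -
      have zD: "z \<in> D0" using inner z by simp
      then have "\<phi> z \<in> C" using C_iff z by simp
      then obtain k where k: "n k \<bullet> \<phi> z = c k" using C_wall by blast
      then have "k = j" using r2(2)[of z k] z zD by (auto simp: r3_def)
      then show ?thesis using k by simp
    qed
    have inside: "n j \<bullet> \<phi> z < c j" if z: "z \<in> ball y r \<inter> D0" "norm z < 1" for z
    proof -
      have "\<phi> z \<in> I" using disk_facts(5) z(2) by auto
      then show ?thesis by (simp add: I_iff)
    qed
    have Rn: "n j \<bullet> R x = 2 * c j - n j \<bullet> x" for x by (simp add: R_def inner_diff_right nn)
    have Rx: "R x = x - (2 * (n j \<bullet> x - c j)) *\<^sub>R n j" for x by (simp add: R_def)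
    have RR: "R (R x) = x" for x unfolding Rx[of "R x"] Rn unfolding Rx[of x] by (simp add: algebra_simps)
    have Rs: "R (x + s *\<^sub>R d) = R x + s *\<^sub>R d" for x s by (simp add: R_def inner_add_right nd)
    \<comment> \<open>The side of the wall on which \<open>F z\<close> lies decides whether
      \<open>z\<close> belongs to the disk, and translation along \<open>d\<close> does not change
      the side. Hence the original and the reflected half never meet over one point, and a point
      over the prism has its preimage in the disk.\<close>
    have lev: "n j \<bullet> F z < c j \<longleftrightarrow> norm z < 1" "n j \<bullet> F z \<le> c j \<longleftrightarrow> norm z \<le> 1" if z: "z \<in> ?U" for z
    proof -
      consider "norm z < 1" | "norm z = 1" | "norm z > 1" by linarith
      then have "(norm z < 1 \<and> n j \<bullet> F z < c j) \<or> (norm z = 1 \<and> n j \<bullet> F z = c j) \<or> (norm z > 1 \<and> n j \<bullet> F z > c j)"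
      proof cases
        case 1
        then show ?thesis using inside[OF inner[OF z]] by (simp add: F_def)
      next
        case 2
        then show ?thesis using wall[OF z] by (simp add: F_def)
      next
        case 3
        then have "norm (iv z) < 1" unfolding niv by (subst divide_less_eq_1_pos) auto
        then have "n j \<bullet> \<phi> (iv z) < c j" using inside[OF ivin[OF z]] 3 by simp
        then show ?thesis using 3 by (simp add: F_def Rn)
      qed
      then show "n j \<bullet> F z < c j \<longleftrightarrow> norm z < 1" "n j \<bullet> F z \<le> c j \<longleftrightarrow> norm z \<le> 1" by auto
    qed
    have cF: "continuous_on ?U F"
    proof -
      have Ueq: "{z\<in>?U. norm z \<le> 1} \<union> {z\<in>?U. 1 \<le> norm z} = ?U" by auto
      have "continuous_on ({z\<in>?U. norm z \<le> 1} \<union> {z\<in>?U. 1 \<le> norm z}) F"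
        unfolding F_def
      proof (rule continuous_on_cases_local)
        have e: "{z\<in>?U. norm z \<le> 1} \<union> {z\<in>?U. 1 \<le> norm z} = ?U" by auto
        have "closedin (top_of_set ?U) (?U \<inter> cball 0 1)" by (intro closedin_closed_Int closed_cball)
        moreover have "{z\<in>?U. norm z \<le> 1} = ?U \<inter> cball 0 1" by auto
        ultimately show "closedin (top_of_set ({z\<in>?U. norm z \<le> 1} \<union> {z\<in>?U. 1 \<le> norm z})) {z\<in>?U. norm z \<le> 1}"
          unfolding e by simp
        have "closed {z::real^2. 1 \<le> norm z}" by (intro closed_Collect_le continuous_intros)
        then have "closedin (top_of_set ?U) (?U \<inter> {z. 1 \<le> norm z})" by (rule closedin_closed_Int)
        moreover have "{z\<in>?U. 1 \<le> norm z} = ?U \<inter> {z. 1 \<le> norm z}" by auto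
        ultimately show "closedin (top_of_set ({z\<in>?U. norm z \<le> 1} \<union> {z\<in>?U. 1 \<le> norm z})) {z\<in>?U. 1 \<le> norm z}"
          unfolding e by simp
        show "continuous_on {z\<in>?U. norm z \<le> 1} \<phi>"
          using inner by (intro continuous_on_subset[OF phi_cont]) auto
        have "continuous_on {z\<in>?U. 1 \<le> norm z} iv"
          unfolding iv_def using U0 by (intro continuous_intros) auto
        then have "continuous_on {z\<in>?U. 1 \<le> norm z} (\<lambda>z. \<phi> (iv z))"
          using ivin by (intro continuous_on_compose2[OF phi_cont]) auto
        then show "continuous_on {z\<in>?U. 1 \<le> norm z} (\<lambda>z. R (\<phi> (iv z)))"
          unfolding R_def by (intro continuous_intros)
        fix z assume "z \<in> {z\<in>?U. norm z \<le> 1} \<and> \<not> norm z \<le> 1 \<or> z \<in> {z\<in>?U. 1 \<le> norm z} \<and> norm z \<le> 1"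
        then have z: "z \<in> ?U" "norm z = 1" by auto
        then have "iv z = z" by (simp add: iv_def)
        then show "\<phi> z = R (\<phi> (iv z))" using wall[OF z] by (simp add: R_def)
      qed
      then show ?thesis unfolding Ueq .
    qed
    have injF: "w' = w" if w: "w \<in> ?U" "w' \<in> ?U" and eq: "F w' = F w + s *\<^sub>R d" for w w' s
    proof -
      have "n j \<bullet> F w' = n j \<bullet> F w" using eq by (simp add: inner_add_right nd)
      then have iff: "norm w' \<le> 1 \<longleftrightarrow> norm w \<le> 1" using lev(2)[OF w(1)] lev(2)[OF w(2)] by simp
      show ?thesis
      proof (cases "norm w \<le> 1")
        case True
        then have "\<phi> w' = \<phi> w + s *\<^sub>R d" using eq iff by (simp add: F_def)
        then have "hor (\<phi> w') = hor (\<phi> w)" by (simp add: hor_simps)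
        then show ?thesis using inj[OF inner[OF w(2)] inner[OF w(1)]] True iff by simp
      next
        case False
        then have "R (\<phi> (iv w')) = R (\<phi> (iv w)) + s *\<^sub>R d" using eq iff by (simp add: F_def)
        then have "R (R (\<phi> (iv w'))) = R (R (\<phi> (iv w))) + s *\<^sub>R d" by (simp add: Rs)
        then have "hor (\<phi> (iv w')) = hor (\<phi> (iv w))" by (simp add: RR hor_simps)
        then have e: "iv w' = iv w" using inj[OF ivin[OF w(2)] ivin[OF w(1)]] False iff by simp
        then have "norm w' = norm w" using niv[of w] niv[of w'] by simp
        then show ?thesis using e U0[OF w(1)] by (simp add: iv_def)
      qed
    qed
    obtain T g where T: "open T" "homeomorphism (?U \<times> UNIV) T (\<lambda>(w, s). F w + s *\<^sub>R d) g"
      by (rule lift_homeomorphism[OF open_ball cF d_nz injF])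
    have im: "T = (\<lambda>(w, s). F w + s *\<^sub>R d) ` (?U \<times> UNIV)" using homeomorphism_image1[OF T(2)] by simp
    have Fy: "F y = \<phi> y" using y1 by (simp add: F_def)
    have "\<phi> y \<in> T" unfolding im using r3 Fy by (intro image_eqI[of _ _ "(y, 0)"]) auto
    then obtain \<rho> where rho: "\<rho> > 0" "ball (\<phi> y) \<rho> \<subseteq> T" using T(1) openE by blast
    have "\<exists>y'\<in>ball y r \<inter> D0. hor (\<phi> y') = hor x" if x: "\<forall>j. n j \<bullet> x \<le> c j" "dist (hor x) (hor (\<phi> y)) < \<rho>" for x
    proof -
      have "hor x + (d \<bullet> \<phi> y) *\<^sub>R d \<in> T"
        using rho(2) x(2) dist_hor_shift[of x "\<phi> y"] by (auto simp: dist_commute subset_eq)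
      then obtain p where p: "p \<in> ?U \<times> (UNIV :: real set)"
        "hor x + (d \<bullet> \<phi> y) *\<^sub>R d = (\<lambda>(w, s). F w + s *\<^sub>R d) p" unfolding im by (elim imageE)
      define y' where "y' = fst p"
      define s where "s = snd p"
      have ys: "y' \<in> ?U" "hor x + (d \<bullet> \<phi> y) *\<^sub>R d = F y' + s *\<^sub>R d"
        using p by (auto simp: y'_def s_def case_prod_beta mem_Times_iff)
      have "n j \<bullet> F y' = n j \<bullet> (F y' + s *\<^sub>R d)" by (simp add: inner_add_right nd)
      also have "\<dots> = n j \<bullet> x" unfolding ys(2)[symmetric] by (simp add: inner_add_right nd hor_simps)
      also have "\<dots> \<le> c j" using x(1) by simp
      finally have ny: "norm y' \<le> 1" using lev(2)[OF ys(1)] by simp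
      have "hor x = hor (F y')" using arg_cong[OF ys(2), of hor] by (simp add: hor_simps)
      then have "hor x = hor (\<phi> y')" using ny by (simp add: F_def)
      then show ?thesis using inner[OF ys(1) ny] by (intro bexI[of _ y']) simp_all
    qed
    then show ?thesis using rho(1) by blast
  qed
qed

lemma disk_limit:
  fixes y :: "nat \<Rightarrow> real^2"
  assumes "\<And>k. y k \<in> D0"
  obtains a r where "a \<in> cball 0 1" "strict_mono (r :: nat \<Rightarrow> nat)" "(y \<circ> r) \<longlonglongrightarrow> a"
  using compact_cball[of "0::real^2" 1] assms unfolding compact_def by (metis Diff_iff)

lemma phi_tendsto:
  assumes "\<And>k. y k \<in> D0" "y \<longlonglongrightarrow> a" "a \<in> D0"
  shows "(\<lambda>k. \<phi> (y k)) \<longlonglongrightarrow> \<phi> a"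
  using continuous_on_tendsto_compose[OF phi_cont assms(2,3)] assms(1) by simp

lemma hor_tendsto: "(f \<longlongrightarrow> l) F \<Longrightarrow> ((\<lambda>x. hor (f x)) \<longlongrightarrow> hor l) F"
  unfolding hor_def by (intro tendsto_intros)

text \<open>Points of the circle are extreme points of the disk; so a convex piece of the disk stays
  convex when a vertex is removed.\<close>

lemma strictly_inside_segment:
  fixes a y z :: "real^2"
  assumes "norm a = 1" "norm y \<le> 1" "norm z \<le> 1" "a \<in> closed_segment y z"
  shows "a = y \<or> a = z"
proof -
  obtain t where t: "0 \<le> t" "t \<le> 1" "a = (1 - t) *\<^sub>R y + t *\<^sub>R z" using assms(4) by (auto simp: closed_segment_def)
  have ay: "a \<bullet> y \<le> 1" "a \<bullet> z \<le> 1"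
    using norm_cauchy_schwarz[of a y] norm_cauchy_schwarz[of a z] assms by auto
  have "a \<bullet> a = a \<bullet> ((1 - t) *\<^sub>R y + t *\<^sub>R z)" by (rule arg_cong[OF t(3)])
  then have "(1 - t) * (1 - a \<bullet> y) + t * (1 - a \<bullet> z) = 0"
    using assms(1) by (simp add: inner_add_right norm_eq_1 algebra_simps)
  moreover have "0 \<le> (1 - t) * (1 - a \<bullet> y)" "0 \<le> t * (1 - a \<bullet> z)" using t ay by simp_all
  ultimately have z: "(1 - t) * (1 - a \<bullet> y) = 0" "t * (1 - a \<bullet> z) = 0" by linarith+
  have eq: "a = x" if "a \<bullet> x = 1" "norm x \<le> 1" for x
  proof -
    have "(a - x) \<bullet> (a - x) \<le> 0" using assms(1) that
      by (simp add: inner_diff_left inner_diff_right norm_eq_1 norm_le_square inner_commute)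
    then have "(a - x) \<bullet> (a - x) = 0" using inner_ge_zero[of "a - x"] by linarith
    then show ?thesis by simp
  qed
  show ?thesis
  proof (cases "t = 0")
    case True then show ?thesis using t by simp
  next
    case False
    then show ?thesis using z eq[of z] assms(3) by simp
  qed
qed

text \<open>The horizontal projection converges at the vertex although nothing bounds the heights.
  Let \<open>f\<close> be the distance of the projection from the corner. Small values of
  \<open>f\<close> occur only near the vertex; close to the vertex \<open>f\<close> omits any given
  small value \<open>\<rho>\<close>; and a punctured neighbourhood of the vertex is connected and
  contains a point with \<open>f\<close> below \<open>\<rho>\<close>, so \<open>f\<close> remains
  below \<open>\<rho>\<close> on it.\<close>

lemma vertex_limit_small:
  obtains r0 B where "r0 > 0" "cball 0 1 \<inter> ball (v i) r0 \<subseteq> B" "B \<subseteq> cball 0 1" "closure B \<inter> V = {v i}"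
    "\<And>y y'. y \<in> B - {v i} \<Longrightarrow> y' \<in> B - {v i} \<Longrightarrow> hor (\<phi> y) = hor (\<phi> y') \<Longrightarrow> y = y'"
    "\<And>e. e > 0 \<Longrightarrow> \<exists>\<delta>>0. \<forall>y\<in>D0. dist y (v i) < \<delta> \<longrightarrow> dist (hor (\<phi> y)) (hor (q i)) < e"
proof -
  obtain B r0 \<rho>0 where r0: "r0 > 0" "\<rho>0 > 0" "cball 0 1 \<inter> ball (v i) r0 \<subseteq> B" "B \<subseteq> cball 0 1" "closure B \<inter> V = {v i}"
    and inj: "\<And>y y'. y \<in> B - {v i} \<Longrightarrow> y' \<in> B - {v i} \<Longrightarrow> hor (\<phi> y) = hor (\<phi> y') \<Longrightarrow> y = y'"
    and ex: "\<And>x. x \<in> closure I \<Longrightarrow> d \<bullet> x = d \<bullet> q i \<Longrightarrow> x \<noteq> q i \<Longrightarrow> dist x (q i) < \<rho>0 \<Longrightarrow> \<exists>y\<in>B - {v i}. hor (\<phi> y) = hor x"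
    and dom: "\<And>y. y \<in> B - {v i} \<Longrightarrow> \<exists>x\<in>closure I. d \<bullet> x = d \<bullet> q i \<and> x \<noteq> q i \<and> hor x = hor (\<phi> y)"
    and qI: "q i \<in> closure I"
    by (rule graph_data[of i], rule that; assumption)
  define f where "f = (\<lambda>y. dist (hor (\<phi> y)) (hor (q i)))"
  have BD: "y \<in> D0" if "y \<in> B - {v i}" for y
    using that r0(4,5) closure_subset[of B] by blast
  \<comment> \<open>Otherwise a limit point in the disk, different from \<open>v i\<close> and hence
    not a vertex, would be mapped over the corner, where \<open>S\<close> has no point.\<close>
  have step1: "\<exists>\<rho>>0. \<rho> \<le> \<rho>0 \<and> (\<forall>y\<in>B - {v i}. f y < \<rho> \<longrightarrow> dist y (v i) < r)" if r: "r > 0" for r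
  proof (rule ccontr)
    assume neg: "\<not> ?thesis"
    have "\<exists>y. y \<in> B - {v i} \<and> f y < \<rho>0 * inverse (real (Suc k)) \<and> \<not> dist y (v i) < r" for k
    proof -
      have "\<rho>0 * inverse (real (Suc k)) > 0" "\<rho>0 * inverse (real (Suc k)) \<le> \<rho>0"
        using r0(2) by (auto intro!: mult_left_le simp: inverse_le_1_iff)
      then show ?thesis using neg by blast
    qed
    then obtain y where y: "\<And>k. y k \<in> B - {v i}" "\<And>k. f (y k) < \<rho>0 * inverse (real (Suc k))" "\<And>k. \<not> dist (y k) (v i) < r"
      by metis
    have yD: "y k \<in> D0" for k using BD y(1) .
    obtain a t where a: "a \<in> cball 0 1" "strict_mono t" "(y \<circ> t) \<longlonglongrightarrow> a" by (rule disk_limit[OF yD], rule that; assumption)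
    have "a \<in> closure B" using a(3) y(1) unfolding closure_sequential by (intro exI[of _ "y \<circ> t"]) auto
    moreover have "dist a (v i) \<ge> r"
    proof (rule LIMSEQ_le_const)
      show "(\<lambda>k. dist ((y \<circ> t) k) (v i)) \<longlonglongrightarrow> dist a (v i)" by (intro tendsto_intros a(3))
      show "\<exists>N. \<forall>k\<ge>N. r \<le> dist ((y \<circ> t) k) (v i)" using y(3) by (auto simp: not_less)
    qed
    then have "a \<noteq> v i" using r by auto
    ultimately have aD: "a \<in> D0" using r0(5) a(1) by blast
    have "(\<lambda>k. \<phi> ((y \<circ> t) k)) \<longlonglongrightarrow> \<phi> a" using yD by (intro phi_tendsto[OF _ a(3) aD]) simp
    then have 1: "(\<lambda>k. f ((y \<circ> t) k)) \<longlonglongrightarrow> f a" unfolding f_def by (intro tendsto_intros hor_tendsto)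
    have "(\<lambda>k. \<rho>0 * inverse (real (Suc k))) \<longlonglongrightarrow> \<rho>0 * 0" by (intro tendsto_intros LIMSEQ_inverse_real_of_nat)
    then have 2: "((\<lambda>k. \<rho>0 * inverse (real (Suc k))) \<circ> t) \<longlonglongrightarrow> 0"
      using LIMSEQ_subseq_LIMSEQ[OF _ a(2)] by simp
    have "f a \<le> 0"
      by (rule LIMSEQ_le[OF 1 2]) (use y(2) in \<open>auto intro: less_imp_le\<close>)
    then have "hor (\<phi> a) = hor (q i)" by (simp add: f_def)
    moreover have "\<phi> a \<in> S" using aD by (simp add: S)
    ultimately show False using hor_q_not_S by blast
  qed
  obtain \<rho>1 where rho1: "\<rho>1 > 0" "\<rho>1 \<le> \<rho>0" "\<And>y. y \<in> B - {v i} \<Longrightarrow> f y < \<rho>1 \<Longrightarrow> dist y (v i) < r0"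
    using step1[OF r0(1)] by blast
  \<comment> \<open>If \<open>f = \<rho>\<close> along a sequence tending to the vertex, a
    subsequence of the projections tends to a point that the graph property also places under some
    \<open>w0\<close> away from the vertex. The projection is open at \<open>w0\<close>, so late
    terms of the sequence share their projection with points near \<open>w0\<close>, contrary to
    injectivity on \<open>B\<close>.\<close>
  have step2: "\<exists>\<delta>>0. \<forall>y\<in>D0. dist y (v i) < \<delta> \<longrightarrow> f y \<noteq> \<rho>" if rho: "0 < \<rho>" "\<rho> < \<rho>1" for \<rho>
  proof (rule ccontr)
    assume neg: "\<not> ?thesis"
    have "\<exists>y. y \<in> D0 \<and> dist y (v i) < r0 * inverse (real (Suc k)) \<and> f y = \<rho>" for k
    proof -
      have "r0 * inverse (real (Suc k)) > 0" using r0(1) by simp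
      then show ?thesis using neg by blast
    qed
    then obtain y where y: "\<And>k. y k \<in> D0" "\<And>k. dist (y k) (v i) < r0 * inverse (real (Suc k))" "\<And>k. f (y k) = \<rho>"
      by metis
    have yB: "y k \<in> B - {v i}" for k
    proof -
      have "r0 * inverse (real (Suc k)) \<le> r0" using r0(1) by (auto intro!: mult_left_le simp: inverse_le_1_iff)
      then have "dist (v i) (y k) < r0" using y(2)[of k] by (simp add: dist_commute)
      then have "y k \<in> B" using y(1)[of k] r0(3) by auto
      moreover have "y k \<noteq> v i" using y(1)[of k] v_sphere(2)[of i] by (metis Diff_iff)
      ultimately show ?thesis by blast
    qed
    have ylim: "y \<longlonglongrightarrow> v i"
    proof (rule tendsto_dist_iff[THEN iffD2], rule Lim_null_comparison)
      show "\<forall>\<^sub>F k in sequentially. norm (dist (y k) (v i)) \<le> r0 * inverse (real (Suc k))"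
        using y(2) by (auto intro!: always_eventually less_imp_le)
      have "(\<lambda>k. r0 * inverse (real (Suc k))) \<longlonglongrightarrow> r0 * 0" by (intro tendsto_intros LIMSEQ_inverse_real_of_nat)
      then show "(\<lambda>k. r0 * inverse (real (Suc k))) \<longlonglongrightarrow> 0" by simp
    qed
    have "bounded (range (\<lambda>k. hor (\<phi> (y k))))"
      unfolding bounded_def
    proof (intro exI ballI)
      fix z assume "z \<in> range (\<lambda>k. hor (\<phi> (y k)))"
      then show "dist (hor (q i)) z \<le> \<rho>" using y(3) by (auto simp: f_def dist_commute)
    qed
    then obtain a t where a: "strict_mono (t :: nat \<Rightarrow> nat)" "((\<lambda>k. hor (\<phi> (y k))) \<circ> t) \<longlonglongrightarrow> a"
      using bounded_imp_convergent_subsequence by blast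
    define x where "x = a + (d \<bullet> q i) *\<^sub>R d"
    have xk: "hor (\<phi> (y k)) + (d \<bullet> q i) *\<^sub>R d \<in> closure I" for k
    proof -
      obtain z where z: "z \<in> closure I" "d \<bullet> z = d \<bullet> q i" "hor z = hor (\<phi> (y k))" using dom[OF yB] by blast
      have "hor z + (d \<bullet> z) *\<^sub>R d = z" by (simp add: hor_def)
      then have "hor (\<phi> (y k)) + (d \<bullet> q i) *\<^sub>R d = z" unfolding z(2,3) .
      then show ?thesis using z(1) by simp
    qed
    have xlim: "(\<lambda>k. hor (\<phi> (y (t k))) + (d \<bullet> q i) *\<^sub>R d) \<longlonglongrightarrow> x"
      unfolding x_def using a(2) by (intro tendsto_intros) (simp add: o_def)
    have xI: "x \<in> closure I" by (rule closed_sequentially[OF closed_closure _ xlim]) (rule xk)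
    have he: "(\<lambda>k. hor (((\<lambda>k. hor (\<phi> (y k))) \<circ> t) k)) = ((\<lambda>k. hor (\<phi> (y k))) \<circ> t)"
      by (auto simp: hor_simps)
    have "(\<lambda>k. hor (((\<lambda>k. hor (\<phi> (y k))) \<circ> t) k)) \<longlonglongrightarrow> hor a" by (rule hor_tendsto[OF a(2)])
    then have ah: "hor a = a" unfolding he using a(2) by (rule LIMSEQ_unique)
    have da: "d \<bullet> a = 0" using hor_simps(5)[of a] ah by simp
    have dx: "d \<bullet> x = d \<bullet> q i" "hor x = a" using da ah by (simp_all add: x_def inner_add_right dd hor_simps)
    have "(\<lambda>k. dist (((\<lambda>k. hor (\<phi> (y k))) \<circ> t) k) (hor (q i))) \<longlonglongrightarrow> dist a (hor (q i))" by (intro tendsto_intros a(2))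
    moreover have "(\<lambda>k. dist (((\<lambda>k. hor (\<phi> (y k))) \<circ> t) k) (hor (q i))) = (\<lambda>k. \<rho>)"
      using y(3) by (auto simp: f_def)
    ultimately have daq: "dist a (hor (q i)) = \<rho>" by (simp add: LIMSEQ_const_iff)
    have dxq: "dist x (q i) = \<rho>" using daq dist_hor_shift[of x "q i"] dx by (simp add: x_def)
    then obtain w0 where w0: "w0 \<in> B - {v i}" "hor (\<phi> w0) = hor x"
    proof -
      have "x \<noteq> q i" "dist x (q i) < \<rho>0" using dxq rho rho1 by auto
      from ex[OF xI dx(1) this] show thesis using that by blast
    qed
    have "f w0 = \<rho>" using daq dx w0 by (simp add: f_def)
    then have near: "dist w0 (v i) < r0" using rho1(3)[OF w0(1)] rho by simp
    have y0D: "w0 \<in> D0" using BD w0(1) .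
    define r where "r = min (r0 - dist w0 (v i)) (dist w0 (v i)) / 2"
    have wpos: "0 < dist w0 (v i)" using w0(1) by simp
    have r: "r > 0" using near w0(1) by (simp add: r_def)
    have rle: "2 * r \<le> r0 - dist w0 (v i)" "2 * r \<le> dist w0 (v i)"
      unfolding r_def by auto
    have ballB: "z \<in> B - {v i}" if z: "z \<in> ball w0 r \<inter> D0" for z
    proof -
      have "dist w0 z < r" using z by simp
      then have 1: "dist w0 z < r0 - dist w0 (v i)" using rle wpos near by linarith
      have 2: "dist w0 z < dist w0 (v i)" using \<open>dist w0 z < r\<close> rle wpos near by linarith
      from 1 2 have "dist (v i) z < r0" "z \<noteq> v i" using dist_triangle[of "v i" z w0] by (auto simp: dist_commute)
      then show ?thesis using z r0(3) by auto
    qed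
    have "\<exists>\<rho>>0. \<forall>x. (\<forall>j. n j \<bullet> x \<le> c j) \<longrightarrow> dist (hor x) (hor (\<phi> w0)) < \<rho> \<longrightarrow>
     (\<exists>y'\<in>ball w0 r \<inter> D0. hor (\<phi> y') = hor x)"
      by (rule projection_open[OF y0D r]) (rule inj; (rule ballB)?; assumption)
    then obtain \<rho>' where rho': "\<rho>' > 0" "\<And>x. (\<forall>j. n j \<bullet> x \<le> c j) \<Longrightarrow> dist (hor x) (hor (\<phi> w0)) < \<rho>' \<Longrightarrow> \<exists>y'\<in>ball w0 r \<inter> D0. hor (\<phi> y') = hor x"
      by blast
    have "\<forall>\<^sub>F k in sequentially. dist (((\<lambda>k. hor (\<phi> (y k))) \<circ> t) k) a < \<rho>'"
      using a(2) rho'(1) tendstoD by blast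
    moreover have "\<forall>\<^sub>F k in sequentially. dist ((y \<circ> t) k) (v i) < dist w0 (v i) / 2"
      by (rule tendstoD[OF LIMSEQ_subseq_LIMSEQ[OF ylim a(1)]]) (use wpos in simp)
    ultimately have "\<forall>\<^sub>F k in sequentially. dist (hor (\<phi> (y (t k)))) a < \<rho>' \<and> dist (y (t k)) (v i) < dist w0 (v i) / 2"
      by eventually_elim simp
    then obtain k where k: "dist (hor (\<phi> (y (t k)))) a < \<rho>'" "dist (y (t k)) (v i) < dist w0 (v i) / 2"
      using eventually_happens'[OF sequentially_bot] by blast
    have "\<phi> (y (t k)) \<in> S" using y(1) by (auto simp: S)
    then obtain y' where y': "y' \<in> ball w0 r \<inter> D0" "hor (\<phi> y') = hor (\<phi> (y (t k)))"
    proof -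
      have "\<forall>j. n j \<bullet> \<phi> (y (t k)) \<le> c j" using S_walls(1)[OF \<open>\<phi> (y (t k)) \<in> S\<close>] by blast
      moreover have "dist (hor (\<phi> (y (t k)))) (hor (\<phi> w0)) < \<rho>'" using k(1) w0(2) dx by simp
      ultimately show thesis using rho'(2) that by blast
    qed
    then have "y' = y (t k)" using inj[OF ballB[OF y'(1)] yB] by simp
    then have "dist w0 (y (t k)) < r" using y'(1) by simp
    then have "dist w0 (y (t k)) < dist w0 (v i) / 2" using rle by linarith
    then show False using k(2) dist_triangle[of w0 "v i" "y (t k)"] by (simp add: dist_commute)
  qed
  \<comment> \<open>An intermediate value argument on the connected set \<open>M\<close>: the value
    \<open>\<rho>\<close> is omitted and a smaller one is attained.\<close>
  have step3: "\<exists>\<delta>>0. \<forall>y\<in>D0. dist y (v i) < \<delta> \<longrightarrow> f y < \<rho>" if rho: "0 < \<rho>" "\<rho> < \<rho>1" for \<rho>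
  proof -
    obtain \<delta> where \<delta>: "\<delta> > 0" "\<And>y. y \<in> D0 \<Longrightarrow> dist y (v i) < \<delta> \<Longrightarrow> f y \<noteq> \<rho>" using step2[OF rho] by blast
    define \<delta>' where "\<delta>' = min \<delta> r0"
    have \<delta>': "\<delta>' > 0" using \<delta> r0 by (simp add: \<delta>'_def)
    define M where "M = D0 \<inter> ball (v i) \<delta>'"
    have MB: "y \<in> B - {v i}" if "y \<in> M" for y
      using that r0(3) v_sphere(2)[of i] by (auto simp: M_def \<delta>'_def)
    have Meq: "M = (cball 0 1 \<inter> ball (v i) \<delta>') - {v i}"
    proof
      show "M \<subseteq> (cball 0 1 \<inter> ball (v i) \<delta>') - {v i}" using v_sphere(2) by (auto simp: M_def)
      show "(cball 0 1 \<inter> ball (v i) \<delta>') - {v i} \<subseteq> M"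
      proof
        fix y assume y: "y \<in> (cball 0 1 \<inter> ball (v i) \<delta>') - {v i}"
        then have "y \<in> B - {v i}" using r0(3) by (auto simp: \<delta>'_def)
        then show "y \<in> M" using BD y unfolding M_def by blast
      qed
    qed
    have "convex M"
      unfolding convex_contains_segment
    proof (intro ballI)
      fix y z assume yz: "y \<in> M" "z \<in> M"
      have "closed_segment y z \<subseteq> cball 0 1 \<inter> ball (v i) \<delta>'"
        using yz unfolding Meq by (intro closed_segment_subset convex_Int convex_cball convex_ball) auto
      moreover have "v i \<notin> closed_segment y z"
        using strictly_inside_segment[OF v_sphere(1)[of i], of y z] yz unfolding Meq by auto
      ultimately show "closed_segment y z \<subseteq> M" unfolding Meq by blast
    qed
    then have con: "connected M" by (rule convex_connected)
    have cf: "continuous_on M f"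
      unfolding f_def hor_def by (intro continuous_intros continuous_on_subset[OF phi_cont]) (auto simp: M_def)
    obtain r1 where r1: "r1 > 0" "r1 \<le> \<rho>0" "\<And>y. y \<in> B - {v i} \<Longrightarrow> f y < r1 \<Longrightarrow> dist y (v i) < \<delta>'"
      using step1[OF \<delta>'] by blast
    \<comment> \<open>A point of \<open>closure I\<close> at small distance \<open>l\<close> from
      \<open>q i\<close> is taken on a segment starting at \<open>q i\<close>; the surface point
      over it has \<open>f = l\<close> and lies near the vertex by \<open>step1\<close>.\<close>
    have "\<exists>y\<in>M. f y < \<rho>"
    proof -
      have "(1 - min r0 1 / 2) *\<^sub>R v i \<in> B - {v i}"
      proof -
        have n: "norm (min r0 1 / 2) < r0" "min r0 1 / 2 > 0" "min r0 1 / 2 \<le> 1" using r0(1) by (auto simp: min_def)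
        have "v i - (1 - min r0 1 / 2) *\<^sub>R v i = (min r0 1 / 2) *\<^sub>R v i" by (simp add: algebra_simps)
        then have dv: "dist (v i) ((1 - min r0 1 / 2) *\<^sub>R v i) = min r0 1 / 2"
          using n v_sphere(1)[of i] by (simp add: dist_norm)
        then have "(1 - min r0 1 / 2) *\<^sub>R v i \<in> cball 0 1 \<inter> ball (v i) r0"
          using n v_sphere(1)[of i] by auto
        moreover have "(1 - min r0 1 / 2) *\<^sub>R v i \<noteq> v i" using dv n by (metis dist_self less_irrefl)
        ultimately show ?thesis using r0(3) by blast
      qed
      from dom[OF this] obtain x1 where x1: "x1 \<in> closure I" "d \<bullet> x1 = d \<bullet> q i" "x1 \<noteq> q i" by blast
      define l where "l = min (min \<rho> r1) (dist x1 (q i)) / 2"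
      have l: "0 < l" "l < \<rho>" "l < r1" "l < dist x1 (q i)" using rho r1 x1(3) by (auto simp: l_def min_def)
      define s where "s = l / dist x1 (q i)"
      have s: "0 < s" "s < 1"
      proof -
        have "0 < dist x1 (q i)" using l by linarith
        then show "0 < s" "s < 1" using l by (simp_all add: s_def divide_less_eq_1_pos)
      qed
      define x where "x = q i + s *\<^sub>R (x1 - q i)"
      have xI: "x \<in> closure I"
        unfolding x_def
      proof (rule segment_param_mem)
        show "closed_segment (q i) x1 \<subseteq> closure I"
          using I_convex qI x1(1) by (intro closed_segment_subset convex_closure)
        show "s \<in> {0..1}" using s by simp
      qed
      have dx: "d \<bullet> x = d \<bullet> q i" using x1(2) by (simp add: x_def inner_add_right inner_diff_right)
      have "x - q i = s *\<^sub>R (x1 - q i)" by (simp add: x_def)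
      then have "dist x (q i) = s * dist x1 (q i)" using s by (simp add: dist_norm)
      then have dist: "dist x (q i) = l" using l unfolding s_def by auto
      then have "x \<noteq> q i" using l by auto
      then obtain y where y: "y \<in> B - {v i}" "hor (\<phi> y) = hor x" using ex[OF xI dx] dist l r1(2) by auto
      have "hor x + (d \<bullet> q i) *\<^sub>R d = x" using dx by (simp add: hor_def)
      then have fy: "f y = l" using dist_hor_shift[of x "q i"] dist y(2) by (simp add: f_def)
      then have "dist y (v i) < \<delta>'" using r1(3)[OF y(1)] l by simp
      then have "y \<in> M" using BD[OF y(1)] by (simp add: M_def dist_commute)
      then show ?thesis using fy l by auto
    qed
    then obtain z where z: "z \<in> M" "f z < \<rho>" by blast
    have "f y < \<rho>" if y: "y \<in> M" for y
    proof (rule ccontr)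
      assume "\<not> f y < \<rho>"
      then have le: "f z \<le> \<rho>" "\<rho> \<le> f y" using z by simp_all
      have "\<rho> \<in> f ` M"
        by (rule connectedD_interval[OF connected_continuous_image[OF cf con] _ _ le]) (use z y in blast)+
      then obtain w where w: "w \<in> M" "f w = \<rho>" by blast
      then have "w \<in> D0" "dist w (v i) < \<delta>" by (auto simp: M_def \<delta>'_def dist_commute)
      then show False using \<delta>(2) w(2) by blast
    qed
    then show ?thesis using \<delta>' by (intro exI[of _ \<delta>']) (auto simp: M_def dist_commute)
  qed
  have "\<exists>\<delta>>0. \<forall>y\<in>D0. dist y (v i) < \<delta> \<longrightarrow> dist (hor (\<phi> y)) (hor (q i)) < e" if "e > 0" for e
  proof -
    have "0 < min e \<rho>1 / 2" "min e \<rho>1 / 2 < \<rho>1" "min e \<rho>1 / 2 < e" using that rho1 by (auto simp: min_def)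
    then show ?thesis using step3[of "min e \<rho>1 / 2"] unfolding f_def by (meson order_less_trans)
  qed
  note lim = this
  show thesis by (rule that[OF r0(1,3,4,5)]) (fact inj, fact lim)
qed

lemma vertex_limit:
  assumes "e > 0"
  shows "\<exists>\<delta>>0. \<forall>y\<in>D0. dist y (v i) < \<delta> \<longrightarrow> dist (hor (\<phi> y)) (hor (q i)) < e"
  by (rule vertex_limit_small[of i]) (use assms in blast)

lemma vertex_tendsto:
  assumes y: "\<And>k. y k \<in> D0" "y \<longlonglongrightarrow> v i"
  shows "(\<lambda>k. hor (\<phi> (y k))) \<longlonglongrightarrow> hor (q i)"
proof (rule tendstoI)
  fix e :: real assume "e > 0"
  then obtain \<delta> where \<delta>: "\<delta> > 0" "\<And>y. y \<in> D0 \<Longrightarrow> dist y (v i) < \<delta> \<Longrightarrow> dist (hor (\<phi> y)) (hor (q i)) < e"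
    using vertex_limit by blast
  show "\<forall>\<^sub>F k in sequentially. dist (hor (\<phi> (y k))) (hor (q i)) < e"
    using tendstoD[OF y(2) \<delta>(1)] by eventually_elim (use \<delta>(2) y(1) in blast)
qed

lemma disk_limit_cases:
  assumes "a \<in> cball 0 1"
  obtains "a \<in> D0" | i where "a = v i"
  using assms vertices(1) by blast

text \<open>Compactness of the closed disk. At a vertex only the horizontal projection converges,
  since heights may diverge there; this second alternative accompanies every limit argument on
  \<open>S\<close>.\<close>

lemma S_limit:
  assumes "\<And>k. p k \<in> S"
  obtains t x where "strict_mono (t :: nat \<Rightarrow> nat)" "x \<in> S" "(\<lambda>k. p (t k)) \<longlonglongrightarrow> x"
  | t i where "strict_mono (t :: nat \<Rightarrow> nat)" "(\<lambda>k. hor (p (t k))) \<longlonglongrightarrow> hor (q i)"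
proof -
  have "\<forall>k. \<exists>y. y \<in> D0 \<and> p k = \<phi> y" using assms unfolding S by blast
  then obtain y where y: "\<And>k. y k \<in> D0" "\<And>k. p k = \<phi> (y k)" by metis
  obtain a t where a: "a \<in> cball 0 1" "strict_mono t" "(y \<circ> t) \<longlonglongrightarrow> a"
    by (rule disk_limit[of y, OF y(1)])
  have yt: "(y \<circ> t) k \<in> D0" for k using y(1) by simp
  from a(1) show thesis
  proof (cases rule: disk_limit_cases)
    case 1
    have "(\<lambda>k. \<phi> ((y \<circ> t) k)) \<longlonglongrightarrow> \<phi> a" by (rule phi_tendsto[OF yt a(3) 1])
    then have "(\<lambda>k. p (t k)) \<longlonglongrightarrow> \<phi> a" by (simp add: y(2))
    moreover have "\<phi> a \<in> S" using 1 unfolding S by blast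
    ultimately show thesis using that(1) a(2) by blast
  next
    case (2 i)
    have "(\<lambda>k. hor (\<phi> ((y \<circ> t) k))) \<longlonglongrightarrow> hor (q i)" using a(3) unfolding 2 by (intro vertex_tendsto yt)
    then have "(\<lambda>k. hor (p (t k))) \<longlonglongrightarrow> hor (q i)" by (simp add: y(2))
    then show thesis using that(2) a(2) by blast
  qed
qed

text \<open>By compactness: a limit parameter outside \<open>V\<close> would put a point of
  \<open>S\<close> over the corner, and a different vertex would project to a different
  corner.\<close>

lemma near_corner_near_vertex:
  assumes r: "r > 0"
  shows "\<exists>e>0. \<forall>y\<in>D0. dist (hor (\<phi> y)) (hor (q i)) < e \<longrightarrow> dist y (v i) < r"
proof (rule ccontr)
  assume neg: "\<not> ?thesis"
  have "\<exists>y. y \<in> D0 \<and> dist (hor (\<phi> y)) (hor (q i)) < inverse (real (Suc k)) \<and> \<not> dist y (v i) < r" for k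
  proof -
    have "inverse (real (Suc k)) > 0" by simp
    then show ?thesis using neg by blast
  qed
  then obtain y where y: "\<And>k. y k \<in> D0" "\<And>k. dist (hor (\<phi> (y k))) (hor (q i)) < inverse (real (Suc k))"
    "\<And>k. \<not> dist (y k) (v i) < r" by metis
  have "(\<lambda>k. hor (\<phi> (y k))) \<longlonglongrightarrow> hor (q i)"
    by (rule tendsto_dist_iff[THEN iffD2], rule Lim_null_comparison[OF _ LIMSEQ_inverse_real_of_nat])
      (use y(2) in \<open>auto intro!: always_eventually less_imp_le\<close>)
  note lim = this
  obtain a t where a: "a \<in> cball 0 1" "strict_mono t" "(y \<circ> t) \<longlonglongrightarrow> a"
    by (rule disk_limit[of y, OF y(1)])
  have yt: "(y \<circ> t) k \<in> D0" for k using y(1) by simp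
  have lim': "(\<lambda>k. hor (\<phi> ((y \<circ> t) k))) \<longlonglongrightarrow> hor (q i)"
    using LIMSEQ_subseq_LIMSEQ[OF lim a(2)] by (simp add: o_def)
  from a(1) show False
  proof (cases rule: disk_limit_cases)
    case 1
    have "(\<lambda>k. hor (\<phi> ((y \<circ> t) k))) \<longlonglongrightarrow> hor (\<phi> a)" by (intro hor_tendsto phi_tendsto[OF yt a(3) 1])
    then have "hor (\<phi> a) = hor (q i)" using lim' by (rule LIMSEQ_unique)
    moreover have "\<phi> a \<in> S" using 1 unfolding S by blast
    ultimately show False using hor_q_not_S by blast
  next
    case (2 j)
    have "(\<lambda>k. hor (\<phi> ((y \<circ> t) k))) \<longlonglongrightarrow> hor (q j)" using a(3) unfolding 2 by (intro vertex_tendsto yt)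
    then have "hor (q j) = hor (q i)" using lim' by (rule LIMSEQ_unique)
    then have "j = i" by (rule hor_q_inj)
    then have "\<forall>\<^sub>F k in sequentially. dist ((y \<circ> t) k) (v i) < r" using a(3) 2 tendstoD r by blast
    then obtain k where "dist ((y \<circ> t) k) (v i) < r" using eventually_happens'[OF sequentially_bot] by blast
    then show False using y(3)[of "t k"] by simp
  qed
qed

text \<open>All of \<open>S\<close> over a small neighbourhood of the corner comes from the
  neighbourhood of the vertex on which the projection is injective.\<close>

lemma corner_single_sheet:
  "\<exists>e>0. \<forall>p\<in>S. \<forall>p'\<in>S. hor p = hor p' \<longrightarrow> dist (hor p) (hor (q i)) < e \<longrightarrow> p = p'"
proof -
  obtain r0 B where B: "r0 > 0" "cball 0 1 \<inter> ball (v i) r0 \<subseteq> B"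
    and inj: "\<And>y y'. y \<in> B - {v i} \<Longrightarrow> y' \<in> B - {v i} \<Longrightarrow> hor (\<phi> y) = hor (\<phi> y') \<Longrightarrow> y = y'"
    by (rule vertex_limit_small[of i], rule that; assumption)
  obtain e where e: "e > 0" "\<And>y. y \<in> D0 \<Longrightarrow> dist (hor (\<phi> y)) (hor (q i)) < e \<Longrightarrow> dist y (v i) < r0"
    using near_corner_near_vertex[OF B(1)] by blast
  have inB: "y \<in> B - {v i}" if "y \<in> D0" "dist (hor (\<phi> y)) (hor (q i)) < e" for y
  proof -
    have "y \<in> cball 0 1 \<inter> ball (v i) r0" using e(2)[OF that] that(1) by (auto simp: dist_commute)
    moreover have "y \<noteq> v i" using that(1) v_sphere(2)[of i] by blast
    ultimately show ?thesis using B(2) by blast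
  qed
  have "p = p'" if p: "p \<in> S" "p' \<in> S" "hor p = hor p'" "dist (hor p) (hor (q i)) < e" for p p'
  proof -
    obtain y where y: "y \<in> D0" "p = \<phi> y" using p(1) unfolding S by blast
    obtain y' where y': "y' \<in> D0" "p' = \<phi> y'" using p(2) unfolding S by blast
    have "y = y'" by (rule inj) (use inB y y' p in auto)
    then show ?thesis using y y' by simp
  qed
  then show ?thesis using e(1) by blast
qed

section \<open>The drop below and above the surface\<close>

lemma Omega_component: "\<Omega> \<in> components (I - S)" "plane m b \<inter> closure I \<subseteq> closure \<Omega>"
  using drop by (auto simp: drop_region_def)

lemma Omega_absorb: "x \<in> \<Omega> \<Longrightarrow> x \<in> K \<Longrightarrow> connected K \<Longrightarrow> K \<subseteq> I - S \<Longrightarrow> K \<subseteq> \<Omega>"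
  using components_maximal[OF Omega_component(1)] by blast

lemma m_shift: "m \<bullet> (x + s *\<^sub>R d) = m \<bullet> x + s * (m \<bullet> d)" and n_shift: "n j \<bullet> (x + s *\<^sub>R d) = n j \<bullet> x"
  by (simp_all add: inner_add_right nd)

text \<open>The ray downward reaches the base at a point \<open>xb\<close> inside the cross section.
  No point of \<open>S\<close> is near \<open>xb\<close>, so a neighbourhood of \<open>xb\<close>
  within \<open>I\<close> belongs to \<open>\<Omega>\<close>, and the segment from \<open>x\<close>
  down to the base is connected and avoids \<open>S\<close>.\<close>

lemma below_in_Omega:
  assumes x: "x \<in> I" and free: "\<And>s. 0 \<le> s \<Longrightarrow> x - s *\<^sub>R d \<notin> S"
  shows "x \<in> \<Omega>"
proof -
  define sb where "sb = (b - m \<bullet> x) / (- (m \<bullet> d))"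
  have xI: "n j \<bullet> x < c j" "m \<bullet> x < b" for j using x I_iff by auto
  have sb: "sb > 0" "sb * (m \<bullet> d) = m \<bullet> x - b" using md xI by (auto simp: sb_def field_simps intro!: divide_pos_neg)
  define xb where "xb = x - sb *\<^sub>R d"
  have xb: "m \<bullet> xb = b" using sb by (simp add: xb_def inner_diff_right)
  have segI: "x - s *\<^sub>R d \<in> I" if "s < sb" for s
  proof -
    have "s * (m \<bullet> d) > sb * (m \<bullet> d)" using that md by (simp add: mult_less_cancel_right)
    then have "m \<bullet> (x - s *\<^sub>R d) < b" using sb(2) by (simp add: inner_diff_right)
    then show ?thesis using xI by (simp add: I_iff inner_diff_right nd)
  qed
  define sk where "sk = (\<lambda>k. sb - sb * inverse (real (Suc k)))"
  have sk: "sk k < sb" "0 \<le> sk k" for k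
    using sb(1) by (auto simp: sk_def intro!: mult_left_le inverse_le_1_iff[THEN iffD2])
  have "sk \<longlonglongrightarrow> sb - sb * 0" unfolding sk_def by (intro tendsto_intros LIMSEQ_inverse_real_of_nat)
  then have xklim: "(\<lambda>k. x - sk k *\<^sub>R d) \<longlonglongrightarrow> xb" unfolding xb_def by (intro tendsto_intros) simp
  have "xb \<in> closure I"
    unfolding closure_sequential using segI sk(1) xklim by (intro exI[of _ "\<lambda>k. x - sk k *\<^sub>R d"]) auto
  then have cl: "xb \<in> closure \<Omega>" using Omega_component(2) xb by (auto simp: plane_def)
  \<comment> \<open>Points of \<open>S\<close> accumulating at \<open>xb\<close> would put a point
    of \<open>S\<close> on the base or \<open>xb\<close> over a corner.\<close>
  have "\<exists>r>0. ball xb r \<inter> S = {}"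
  proof (rule ccontr)
    assume neg: "\<not> ?thesis"
    have "\<exists>p. p \<in> S \<and> dist p xb < inverse (real (Suc k))" for k
    proof -
      have "inverse (real (Suc k)) > 0" by simp
      then have "ball xb (inverse (real (Suc k))) \<inter> S \<noteq> {}" using neg by blast
      then show ?thesis by (auto simp: dist_commute)
    qed
    then obtain p where p: "\<And>k. p k \<in> S" "\<And>k. dist (p k) xb < inverse (real (Suc k))" by metis
    have plim: "p \<longlonglongrightarrow> xb"
      by (rule tendsto_dist_iff[THEN iffD2], rule Lim_null_comparison[OF _ LIMSEQ_inverse_real_of_nat])
        (use p(2) in \<open>auto intro!: always_eventually less_imp_le\<close>)
    show False
    proof (rule S_limit[OF p(1)])
      fix t z assume t: "strict_mono (t :: nat \<Rightarrow> nat)" "z \<in> S" "(\<lambda>k. p (t k)) \<longlonglongrightarrow> z"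
      have "z = xb" using LIMSEQ_unique[OF t(3)] LIMSEQ_subseq_LIMSEQ[OF plim t(1)] by (simp add: o_def)
      then show False using S_base' t(2) xb by fastforce
    next
      fix t i assume t: "strict_mono (t :: nat \<Rightarrow> nat)" "(\<lambda>k. hor (p (t k))) \<longlonglongrightarrow> hor (q i)"
      have "(\<lambda>k. hor (p (t k))) \<longlonglongrightarrow> hor xb" using hor_tendsto[OF LIMSEQ_subseq_LIMSEQ[OF plim t(1)]] by (simp add: o_def)
      then have "hor (q i) = hor xb" using t(2) LIMSEQ_unique by blast
      then have "n i \<bullet> q i = n i \<bullet> xb" using hor_simps(6)[of i "q i"] hor_simps(6)[of i xb] by simp
      also have "\<dots> = n i \<bullet> x" by (simp add: xb_def inner_diff_right nd)
      finally show False using q_on(1)[of i] xI(1)[of i] by simp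
    qed
  qed
  then obtain r where r: "r > 0" "ball xb r \<inter> S = {}" by blast
  have "ball xb r \<inter> \<Omega> \<noteq> {}"
    using cl r(1) unfolding closure_approachable by (metis disjoint_iff dist_commute mem_ball)
  then obtain z where z: "z \<in> ball xb r" "z \<in> \<Omega>" by blast
  have OI: "\<Omega> \<subseteq> I - S" using Omega_component(1) in_components_subset by blast
  have sub: "ball xb r \<inter> I \<subseteq> \<Omega>"
    by (rule Omega_absorb[OF z(2)]) (use z OI r(2) I_convex in \<open>auto intro!: convex_connected convex_Int\<close>)
  obtain k where k: "dist (x - sk k *\<^sub>R d) xb < r"
    using tendstoD[OF xklim r(1)] eventually_happens'[OF sequentially_bot] by blast
  define K where "K = (\<lambda>s. x - s *\<^sub>R d) ` {0..<sb}"
  have "K \<subseteq> \<Omega>"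
  proof (rule Omega_absorb)
    show "x - sk k *\<^sub>R d \<in> \<Omega>" using sub k segI[OF sk(1)] by (auto simp: dist_commute)
    show "x - sk k *\<^sub>R d \<in> K" using sk by (auto simp: K_def)
    show "connected K" unfolding K_def by (intro connected_continuous_image continuous_intros) auto
    show "K \<subseteq> I - S" using segI free by (auto simp: K_def)
  qed
  moreover have "x \<in> K" unfolding K_def using sb by (intro image_eqI[of _ _ 0]) auto
  ultimately show ?thesis by blast
qed

text \<open>For large \<open>M\<close> this part of the prism lies on the inner side of the possibly
  oblique base plane; it stands for the open end of the container.\<close>

definition high :: "real \<Rightarrow> (real^3) set" where "high M = {x. (\<forall>j. n j \<bullet> x < c j) \<and> M < d \<bullet> x}"

lemma high_convex: "convex (high M)"
proof -
  have "high M = (\<Inter>j. {x. n j \<bullet> x < c j}) \<inter> {x. d \<bullet> x > M}" by (auto simp: high_def)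
  then show ?thesis by (simp add: convex_Int convex_INT convex_halfspace_lt convex_halfspace_gt)
qed

lemma high_subset_I: "\<exists>M0. \<forall>M\<ge>M0. high M \<subseteq> I"
proof -
  obtain R where R: "\<And>x. (\<And>j. n j \<bullet> x \<le> c j) \<Longrightarrow> norm (hor x) \<le> R" using hor_bounded by blast
  define M0 where "M0 = (norm m * R - b) / (- (m \<bullet> d))"
  have "x \<in> I" if "x \<in> high M" "M0 \<le> M" for x M
  proof -
    have x: "\<And>j. n j \<bullet> x < c j" "M0 < d \<bullet> x" using that by (auto simp: high_def)
    have "m \<bullet> x = m \<bullet> hor x + (d \<bullet> x) * (m \<bullet> d)" by (simp add: hor_def inner_diff_right)
    moreover have "m \<bullet> hor x \<le> norm m * R"
      using norm_cauchy_schwarz[of m "hor x"] mult_left_mono[OF R[OF less_imp_le[OF x(1)]], of "norm m"] by simp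
    moreover have "M0 * (- (m \<bullet> d)) < (d \<bullet> x) * (- (m \<bullet> d))" using x(2) md by (intro mult_strict_right_mono) auto
    moreover have "M0 * (- (m \<bullet> d)) = norm m * R - b" using md by (simp add: M0_def)
    ultimately have "m \<bullet> x < b" by simp
    then show ?thesis using x(1) by (simp add: I_iff)
  qed
  then show ?thesis by blast
qed

text \<open>Counterpart of \<open>below_in_Omega\<close> with the open end in the role of the base,
  under the assumption that the drop reaches the open end.\<close>

lemma above_in_Omega:
  assumes S: "\<And>p. p \<in> S \<Longrightarrow> d \<bullet> p \<le> M" and M: "high M \<subseteq> I" and z: "z \<in> \<Omega>" "z \<in> high M"
    and x: "x \<in> I" and free: "\<And>s. 0 \<le> s \<Longrightarrow> x + s *\<^sub>R d \<notin> S"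
  shows "x \<in> \<Omega>"
proof -
  have highS: "high M \<inter> S = {}" using S by (fastforce simp: high_def)
  have H: "high M \<subseteq> \<Omega>"
    by (rule Omega_absorb[OF z]) (use highS M in \<open>auto intro: convex_connected high_convex\<close>)
  define s where "s = \<bar>M - d \<bullet> x\<bar> + 1"
  have xI: "n j \<bullet> x < c j" "m \<bullet> x < b" for j using x I_iff by auto
  define K where "K = (\<lambda>s. x + s *\<^sub>R d) ` {0..}"
  have "x + s *\<^sub>R d \<in> high M" using xI by (auto simp: high_def n_shift inner_add_right dd nd s_def abs_if)
  then have 1: "x + s *\<^sub>R d \<in> \<Omega>" using H by blast
  have 2: "x + s *\<^sub>R d \<in> K" by (auto simp: K_def s_def)
  have 3: "connected K" unfolding K_def by (intro connected_continuous_image continuous_intros) auto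
  have "m \<bullet> (x + t *\<^sub>R d) < b" if "0 \<le> t" for t
    using xI(2) md that mult_nonneg_nonpos[of t "m \<bullet> d"] by (simp add: m_shift)
  then have 4: "K \<subseteq> I - S" using xI free by (auto simp: K_def I_iff n_shift)
  have "K \<subseteq> \<Omega>" by (rule Omega_absorb[OF 1 2 3 4])
  moreover have "x \<in> K" unfolding K_def by (intro image_eqI[of _ _ 0]) auto
  ultimately show ?thesis by blast
qed

end

section \<open>Sides of the surface\<close>

lemma C2_on_partial_isCont:
  assumes "C2_on U X" "w \<in> U"
  shows "isCont X w" "isCont (partial i X) w"
  using assms by (auto simp: C2_on_def intro: differentiable_imp_continuous_within)

lemma isCont_near: "isCont f x \<Longrightarrow> e > 0 \<Longrightarrow> \<forall>\<^sub>F w in nhds x. dist (f w) (f x) < e"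
  unfolding isCont_def tendsto_at_iff_tendsto_nhds by (rule tendstoD)

lemma frechet_derivative_partial:
  assumes "C2_on U (X :: real^2 \<Rightarrow> 'a::real_normed_vector)" "w \<in> U"
  shows "frechet_derivative X (at w) z = (z $ 1) *\<^sub>R partial 1 X w + (z $ 2) *\<^sub>R partial 2 X w"
proof -
  have L: "linear (frechet_derivative X (at w))"
    using has_derivative_linear[OF partial_has_derivative(1)[OF assms]] .
  show ?thesis
    by (subst vec2_eq[of z]) (simp add: linear_add[OF L] linear_cmul[OF L] partial_def)
qed

text \<open>The projection \<open>L\<close> along \<open>e\<close> onto the tangent plane does not
  change the derivative of \<open>X\<close> at \<open>w0\<close>, which is injective. The partial
  derivatives are continuous, so \<open>L\<close> after \<open>X\<close> is injective on a
  ball.\<close>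

lemma local_transversal:
  fixes X :: "real^2 \<Rightarrow> real^3"
  assumes X: "open U" "C2_on U X" "w0 \<in> U" "inj (frechet_derivative X (at w0))"
    and N0: "\<And>z. N0 \<bullet> frechet_derivative X (at w0) z = 0" "N0 \<bullet> e \<noteq> 0"
  shows "\<exists>\<delta>>0. ball w0 \<delta> \<subseteq> U \<and> (\<forall>w\<in>ball w0 \<delta>. \<forall>w'\<in>ball w0 \<delta>. \<forall>s. X w' = X w + s *\<^sub>R e \<longrightarrow> w' = w)"
proof -
  define L where "L = (\<lambda>z. z - ((N0 \<bullet> z) / (N0 \<bullet> e)) *\<^sub>R e)"
  have L: "bounded_linear L" unfolding L_def
    by (intro bounded_linear_intros bounded_linear_sub bounded_linear_ident bounded_linear_scaleR_const)
      (auto intro!: bounded_linear_divide[THEN bounded_linear_compose] bounded_linear_inner_right)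
  obtain K where K: "K > 0" "\<And>z. norm (L z) \<le> norm z * K" using bounded_linear.pos_bounded[OF L] by blast
  let ?X' = "\<lambda>w. frechet_derivative X (at w)"
  have lin0: "linear (?X' w0)" using has_derivative_linear[OF partial_has_derivative(1)[OF X(2,3)]] .
  obtain g where g: "linear g" "g \<circ> ?X' w0 = id"
    using linear_injective_left_inverse[OF lin0 X(4)] by blast
  have der: "((\<lambda>w. L (X w)) has_derivative (\<lambda>z. L (?X' w z))) (at w)" if "w \<in> U" for w
    by (rule bounded_linear.has_derivative[OF L partial_has_derivative(1)[OF X(2) that]])
  have L0: "L (?X' w0 z) = ?X' w0 z" for z by (simp add: L_def N0(1))
  obtain r where r: "r > 0" "ball w0 r \<subseteq> U" "inj_on (\<lambda>w. L (X w)) (ball w0 r)"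
  proof (rule has_derivative_locally_injective[of w0 U g "\<lambda>w z. L (?X' w z)" "\<lambda>w. L (X w)"])
    show "w0 \<in> U" "open U" "bounded_linear g" using X g linear_conv_bounded_linear by auto
    show "g \<circ> (\<lambda>z. L (?X' w0 z)) = id" using g(2) unfolding L0 by (simp add: o_def)
    show "((\<lambda>w. L (X w)) has_derivative (\<lambda>z. L (?X' w z))) (at w)" if "w \<in> U" for w by (rule der[OF that])
    fix \<epsilon> :: real assume e: "\<epsilon> > 0"
    \<comment> \<open>The two coordinate terms contribute \<open>2 * \<mu> * K * norm z\<close> in
      total, which is \<open>(\<epsilon> / 2) * norm z\<close>.\<close>
    define \<mu> where "\<mu> = \<epsilon> / (4 * K)"
    have mu: "\<mu> > 0" using e K(1) by (simp add: \<mu>_def)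
    have "\<forall>\<^sub>F w in nhds w0. w \<in> U" using X(1,3) eventually_nhds by blast
    moreover have "\<forall>\<^sub>F w in nhds w0. dist (partial i X w) (partial i X w0) < \<mu>" for i
      by (rule isCont_near[OF C2_on_partial_isCont(2)[OF X(2,3)] mu])
    ultimately have "\<forall>\<^sub>F w in nhds w0. w \<in> U \<and> dist (partial 1 X w) (partial 1 X w0) < \<mu> \<and> dist (partial 2 X w) (partial 2 X w0) < \<mu>"
      by (intro eventually_conj) auto
    then obtain \<delta> where \<delta>: "\<delta> > 0" "\<And>w. dist w w0 < \<delta> \<Longrightarrow> w \<in> U \<and> dist (partial 1 X w) (partial 1 X w0) < \<mu> \<and> dist (partial 2 X w) (partial 2 X w0) < \<mu>"
      unfolding eventually_nhds_metric by blast
    have "onorm (\<lambda>z. L (?X' w z) - L (?X' w0 z)) < \<epsilon>" if "dist w0 w < \<delta>" for w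
    proof -
      have w: "w \<in> U" "norm (partial 1 X w - partial 1 X w0) < \<mu>" "norm (partial 2 X w - partial 2 X w0) < \<mu>"
        using \<delta>(2)[of w] that unfolding dist_commute[of w0] by (simp_all add: dist_norm)
      have "norm (L (?X' w z) - L (?X' w0 z)) \<le> (\<epsilon> / 2) * norm z" for z
      proof -
        have "L (?X' w z) - L (?X' w0 z) = L ((z $ 1) *\<^sub>R (partial 1 X w - partial 1 X w0) + (z $ 2) *\<^sub>R (partial 2 X w - partial 2 X w0))"
          unfolding frechet_derivative_partial[OF X(2) w(1)] frechet_derivative_partial[OF X(2,3)]
            linear_diff[OF bounded_linear.linear[OF L], symmetric] by (simp add: algebra_simps)
        also have "norm \<dots> \<le> norm ((z $ 1) *\<^sub>R (partial 1 X w - partial 1 X w0) + (z $ 2) *\<^sub>R (partial 2 X w - partial 2 X w0)) * K" by (rule K(2))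
        also have "\<dots> \<le> (norm z * \<mu> + norm z * \<mu>) * K"
        proof (intro mult_right_mono norm_triangle_mono)
          show "norm ((z $ 1) *\<^sub>R (partial 1 X w - partial 1 X w0)) \<le> norm z * \<mu>"
            unfolding norm_scaleR using component_le_norm_cart[of z 1] w(2) by (intro mult_mono) auto
          show "norm ((z $ 2) *\<^sub>R (partial 2 X w - partial 2 X w0)) \<le> norm z * \<mu>"
            unfolding norm_scaleR using component_le_norm_cart[of z 2] w(3) by (intro mult_mono) auto
        qed (use K in auto)
        also have "\<dots> = (\<epsilon> / 2) * norm z" using K(1) by (simp add: \<mu>_def)
        finally show ?thesis .
      qed
      then have "onorm (\<lambda>z. L (?X' w z) - L (?X' w0 z)) \<le> \<epsilon> / 2" using e by (intro onorm_le) auto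
      then show ?thesis using e by linarith
    qed
    then show "\<exists>\<delta>>0. \<forall>w. dist w0 w < \<delta> \<longrightarrow> onorm (\<lambda>z. L (?X' w z) - L (?X' w0 z)) < \<epsilon>" using \<delta>(1) by blast
  qed
  have "w' = w" if w: "w \<in> ball w0 r" "w' \<in> ball w0 r" "X w' = X w + s *\<^sub>R e" for w w' s
  proof -
    have "L e = 0" using N0(2) by (simp add: L_def)
    then have "L (X w') = L (X w)" unfolding w(3) using linear_add[OF bounded_linear.linear[OF L]] linear_cmul[OF bounded_linear.linear[OF L]] by simp
    then show ?thesis using r(3) w(1,2) by (simp add: inj_on_def)
  qed
  then show ?thesis using r by blast
qed

text \<open>The chart is a homeomorphism onto a relatively open piece of \<open>S\<close>, so no
  other part of \<open>S\<close> comes close to \<open>X w0\<close>.\<close>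

lemma chart_near:
  assumes ch: "C2_chart S C U X" and w0: "w0 \<in> U" "0 \<le> w0 $ 2" and \<delta>: "\<delta> > 0"
  shows "\<exists>\<rho>>0. \<forall>p\<in>S. dist p (X w0) < \<rho> \<longrightarrow> (\<exists>w\<in>U. 0 \<le> w $ 2 \<and> dist w w0 < \<delta> \<and> X w = p)"
proof -
  let ?A = "U \<inter> upper_half"
  obtain Y where Y: "homeomorphism ?A (X ` ?A) X Y" using ch unfolding C2_chart_def by blast
  have op: "openin (top_of_set S) (X ` ?A)" using ch unfolding C2_chart_def by blast
  have "openin (top_of_set ?A) (?A \<inter> ball w0 \<delta>)" by (simp add: openin_open_Int)
  then have "openin (top_of_set (X ` ?A)) (X ` (?A \<inter> ball w0 \<delta>))"
    by (rule homeomorphism_imp_open_map[OF Y])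
  then have "openin (top_of_set S) (X ` (?A \<inter> ball w0 \<delta>))" using op openin_trans by blast
  moreover have "X w0 \<in> X ` (?A \<inter> ball w0 \<delta>)" using w0 \<delta> by (auto simp: upper_half_def)
  ultimately obtain \<rho> where \<rho>: "\<rho> > 0" "ball (X w0) \<rho> \<inter> S \<subseteq> X ` (?A \<inter> ball w0 \<delta>)"
    unfolding openin_contains_ball by blast
  have "\<exists>w\<in>U. 0 \<le> w $ 2 \<and> dist w w0 < \<delta> \<and> X w = p" if "p \<in> S" "dist p (X w0) < \<rho>" for p
  proof -
    have "p \<in> X ` (?A \<inter> ball w0 \<delta>)" using that \<rho>(2) by (auto simp: dist_commute)
    then show ?thesis by (auto simp: upper_half_def dist_commute)
  qed
  then show ?thesis using \<rho>(1) by blast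
qed

context capillary_drop begin

lemma N_cont: "continuous_on S N" and N_norm: "p \<in> S \<Longrightarrow> norm (N p) = 1"
  and N_orth: "C2_chart S C U X \<Longrightarrow> w \<in> U \<Longrightarrow> 0 \<le> w $ 2 \<Longrightarrow> N (X w) \<bullet> frechet_derivative X (at w) z = 0"
  and N_side: "p \<in> S - C \<Longrightarrow> \<forall>\<^sub>F t in at_right 0. p - t *\<^sub>R N p \<in> \<Omega> \<and> p + t *\<^sub>R N p \<notin> \<Omega>"
  using normal unfolding outward_unit_normal_def upper_half_def by auto

lemma chart_at:
  assumes "p \<in> S"
  obtains U X w0 where "C2_chart S C U X" "w0 \<in> U" "0 \<le> w0 $ 2" "X w0 = p"
proof -
  obtain U X where UX: "C2_chart S C U X" "p \<in> X ` (U \<inter> upper_half)"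
    using disk_facts(7) assms unfolding C2_surface_with_boundary_def by blast
  then obtain w where "w \<in> U \<inter> upper_half" "p = X w" by blast
  then show thesis using that[OF UX(1), of w] by (simp add: upper_half_def)
qed

lemma chart_at_interior:
  assumes "p \<in> S - C"
  obtains U X w0 where "C2_chart S C U X" "w0 \<in> U" "0 < w0 $ 2" "X w0 = p"
proof -
  obtain U X w0 where *: "C2_chart S C U X" "w0 \<in> U" "0 \<le> w0 $ 2" "X w0 = p" by (rule chart_at[of p]) (use assms in auto)
  then have "w0 $ 2 \<noteq> 0" using C2_chart_facts(6)[OF *(1-3)] assms by auto
  then show thesis using that[OF *(1,2) _ *(4)] *(3) by simp
qed

lemma local_sheet:
  assumes p: "p \<in> S" "N p \<bullet> e \<noteq> 0"
  shows "\<exists>\<rho>>0. \<forall>p1\<in>S. \<forall>p2\<in>S. \<forall>s. dist p1 p < \<rho> \<longrightarrow> dist p2 p < \<rho> \<longrightarrow> p2 = p1 + s *\<^sub>R e \<longrightarrow> p2 = p1"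
proof -
  obtain U X w0 where ch: "C2_chart S C U X" "w0 \<in> U" "0 \<le> w0 $ 2" "X w0 = p" by (rule chart_at[OF p(1)])
  note cf = C2_chart_facts[OF ch(1)]
  obtain \<delta> where \<delta>: "\<delta> > 0" "\<And>w w' s. w \<in> ball w0 \<delta> \<Longrightarrow> w' \<in> ball w0 \<delta> \<Longrightarrow> X w' = X w + s *\<^sub>R e \<Longrightarrow> w' = w"
    using local_transversal[OF cf(1,2) ch(2) cf(3)[OF ch(2)] N_orth[OF ch(1-3)]] p(2) unfolding ch(4) by blast
  obtain \<rho> where \<rho>: "\<rho> > 0" "\<And>p'. p' \<in> S \<Longrightarrow> dist p' p < \<rho> \<Longrightarrow> \<exists>w\<in>U. 0 \<le> w $ 2 \<and> dist w w0 < \<delta> \<and> X w = p'"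
    using chart_near[OF ch(1-3) \<delta>(1)] unfolding ch(4) by blast
  have "p2 = p1" if p12: "p1 \<in> S" "p2 \<in> S" "dist p1 p < \<rho>" "dist p2 p < \<rho>" "p2 = p1 + s *\<^sub>R e" for p1 p2 s
  proof -
    obtain w1 where w1: "dist w1 w0 < \<delta>" "X w1 = p1" using \<rho>(2) p12 by blast
    obtain w2 where w2: "dist w2 w0 < \<delta>" "X w2 = p2" using \<rho>(2) p12 by blast
    have "w2 = w1" using w1 w2 p12(5) by (intro \<delta>(2)[of w1 w2 s]) (auto simp: dist_commute)
    then show ?thesis using w1 w2 by simp
  qed
  then show ?thesis using \<rho>(1) by blast
qed

lemma chart_jacobian_nz:
  assumes ch: "C2_chart S C U X" "w \<in> U" "0 \<le> w $ 2" and nu: "N (X w) \<bullet> e \<noteq> 0"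
  shows "e \<bullet> cross3 (frechet_derivative X (at w) (axis 1 1)) (frechet_derivative X (at w) (axis 2 1)) \<noteq> 0"
proof -
  note cf = C2_chart_facts[OF ch(1)]
  let ?c = "cross3 (frechet_derivative X (at w) (axis 1 1)) (frechet_derivative X (at w) (axis 2 1))"
  have c0: "?c \<noteq> 0" using cross_partial_nonzero[OF cf(2) ch(2) cf(3)[OF ch(2)]] by (simp add: partial_def)
  have Ns: "N (X w) = (N (X w) \<bullet> sgn ?c) *\<^sub>R sgn ?c"
    by (rule parallel_if_orthogonal_to_both[OF N_orth[OF ch] N_orth[OF ch] c0])
  show ?thesis
  proof
    assume "e \<bullet> ?c = 0"
    then have "sgn ?c \<bullet> e = 0" by (simp add: sgn_div_norm inner_commute)
    then have "((N (X w) \<bullet> sgn ?c) *\<^sub>R sgn ?c) \<bullet> e = 0" by simp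
    then show False using nu Ns by metis
  qed
qed

text \<open>Compares the two sides of the sheet along its normal with above and below along
  \<open>d\<close>. The foot \<open>Z\<close> along \<open>d\<close> has a tangential derivative, so
  the signed normal distance \<open>G\<close> of the moving point from its foot has derivative
  \<open>1\<close> at zero; and this distance equals
  \<open>\<kappa> * (s * (N p \<bullet> d))\<close>. The sign \<open>\<kappa>\<close> selects the
  outer or the inner side.\<close>

lemma vertical_foot:
  assumes p: "p \<in> S - C" and nu: "N p \<bullet> d \<noteq> 0" and r: "r > 0" and \<kappa>: "\<kappa> * \<kappa> = (1::real)"
  shows "\<forall>\<^sub>F t in at_right 0. \<exists>p'\<in>S. dist p' p < r \<and> (\<exists>s. p + (\<kappa> * t) *\<^sub>R N p = p' + s *\<^sub>R d \<and> 0 < \<kappa> * (s * (N p \<bullet> d)))"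
proof -
  obtain U X w0 where ch: "C2_chart S C U X" "w0 \<in> U" "0 < w0 $ 2" "X w0 = p" by (rule chart_at_interior[OF p])
  note cf = C2_chart_facts[OF ch(1)]
  have w0': "0 \<le> w0 $ 2" using ch by simp
  obtain \<delta>1 where \<delta>1: "\<delta>1 > 0" "ball w0 \<delta>1 \<subseteq> U" "\<And>w w' s. w \<in> ball w0 \<delta>1 \<Longrightarrow> w' \<in> ball w0 \<delta>1 \<Longrightarrow> X w' = X w + s *\<^sub>R d \<Longrightarrow> w' = w"
    using local_transversal[OF cf(1,2) ch(2) cf(3)[OF ch(2)] N_orth[OF ch(1,2) w0']] nu unfolding ch(4) by blast
  have "\<forall>\<^sub>F w in nhds w0. dist (X w) p < r"
    using isCont_near[OF C2_on_partial_isCont(1)[OF cf(2) ch(2)] r] unfolding ch(4) .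
  moreover have "isCont (\<lambda>w. w $ 2) w0" by (intro continuous_intros)
  then have "\<forall>\<^sub>F w in nhds w0. dist (w $ 2) (w0 $ 2) < w0 $ 2" using ch(3) by (rule isCont_near)
  then have "\<forall>\<^sub>F w in nhds w0. 0 < w $ 2" by (rule eventually_mono) (auto simp: dist_real_def)
  ultimately have "\<forall>\<^sub>F w in nhds w0. dist (X w) p < r \<and> 0 < w $ 2" by (rule eventually_conj)
  then obtain \<delta>2 where \<delta>2: "\<delta>2 > 0" "\<And>w. dist w w0 < \<delta>2 \<Longrightarrow> dist (X w) p < r \<and> 0 < w $ 2"
    unfolding eventually_nhds_metric by blast
  define \<delta> where "\<delta> = min \<delta>1 \<delta>2"
  have \<delta>: "\<delta> > 0" using \<delta>1 \<delta>2 by (simp add: \<delta>_def)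
  have sub: "ball w0 \<delta> \<subseteq> U" using \<delta>1(2) by (auto simp: \<delta>_def)
  have inj: "w' = w" if "w \<in> ball w0 \<delta>" "w' \<in> ball w0 \<delta>" "X w' = X w + s *\<^sub>R d" for w w' s
    by (rule \<delta>1(3)[OF _ _ that(3)]) (use that in \<open>auto simp: \<delta>_def\<close>)
  have near: "X w \<in> S" "dist (X w) p < r" if "w \<in> ball w0 \<delta>" for w
  proof -
    have "dist w w0 < \<delta>2" using that by (simp add: \<delta>_def dist_commute)
    then have "dist (X w) p < r \<and> 0 < w $ 2" by (rule \<delta>2(2))
    then show "X w \<in> S" "dist (X w) p < r" using cf(4)[of w] sub that by auto
  qed
  have cX: "continuous_on (ball w0 \<delta>) X" using cf(5) sub continuous_on_subset by blast
  obtain T g where T: "open T" "homeomorphism (ball w0 \<delta> \<times> UNIV) T (\<lambda>(w, s). X w + s *\<^sub>R d) g"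
    by (rule lift_homeomorphism[OF open_ball cX d_nz inj]) auto
  define Z where "Z = (\<lambda>x. X (fst (g x)))"
  have gZ: "g (X w + s *\<^sub>R d) = (w, s)" if "w \<in> ball w0 \<delta>" for w s
    using homeomorphism_apply1[OF T(2), of "(w, s)"] that by simp
  have Zeq: "Z (X w + s *\<^sub>R d) = X w" if "w \<in> ball w0 \<delta>" for w s using gZ[OF that] by (simp add: Z_def)
  have dX: "(X has_derivative frechet_derivative X (at w0)) (at w0)"
    using partial_has_derivative(1)[OF cf(2) ch(2)] .
  have w0b: "w0 \<in> ball w0 \<delta>" using \<delta> by simp
  have nuX: "N (X w0) \<bullet> d \<noteq> 0" using nu ch(4) by simp
  let ?X' = "frechet_derivative X (at w0)"
  have "\<exists>f. (Z has_derivative f) (at (X w0 + 0 *\<^sub>R d)) \<and>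
    (\<forall>a b. d \<bullet> cross3 (f a) b + d \<bullet> cross3 a (f b) =
      (d \<bullet> cross3 (?X' (axis 1 1)) (?X' (axis 2 1)) + d \<bullet> cross3 (?X' (axis 1 1)) (?X' (axis 2 1)))
        / (d \<bullet> cross3 (?X' (axis 1 1)) (?X' (axis 2 1))) * (d \<bullet> cross3 a b)) \<and> (\<forall>x. \<exists>v. f x = ?X' v)"
    by (rule lift_derivative_range[OF open_ball cX d_nz inj w0b dX dX refl chart_jacobian_nz[OF ch(1,2) w0' nuX] Zeq scaleR_one[symmetric]])
  then obtain f where f: "(Z has_derivative f) (at (X w0 + 0 *\<^sub>R d))" "\<forall>x. \<exists>z. f x = ?X' z" by blast
  have f': "(Z has_derivative f) (at (p + (\<kappa> * 0) *\<^sub>R N p))" using f(1) ch(4) by simp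
  have Nf: "N p \<bullet> f x = 0" for x using f(2) N_orth[OF ch(1,2) w0'] ch(4) by metis
  define G where "G = (\<lambda>t. \<kappa> * (N p \<bullet> (p + (\<kappa> * t) *\<^sub>R N p - Z (p + (\<kappa> * t) *\<^sub>R N p))))"
  have path: "((\<lambda>t. p + (\<kappa> * t) *\<^sub>R N p) has_derivative (\<lambda>t. (\<kappa> * t) *\<^sub>R N p)) (at 0)"
    by (auto intro!: derivative_eq_intros)
  have "((\<lambda>t. Z (p + (\<kappa> * t) *\<^sub>R N p)) has_derivative (\<lambda>t. f ((\<kappa> * t) *\<^sub>R N p))) (at 0)"
    using has_derivative_compose[OF path f'] .
  then have "(G has_derivative (\<lambda>t. \<kappa> * (N p \<bullet> ((\<kappa> * t) *\<^sub>R N p - f ((\<kappa> * t) *\<^sub>R N p))))) (at 0)"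
    unfolding G_def by (intro has_derivative_mult_right has_derivative_inner_right has_derivative_diff path)
  moreover have "(\<lambda>t. \<kappa> * (N p \<bullet> ((\<kappa> * t) *\<^sub>R N p - f ((\<kappa> * t) *\<^sub>R N p)))) = times 1"
  proof
    fix t
    have "N p \<bullet> N p = 1" using N_norm p by (simp add: norm_eq_1)
    then have "\<kappa> * (N p \<bullet> ((\<kappa> * t) *\<^sub>R N p - f ((\<kappa> * t) *\<^sub>R N p))) = (\<kappa> * \<kappa>) * t" by (simp add: inner_diff_right Nf)
    then show "\<kappa> * (N p \<bullet> ((\<kappa> * t) *\<^sub>R N p - f ((\<kappa> * t) *\<^sub>R N p))) = 1 * t" by (simp add: \<kappa>)
  qed
  ultimately have "(G has_real_derivative 1) (at 0)" by (simp add: has_field_derivative_def)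
  from DERIV_pos_inc_right[OF this] obtain \<epsilon> where \<epsilon>: "\<epsilon> > 0" "\<And>h. h > 0 \<Longrightarrow> h < \<epsilon> \<Longrightarrow> G 0 < G h" by auto
  have Zp: "Z p = p" using Zeq[OF w0b, of 0] ch(4) by simp
  have G0: "G 0 = 0" by (simp add: G_def Zp)
  have ev1: "\<forall>\<^sub>F t in at_right 0. 0 < G t"
    unfolding eventually_at_right_field using \<epsilon> G0 by (intro exI[of _ \<epsilon>]) auto
  have "p \<in> T"
    using homeomorphism_image1[OF T(2)] w0b ch(4) by (auto intro!: image_eqI[of _ _ "(w0, 0)"])
  moreover have "((\<lambda>t. p + (\<kappa> * t) *\<^sub>R N p) \<longlongrightarrow> p + (\<kappa> * 0) *\<^sub>R N p) (at_right 0)" by (intro tendsto_intros)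
  ultimately have ev2: "\<forall>\<^sub>F t in at_right 0. p + (\<kappa> * t) *\<^sub>R N p \<in> T" using T(1) topological_tendstoD by fastforce
  from ev1 ev2 show ?thesis
  proof eventually_elim
    fix t assume t: "0 < G t" "p + (\<kappa> * t) *\<^sub>R N p \<in> T"
    then have "p + (\<kappa> * t) *\<^sub>R N p \<in> (\<lambda>(w, s). X w + s *\<^sub>R d) ` (ball w0 \<delta> \<times> UNIV)"
      using homeomorphism_image1[OF T(2)] by simp
    then obtain z where z: "z \<in> ball w0 \<delta> \<times> UNIV" "p + (\<kappa> * t) *\<^sub>R N p = (\<lambda>(w, s). X w + s *\<^sub>R d) z" by blast
    obtain w s where ws: "z = (w, s)" by (cases z)
    have w: "w \<in> ball w0 \<delta>" "p + (\<kappa> * t) *\<^sub>R N p = X w + s *\<^sub>R d" using z unfolding ws by simp_all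
    have "G t = \<kappa> * (s * (N p \<bullet> d))" unfolding G_def w(2) Zeq[OF w(1)] by simp
    then show "\<exists>p'\<in>S. dist p' p < r \<and> (\<exists>s. p + (\<kappa> * t) *\<^sub>R N p = p' + s *\<^sub>R d \<and> 0 < \<kappa> * (s * (N p \<bullet> d)))"
      using near[OF w(1)] w(2) t(1) by (intro bexI[of _ "X w"]) auto
  qed
qed

text \<open>With a downward normal the outer point \<open>p + t *\<^sub>R N p\<close> lies below the
  local sheet. If \<open>S\<close> has no point below that sheet, \<open>below_in_Omega\<close> puts
  the outer point into the drop.\<close>

lemma not_downward:
  assumes p: "p \<in> S - C" and nu: "N p \<bullet> d < 0" and r: "r > 0"
    and free: "\<And>p' s. p' \<in> S \<Longrightarrow> dist p' p < r \<Longrightarrow> s > 0 \<Longrightarrow> p' - s *\<^sub>R d \<notin> S"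
  shows False
proof -
  have nu0: "N p \<bullet> d \<noteq> 0" using nu by simp
  have e1: "\<forall>\<^sub>F t in at_right 0. \<exists>p'\<in>S. dist p' p < r \<and> (\<exists>s. p + (1 * t) *\<^sub>R N p = p' + s *\<^sub>R d \<and> 0 < 1 * (s * (N p \<bullet> d)))"
    by (rule vertical_foot[OF p nu0 r]) simp
  have "((\<lambda>t. p + t *\<^sub>R N p) \<longlongrightarrow> p + 0 *\<^sub>R N p) (at_right 0)" by (intro tendsto_intros)
  then have e2: "\<forall>\<^sub>F t in at_right 0. p + t *\<^sub>R N p \<in> I" using I_open S_not_C[OF p] topological_tendstoD by fastforce
  obtain t where a: "\<exists>p'\<in>S. dist p' p < r \<and> (\<exists>s. p + (1 * t) *\<^sub>R N p = p' + s *\<^sub>R d \<and> 0 < 1 * (s * (N p \<bullet> d)))"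
      and I': "p + t *\<^sub>R N p \<in> I" and O: "p - t *\<^sub>R N p \<in> \<Omega> \<and> p + t *\<^sub>R N p \<notin> \<Omega>"
    using eventually_happens'[OF trivial_limit_at_right_real eventually_conj[OF e1 eventually_conj[OF e2 N_side[OF p]]]] by blast
    obtain p' s where s: "p' \<in> S" "dist p' p < r" "p + t *\<^sub>R N p = p' + s *\<^sub>R d" "0 < s * (N p \<bullet> d)" using a by auto
    have "s < 0" using s(4) nu by (auto simp: zero_less_mult_iff)
    have "p + t *\<^sub>R N p \<in> \<Omega>"
    proof (rule below_in_Omega[OF I'])
      fix u :: real assume "0 \<le> u"
      then have "u - s > 0" using \<open>s < 0\<close> by linarith
      then have "p' - (u - s) *\<^sub>R d \<notin> S" by (rule free[OF s(1,2)])
      then show "p + t *\<^sub>R N p - u *\<^sub>R d \<notin> S" unfolding s(3) by (simp add: algebra_simps)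
    qed
  then show False using O by blast
qed

lemma Omega_ray_up:
  assumes M: "high M \<subseteq> I" and S: "\<And>p. p \<in> S \<Longrightarrow> d \<bullet> p \<le> M" and x: "x \<in> \<Omega>" and free: "\<And>s. 0 \<le> s \<Longrightarrow> x + s *\<^sub>R d \<notin> S"
  shows "high M \<inter> \<Omega> \<noteq> {}"
proof -
  define s where "s = \<bar>M - d \<bullet> x\<bar> + 1"
  have "x \<in> I" using x Omega_component(1) in_components_subset by blast
  then have xI: "n j \<bullet> x < c j" "m \<bullet> x < b" for j using I_iff by auto
  define K where "K = (\<lambda>s. x + s *\<^sub>R d) ` {0..}"
  have 0: "x + s *\<^sub>R d \<in> high M" using xI by (auto simp: high_def n_shift inner_add_right dd nd s_def abs_if)
  have 2: "x \<in> K" unfolding K_def by (intro image_eqI[of _ _ 0]) auto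
  have 3: "connected K" unfolding K_def by (intro connected_continuous_image continuous_intros) auto
  have "m \<bullet> (x + t *\<^sub>R d) < b" if "0 \<le> t" for t
    using xI(2) md that mult_nonneg_nonpos[of t "m \<bullet> d"] by (simp add: m_shift)
  then have 4: "K \<subseteq> I - S" using xI free by (auto simp: K_def I_iff n_shift)
  have "K \<subseteq> \<Omega>" by (rule Omega_absorb[OF x 2 3 4])
  moreover have "x + s *\<^sub>R d \<in> K" by (auto simp: K_def s_def)
  ultimately show ?thesis using 0 by blast
qed

text \<open>Mirror image of \<open>not_downward\<close>: the inner point
  \<open>p - t *\<^sub>R N p\<close> lies above the local sheet, and the ray upward would connect
  the drop with the open end.\<close>

lemma not_upward:
  assumes p: "p \<in> S - C" and nu: "N p \<bullet> d < 0" and r: "r > 0"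
    and M: "high M \<subseteq> I" "\<And>p. p \<in> S \<Longrightarrow> d \<bullet> p \<le> M" "high M \<inter> \<Omega> = {}"
    and free: "\<And>p' s. p' \<in> S \<Longrightarrow> dist p' p < r \<Longrightarrow> s > 0 \<Longrightarrow> p' + s *\<^sub>R d \<notin> S"
  shows False
proof -
  have nu0: "N p \<bullet> d \<noteq> 0" using nu by simp
  have e1: "\<forall>\<^sub>F t in at_right 0. \<exists>p'\<in>S. dist p' p < r \<and> (\<exists>s. p + (- 1 * t) *\<^sub>R N p = p' + s *\<^sub>R d \<and> 0 < - 1 * (s * (N p \<bullet> d)))"
    by (rule vertical_foot[OF p nu0 r]) simp
  obtain t where a: "\<exists>p'\<in>S. dist p' p < r \<and> (\<exists>s. p + (- 1 * t) *\<^sub>R N p = p' + s *\<^sub>R d \<and> 0 < - 1 * (s * (N p \<bullet> d)))"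
      and O: "p - t *\<^sub>R N p \<in> \<Omega> \<and> p + t *\<^sub>R N p \<notin> \<Omega>"
    using eventually_happens'[OF trivial_limit_at_right_real eventually_conj[OF e1 N_side[OF p]]] by blast
    obtain p' s where s: "p' \<in> S" "dist p' p < r" "p - t *\<^sub>R N p = p' + s *\<^sub>R d" "s * (N p \<bullet> d) < 0" using a by auto
    have "s > 0" using s(4) nu by (auto simp: mult_less_0_iff)
    have "p - t *\<^sub>R N p + u *\<^sub>R d \<notin> S" if "0 \<le> u" for u
    proof -
      have "s + u > 0" using \<open>s > 0\<close> that by linarith
      then have "p' + (s + u) *\<^sub>R d \<notin> S" by (rule free[OF s(1,2)])
      then show ?thesis unfolding s(3) by (simp add: algebra_simps)
    qed
    moreover have "p - t *\<^sub>R N p \<in> \<Omega>" using O by blast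
  ultimately show False using Omega_ray_up[OF M(1,2)] M(3) by blast
qed

lemma interior_dense:
  assumes "p \<in> S" "r > 0"
  shows "\<exists>p'\<in>S - C. dist p' p < r"
proof -
  obtain y where y: "y \<in> D0" "p = \<phi> y" using assms(1) unfolding S by blast
  define z where "z = (\<lambda>k. (1 - inverse (real (Suc (Suc k)))) *\<^sub>R y)"
  have fac: "0 \<le> 1 - inverse (real (Suc (Suc k)))" "1 - inverse (real (Suc (Suc k))) < 1" for k
    by (simp_all add: inverse_le_1_iff)
  have zn: "norm (z k) < 1" for k
  proof -
    have "norm (z k) = (1 - inverse (real (Suc (Suc k)))) * norm y" using fac[of k] by (simp add: z_def)
    also have "\<dots> \<le> (1 - inverse (real (Suc (Suc k)))) * 1" using y(1) fac[of k] by (intro mult_left_mono) auto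
    also have "\<dots> < 1" using fac[of k] by simp
    finally show ?thesis .
  qed
  have zD: "z k \<in> D0" for k using zn[of k] disk_facts(2) by auto
  have "(\<lambda>k. inverse (real (Suc (Suc k)))) \<longlonglongrightarrow> 0" using LIMSEQ_Suc[OF LIMSEQ_inverse_real_of_nat] .
  then have "z \<longlonglongrightarrow> (1 - 0) *\<^sub>R y" unfolding z_def by (intro tendsto_intros)
  then have "(\<lambda>k. \<phi> (z k)) \<longlonglongrightarrow> \<phi> y" using phi_tendsto[OF zD _ y(1)] by simp
  then obtain k where "dist (\<phi> (z k)) p < r"
    using tendstoD[OF _ assms(2)] eventually_happens'[OF sequentially_bot] unfolding y(2) by blast
  moreover have "\<phi> (z k) \<in> S - C" using C_iff[OF zD[of k]] zn[of k] zD[of k] unfolding S by auto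
  ultimately show ?thesis by blast
qed

lemma interior_near_corner:
  assumes "e > 0"
  shows "\<exists>p\<in>S - C. dist (hor p) (hor (q i)) < e"
proof -
  obtain \<delta> where \<delta>: "\<delta> > 0" "\<And>y. y \<in> D0 \<Longrightarrow> dist y (v i) < \<delta> \<Longrightarrow> dist (hor (\<phi> y)) (hor (q i)) < e"
    using vertex_limit[OF assms] by blast
  define \<mu> where "\<mu> = min (\<delta> / 2) (1 / 2)"
  have mu: "0 < \<mu>" "\<mu> < \<delta>" "\<mu> < 1" using \<delta>(1) by (auto simp: \<mu>_def min_def)
  define y where "y = (1 - \<mu>) *\<^sub>R v i"
  have ny: "norm y < 1" using mu by (simp add: y_def v_sphere)
  have yD: "y \<in> D0" using ny disk_facts(2) by auto
  have "y - v i = (- \<mu>) *\<^sub>R v i" by (simp add: y_def algebra_simps)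
  then have "dist y (v i) = \<mu>" using mu by (simp add: dist_norm v_sphere)
  then have "dist (hor (\<phi> y)) (hor (q i)) < e" using \<delta>(2)[OF yD] mu by simp
  moreover have "\<phi> y \<in> S - C" using C_iff[OF yD] ny yD unfolding S by auto
  ultimately show ?thesis by blast
qed

lemma hor_dist_le: "dist (hor x) (hor y) \<le> dist x y"
  using norm_hor_le[of "x - y"] by (simp add: dist_norm hor_simps)

text \<open>Near a corner there is a single sheet, so nothing lies below it and
  \<open>not_downward\<close> applies.\<close>

lemma corner_normal:
  "\<exists>e>0. \<forall>p\<in>S - C. dist (hor p) (hor (q i)) < e \<longrightarrow> 0 \<le> N p \<bullet> d"
proof -
  obtain e where e: "e > 0" "\<And>p p'. p \<in> S \<Longrightarrow> p' \<in> S \<Longrightarrow> hor p = hor p' \<Longrightarrow> dist (hor p) (hor (q i)) < e \<Longrightarrow> p = p'"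
    using corner_single_sheet[of i] by blast
  have "0 \<le> N p \<bullet> d" if p: "p \<in> S - C" "dist (hor p) (hor (q i)) < e" for p
  proof (rule ccontr)
    assume "\<not> 0 \<le> N p \<bullet> d"
    then have nu: "N p \<bullet> d < 0" by simp
    define r where "r = e - dist (hor p) (hor (q i))"
    have "r > 0" using p(2) by (simp add: r_def)
    then show False
    proof (rule not_downward[OF p(1) nu])
      fix p' and s :: real assume p': "p' \<in> S" "dist p' p < r" "s > 0"
      have "dist (hor p') (hor (q i)) \<le> dist (hor p') (hor p) + dist (hor p) (hor (q i))" by (rule dist_triangle)
      also have "\<dots> < e" using hor_dist_le[of p' p] p'(2) by (simp add: r_def)
      finally have d': "dist (hor p') (hor (q i)) < e" .
      show "p' - s *\<^sub>R d \<notin> S"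
      proof
        assume "p' - s *\<^sub>R d \<in> S"
        then have "p' = p' - s *\<^sub>R d" using e(2)[OF p'(1) _ _ d'] by (simp add: hor_simps)
        then show False using p'(3) d_nz by simp
      qed
    qed
  qed
  then show ?thesis using e(1) by blast
qed

text \<open>Near a corner every vertical line meets \<open>S\<close> at most once, so a point off
  \<open>S\<close> can leave either downward or upward without meeting \<open>S\<close>. A drop that
  contains both the base region and the open end would then contain both sides of the sheet, against
  the definition of the normal.\<close>

lemma top_not_in_Omega:
  assumes M: "high M \<subseteq> I" and Sb: "\<And>p. p \<in> S \<Longrightarrow> d \<bullet> p \<le> M"
  shows "high M \<inter> \<Omega> = {}"
proof (rule ccontr)
  assume "high M \<inter> \<Omega> \<noteq> {}"
  then obtain z where z: "z \<in> \<Omega>" "z \<in> high M" by blast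
  fix i :: 3
  obtain e where e: "e > 0" "\<And>p p'. p \<in> S \<Longrightarrow> p' \<in> S \<Longrightarrow> hor p = hor p' \<Longrightarrow> dist (hor p) (hor (q i)) < e \<Longrightarrow> p = p'"
    using corner_single_sheet[of i] by blast
  obtain p where p: "p \<in> S - C" "dist (hor p) (hor (q i)) < e" using interior_near_corner[OF e(1)] by blast
  have pS: "p \<in> S" "N p \<bullet> N p = 1" using p N_norm by (auto simp: norm_eq_1)
  then have pNN: "N p \<bullet> N p \<noteq> 0" by simp
  obtain \<rho> where \<rho>: "\<rho> > 0" "\<And>p1 p2 s. p1 \<in> S \<Longrightarrow> p2 \<in> S \<Longrightarrow> dist p1 p < \<rho> \<Longrightarrow> dist p2 p < \<rho> \<Longrightarrow> p2 = p1 + s *\<^sub>R N p \<Longrightarrow> p2 = p1"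
    using local_sheet[OF pS(1) pNN] by blast
  define r where "r = min \<rho> (e - dist (hor p) (hor (q i)))"
  have r: "r > 0" using p(2) \<rho>(1) by (simp add: r_def)
  have lim: "((\<lambda>t. p + t *\<^sub>R N p) \<longlongrightarrow> p + 0 *\<^sub>R N p) (at_right 0)" by (intro tendsto_intros)
  then have e1: "\<forall>\<^sub>F t in at_right 0. p + t *\<^sub>R N p \<in> I" using I_open S_not_C[OF p(1)] topological_tendstoD by fastforce
  have e2: "\<forall>\<^sub>F t in at_right 0. dist (p + t *\<^sub>R N p) p < r" using tendstoD[OF lim r] by simp
  have e3: "\<forall>\<^sub>F t in at_right 0. (0::real) < t" by (simp add: eventually_at_right_less)
  obtain t where xI: "p + t *\<^sub>R N p \<in> I" and near: "dist (p + t *\<^sub>R N p) p < r" and t: "0 < t"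
      and O: "p - t *\<^sub>R N p \<in> \<Omega> \<and> p + t *\<^sub>R N p \<notin> \<Omega>"
    using eventually_happens'[OF trivial_limit_at_right_real eventually_conj[OF e1 eventually_conj[OF e2 eventually_conj[OF e3 N_side[OF p(1)]]]]] by blast
    define x where "x = p + t *\<^sub>R N p"
    have xS: "x \<notin> S"
    proof
      assume "x \<in> S"
      then have "x = p" by (rule \<rho>(2)[OF pS(1), of x t]) (use near \<rho>(1) in \<open>auto simp: x_def r_def\<close>)
      then show False using t pS(2) by (auto simp: x_def)
    qed
    have "dist (hor x) (hor (q i)) \<le> dist (hor x) (hor p) + dist (hor p) (hor (q i))" by (rule dist_triangle)
    also have "\<dots> < e" using hor_dist_le[of x p] near by (simp add: r_def x_def)
    finally have dx: "dist (hor x) (hor (q i)) < e" .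
    have one: "s = s'" if "x + s *\<^sub>R d \<in> S" "x + s' *\<^sub>R d \<in> S" for s s'
    proof -
      have "x + s *\<^sub>R d = x + s' *\<^sub>R d" by (rule e(2)[OF that]) (use dx in \<open>auto simp: hor_simps\<close>)
      then show ?thesis using d_nz by simp
    qed
    have "x \<in> \<Omega>"
    proof (cases "\<exists>s\<ge>0. x + s *\<^sub>R d \<in> S")
      case True
      then obtain s where s: "s \<ge> 0" "x + s *\<^sub>R d \<in> S" by blast
      have "s \<noteq> 0" using s xS by auto
      show ?thesis
      proof (rule below_in_Omega)
        show "x \<in> I" using xI by (simp add: x_def)
        show "x - u *\<^sub>R d \<notin> S" if "0 \<le> u" for u
          using one[of s "- u"] s that \<open>s \<noteq> 0\<close> by auto
      qed
    next
      case False
      then show ?thesis by (intro above_in_Omega[OF Sb M z]) (use xI in \<open>auto simp: x_def\<close>)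
    qed
  then show False using O by (simp add: x_def)
qed

end

section \<open>Maxima of the height difference\<close>

lemma unit_eq_or_neg:
  fixes u w a b :: "real^3"
  assumes "u \<bullet> a = 0" "u \<bullet> b = 0" "w \<bullet> a = 0" "w \<bullet> b = 0" "cross3 a b \<noteq> 0" "u \<bullet> u = w \<bullet> w"
  shows "u = w \<or> u = - w"
proof -
  define s where "s = sgn (cross3 a b)"
  have u: "u = (u \<bullet> s) *\<^sub>R s" unfolding s_def by (rule parallel_if_orthogonal_to_both[OF assms(1,2,5)])
  have w: "w = (w \<bullet> s) *\<^sub>R s" unfolding s_def by (rule parallel_if_orthogonal_to_both[OF assms(3,4,5)])
  have "norm s = 1" using assms(5) by (simp add: s_def norm_sgn)
  then have ss: "s \<bullet> s = 1" by (simp add: norm_eq_1)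
  have "u \<bullet> u = (u \<bullet> s) * (u \<bullet> s)"
  proof -
    have "u \<bullet> u = ((u \<bullet> s) *\<^sub>R s) \<bullet> ((u \<bullet> s) *\<^sub>R s)" using u by (rule arg_cong2[of _ _ _ _ "(\<bullet>)", OF _ u])
    then show ?thesis by (simp add: ss)
  qed
  moreover have "w \<bullet> w = (w \<bullet> s) * (w \<bullet> s)"
  proof -
    have "w \<bullet> w = ((w \<bullet> s) *\<^sub>R s) \<bullet> ((w \<bullet> s) *\<^sub>R s)" using w by (rule arg_cong2[of _ _ _ _ "(\<bullet>)", OF _ w])
    then show ?thesis by (simp add: ss)
  qed
  ultimately have "(u \<bullet> s) * (u \<bullet> s) = (w \<bullet> s) * (w \<bullet> s)" using assms(6) by simp
  then have "u \<bullet> s = w \<bullet> s \<or> u \<bullet> s = - (w \<bullet> s)" by (simp add: square_eq_iff)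
  then show ?thesis
  proof
    assume "u \<bullet> s = w \<bullet> s" then show ?thesis using u w by metis
  next
    assume "u \<bullet> s = - (w \<bullet> s)"
    then have "u = - ((w \<bullet> s) *\<^sub>R s)" using u by (metis scaleR_minus_left)
    then show ?thesis using w by metis
  qed
qed

text \<open>Fermat's condition along \<open>w0 + t *\<^sub>R z\<close>. At a boundary point only
  directions tangent to the contact line can be followed both ways.\<close>

lemma extremal_direction:
  assumes ch: "C2_chart S C U X" and w0: "w0 \<in> U" "0 \<le> w0 $ 2" "0 < w0 $ 2 \<or> z $ 2 = 0"
    and F: "(F has_derivative F') (at (X w0))" "\<And>p. p \<in> S \<Longrightarrow> F p \<le> (F (X w0) :: real)"
  shows "F' (frechet_derivative X (at w0) z) = 0"
proof -
  note cf = C2_chart_facts[OF ch]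
  let ?X' = "frechet_derivative X (at w0)"
  have path: "((\<lambda>t. w0 + t *\<^sub>R z) has_derivative (\<lambda>t. t *\<^sub>R z)) (at 0)" by (auto intro!: derivative_eq_intros)
  have dX: "(X has_derivative ?X') (at (w0 + 0 *\<^sub>R z))" using partial_has_derivative(1)[OF cf(2) w0(1)] by simp
  have "((\<lambda>t. X (w0 + t *\<^sub>R z)) has_derivative (\<lambda>t. ?X' (t *\<^sub>R z))) (at 0)" by (rule has_derivative_compose[OF path dX])
  then have "((\<lambda>t. F (X (w0 + t *\<^sub>R z))) has_derivative (\<lambda>t. F' (?X' (t *\<^sub>R z)))) (at 0)"
    by (rule has_derivative_compose) (use F(1) in simp)
  moreover have "(\<lambda>t. F' (?X' (t *\<^sub>R z))) = times (F' (?X' z))"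
    using linear_cmul[OF has_derivative_linear[OF F(1)]] linear_cmul[OF has_derivative_linear[OF dX]]
    by (simp add: fun_eq_iff mult.commute)
  ultimately have D: "((\<lambda>t. F (X (w0 + t *\<^sub>R z))) has_real_derivative F' (?X' z)) (at 0)"
    by (simp add: has_field_derivative_def)
  have "((\<lambda>t. w0 + t *\<^sub>R z) \<longlongrightarrow> w0 + 0 *\<^sub>R z) (nhds 0)" by (intro tendsto_intros filterlim_ident)
  then have e1: "\<forall>\<^sub>F t in nhds 0. w0 + t *\<^sub>R z \<in> U" using cf(1) w0(1) topological_tendstoD by fastforce
  have "\<forall>\<^sub>F t in nhds 0. 0 \<le> (w0 + t *\<^sub>R z) $ 2"
  proof (cases "z $ 2 = 0")
    case True then show ?thesis using w0(2) by simp
  next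
    case False
    have "((\<lambda>t. (w0 + t *\<^sub>R z) $ 2) \<longlongrightarrow> (w0 + 0 *\<^sub>R z) $ 2) (nhds 0)" by (intro tendsto_intros filterlim_ident)
    then have "\<forall>\<^sub>F t in nhds 0. 0 < (w0 + t *\<^sub>R z) $ 2" using w0(3) False by (intro order_tendstoD(1)) auto
    then show ?thesis by (rule eventually_mono) simp
  qed
  with e1 have "\<forall>\<^sub>F t in nhds 0. w0 + t *\<^sub>R z \<in> U \<and> 0 \<le> (w0 + t *\<^sub>R z) $ 2" by (rule eventually_conj)
  then obtain \<epsilon> where \<epsilon>: "\<epsilon> > 0" "\<And>t. dist t 0 < \<epsilon> \<Longrightarrow> w0 + t *\<^sub>R z \<in> U \<and> 0 \<le> (w0 + t *\<^sub>R z) $ 2"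
    unfolding eventually_nhds_metric by blast
  show ?thesis
  proof (rule DERIV_local_max[OF D \<epsilon>(1)], intro allI impI)
    fix t :: real assume "\<bar>0 - t\<bar> < \<epsilon>"
    then have "X (w0 + t *\<^sub>R z) \<in> S" using \<epsilon>(2)[of t] cf(4) by (simp add: dist_real_def)
    then show "F (X (w0 + t *\<^sub>R z)) \<le> F (X (w0 + 0 *\<^sub>R z))" using F(2) by simp
  qed
qed

context capillary_drop begin

text \<open>Makes \<open>sg * (H - H0)\<close> nonnegative, the sign of the term without derivatives
  of the cutoff in the divergence.\<close>

definition sg :: real where "sg = (if H0 \<le> H then 1 else - 1)"
definition yv :: "real^3 \<Rightarrow> real" where "yv p = sg * height p"

lemma sg: "sg * sg = 1" "sg = 1 \<or> sg = - 1" "0 \<le> sg * (H - H0)"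
  by (auto simp: sg_def)

lemma yv_has_derivative:
  "norm (P x) < 1 \<Longrightarrow> (yv has_derivative (\<lambda>z. sg * ((W x \<bullet> z) / om x))) (at x)"
  unfolding yv_def[abs_def] by (intro has_derivative_mult_right height_has_derivative)

lemma yv_shift: "norm (P x) < 1 \<Longrightarrow> yv (x + s *\<^sub>R d) = yv x + sg * s"
  by (simp add: yv_def height_shift algebra_simps)

lemma isCont_cap:
  assumes "norm (P x) < 1"
  shows "isCont yv x" "isCont W x" "isCont om x"
  by (rule has_derivative_continuous[OF yv_has_derivative[OF assms]], rule has_derivative_continuous[OF W_has_derivative[OF assms]],
    rule has_derivative_continuous[OF om_has_derivative[OF assms]])

lemma cap_continuous_on: "continuous_on S yv" "continuous_on S W" "continuous_on S om"
  using isCont_cap[OF P_S] by (auto intro!: continuous_at_imp_continuous_on)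

lemma S_near:
  assumes "continuous_on S f" "p \<in> S" "e > 0"
  shows "\<exists>r>0. \<forall>p'\<in>S. dist p' p < r \<longrightarrow> dist (f p') (f p) < (e::real)"
  using assms unfolding continuous_on_iff by blast

text \<open>At an interior maximum both normals are orthogonal to the same tangent plane. On a
  contact line only the derivative along the line is available: \<open>N p\<close> and
  \<open>W p\<close> are orthogonal to its tangent \<open>a\<close> and have the same component
  along \<open>n j\<close>, so they agree or are mirror images, and in the latter case the vertical
  component is reversed.\<close>

lemma max_normal_cases:
  assumes p: "p \<in> S" and max: "\<And>p'. p' \<in> S \<Longrightarrow> yv p' \<le> yv p"
  shows "N p = W p \<or> N p \<bullet> d = - om p"
proof -
  obtain U X w0 where ch: "C2_chart S C U X" "w0 \<in> U" "0 \<le> w0 $ 2" "X w0 = p" by (rule chart_at[OF p])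
  note cf = C2_chart_facts[OF ch(1)]
  let ?X' = "frechet_derivative X (at w0)"
  have Pp: "norm (P p) < 1" by (rule P_S[OF p])
  have omp: "om p > 0" by (rule om_pos[OF Pp])
  have NN: "N p \<bullet> N p = 1" and WW: "W p \<bullet> W p = 1"
    using N_norm[OF p] W_norm[of p] Pp by (simp_all add: norm_eq_1)
  have tang: "W p \<bullet> ?X' z = 0" if "0 < w0 $ 2 \<or> z $ 2 = 0" for z
  proof -
    have "sg * ((W p \<bullet> ?X' z) / om p) = 0"
      by (rule extremal_direction[OF ch(1-3) that, where F = yv]) (use yv_has_derivative[OF Pp] max ch(4) in auto)
    then show ?thesis using sg(1) omp by auto
  qed
  have orth: "N p \<bullet> ?X' z = 0" for z using N_orth[OF ch(1-3)] ch(4) by simp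
  show ?thesis
  proof (cases "w0 $ 2 = 0")
    case False
    then have pos: "0 < w0 $ 2" using ch(3) by simp
    have c0: "cross3 (?X' (axis 1 1)) (?X' (axis 2 1)) \<noteq> 0"
      using cross_partial_nonzero[OF cf(2) ch(2) cf(3)[OF ch(2)]] by (simp add: partial_def)
    have "N p = W p \<or> N p = - W p"
      by (rule unit_eq_or_neg[OF orth orth tang tang c0]) (use pos NN WW in auto)
    then show ?thesis by (auto simp: W_d)
  next
    case True
    then have pC: "p \<in> C" using cf(6)[OF ch(2,3)] ch(4) by simp
    obtain j where j: "n j \<bullet> p = c j" by (rule C_wall[OF pC])
    define a where "a = ?X' (axis 1 1)"
    have Na: "N p \<bullet> a = 0" and Wa: "W p \<bullet> a = 0" using orth tang[of "axis 1 1"] by (simp_all add: a_def axis_def)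
    \<comment> \<open>On \<open>S\<close> the function \<open>n j \<bullet> x\<close> is maximal at
      points of the wall, so its derivative along the contact line vanishes too.\<close>
    have na: "n j \<bullet> a = 0" unfolding a_def
      by (rule extremal_direction[OF ch(1-3), where F = "\<lambda>x. n j \<bullet> x"])
        (auto simp: axis_def ch(4) j S_walls intro!: derivative_eq_intros)
    have "linear ?X'" using has_derivative_linear[OF partial_has_derivative(1)[OF cf(2) ch(2)]] .
    then have a0: "a \<noteq> 0"
      using cf(3)[OF ch(2)] linear_injective_0 by (force simp: a_def axis_eq_0_iff)
    have cr: "cross3 a (n j) \<noteq> 0"
    proof
      assume "cross3 a (n j) = 0"
      then have "(norm a * norm (n j))\<^sup>2 = 0" using norm_cross_dot[of a "n j"] na by (simp add: inner_commute)
      then show False using a0 n1[of j] by simp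
    qed
    have Nn: "N p \<bullet> n j = - cos (\<gamma> j)" by (rule contact_angle) (use pC j in \<open>simp add: plane_def\<close>)
    have Wn: "W p \<bullet> n j = - cos (\<gamma> j)" using W_wall[OF j] by (simp add: inner_commute)
    \<comment> \<open>Components of the two normals within the wall: orthogonal to \<open>a\<close>
      and of equal length.\<close>
    define u where "u = N p + cos (\<gamma> j) *\<^sub>R n j"
    define w where "w = W p + cos (\<gamma> j) *\<^sub>R n j"
    have nW: "n j \<bullet> W p = - cos (\<gamma> j)" "n j \<bullet> N p = - cos (\<gamma> j)" using Nn Wn by (simp_all add: inner_commute)
    have "u = w \<or> u = - w"
    proof (rule unit_eq_or_neg[OF _ _ _ _ cr])
      show "u \<bullet> a = 0" "w \<bullet> a = 0" using Na Wa na by (simp_all add: u_def w_def inner_add_left)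
      show "u \<bullet> n j = 0" "w \<bullet> n j = 0" using Nn Wn nn by (simp_all add: u_def w_def inner_add_left)
      show "u \<bullet> u = w \<bullet> w" using NN WW Nn Wn nW nn by (simp add: u_def w_def inner_add_left inner_add_right)
    qed
    then show ?thesis
    proof
      assume "u = w" then show ?thesis by (simp add: u_def w_def)
    next
      assume "u = - w"
      then have "u \<bullet> d = - (w \<bullet> d)" by simp
      then show ?thesis by (simp add: u_def w_def inner_add_left nd W_d)
    qed
  qed
qed

text \<open>In the reversed case no second sheet lies near \<open>p\<close> on the side of
  increasing \<open>yv\<close>: close by because of \<open>local_sheet\<close>, further off because
  of maximality. That side is below for \<open>sg = - 1\<close>, against
  \<open>not_downward\<close>. It is above for \<open>sg = 1\<close>; then the maximum also bounds
  \<open>S\<close> from above, so the drop does not reach the open end and \<open>not_upward\<close>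
  applies.\<close>

lemma max_normal:
  assumes p: "p \<in> S" and max: "\<And>p'. p' \<in> S \<Longrightarrow> yv p' \<le> yv p"
  shows "N p = W p"
proof (rule ccontr)
  assume "N p \<noteq> W p"
  then have Nd: "N p \<bullet> d = - om p" using max_normal_cases[OF assms] by blast
  have nu: "N p \<bullet> d < 0" using Nd om_pos[OF P_S[OF p]] by simp
  have nu0: "N p \<bullet> d \<noteq> 0" using nu by simp
  obtain \<rho> where \<rho>: "\<rho> > 0" "\<And>p1 p2 s. p1 \<in> S \<Longrightarrow> p2 \<in> S \<Longrightarrow> dist p1 p < \<rho> \<Longrightarrow> dist p2 p < \<rho> \<Longrightarrow> p2 = p1 + s *\<^sub>R d \<Longrightarrow> p2 = p1"
    using local_sheet[OF p nu0] by blast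
  have "\<rho> / 2 > 0" using \<rho>(1) by simp
  then obtain r1 where r1: "r1 > 0" "\<And>p'. p' \<in> S \<Longrightarrow> dist p' p < r1 \<Longrightarrow> dist (yv p') (yv p) < \<rho> / 2"
    using S_near[OF cap_continuous_on(1) p] by blast
  have "continuous_on S (\<lambda>p. N p \<bullet> d)" using N_cont by (intro continuous_intros)
  moreover have "- (N p \<bullet> d) > 0" using nu by simp
  ultimately obtain r2 where r2: "r2 > 0" "\<And>p'. p' \<in> S \<Longrightarrow> dist p' p < r2 \<Longrightarrow> dist (N p' \<bullet> d) (N p \<bullet> d) < - (N p \<bullet> d)"
    using S_near[OF _ p] by blast
  define r where "r = min r1 (\<rho> / 2)"
  have r: "r > 0" using r1(1) \<rho>(1) by (simp add: r_def)
  have free: "p' + (sg * s) *\<^sub>R d \<notin> S" if p': "p' \<in> S" "dist p' p < r" "s > 0" for p' s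
  proof
    assume S': "p' + (sg * s) *\<^sub>R d \<in> S"
    have "yv (p' + (sg * s) *\<^sub>R d) = yv p' + s"
      using yv_shift[OF P_S[OF p'(1)], of "sg * s"] sg(1) by (simp add: mult.assoc[symmetric])
    then have "yv p' + s \<le> yv p" using max[OF S'] by simp
    moreover have "dist (yv p') (yv p) < \<rho> / 2" using r1(2) p' by (simp add: r_def)
    ultimately have s: "s < \<rho> / 2" using p'(3) by (simp add: dist_real_def)
    have "dist (p' + (sg * s) *\<^sub>R d) p \<le> dist (p' + (sg * s) *\<^sub>R d) p' + dist p' p" by (rule dist_triangle)
    also have "dist (p' + (sg * s) *\<^sub>R d) p' = s" using sg(2) p'(3) by (auto simp: dist_norm d1)
    finally have "dist (p' + (sg * s) *\<^sub>R d) p < \<rho>" using s p'(2) by (simp add: r_def)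
    moreover have "dist p' p < \<rho>" using p'(2) \<rho>(1) by (simp add: r_def)
    ultimately have "p' + (sg * s) *\<^sub>R d = p'" using \<rho>(2)[OF p'(1) S'] by blast
    then show False using p'(3) sg(2) d_nz by auto
  qed
  have "min (r / 2) r2 > 0" using r r2(1) by simp
  \<comment> \<open>The lemmas on the sides of \<open>S\<close> concern interior points, so they are
    applied at a nearby \<open>p1\<close> whose normal still points downward.\<close>
  then obtain p1 where p1: "p1 \<in> S - C" "dist p1 p < min (r / 2) r2" using interior_dense[OF p] by blast
  have nu1: "N p1 \<bullet> d < 0" using r2(2)[of p1] p1 nu by (simp add: dist_real_def abs_if split: if_splits)
  have near: "dist p' p < r" if "dist p' p1 < r / 2" for p'
    using dist_triangle[of p' p p1] p1(2) that by simp
  have r': "r / 2 > 0" using r by simp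
  show False
  proof (cases "sg = 1")
    case False
    then have sgm: "sg = - 1" using sg(2) by simp
    show False
      by (rule not_downward[OF p1(1) nu1 r']) (use free near sgm in force)
  next
    case True
    have "\<exists>K. \<forall>x. (\<forall>j. n j \<bullet> x \<le> c j) \<longrightarrow> norm (P x) < 1 \<longrightarrow> \<bar>height x - d \<bullet> x\<bar> \<le> K"
      by (rule height_bound) blast
    then obtain K where K: "\<And>x. (\<And>j. n j \<bullet> x \<le> c j) \<Longrightarrow> norm (P x) < 1 \<Longrightarrow> \<bar>height x - d \<bullet> x\<bar> \<le> K" by blast
    have b: "d \<bullet> p' \<le> height p + K" if "p' \<in> S" for p'
      using K[OF S_walls(1)[OF that] P_S[OF that]] max[OF that] True by (simp add: yv_def abs_le_iff)
    obtain M0 where M0: "\<And>M. M \<ge> M0 \<Longrightarrow> high M \<subseteq> I" using high_subset_I by blast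
    define M where "M = max M0 (height p + K)"
    have M: "high M \<subseteq> I" "\<And>p'. p' \<in> S \<Longrightarrow> d \<bullet> p' \<le> M" using M0 b by (auto simp: M_def intro: le_max_iff_disj[THEN iffD2])
    show False
      by (rule not_upward[OF p1(1) nu1 r' M top_not_in_Omega[OF M]]) (use free near True in auto)
  qed
qed

text \<open>Levels that approach the supremum of \<open>yv\<close> from below. The supremum may be
  infinite, as \<open>S\<close> may be unbounded at a vertex.\<close>

lemma level_sequence:
  "\<exists>\<tau>::nat \<Rightarrow> real. (\<forall>k. \<exists>p\<in>S. \<tau> k < yv p) \<and> (\<forall>p\<in>S. \<forall>e>0. \<forall>\<^sub>F k in sequentially. yv p - e < \<tau> k)"
proof -
  have ne: "yv ` S \<noteq> {}" using interior_near_corner[of 1] by auto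
  show ?thesis
  proof (cases "bdd_above (yv ` S)")
    case True
    define \<tau> where "\<tau> = (\<lambda>k. Sup (yv ` S) - inverse (real (Suc k)))"
    have "\<exists>p\<in>S. \<tau> k < yv p" for k
    proof -
      have "\<tau> k < Sup (yv ` S)" by (simp add: \<tau>_def)
      then show ?thesis using less_cSup_iff[OF ne True] by auto
    qed
    moreover have "\<forall>\<^sub>F k in sequentially. yv p - e < \<tau> k" if "p \<in> S" "e > 0" for p e
    proof -
      have "\<tau> \<longlonglongrightarrow> Sup (yv ` S) - 0" unfolding \<tau>_def by (intro tendsto_intros LIMSEQ_inverse_real_of_nat)
      moreover have "yv p - e < Sup (yv ` S) - 0" using cSup_upper[OF _ True, of "yv p"] that by force
      ultimately show ?thesis by (rule order_tendstoD(1))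
    qed
    ultimately show ?thesis by blast
  next
    case False
    have "\<exists>p\<in>S. real k < yv p" for k 
    proof (rule ccontr)
      assume "\<not> (\<exists>p\<in>S. real k < yv p)"
      then have "bdd_above (yv ` S)" by (intro bdd_aboveI[of _ "real k"]) (auto simp: not_less)
      then show False using False by blast
    qed
    moreover have "\<forall>\<^sub>F k in sequentially. yv p - e < real k" for p e
      using filterlim_at_top_dense[THEN iffD1, OF filterlim_real_sequentially] by blast
    ultimately show ?thesis by (intro exI[of _ real]) simp
  qed
qed

text \<open>Near the supremum of the height difference the surface is a graph over the cross section. Otherwise
  two sheets, or downward normals, accumulate either at a corner or at a maximum point, where
  \<open>N\<close> coincides with the upward normal \<open>W\<close>.\<close>

lemma good_level:
  obtains t' where "\<exists>p\<in>S. t' < yv p"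
    "\<And>p p'. p \<in> S \<Longrightarrow> p' \<in> S \<Longrightarrow> hor p = hor p' \<Longrightarrow> t' < yv p \<Longrightarrow> t' < yv p' \<Longrightarrow> p = p'"
    "\<And>p. p \<in> S - C \<Longrightarrow> t' < yv p \<Longrightarrow> 0 \<le> N p \<bullet> d"
proof -
  define bad where "bad = (\<lambda>t' p. (\<exists>s. s \<noteq> 0 \<and> p + s *\<^sub>R d \<in> S \<and> t' < yv (p + s *\<^sub>R d)) \<or> (p \<in> S - C \<and> N p \<bullet> d < 0))"
  obtain \<tau> where \<tau>: "\<And>k::nat. \<exists>p\<in>S. \<tau> k < yv p" "\<And>p e. p \<in> S \<Longrightarrow> e > 0 \<Longrightarrow> \<forall>\<^sub>F k in sequentially. yv p - e < \<tau> k"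
    using level_sequence by blast
  have "\<exists>k. \<forall>p\<in>S. \<tau> k < yv p \<longrightarrow> \<not> bad (\<tau> k) p"
  proof (rule ccontr)
    assume "\<not> ?thesis"
    then have "\<forall>k. \<exists>p. p \<in> S \<and> \<tau> k < yv p \<and> bad (\<tau> k) p" by blast
    then obtain p where p: "\<And>k. p k \<in> S" "\<And>k. \<tau> k < yv (p k)" "\<And>k. bad (\<tau> k) (p k)" by metis
    show False
    proof (rule S_limit[OF p(1)])
      fix t :: "nat \<Rightarrow> nat" and x assume t: "strict_mono t" "x \<in> S" "(\<lambda>k. p (t k)) \<longlonglongrightarrow> x"
      have sub: "\<forall>\<^sub>F k in sequentially. Q (t k)" if "\<forall>\<^sub>F k in sequentially. Q k" for Q
        using eventually_subseq[OF t(1) that] by simp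
      have lim: "(\<lambda>k. f (p (t k))) \<longlonglongrightarrow> f x" if "continuous_on S f" for f :: "real^3 \<Rightarrow> real"
        using continuous_on_tendsto_compose[OF that t(3,2)] p(1) by simp
      \<comment> \<open>The levels eventually exceed \<open>yv p' - e\<close> for every
        \<open>p'\<close> and every positive \<open>e\<close>, so the limit point is a maximum
        point.\<close>
      have max: "yv p' \<le> yv x" if "p' \<in> S" for p'
      proof (rule field_le_epsilon)
        fix e :: real assume "e > 0"
        have "\<forall>\<^sub>F k in sequentially. yv p' - e \<le> yv (p (t k))"
          using sub[OF \<tau>(2)[OF that \<open>e > 0\<close>]] by (rule eventually_mono) (use p(2) in \<open>meson less_imp_le less_trans\<close>)
        then have "yv p' - e \<le> yv x" by (rule tendsto_lowerbound[OF lim[OF cap_continuous_on(1)]]) simp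
        then show "yv p' \<le> yv x + e" by simp
      qed
      have Nx: "N x \<bullet> d > 0" using max_normal[OF t(2) max] om_pos[OF P_S[OF t(2)]] by (simp add: W_d)
      then have Nx0: "N x \<bullet> d \<noteq> 0" by simp
      obtain \<rho> where \<rho>: "\<rho> > 0" "\<And>p1 p2 s. p1 \<in> S \<Longrightarrow> p2 \<in> S \<Longrightarrow> dist p1 x < \<rho> \<Longrightarrow> dist p2 x < \<rho> \<Longrightarrow> p2 = p1 + s *\<^sub>R d \<Longrightarrow> p2 = p1"
        using local_sheet[OF t(2) Nx0] by blast
      have r4: "\<rho> / 4 > 0" "\<rho> / 2 > 0" using \<rho>(1) by auto
      have "continuous_on S (\<lambda>p. N p \<bullet> d)" using N_cont by (intro continuous_intros)
      from order_tendstoD(1)[OF lim[OF this] Nx]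
      have e1: "\<forall>\<^sub>F k in sequentially. 0 < N (p (t k)) \<bullet> d" .
      have e2: "\<forall>\<^sub>F k in sequentially. yv x - \<rho> / 4 < \<tau> (t k)" by (rule sub[OF \<tau>(2)[OF t(2) r4(1)]])
      have e3: "\<forall>\<^sub>F k in sequentially. dist (p (t k)) x < \<rho> / 2" by (rule tendstoD[OF t(3) r4(2)])
      obtain k where k: "0 < N (p (t k)) \<bullet> d" "yv x - \<rho> / 4 < \<tau> (t k)" "dist (p (t k)) x < \<rho> / 2"
        using eventually_happens'[OF sequentially_bot eventually_conj[OF e1 eventually_conj[OF e2 e3]]] by blast
      define a where "a = p (t k)"
      have a: "a \<in> S" "\<tau> (t k) < yv a" "bad (\<tau> (t k)) a" using p by (simp_all add: a_def)
      then obtain s where s: "s \<noteq> 0" "a + s *\<^sub>R d \<in> S" "\<tau> (t k) < yv (a + s *\<^sub>R d)"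
        using k(1) unfolding bad_def a_def by auto
      have "yv (a + s *\<^sub>R d) = yv a + sg * s" by (rule yv_shift[OF P_S[OF a(1)]])
      \<comment> \<open>Both points have \<open>yv\<close> between \<open>yv x - \<rho> / 4\<close>
        and the maximum \<open>yv x\<close>, which bounds their vertical distance and brings both
        into the range of \<open>local_sheet\<close>.\<close>
      then have "\<bar>sg * s\<bar> < \<rho> / 4" using a(2) s(3) k(2) max[OF a(1)] max[OF s(2)] by linarith
      then have "\<bar>s\<bar> < \<rho> / 4" using sg(2) by (auto simp: abs_mult)
      moreover have "dist (a + s *\<^sub>R d) x \<le> dist (a + s *\<^sub>R d) a + dist a x" by (rule dist_triangle)
      moreover have "dist (a + s *\<^sub>R d) a = \<bar>s\<bar>" by (simp add: dist_norm d1)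
      ultimately have "dist (a + s *\<^sub>R d) x < \<rho>" using k(3) \<rho>(1) by (simp add: a_def)
      moreover have "dist a x < \<rho>" using k(3) \<rho>(1) by (simp add: a_def)
      ultimately have "a + s *\<^sub>R d = a" using \<rho>(2)[OF a(1) s(2)] by blast
      then show False using s(1) d_nz by simp
    next
      fix t :: "nat \<Rightarrow> nat" and i assume t: "strict_mono t" "(\<lambda>k. hor (p (t k))) \<longlonglongrightarrow> hor (q i)"
      obtain e where e: "e > 0" "\<And>p p'. p \<in> S \<Longrightarrow> p' \<in> S \<Longrightarrow> hor p = hor p' \<Longrightarrow> dist (hor p) (hor (q i)) < e \<Longrightarrow> p = p'"
        using corner_single_sheet[of i] by blast
      obtain e' where e': "e' > 0" "\<And>p. p \<in> S - C \<Longrightarrow> dist (hor p) (hor (q i)) < e' \<Longrightarrow> 0 \<le> N p \<bullet> d"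
        using corner_normal[of i] by blast
      have "min e e' > 0" using e(1) e'(1) by simp
      from eventually_happens'[OF sequentially_bot tendstoD[OF t(2) this]]
      obtain k where k: "dist (hor (p (t k))) (hor (q i)) < min e e'" by blast
      define a where "a = p (t k)"
      have a: "a \<in> S" "bad (\<tau> (t k)) a" using p by (simp_all add: a_def)
      have "\<not> (a \<in> S - C \<and> N a \<bullet> d < 0)" using e'(2)[of a] k by (auto simp: a_def)
      then obtain s where s: "s \<noteq> 0" "a + s *\<^sub>R d \<in> S" using a(2) unfolding bad_def by blast
      have "a = a + s *\<^sub>R d" by (rule e(2)[OF a(1) s(2)]) (use k in \<open>auto simp: a_def hor_simps\<close>)
      then show False using s(1) d_nz by simp
    qed
  qed
  then obtain k where k: "\<And>p. p \<in> S \<Longrightarrow> \<tau> k < yv p \<Longrightarrow> \<not> bad (\<tau> k) p" by blast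
  show thesis
  proof (rule that[OF \<tau>(1)[of k]])
    show "p = p'" if pp: "p \<in> S" "p' \<in> S" "hor p = hor p'" "\<tau> k < yv p" "\<tau> k < yv p'" for p p'
    proof -
      obtain s where s: "p' = p + s *\<^sub>R d" using hor_eq_iff[of p' p] pp(3) by auto
      then have "s = 0" using k[OF pp(1,4)] pp(2,5) unfolding bad_def by blast
      then show ?thesis using s by simp
    qed
    show "0 \<le> N p \<bullet> d" if "p \<in> S - C" "\<tau> k < yv p" for p
      using k[of p] that unfolding bad_def by (meson DiffD1 not_le_imp_less)
  qed
qed

end

section \<open>Coordinates over the tangent plane and the divergence\<close>

lemma frame_cross:
  assumes "norm d = 1" "k \<bullet> d = 0"
  shows "cross3 (cross3 k d) d = - k"
proof -
  have "cross3 (cross3 k d) d = - cross3 d (cross3 k d)" by (rule cross_skew)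
  also have "\<dots> = - ((d \<bullet> d) *\<^sub>R k - (d \<bullet> k) *\<^sub>R d)" by (simp add: Lagrange)
  finally show ?thesis using assms by (simp add: norm_eq_1 inner_commute)
qed

lemma cross_eq_normal:
  fixes N A B :: "real^3"
  assumes "N \<bullet> N = 1" "N \<bullet> A = 0" "N \<bullet> B = 0"
  shows "cross3 A B = (N \<bullet> cross3 A B) *\<^sub>R N"
proof -
  have "cross3 N (cross3 A B) = 0" using assms by (simp add: Lagrange)
  then have "cross3 N (cross3 N (cross3 A B)) = 0" by simp
  then show ?thesis unfolding Lagrange[of N N] using assms(1) by simp
qed

text \<open>Inverse function theorem for the coordinates along \<open>cross3 k d\<close> and
  \<open>d\<close>, where \<open>k\<close> is horizontal and normal to the surface at
  \<open>w0\<close>. The bound for the first column of the derivative is uniform on the square, as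
  the estimate of the tilt error requires.\<close>

lemma graph_coordinates:
  fixes X :: "real^2 \<Rightarrow> real^3" and k d :: "real^3"
  assumes X: "open U" "C2_on U X" "w0 \<in> U" "inj (frechet_derivative X (at w0))"
    and kd: "norm k = 1" "norm d = 1" "k \<bullet> d = 0" and orth: "\<And>z. k \<bullet> frechet_derivative X (at w0) z = 0"
    and \<eta>: "\<eta> > 0"
  obtains r and \<Gamma> :: "real^2 \<Rightarrow> real^2" and \<Gamma>' :: "real^2 \<Rightarrow> real^2 \<Rightarrow> real^2" and K
  where "r > 0" "\<Gamma> (vector [cross3 k d \<bullet> X w0, d \<bullet> X w0]) = w0"
    "\<And>w. \<bar>w $ 1 - cross3 k d \<bullet> X w0\<bar> < r \<Longrightarrow> \<bar>w $ 2 - d \<bullet> X w0\<bar> < r \<Longrightarrow>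
      \<Gamma> w \<in> ball w0 \<eta> \<inter> U \<and> cross3 k d \<bullet> X (\<Gamma> w) = w $ 1 \<and> d \<bullet> X (\<Gamma> w) = w $ 2 \<and> (\<Gamma> has_derivative \<Gamma>' w) (at w) \<and>
      (\<forall>z. cross3 k d \<bullet> frechet_derivative X (at (\<Gamma> w)) (\<Gamma>' w z) = z $ 1 \<and> d \<bullet> frechet_derivative X (at (\<Gamma> w)) (\<Gamma>' w z) = z $ 2) \<and>
      norm (\<Gamma>' w (axis 1 1)) \<le> K"
proof -
  define e where "e = cross3 k d"
  have ed: "cross3 e d = - k" unfolding e_def by (rule frame_cross[OF kd(2,3)])
  have kk: "k \<bullet> k = 1" using kd(1) by (simp add: norm_eq_1)
  then have knz: "k \<bullet> k \<noteq> 0" by simp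
  let ?X' = "\<lambda>w. frechet_derivative X (at w)"
  obtain \<delta>1 where \<delta>1: "\<delta>1 > 0" "ball w0 \<delta>1 \<subseteq> U" "\<And>w w' s. w \<in> ball w0 \<delta>1 \<Longrightarrow> w' \<in> ball w0 \<delta>1 \<Longrightarrow> X w' = X w + s *\<^sub>R k \<Longrightarrow> w' = w"
    using local_transversal[OF X orth knz] by blast
  \<comment> \<open>Jacobian of the projection along \<open>k\<close>; \<open>\<Delta>c\<close>
    expresses it through the surface normal, so it does not vanish at \<open>w0\<close>.\<close>
  define \<Delta> where "\<Delta> = (\<lambda>w. (e \<bullet> partial 1 X w) * (d \<bullet> partial 2 X w) - (e \<bullet> partial 2 X w) * (d \<bullet> partial 1 X w))"
  have \<Delta>c: "\<Delta> w = - (k \<bullet> cross3 (partial 1 X w) (partial 2 X w))" for w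
    using dot_cross[of e d "partial 1 X w" "partial 2 X w"] unfolding ed by (simp add: \<Delta>_def)
  have \<Delta>0: "\<Delta> w0 \<noteq> 0"
  proof
    assume "\<Delta> w0 = 0"
    then have "k \<bullet> cross3 (partial 1 X w0) (partial 2 X w0) = 0" using \<Delta>c by simp
    moreover have "cross3 (partial 1 X w0) (partial 2 X w0) = (k \<bullet> cross3 (partial 1 X w0) (partial 2 X w0)) *\<^sub>R k"
      by (rule cross_eq_normal) (use kk orth in \<open>simp_all add: partial_def\<close>)
    ultimately show False using cross_partial_nonzero[OF X(2-4)] by simp
  qed
  note cont = C2_on_partial_isCont(2)[OF X(2,3)]
  have "isCont \<Delta> w0" unfolding \<Delta>_def by (intro continuous_intros cont)
  moreover have "\<bar>\<Delta> w0\<bar> / 2 > 0" using \<Delta>0 by simp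
  ultimately have ev1: "\<forall>\<^sub>F w in nhds w0. dist (\<Delta> w) (\<Delta> w0) < \<bar>\<Delta> w0\<bar> / 2" by (rule isCont_near)
  have ev2: "\<forall>\<^sub>F w in nhds w0. dist (partial i X w) (partial i X w0) < 1" for i by (rule isCont_near[OF cont]) simp
  obtain \<delta>2 where \<delta>2: "\<delta>2 > 0" "\<And>w. dist w w0 < \<delta>2 \<Longrightarrow> dist (\<Delta> w) (\<Delta> w0) < \<bar>\<Delta> w0\<bar> / 2 \<and>
      dist (partial 1 X w) (partial 1 X w0) < 1 \<and> dist (partial 2 X w) (partial 2 X w0) < 1"
    using eventually_conj[OF ev1 eventually_conj[OF ev2 ev2]] unfolding eventually_nhds_metric by blast
  define \<delta> where "\<delta> = min \<eta> (min \<delta>1 \<delta>2)"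
  have \<delta>: "\<delta> > 0" using \<delta>1 \<delta>2 \<eta> by (simp add: \<delta>_def)
  have bU: "w \<in> U" if "w \<in> ball w0 \<delta>" for w using that \<delta>1(2) by (auto simp: \<delta>_def)
  have near: "\<Delta> w \<noteq> 0" "\<bar>\<Delta> w0\<bar> / 2 \<le> \<bar>\<Delta> w\<bar>" "norm (partial 1 X w) \<le> norm (partial 1 X w0) + 1"
    "norm (partial 2 X w) \<le> norm (partial 2 X w0) + 1" if "w \<in> ball w0 \<delta>" for w
  proof -
    have n: "dist (\<Delta> w) (\<Delta> w0) < \<bar>\<Delta> w0\<bar> / 2" "dist (partial 1 X w) (partial 1 X w0) < 1" "dist (partial 2 X w) (partial 2 X w0) < 1"
      using \<delta>2(2)[of w] that by (auto simp: \<delta>_def dist_commute)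
    show 1: "\<bar>\<Delta> w0\<bar> / 2 \<le> \<bar>\<Delta> w\<bar>" using n(1) unfolding dist_real_def by (simp add: abs_if split: if_splits)
    show "\<Delta> w \<noteq> 0" using 1 \<Delta>0 by auto
    show "norm (partial 1 X w) \<le> norm (partial 1 X w0) + 1" using n(2) norm_triangle_sub[of "partial 1 X w" "partial 1 X w0"] by (simp add: dist_norm)
    show "norm (partial 2 X w) \<le> norm (partial 2 X w0) + 1" using n(3) norm_triangle_sub[of "partial 2 X w" "partial 2 X w0"] by (simp add: dist_norm)
  qed
  define f :: "real^2 \<Rightarrow> real^2" where "f = (\<lambda>w. (e \<bullet> X w) *\<^sub>R axis 1 1 + (d \<bullet> X w) *\<^sub>R axis 2 1)"
  have f_comp: "f w $ 1 = e \<bullet> X w" "f w $ 2 = d \<bullet> X w" for w by (simp_all add: f_def axis_def)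
  have f0: "f w0 = vector [e \<bullet> X w0, d \<bullet> X w0]" unfolding vector2_eq f_def ..
  define f' :: "real^2 \<Rightarrow> real^2 \<Rightarrow> real^2" where "f' = (\<lambda>w z. (e \<bullet> ?X' w z) *\<^sub>R axis 1 1 + (d \<bullet> ?X' w z) *\<^sub>R axis 2 1)"
  have der: "(f has_derivative f' w) (at w)" if "w \<in> ball w0 \<delta>" for w
    unfolding f_def f'_def
    by (intro has_derivative_add has_derivative_scaleR_left has_derivative_inner_right partial_has_derivative(1)[OF X(2) bU[OF that]])
  have fc: "continuous_on (ball w0 \<delta>) f"
    using der has_derivative_continuous by (blast intro: continuous_at_imp_continuous_on)
  have finj: "inj_on f (ball w0 \<delta>)"
  proof (rule inj_onI)
    fix w w' assume w: "w \<in> ball w0 \<delta>" "w' \<in> ball w0 \<delta>" "f w = f w'"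
    define u where "u = X w' - X w"
    have "f w $ 1 = f w' $ 1" "f w $ 2 = f w' $ 2" using w(3) by simp_all
    then have "u \<bullet> e = 0" "u \<bullet> d = 0" unfolding f_comp by (simp_all add: u_def inner_diff_right inner_commute[of _ e] inner_commute[of _ d])
    moreover have "cross3 e d \<noteq> 0" using ed kd(1) by auto
    ultimately have "u = (u \<bullet> sgn (cross3 e d)) *\<^sub>R sgn (cross3 e d)" by (rule parallel_if_orthogonal_to_both)
    moreover have "sgn (cross3 e d) = - k" unfolding ed by (simp add: sgn_div_norm kd(1))
    ultimately have "u = (u \<bullet> k) *\<^sub>R k" by simp
    then have "X w' = X w + (u \<bullet> k) *\<^sub>R k" unfolding u_def by (simp add: algebra_simps)
    then have "w' = w" by (rule \<delta>1(3)[rotated 2]) (use w in \<open>auto simp: \<delta>_def\<close>)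
    then show "w = w'" by simp
  qed
  define \<Gamma> where "\<Gamma> = inv_into (ball w0 \<delta>) f"
  have \<Gamma>f: "\<Gamma> (f w) = w" if "w \<in> ball w0 \<delta>" for w unfolding \<Gamma>_def by (rule inv_into_f_f[OF finj that])
  have "open (f ` ball w0 \<delta>)" by (rule invariance_of_domain[OF fc open_ball finj])
  moreover have "f w0 \<in> f ` ball w0 \<delta>" using \<delta> by simp
  ultimately obtain r0 where r0: "r0 > 0" "ball (f w0) r0 \<subseteq> f ` ball w0 \<delta>" using open_contains_ball by blast
  \<comment> \<open>Inverse of the derivative of \<open>f\<close>, by Cramer's rule.\<close>
  define G :: "real^2 \<Rightarrow> real^2 \<Rightarrow> real^2" where "G = (\<lambda>x u.
    (((d \<bullet> partial 2 X x) * u $ 1 - (e \<bullet> partial 2 X x) * u $ 2) / \<Delta> x) *\<^sub>R axis 1 1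
    + (((e \<bullet> partial 1 X x) * u $ 2 - (d \<bullet> partial 1 X x) * u $ 1) / \<Delta> x) *\<^sub>R axis 2 1)"
  have XG: "e \<bullet> ?X' x (G x u) = u $ 1" "d \<bullet> ?X' x (G x u) = u $ 2" if "x \<in> ball w0 \<delta>" for x u
  proof -
    have G12: "G x u $ 1 = ((d \<bullet> partial 2 X x) * u $ 1 - (e \<bullet> partial 2 X x) * u $ 2) / \<Delta> x"
      "G x u $ 2 = ((e \<bullet> partial 1 X x) * u $ 2 - (d \<bullet> partial 1 X x) * u $ 1) / \<Delta> x" by (simp_all add: G_def axis_def)
    have "e \<bullet> ?X' x (G x u) = G x u $ 1 * (e \<bullet> partial 1 X x) + G x u $ 2 * (e \<bullet> partial 2 X x)"
      unfolding frechet_derivative_partial[OF X(2) bU[OF that]] by (simp add: inner_add_right)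
    also have "\<dots> = (u $ 1 * \<Delta> x) / \<Delta> x" unfolding G12 \<Delta>_def by (simp add: add_divide_distrib[symmetric] algebra_simps)
    finally show "e \<bullet> ?X' x (G x u) = u $ 1" using near(1)[OF that] by simp
    have "d \<bullet> ?X' x (G x u) = G x u $ 1 * (d \<bullet> partial 1 X x) + G x u $ 2 * (d \<bullet> partial 2 X x)"
      unfolding frechet_derivative_partial[OF X(2) bU[OF that]] by (simp add: inner_add_right)
    also have "\<dots> = (u $ 2 * \<Delta> x) / \<Delta> x" unfolding G12 \<Delta>_def by (simp add: add_divide_distrib[symmetric] algebra_simps)
    finally show "d \<bullet> ?X' x (G x u) = u $ 2" using near(1)[OF that] by simp
  qed
  define K where "K = (norm (partial 1 X w0) + norm (partial 2 X w0) + 2) / (\<bar>\<Delta> w0\<bar> / 2)"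
  have d_le: "\<bar>d \<bullet> v\<bar> \<le> norm v" for v using Cauchy_Schwarz_ineq2[of d v] kd(2) by simp
  have GK: "norm (G x (axis 1 1)) \<le> K" if x: "x \<in> ball w0 \<delta>" for x
  proof -
    have "norm (G x (axis 1 1)) \<le> \<bar>(d \<bullet> partial 2 X x) / \<Delta> x\<bar> + \<bar>(d \<bullet> partial 1 X x) / \<Delta> x\<bar>"
    proof -
      have c: "axis 1 1 $ (1::2) = (1::real)" "axis 1 1 $ (2::2) = (0::real)" by (simp_all add: axis_def)
      show ?thesis unfolding G_def by (rule order_trans[OF norm_triangle_ineq]) (simp add: c norm_axis_1)
    qed
    also have "\<dots> = (\<bar>d \<bullet> partial 1 X x\<bar> + \<bar>d \<bullet> partial 2 X x\<bar>) / \<bar>\<Delta> x\<bar>" by (simp add: add_divide_distrib)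
    also have "\<dots> \<le> K" unfolding K_def
      using near[OF x] \<Delta>0 d_le[of "partial 1 X x"] d_le[of "partial 2 X x"] by (intro frac_le) auto
    finally show ?thesis .
  qed
  show thesis
  proof (rule that[of "r0 / 2" \<Gamma> "\<lambda>w. G (\<Gamma> w)" K])
    show "r0 / 2 > 0" using r0 by simp
    show "\<Gamma> (vector [cross3 k d \<bullet> X w0, d \<bullet> X w0]) = w0" using \<Gamma>f[of w0] \<delta> f0 by (simp add: e_def)
    fix w :: "real^2" assume w: "\<bar>w $ 1 - cross3 k d \<bullet> X w0\<bar> < r0 / 2" "\<bar>w $ 2 - d \<bullet> X w0\<bar> < r0 / 2"
    have "norm (w - f w0) \<le> \<bar>(w - f w0) $ 1\<bar> + \<bar>(w - f w0) $ 2\<bar>"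
      using norm_le_l1_cart[of "w - f w0"] by (simp add: sum_2)
    also have "\<dots> < r0" using w by (simp add: f_comp e_def)
    finally have "w \<in> ball (f w0) r0" by (simp add: dist_norm norm_minus_commute)
    then obtain x where x: "x \<in> ball w0 \<delta>" "w = f x" using r0(2) by blast
    have gx: "\<Gamma> w = x" using \<Gamma>f x by simp
    have "(\<Gamma> has_derivative G x) (at (f x))"
    proof (rule has_derivative_inverse_strong[OF open_ball x(1) fc \<Gamma>f der[OF x(1)]])
      show "f' x \<circ> G x = id"
      proof
        fix u show "(f' x \<circ> G x) u = id u" using vec2_eq[of u] by (simp add: f'_def XG[OF x(1)])
      qed
    qed
    then show "\<Gamma> w \<in> ball w0 \<eta> \<inter> U \<and> cross3 k d \<bullet> X (\<Gamma> w) = w $ 1 \<and> d \<bullet> X (\<Gamma> w) = w $ 2 \<and> (\<Gamma> has_derivative G (\<Gamma> w)) (at w) \<and>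
      (\<forall>z. cross3 k d \<bullet> frechet_derivative X (at (\<Gamma> w)) (G (\<Gamma> w) z) = z $ 1 \<and> d \<bullet> frechet_derivative X (at (\<Gamma> w)) (G (\<Gamma> w) z) = z $ 2) \<and>
      norm (G (\<Gamma> w) (axis 1 1)) \<le> K"
      unfolding gx using x bU[OF x(1)] XG[OF x(1)] GK[OF x(1)] f_comp by (auto simp: e_def \<delta>_def)
  qed
qed

text \<open>The divergence of \<open>h (y - t) *\<^sub>R \<sigma> *\<^sub>R (W - N)\<close>, computed from directional derivatives along
  two tangent vectors \<open>A\<close>, \<open>B\<close>.\<close>

lemma divergence_identity:
  fixes N W A B d :: "real^3"
  assumes N: "N \<bullet> N = 1" "N \<bullet> A = 0" "N \<bullet> B = 0" and W: "W \<bullet> W = 1" and om: "om \<noteq> 0"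
    and divW: "d \<bullet> cross3 WA B + d \<bullet> cross3 A WB = - 2 * H0 * (d \<bullet> cross3 A B)"
    and divN: "d \<bullet> cross3 NA B + d \<bullet> cross3 A NB = - 2 * H * (d \<bullet> cross3 A B)"
    and \<xi>A: "\<xi>A = (h1 * ((W \<bullet> A) / om)) *\<^sub>R (W - N) + (h * s) *\<^sub>R (WA - NA)"
    and \<xi>B: "\<xi>B = (h1 * ((W \<bullet> B) / om)) *\<^sub>R (W - N) + (h * s) *\<^sub>R (WB - NB)"
  shows "d \<bullet> cross3 \<xi>A B + d \<bullet> cross3 A \<xi>B =
    h1 / om * (N \<bullet> cross3 A B) * (1 - W \<bullet> N) * (W \<bullet> d + N \<bullet> d) + 2 * s * (H - H0) * h * (d \<bullet> cross3 A B)"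
proof -
  let ?Q = "W - N" and ?l = "N \<bullet> cross3 A B"
  \<comment> \<open>The part multiplied by \<open>h1\<close>. Its two terms combine into a product
    with \<open>cross3 W (cross3 B A)\<close>, where \<open>cross3 B A\<close> is a multiple of
    \<open>N\<close>; two expansions of the double cross product then produce the factors
    \<open>1 - W \<bullet> N\<close> and \<open>W \<bullet> d + N \<bullet> d\<close>.\<close>
  have "(W \<bullet> A) * (d \<bullet> cross3 ?Q B) + (W \<bullet> B) * (d \<bullet> cross3 A ?Q) = d \<bullet> cross3 ?Q ((W \<bullet> A) *\<^sub>R B - (W \<bullet> B) *\<^sub>R A)"
    using triple_swap[of d A ?Q] by (simp add: Cross3.right_diff_distrib cross_mult_right inner_diff_right)
  also have "(W \<bullet> A) *\<^sub>R B - (W \<bullet> B) *\<^sub>R A = cross3 W (cross3 B A)" by (simp add: Lagrange)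
  also have "cross3 B A = - (?l *\<^sub>R N)" using cross_eq_normal[OF N] cross_skew[of B A] by simp
  also have "cross3 W (- (?l *\<^sub>R N)) = - (?l *\<^sub>R cross3 W N)" by (simp add: cross_minus_right cross_mult_right)
  also have "cross3 ?Q (- (?l *\<^sub>R cross3 W N)) = - (?l *\<^sub>R cross3 ?Q (cross3 W N))" by (simp add: cross_minus_right cross_mult_right)
  also have "cross3 ?Q (cross3 W N) = (?Q \<bullet> N) *\<^sub>R W - (?Q \<bullet> W) *\<^sub>R N" by (rule Lagrange)
  also have "d \<bullet> - (?l *\<^sub>R ((?Q \<bullet> N) *\<^sub>R W - (?Q \<bullet> W) *\<^sub>R N)) = ?l * (1 - W \<bullet> N) * (W \<bullet> d + N \<bullet> d)"
    using N(1) W by (simp add: inner_diff_left inner_diff_right inner_commute[of N W] inner_commute[of d] algebra_simps)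
  finally have 1: "(W \<bullet> A) * (d \<bullet> cross3 ?Q B) + (W \<bullet> B) * (d \<bullet> cross3 A ?Q) = ?l * (1 - W \<bullet> N) * (W \<bullet> d + N \<bullet> d)" .
  have e1: "d \<bullet> cross3 \<xi>A B = (h1 * ((W \<bullet> A) / om)) * (d \<bullet> cross3 ?Q B) + (h * s) * (d \<bullet> cross3 WA B - d \<bullet> cross3 NA B)"
    unfolding \<xi>A cross_add_left cross_mult_left inner_add_right inner_scaleR_right
    by (simp add: Cross3.left_diff_distrib inner_diff_right)
  have e2: "d \<bullet> cross3 A \<xi>B = (h1 * ((W \<bullet> B) / om)) * (d \<bullet> cross3 A ?Q) + (h * s) * (d \<bullet> cross3 A WB - d \<bullet> cross3 A NB)"
    unfolding \<xi>B cross_add_right cross_mult_right inner_add_right inner_scaleR_right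
    by (simp add: Cross3.right_diff_distrib inner_diff_right)
  have "d \<bullet> cross3 \<xi>A B + d \<bullet> cross3 A \<xi>B = h1 / om * ((W \<bullet> A) * (d \<bullet> cross3 ?Q B) + (W \<bullet> B) * (d \<bullet> cross3 A ?Q))
    + (h * s) * ((d \<bullet> cross3 WA B + d \<bullet> cross3 A WB) - (d \<bullet> cross3 NA B + d \<bullet> cross3 A NB))"
    unfolding e1 e2 by (simp add: algebra_simps add_divide_distrib)
  also have "\<dots> = h1 / om * (?l * (1 - W \<bullet> N) * (W \<bullet> d + N \<bullet> d)) + (h * s) * (- 2 * H0 * (d \<bullet> cross3 A B) - (- 2 * H * (d \<bullet> cross3 A B)))"
    unfolding 1 divW divN ..
  also have "(h * s) * (- 2 * H0 * (d \<bullet> cross3 A B) - (- 2 * H * (d \<bullet> cross3 A B))) = 2 * s * (H - H0) * h * (d \<bullet> cross3 A B)"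
    by (simp add: algebra_simps)
  finally show ?thesis by (simp add: mult.assoc)
qed

text \<open>Differentiable everywhere, so the field stays differentiable across the level
  \<open>t\<close>; bounded, so the field is bounded although \<open>yv\<close> need not be; and at
  most a constant times its derivative where the argument is bounded above, which lets the main term
  absorb the tilt error.\<close>

definition cutoff :: "real \<Rightarrow> real" where "cutoff s = (if 0 < s then s\<^sup>2 / (1 + s\<^sup>2) else 0)"
definition cutoff' :: "real \<Rightarrow> real" where "cutoff' s = (if 0 < s then 2 * s / (1 + s\<^sup>2)\<^sup>2 else 0)"

lemma cutoff_bounds: "0 \<le> cutoff s" "cutoff s \<le> 1" "0 \<le> cutoff' s" "0 < s \<Longrightarrow> 0 < cutoff s" "0 < s \<Longrightarrow> 0 < cutoff' s"
  "s \<le> 0 \<Longrightarrow> cutoff s = 0"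
proof -
  have p: "1 + s\<^sup>2 > 0" by (simp add: add_pos_nonneg)
  show "0 \<le> cutoff s" "cutoff s \<le> 1" "0 \<le> cutoff' s" "0 < s \<Longrightarrow> 0 < cutoff s" "0 < s \<Longrightarrow> 0 < cutoff' s" "s \<le> 0 \<Longrightarrow> cutoff s = 0"
    using p by (auto simp: cutoff_def cutoff'_def divide_le_eq_1)
qed

lemma cutoff_le: "s \<le> K \<Longrightarrow> cutoff s \<le> cutoff' s * (K * (1 + K\<^sup>2))"
proof (cases "0 < s")
  case True
  assume sK: "s \<le> K"
  have p: "1 + s\<^sup>2 > 0" by (simp add: add_pos_nonneg)
  have "2 * s / a\<^sup>2 * (s * a / 2) = s\<^sup>2 / a" if "a \<noteq> 0" for a :: real
    using that by (simp add: power2_eq_square)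
  from this[of "1 + s\<^sup>2"] have "cutoff s = cutoff' s * (s * (1 + s\<^sup>2) / 2)"
    using True p by (simp add: cutoff_def cutoff'_def)
  also have "\<dots> \<le> cutoff' s * (K * (1 + K\<^sup>2))"
  proof (rule mult_left_mono)
    have "s * (1 + s\<^sup>2) \<le> K * (1 + K\<^sup>2)" using True sK by (intro mult_mono add_left_mono power_mono) auto
    moreover have "0 \<le> s * (1 + s\<^sup>2)" using True p by simp
    ultimately show "s * (1 + s\<^sup>2) / 2 \<le> K * (1 + K\<^sup>2)" by simp
  qed (rule cutoff_bounds)
  finally show ?thesis .
qed (simp add: cutoff_def cutoff'_def)

lemma cutoff_DERIV: "(cutoff has_real_derivative cutoff' s) (at s)"
proof -
  have p: "1 + x\<^sup>2 \<noteq> 0" for x :: real using add_pos_nonneg[of 1 "x\<^sup>2"] by simp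
  consider "s > 0" | "s < 0" | "s = 0" by linarith
  then show ?thesis
  proof cases
    case 1
    have "((\<lambda>s. s\<^sup>2 / (1 + s\<^sup>2)) has_real_derivative cutoff' s) (at s)"
      using p[of s] 1 by (auto intro!: derivative_eq_intros simp: cutoff'_def field_simps power2_eq_square)
    then show ?thesis
      by (rule has_field_derivative_transform_within_open[of _ _ _ "{0<..}"]) (use 1 in \<open>auto simp: cutoff_def\<close>)
  next
    case 2
    have "((\<lambda>s. 0) has_real_derivative cutoff' s) (at s)" using 2 by (simp add: cutoff'_def)
    then show ?thesis
      by (rule has_field_derivative_transform_within_open[of _ _ _ "{..<0}"]) (use 2 in \<open>auto simp: cutoff_def\<close>)
  next
    case 3
    have "((\<lambda>x. (cutoff x - cutoff 0) / (x - 0)) \<longlongrightarrow> 0) (at 0)"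
    proof (rule Lim_null_comparison)
      have "norm ((cutoff x - cutoff 0) / (x - 0)) \<le> \<bar>x\<bar>" for x
      proof (cases "x > 0")
        case True
        have "x / (1 + x\<^sup>2) \<le> x / 1" using True by (intro divide_left_mono) (auto simp: add_pos_nonneg)
        moreover have "x\<^sup>2 / a / x = x / a" for a using True by (simp add: power2_eq_square)
        ultimately show ?thesis using True p[of x] by (simp add: cutoff_def add_nonneg_nonneg)
      qed (simp add: cutoff_def)
      then show "\<forall>\<^sub>F x in at 0. norm ((cutoff x - cutoff 0) / (x - 0)) \<le> \<bar>x\<bar>" by simp
      have "((\<lambda>x. \<bar>x\<bar>) \<longlongrightarrow> \<bar>0::real\<bar>) (at 0)" by (intro tendsto_intros)
      then show "((\<lambda>x. \<bar>x\<bar>) \<longlongrightarrow> (0::real)) (at 0)" by simp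
    qed
    then show ?thesis unfolding 3 has_field_derivative_iff by (simp add: cutoff'_def)
  qed
qed

section \<open>The vector field on the prism\<close>

text \<open>Two levels are used: above \<open>t'\<close> the surface is a single sheet without
  downward normals, and the cutoff starts at the larger \<open>t\<close>, so the field already
  vanishes near the edge of that sheet.\<close>

locale graph_cap = capillary_drop +
  fixes t' t :: real
  assumes t't: "t' < t"
    and sheet: "p \<in> S \<Longrightarrow> p' \<in> S \<Longrightarrow> hor p = hor p' \<Longrightarrow> t' < yv p \<Longrightarrow> t' < yv p' \<Longrightarrow> p = p'"
    and upward: "p \<in> S - C \<Longrightarrow> t' < yv p \<Longrightarrow> 0 \<le> N p \<bullet> d"
begin

definition L :: "(real^3) set" where "L = {p \<in> S. t' < yv p}"

definition val :: "real^3 \<Rightarrow> real^3" where "val p = cutoff (yv p - t) *\<^sub>R (sg *\<^sub>R (W p - N p))"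
definition field :: "real^3 \<Rightarrow> real^3" where
  "field x = (if \<exists>p\<in>L. hor p = hor x then val (THE p. p \<in> L \<and> hor p = hor x) else 0)"

lemma L_S: "p \<in> L \<Longrightarrow> p \<in> S" and L_P: "p \<in> L \<Longrightarrow> norm (P p) < 1"
  using P_S by (auto simp: L_def)

lemma L_inj: "p \<in> L \<Longrightarrow> p' \<in> L \<Longrightarrow> hor p = hor p' \<Longrightarrow> p = p'"
  using sheet by (auto simp: L_def)

lemma field_over: "p \<in> L \<Longrightarrow> hor p = hor x \<Longrightarrow> field x = val p"
proof -
  assume p: "p \<in> L" "hor p = hor x"
  have "(THE p. p \<in> L \<and> hor p = hor x) = p"
  proof (rule the_equality)
    show "p \<in> L \<and> hor p = hor x" using p by blast
    show "p' = p" if "p' \<in> L \<and> hor p' = hor x" for p' using L_inj[of p' p] that p by simp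
  qed
  moreover have "\<exists>p\<in>L. hor p = hor x" using p by blast
  ultimately show ?thesis by (simp add: field_def)
qed

lemma field_not_over: "\<not> (\<exists>p\<in>L. hor p = hor x) \<Longrightarrow> field x = 0"
  by (simp add: field_def)

lemma val_bound: "p \<in> S \<Longrightarrow> norm (val p) \<le> 2"
proof -
  assume p: "p \<in> S"
  have "W p \<bullet> W p = 1" using W_norm P_S[OF p] by simp
  then have n: "norm (W p) = 1" "norm (N p) = 1" using N_norm[OF p] by (simp_all add: norm_eq_1)
  have "norm (W p - N p) \<le> 2" using norm_triangle_ineq4[of "W p" "N p"] n by simp
  moreover have "\<bar>sg\<bar> = 1" using sg(2) by auto
  moreover have "0 \<le> cutoff (yv p - t)" "cutoff (yv p - t) \<le> 1" by (rule cutoff_bounds)+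
  moreover have "norm (val p) = cutoff (yv p - t) * norm (W p - N p)"
    using \<open>\<bar>sg\<bar> = 1\<close> \<open>0 \<le> cutoff (yv p - t)\<close> by (simp add: val_def abs_mult)
  ultimately show ?thesis using mult_mono[of "cutoff (yv p - t)" 1 "norm (W p - N p)" 2] by simp
qed

lemma field_bound: "norm (field x) \<le> 2"
proof (cases "\<exists>p\<in>L. hor p = hor x")
  case True
  then obtain p where "p \<in> L" "hor p = hor x" by blast
  then show ?thesis using field_over val_bound[OF L_S] by simp
qed (simp add: field_not_over)

text \<open>Points of \<open>L\<close> over which the field is nonzero satisfy
  \<open>t < yv\<close>, so a limit of them in \<open>S\<close> satisfies \<open>t \<le> yv\<close>
  and belongs to \<open>L\<close> because \<open>t' < t\<close>. The corners are excluded since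
  points of \<open>S\<close> need not have a limit there.\<close>

lemma field_zero_near:
  assumes nc: "\<And>i. hor x \<noteq> hor (q i)" and no: "\<not> (\<exists>p\<in>L. hor p = hor x)"
  shows "\<exists>r>0. \<forall>x'. dist x' x < r \<longrightarrow> field x' = 0"
proof (rule ccontr)
  assume neg: "\<not> ?thesis"
  have "\<exists>p. p \<in> S \<and> t < yv p \<and> dist (hor p) (hor x) < inverse (real (Suc k))" for k
  proof -
    have "inverse (real (Suc k)) > 0" by simp
    then obtain x' where x': "dist x' x < inverse (real (Suc k))" "field x' \<noteq> 0" using neg by blast
    then obtain p where p: "p \<in> L" "hor p = hor x'" using field_not_over by blast
    have "cutoff (yv p - t) \<noteq> 0" using field_over[OF p] x'(2) by (auto simp: val_def)
    then have "t < yv p" by (auto simp: cutoff_def split: if_splits)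
    then show ?thesis using p L_S hor_dist_le[of x' x] x'(1) by (intro exI[of _ p]) auto
  qed
  then obtain p where p: "\<And>k. p k \<in> S" "\<And>k. t < yv (p k)" "\<And>k. dist (hor (p k)) (hor x) < inverse (real (Suc k))" by metis
  have hx: "(\<lambda>k. hor (p k)) \<longlonglongrightarrow> hor x"
    by (rule tendsto_dist_iff[THEN iffD2], rule Lim_null_comparison[OF _ LIMSEQ_inverse_real_of_nat])
      (use p(3) in \<open>auto intro!: always_eventually less_imp_le\<close>)
  show False
  proof (rule S_limit[OF p(1)])
    fix s :: "nat \<Rightarrow> nat" and z assume s: "strict_mono s" "z \<in> S" "(\<lambda>k. p (s k)) \<longlonglongrightarrow> z"
    have "(\<lambda>k. hor (p (s k))) \<longlonglongrightarrow> hor x" using LIMSEQ_subseq_LIMSEQ[OF hx s(1)] by (simp add: o_def)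
    then have "hor z = hor x" using LIMSEQ_unique[OF hor_tendsto[OF s(3)]] by simp
    moreover have "(\<lambda>k. yv (p (s k))) \<longlonglongrightarrow> yv z"
      using continuous_on_tendsto_compose[OF cap_continuous_on(1) s(3,2)] p(1) by simp
    then have "t \<le> yv z" by (rule LIMSEQ_le_const) (use p(2) in \<open>auto intro: less_imp_le\<close>)
    then have "z \<in> L" using t't s(2) by (simp add: L_def)
    ultimately show False using no by blast
  next
    fix s :: "nat \<Rightarrow> nat" and i assume s: "strict_mono s" "(\<lambda>k. hor (p (s k))) \<longlonglongrightarrow> hor (q i)"
    have "(\<lambda>k. hor (p (s k))) \<longlonglongrightarrow> hor x" using LIMSEQ_subseq_LIMSEQ[OF hx s(1)] by (simp add: o_def)
    then show False using LIMSEQ_unique[OF s(2)] nc by metis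
  qed
qed

text \<open>\<open>projection_open\<close> on a ball of the disk that is mapped into
  \<open>L\<close>, where the projection is injective.\<close>

lemma L_over_near:
  assumes p: "p \<in> L" and e: "e > 0"
  shows "\<exists>r>0. \<forall>x. (\<forall>j. n j \<bullet> x \<le> c j) \<longrightarrow> dist (hor x) (hor p) < r \<longrightarrow> (\<exists>p'\<in>L. hor p' = hor x \<and> dist p' p < e)"
proof -
  obtain y where y: "y \<in> D0" "p = \<phi> y" using L_S[OF p] unfolding S by blast
  have "yv p - t' > 0" using p by (simp add: L_def)
  then obtain r1 where r1: "r1 > 0" "\<And>p'. p' \<in> S \<Longrightarrow> dist p' p < r1 \<Longrightarrow> dist (yv p') (yv p) < yv p - t'"
    using S_near[OF cap_continuous_on(1) L_S[OF p]] by blast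
  have "min e r1 > 0" using e r1(1) by simp
  then obtain r0 where r0: "r0 > 0" "\<And>y'. y' \<in> D0 \<Longrightarrow> dist y' y < r0 \<Longrightarrow> dist (\<phi> y') (\<phi> y) < min e r1"
    using phi_cont y(1) unfolding continuous_on_iff by blast
  have inL: "\<phi> y' \<in> L" "dist (\<phi> y') p < e" if "y' \<in> ball y r0 \<inter> D0" for y'
  proof -
    have "dist (\<phi> y') p < min e r1" using r0(2)[of y'] that y(2) by (simp add: dist_commute)
    moreover have "\<phi> y' \<in> S" using that unfolding S by blast
    ultimately show "\<phi> y' \<in> L" "dist (\<phi> y') p < e"
      using r1(2)[of "\<phi> y'"] unfolding L_def dist_real_def by (auto simp: abs_if split: if_splits)
  qed
  obtain \<rho> where \<rho>: "\<rho> > 0" "\<And>x. (\<forall>j. n j \<bullet> x \<le> c j) \<Longrightarrow> dist (hor x) (hor (\<phi> y)) < \<rho> \<Longrightarrow> \<exists>y'\<in>ball y r0 \<inter> D0. hor (\<phi> y') = hor x"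
  proof -
    have "\<exists>\<rho>>0. \<forall>x. (\<forall>j. n j \<bullet> x \<le> c j) \<longrightarrow> dist (hor x) (hor (\<phi> y)) < \<rho> \<longrightarrow> (\<exists>y'\<in>ball y r0 \<inter> D0. hor (\<phi> y') = hor x)"
    proof (rule projection_open[OF y(1) r0(1)])
      fix y1 y2 assume h: "y1 \<in> ball y r0 \<inter> D0" "y2 \<in> ball y r0 \<inter> D0" "hor (\<phi> y1) = hor (\<phi> y2)"
      have "\<phi> y1 = \<phi> y2" by (rule L_inj[OF inL(1)[OF h(1)] inL(1)[OF h(2)] h(3)])
      then show "y1 = y2" using phi_inj h by (auto dest: inj_onD)
    qed
    then show thesis using that by blast
  qed
  show ?thesis using \<rho> inL unfolding y(2) by (intro exI[of _ \<rho>]) (metis)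
qed

lemma val_cont: "continuous_on S val"
proof -
  have "isCont cutoff s" for s using DERIV_isCont[OF cutoff_DERIV] .
  then have "continuous_on UNIV cutoff" by (simp add: continuous_at_imp_continuous_on)
  then have "continuous_on S (\<lambda>p. cutoff (yv p - t))"
    by (rule continuous_on_compose2) (auto intro!: continuous_intros cap_continuous_on)
  then show ?thesis unfolding val_def[abs_def] by (intro continuous_intros cap_continuous_on N_cont)
qed

abbreviation K0 :: "(real^3) set" where "K0 \<equiv> {x. (\<forall>j. n j \<bullet> x \<le> c j) \<and> (\<forall>i. hor x \<noteq> hor (q i))}"

lemma field_cont: "continuous_on K0 field"
  unfolding continuous_on_iff
proof (intro ballI allI impI)
  fix x and e :: real assume x: "x \<in> K0" and e: "e > 0"
  show "\<exists>r>0. \<forall>x'\<in>K0. dist x' x < r \<longrightarrow> dist (field x') (field x) < e"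
  proof (cases "\<exists>p\<in>L. hor p = hor x")
    case False
    obtain r where "r > 0" "\<And>x'. dist x' x < r \<Longrightarrow> field x' = 0" using field_zero_near[OF _ False] x by blast
    then show ?thesis using field_not_over[OF False] e by (intro exI[of _ r]) auto
  next
    case True
    then obtain p where p: "p \<in> L" "hor p = hor x" by blast
    obtain r1 where r1: "r1 > 0" "\<And>p'. p' \<in> S \<Longrightarrow> dist p' p < r1 \<Longrightarrow> dist (val p') (val p) < e"
      using val_cont L_S[OF p(1)] e unfolding continuous_on_iff by blast
    obtain r where r: "r > 0" "\<And>x. (\<forall>j. n j \<bullet> x \<le> c j) \<Longrightarrow> dist (hor x) (hor p) < r \<Longrightarrow> \<exists>p'\<in>L. hor p' = hor x \<and> dist p' p < r1"
      using L_over_near[OF p(1) r1(1)] by blast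
    have "dist (field x') (field x) < e" if "x' \<in> K0" "dist x' x < r" for x'
    proof -
      have "dist (hor x') (hor p) < r" using hor_dist_le[of x' x] that(2) p(2) by simp
      moreover have "\<forall>j. n j \<bullet> x' \<le> c j" using that(1) by simp
      ultimately obtain p' where p': "p' \<in> L" "hor p' = hor x'" "dist p' p < r1" using r(2) by blast
      then show ?thesis using r1(2)[OF L_S] field_over[OF p'(1,2)] field_over[OF p] by simp
    qed
    then show ?thesis using r(1) by blast
  qed
qed

text \<open>Over a wall the normals \<open>N\<close> and \<open>W\<close> have the same component
  along \<open>n j\<close>, given by the contact angle, so it cancels in
  \<open>W - N\<close>.\<close>

lemma field_wall:
  assumes x: "x \<in> K0" and j: "n j \<bullet> x = c j"
  shows "n j \<bullet> field x = 0"
proof (cases "\<exists>p\<in>L. hor p = hor x")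
  case True
  then obtain p where p: "p \<in> L" "hor p = hor x" by blast
  have nj: "n j \<bullet> p = c j" using p(2) j hor_simps(6)[of j p] hor_simps(6)[of j x] by simp
  have "p \<notin> I" using nj I_iff[of p] by (metis less_irrefl)
  then have "p \<in> C" using S_not_C[of p] L_S[OF p(1)] by blast
  then have "N p \<bullet> n j = - cos (\<gamma> j)" by (intro contact_angle) (simp add: plane_def nj)
  then show ?thesis unfolding field_over[OF p] val_def using W_wall[OF nj] by (simp add: inner_diff_right inner_commute)
qed (simp add: field_not_over)

lemma prism_K0: "(\<And>j. n j \<bullet> x < c j) \<Longrightarrow> x \<in> K0"
proof -
  assume x: "\<And>j. n j \<bullet> x < c j"
  have "hor x \<noteq> hor (q i)" for i
  proof
    assume "hor x = hor (q i)"
    then have "n i \<bullet> x = n i \<bullet> q i" using hor_simps(6)[of i x] hor_simps(6)[of i "q i"] by simp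
    then show False using x[of i] q_on(1)[of i] by simp
  qed
  then show ?thesis using x by (auto intro: less_imp_le)
qed

lemma prism_open: "open {x. \<forall>j. n j \<bullet> x < c j}" and prism_convex: "convex {x. \<forall>j. n j \<bullet> x < c j}"
proof -
  have e: "{x. \<forall>j. n j \<bullet> x < c j} = (\<Inter>j. {x. n j \<bullet> x < c j})" by auto
  show "open {x. \<forall>j. n j \<bullet> x < c j}" unfolding e by (intro open_INT ballI open_halfspace_lt) simp
  show "convex {x. \<forall>j. n j \<bullet> x < c j}" unfolding e by (intro convex_INT convex_halfspace_lt)
qed

lemma prism_ball:
  assumes "\<And>j. n j \<bullet> x < c j"
  obtains r where "r > 0" "ball x r \<subseteq> {x. \<forall>j. n j \<bullet> x < c j}" "continuous_on (ball x r) field"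
proof -
  obtain r where r: "r > 0" "ball x r \<subseteq> {x. \<forall>j. n j \<bullet> x < c j}"
    using prism_open assms unfolding open_contains_ball by blast
  moreover have "ball x r \<subseteq> K0" using r(2) prism_K0 by blast
  then have "continuous_on (ball x r) field" using field_cont continuous_on_subset by blast
  ultimately show thesis using that by blast
qed

definition dW :: "real^3 \<Rightarrow> real^3 \<Rightarrow> real^3" where
  "dW p z = - (H0 *\<^sub>R hor z) + (H0 * (P p \<bullet> z) / om p) *\<^sub>R d"

text \<open>The sign \<open>sg\<close> enters the summand with the derivative of the cutoff twice
  and disappears there; in the other summand it remains.\<close>

lemma val_has_derivative:
  assumes Y: "(Y has_derivative Y') (at w)" "((\<lambda>w. N (Y w)) has_derivative N1) (at w)" and P: "norm (P (Y w)) < 1"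
  shows "((\<lambda>w. val (Y w)) has_derivative (\<lambda>z.
    (cutoff' (yv (Y w) - t) * ((W (Y w) \<bullet> Y' z) / om (Y w))) *\<^sub>R (W (Y w) - N (Y w))
      + (cutoff (yv (Y w) - t) * sg) *\<^sub>R (dW (Y w) (Y' z) - N1 z))) (at w)"
proof -
  have y: "((\<lambda>w. yv (Y w) - t) has_derivative (\<lambda>z. sg * ((W (Y w) \<bullet> Y' z) / om (Y w)))) (at w)"
    using has_derivative_diff[OF has_derivative_compose[OF Y(1) yv_has_derivative[OF P]] has_derivative_const] by simp
  have c: "((\<lambda>w. cutoff (yv (Y w) - t)) has_derivative (\<lambda>z. cutoff' (yv (Y w) - t) * (sg * ((W (Y w) \<bullet> Y' z) / om (Y w))))) (at w)"
    by (rule has_derivative_compose[OF y]) (use cutoff_DERIV in \<open>simp add: has_field_derivative_def\<close>)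
  have g: "((\<lambda>w. sg *\<^sub>R (W (Y w) - N (Y w))) has_derivative (\<lambda>z. sg *\<^sub>R (dW (Y w) (Y' z) - N1 z))) (at w)"
    unfolding dW_def by (intro has_derivative_scaleR_right has_derivative_diff has_derivative_compose[OF Y(1) W_has_derivative[OF P]] Y(2))
  have ss: "(a * (sg * b)) *\<^sub>R (sg *\<^sub>R v) = (a * b) *\<^sub>R v" for a b and v :: "real^3"
    using sg(1) by (simp add: algebra_simps)
  show ?thesis
    unfolding val_def by (rule has_derivative_eq_rhs[OF has_derivative_scaleR[OF c g]], rule ext, unfold ss, simp add: add.commute)
qed

lemma sheet_chart:
  assumes p: "p \<in> L - C"
  obtains X :: "real^2 \<Rightarrow> real^3" and w0 \<rho> N' U where "C2_chart S C U X" "X w0 = p" "\<rho> > 0" "ball w0 \<rho> \<subseteq> U"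
    "\<And>w. w \<in> ball w0 \<rho> \<Longrightarrow> X w \<in> L - C \<and> (X has_derivative frechet_derivative X (at w)) (at w) \<and>
      ((\<lambda>w. N (X w)) has_derivative N' w) (at w) \<and>
      (\<forall>a b. cross3 (N' w a) (frechet_derivative X (at w) b) + cross3 (frechet_derivative X (at w) a) (N' w b)
      = (- 2 * H) *\<^sub>R cross3 (frechet_derivative X (at w) a) (frechet_derivative X (at w) b)) \<and>
      (\<forall>z. N (X w) \<bullet> frechet_derivative X (at w) z = 0)"
    "\<And>i. continuous_on (ball w0 \<rho>) (\<lambda>w. N' w (axis i 1))"
    "\<And>w w'. w \<in> ball w0 \<rho> \<Longrightarrow> w' \<in> ball w0 \<rho> \<Longrightarrow> hor (X w) = hor (X w') \<Longrightarrow> w = w'"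
proof -
  have pS: "p \<in> S - C" using p L_S by blast
  obtain U X w0 where ch: "C2_chart S C U X" "w0 \<in> U" "0 < w0 $ 2" "X w0 = p" by (rule chart_at_interior[OF pS])
  note cf = C2_chart_facts[OF ch(1)]
  let ?X' = "\<lambda>w. frechet_derivative X (at w)"
  have "\<exists>\<rho> N'. \<rho> > 0 \<and> ball w0 \<rho> \<subseteq> U \<and> (\<forall>w\<in>ball w0 \<rho>. 0 < w $ 2) \<and>
    (\<forall>w\<in>ball w0 \<rho>. ((\<lambda>w. N (X w)) has_derivative N' w) (at w)) \<and>
    (\<forall>w\<in>ball w0 \<rho>. \<forall>a b. cross3 (N' w a) (?X' w b) + cross3 (?X' w a) (N' w b) = (- 2 * H) *\<^sub>R cross3 (?X' w a) (?X' w b)) \<and>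
    (\<forall>i. continuous_on (ball w0 \<rho>) (\<lambda>w. N' w (axis i 1)))"
    apply (rule mean_curvature_identity[OF ch(1) N_cont N_norm N_orth[OF ch(1)] cmc ch(2,3)], assumption, assumption, assumption)
    subgoal premises p for \<rho> N'
      by (rule exI[of _ \<rho>], rule exI[of _ N'], intro conjI ballI allI, rule p(1), rule p(2), erule p(3), erule p(4), erule p(5), rule p(6))
    done
  then obtain \<rho>1 N' where r1: "\<rho>1 > 0" "ball w0 \<rho>1 \<subseteq> U" "\<And>w. w \<in> ball w0 \<rho>1 \<Longrightarrow> 0 < w $ 2"
    "\<And>w. w \<in> ball w0 \<rho>1 \<Longrightarrow> ((\<lambda>w. N (X w)) has_derivative N' w) (at w)"
    "\<And>w a b. w \<in> ball w0 \<rho>1 \<Longrightarrow> cross3 (N' w a) (?X' w b) + cross3 (?X' w a) (N' w b) = (- 2 * H) *\<^sub>R cross3 (?X' w a) (?X' w b)"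
    "\<And>i. continuous_on (ball w0 \<rho>1) (\<lambda>w. N' w (axis i 1))"
    by blast
  have "yv p - t' > 0" using p by (simp add: L_def)
  moreover have "isCont yv p" using isCont_cap(1)[OF P_S] pS by blast
  then have "isCont (\<lambda>w. yv (X w)) w0"
    using isCont_o2[OF C2_on_partial_isCont(1)[OF cf(2) ch(2)]] ch(4) by blast
  ultimately have "\<forall>\<^sub>F w in nhds w0. dist (yv (X w)) (yv (X w0)) < yv p - t'" by (intro isCont_near)
  then obtain \<rho>2 where r2: "\<rho>2 > 0" "\<And>w. dist w w0 < \<rho>2 \<Longrightarrow> dist (yv (X w)) (yv p) < yv p - t'"
    unfolding eventually_nhds_metric ch(4) by blast
  define \<rho> where "\<rho> = min \<rho>1 \<rho>2"
  have sub: "ball w0 \<rho> \<subseteq> ball w0 \<rho>1" by (auto simp: \<rho>_def)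
  have XL: "X w \<in> L - C" if "w \<in> ball w0 \<rho>" for w
  proof -
    have w: "w \<in> U" "0 < w $ 2" using that sub r1(2,3) by blast+
    then have "X w \<in> S" "X w \<notin> C" using cf(4)[of w] cf(6)[of w] by auto
    moreover have "dist (yv (X w)) (yv p) < yv p - t'" using r2(2)[of w] that by (simp add: \<rho>_def dist_commute)
    ultimately show ?thesis unfolding L_def dist_real_def by (auto simp: abs_if split: if_splits)
  qed
  obtain Yi where Yi: "homeomorphism (U \<inter> upper_half) (X ` (U \<inter> upper_half)) X Yi" using ch(1) unfolding C2_chart_def by blast
  have Xinj: "w = w'" if "w \<in> ball w0 \<rho>" "w' \<in> ball w0 \<rho>" "hor (X w) = hor (X w')" for w w'
  proof -
    have "X w = X w'" using L_inj XL that by blast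
    moreover have "w \<in> U \<inter> upper_half" "w' \<in> U \<inter> upper_half"
      using that sub r1(2) r1(3)[of w] r1(3)[of w'] by (auto simp: upper_half_def intro: less_imp_le)
    ultimately show ?thesis using homeomorphism_apply1[OF Yi] by metis
  qed
  have pos: "\<rho> > 0" using r1(1) r2(1) by (simp add: \<rho>_def)
  have subU: "ball w0 \<rho> \<subseteq> U" using sub r1(2) by blast
  have contN: "continuous_on (ball w0 \<rho>) (\<lambda>w. N' w (axis i 1))" for i using r1(6) sub continuous_on_subset by blast
  have main: "X w \<in> L - C \<and> (X has_derivative frechet_derivative X (at w)) (at w) \<and>
      ((\<lambda>w. N (X w)) has_derivative N' w) (at w) \<and>
      (\<forall>a b. cross3 (N' w a) (frechet_derivative X (at w) b) + cross3 (frechet_derivative X (at w) a) (N' w b)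
      = (- 2 * H) *\<^sub>R cross3 (frechet_derivative X (at w) a) (frechet_derivative X (at w) b)) \<and>
      (\<forall>z. N (X w) \<bullet> frechet_derivative X (at w) z = 0)" if "w \<in> ball w0 \<rho>" for w
  proof -
    have w: "w \<in> ball w0 \<rho>1" "w \<in> U" "0 \<le> w $ 2" using that sub r1(2) r1(3)[of w] by (auto intro: less_imp_le)
    show ?thesis using XL[OF that] partial_has_derivative(1)[OF cf(2) w(2)] r1(4,5)[OF w(1)] N_orth[OF ch(1) w(2,3)] by blast
  qed
  show thesis by (rule that[OF ch(1,4) pos subU]) (fact main, fact contN, fact Xinj)
qed

lemma cap_divergence:
  assumes p: "p \<in> L" and tang: "\<And>z. N p \<bullet> Y' z = 0"
    and curv: "\<And>a b. cross3 (Nd a) (Y' b) + cross3 (Y' a) (Nd b) = (- 2 * H) *\<^sub>R cross3 (Y' a) (Y' b)"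
    and \<xi>: "\<xi> = (\<lambda>z. (cutoff' (yv p - t) * ((W p \<bullet> Y' z) / om p)) *\<^sub>R (W p - N p)
      + (cutoff (yv p - t) * sg) *\<^sub>R (dW p (Y' z) - Nd z))"
  shows "d \<bullet> cross3 (\<xi> z1) (Y' z2) + d \<bullet> cross3 (Y' z1) (\<xi> z2) =
    cutoff' (yv p - t) / om p * (N p \<bullet> cross3 (Y' z1) (Y' z2)) * (1 - W p \<bullet> N p) * (om p + N p \<bullet> d)
      + 2 * sg * (H - H0) * cutoff (yv p - t) * (d \<bullet> cross3 (Y' z1) (Y' z2))"
proof -
  have Pp: "norm (P p) < 1" by (rule L_P[OF p])
  have omp: "om p \<noteq> 0" using om_pos[OF Pp] by simp
  have NN: "N p \<bullet> N p = 1" using N_norm[OF L_S[OF p]] by (simp add: norm_eq_1)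
  have WW: "W p \<bullet> W p = 1" using W_norm[of p] Pp by simp
  have dv: "d \<bullet> cross3 (dW p (Y' z1)) (Y' z2) + d \<bullet> cross3 (Y' z1) (dW p (Y' z2)) = - 2 * H0 * (d \<bullet> cross3 (Y' z1) (Y' z2))"
    unfolding dW_def by (rule W_divergence)
  have "d \<bullet> (cross3 (Nd z1) (Y' z2) + cross3 (Y' z1) (Nd z2)) = d \<bullet> ((- 2 * H) *\<^sub>R cross3 (Y' z1) (Y' z2))" unfolding curv ..
  then have dn: "d \<bullet> cross3 (Nd z1) (Y' z2) + d \<bullet> cross3 (Y' z1) (Nd z2) = - 2 * H * (d \<bullet> cross3 (Y' z1) (Y' z2))"
    by (simp add: inner_add_right)
  have e: "\<xi> z = (cutoff' (yv p - t) * ((W p \<bullet> Y' z) / om p)) *\<^sub>R (W p - N p)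
      + (cutoff (yv p - t) * sg) *\<^sub>R (dW p (Y' z) - Nd z)" for z unfolding \<xi> ..
  show ?thesis
    using divergence_identity[OF NN tang tang WW omp dv dn e e] by (simp add: W_d)
qed

text \<open>Horizontal divergence of \<open>field\<close> on the vertical line through
  \<open>p\<close>: the expression in \<open>divergence_identity\<close> divided by the Jacobian
  \<open>d \<bullet> cross3 A B\<close>, which is
  \<open>(N p \<bullet> cross3 A B) * (N p \<bullet> d)\<close>.\<close>

definition growth :: "real^3 \<Rightarrow> real" where
  "growth p = cutoff' (yv p - t) / om p * (1 - W p \<bullet> N p) * (om p + N p \<bullet> d) / (N p \<bullet> d)
     + 2 * sg * (H - H0) * cutoff (yv p - t)"

lemma W_N_le_1: "p \<in> S \<Longrightarrow> W p \<bullet> N p \<le> 1"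
proof -
  assume p: "p \<in> S"
  have "W p \<bullet> W p = 1" using W_norm P_S[OF p] by simp
  then have "norm (W p) = 1" "norm (N p) = 1" using N_norm[OF p] by (simp_all add: norm_eq_1)
  then show ?thesis using norm_cauchy_schwarz[of "W p" "N p"] by simp
qed

lemma growth_nonneg: "p \<in> L \<Longrightarrow> 0 < N p \<bullet> d \<Longrightarrow> 0 \<le> growth p"
proof -
  assume p: "p \<in> L" and nu: "0 < N p \<bullet> d"
  have "om p > 0" by (rule om_pos[OF L_P[OF p]])
  then have "0 \<le> cutoff' (yv p - t) / om p * (1 - W p \<bullet> N p) * (om p + N p \<bullet> d) / (N p \<bullet> d)"
    using cutoff_bounds(3)[of "yv p - t"] W_N_le_1[OF L_S[OF p]] nu
    by (intro divide_nonneg_pos mult_nonneg_nonneg) auto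
  moreover have "0 \<le> 2 * (sg * (H - H0)) * cutoff (yv p - t)"
    using mult_nonneg_nonneg[OF sg(3) cutoff_bounds(1)[of "yv p - t"]] by (simp add: mult.assoc)
  ultimately show ?thesis by (simp add: growth_def mult.assoc)
qed

text \<open>A chart of the sheet is lifted along \<open>d\<close>. The cross product of its tangent
  vectors is \<open>l *\<^sub>R N p\<close>, so the Jacobian is \<open>l * (N p \<bullet> d)\<close>
  and the chart-dependent \<open>l\<close> cancels.\<close>

lemma field_derivative:
  assumes p: "p \<in> L - C" and nu: "0 < N p \<bullet> d" and x: "hor p = hor x" and D: "D = \<tau> *\<^sub>R d"
  shows "\<exists>f. (field has_derivative f) (at x) \<and>
    (\<forall>a b. D \<bullet> cross3 (f a) b + D \<bullet> cross3 a (f b) = growth p * (D \<bullet> cross3 a b))"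
proof -
  obtain X :: "real^2 \<Rightarrow> real^3" and w0 \<rho> N' U where X: "C2_chart S C U X" "X w0 = p" "\<rho> > 0" "ball w0 \<rho> \<subseteq> U"
    and Xw: "\<And>w. w \<in> ball w0 \<rho> \<Longrightarrow> X w \<in> L - C \<and> (X has_derivative frechet_derivative X (at w)) (at w) \<and>
      ((\<lambda>w. N (X w)) has_derivative N' w) (at w) \<and>
      (\<forall>a b. cross3 (N' w a) (frechet_derivative X (at w) b) + cross3 (frechet_derivative X (at w) a) (N' w b)
      = (- 2 * H) *\<^sub>R cross3 (frechet_derivative X (at w) a) (frechet_derivative X (at w) b)) \<and>
      (\<forall>z. N (X w) \<bullet> frechet_derivative X (at w) z = 0)"
    and inj: "\<And>w w'. w \<in> ball w0 \<rho> \<Longrightarrow> w' \<in> ball w0 \<rho> \<Longrightarrow> hor (X w) = hor (X w') \<Longrightarrow> w = w'"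
    by (rule sheet_chart[OF p], rule that; assumption)
  have w0: "w0 \<in> ball w0 \<rho>" using X(3) by simp
  let ?X' = "frechet_derivative X (at w0)"
  have W0: "p \<in> L" "(X has_derivative ?X') (at w0)" "((\<lambda>w. N (X w)) has_derivative N' w0) (at w0)"
    "\<And>a b. cross3 (N' w0 a) (?X' b) + cross3 (?X' a) (N' w0 b) = (- 2 * H) *\<^sub>R cross3 (?X' a) (?X' b)"
    "\<And>z. N p \<bullet> ?X' z = 0" using Xw[OF w0] X(2) by auto
  define \<xi>' where "\<xi>' = (\<lambda>z. (cutoff' (yv p - t) * ((W p \<bullet> ?X' z) / om p)) *\<^sub>R (W p - N p)
      + (cutoff (yv p - t) * sg) *\<^sub>R (dW p (?X' z) - N' w0 z))"
  have PX: "norm (P (X w0)) < 1" using L_P[OF W0(1)] X(2) by simp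
  have d\<xi>: "((\<lambda>w. val (X w)) has_derivative \<xi>') (at w0)"
    using val_has_derivative[OF W0(2,3) PX] unfolding X(2) \<xi>'_def .
  define J where "J = d \<bullet> cross3 (?X' (axis 1 1)) (?X' (axis 2 1))"
  have NN: "N p \<bullet> N p = 1" using N_norm[OF L_S[OF W0(1)]] by (simp add: norm_eq_1)
  define l where "l = N p \<bullet> cross3 (?X' (axis 1 1)) (?X' (axis 2 1))"
  have cr: "cross3 (?X' (axis 1 1)) (?X' (axis 2 1)) = l *\<^sub>R N p"
    unfolding l_def by (rule cross_eq_normal[OF NN W0(5) W0(5)])
  have Jl: "J = l * (N p \<bullet> d)" unfolding J_def cr by (simp add: inner_commute)
  note cf = C2_chart_facts[OF X(1)]
  have w0U: "w0 \<in> U" using X(4) w0 by blast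
  have "l \<noteq> 0"
    using cross_partial_nonzero[OF cf(2) w0U cf(3)[OF w0U]] cr by (auto simp: partial_def)
  then have J0: "J \<noteq> 0" using Jl nu by simp
  have cX: "continuous_on (ball w0 \<rho>) X" using cf(5) X(4) continuous_on_subset by blast
  have inj': "w' = w" if "w \<in> ball w0 \<rho>" "w' \<in> ball w0 \<rho>" "X w' = X w + s *\<^sub>R d" for w w' s
    by (rule inj[OF that(2,1)]) (simp add: that(3) hor_simps)
  have Zeq: "field (X w + s *\<^sub>R d) = val (X w)" if "w \<in> ball w0 \<rho>" for w s
    by (rule field_over) (use Xw[OF that] in \<open>auto simp: hor_simps\<close>)
  obtain s where s: "x = X w0 + s *\<^sub>R d" using hor_eq_iff[of x p] x X(2) by auto
  have "\<exists>f. (field has_derivative f) (at (X w0 + s *\<^sub>R d)) \<and>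
    (\<forall>a b. D \<bullet> cross3 (f a) b + D \<bullet> cross3 a (f b) =
      (d \<bullet> cross3 (\<xi>' (axis 1 1)) (?X' (axis 2 1)) + d \<bullet> cross3 (?X' (axis 1 1)) (\<xi>' (axis 2 1))) / J
        * (D \<bullet> cross3 a b))"
    by (rule lift_derivative[OF open_ball cX d_nz inj' w0 W0(2) d\<xi> J_def J0 Zeq D])
  moreover have "(d \<bullet> cross3 (\<xi>' (axis 1 1)) (?X' (axis 2 1)) + d \<bullet> cross3 (?X' (axis 1 1)) (\<xi>' (axis 2 1))) / J = growth p"
    unfolding cap_divergence[where Y' = "?X'" and Nd = "N' w0" and \<xi> = \<xi>' and p = p, OF W0(1,5,4) \<xi>'_def] l_def[symmetric] J_def[symmetric] growth_def
    unfolding add_divide_distrib using J0 \<open>l \<noteq> 0\<close> by (simp add: Jl)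
  ultimately show ?thesis unfolding s by simp
qed

end

section \<open>Points with vertical tangent plane\<close>

lemma frame_expand:
  fixes k d z :: "real^3"
  assumes "norm k = 1" "norm d = 1" "k \<bullet> d = 0" and e: "e = cross3 k d"
  shows "e \<bullet> e = 1" "e \<bullet> d = 0" "e \<bullet> k = 0" "z = (e \<bullet> z) *\<^sub>R e + (d \<bullet> z) *\<^sub>R d + (k \<bullet> z) *\<^sub>R k"
proof -
  have kk: "k \<bullet> k = 1" "d \<bullet> d = 1" "d \<bullet> k = 0" using assms by (simp_all add: norm_eq_1 inner_commute)
  show ee: "e \<bullet> e = 1" unfolding e dot_cross using kk assms(3) by simp
  show ed: "e \<bullet> d = 0" and ek: "e \<bullet> k = 0" unfolding e by (simp_all add: dot_cross_self)
  define u where "u = z - ((e \<bullet> z) *\<^sub>R e + (d \<bullet> z) *\<^sub>R d + (k \<bullet> z) *\<^sub>R k)"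
  have de: "d \<bullet> e = 0" "k \<bullet> e = 0" using ed ek by (simp_all add: inner_commute)
  have u: "u \<bullet> e = 0" "u \<bullet> d = 0" "u \<bullet> k = 0"
    using ee kk ed ek de assms(3) by (simp_all add: u_def inner_diff_left inner_add_left inner_commute[of z])
  have c: "cross3 e d = - k" unfolding e by (rule frame_cross[OF assms(2,3)])
  have "cross3 e d \<noteq> 0" using c assms(1) by auto
  from parallel_if_orthogonal_to_both[OF u(1,2) this] have "u = (u \<bullet> sgn (- k)) *\<^sub>R sgn (- k)" unfolding c .
  then have "u = 0" using u(3) by (simp add: sgn_div_norm assms(1))
  then show "z = (e \<bullet> z) *\<^sub>R e + (d \<bullet> z) *\<^sub>R d + (k \<bullet> z) *\<^sub>R k" by (simp add: u_def)
qed

text \<open>\<open>A\<close> and \<open>B\<close> are the tangent vectors over the coordinate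
  directions \<open>e\<close> and \<open>d\<close> of the plane orthogonal to \<open>k\<close>. With
  \<open>cross3 A B = l *\<^sub>R N\<close> the component along \<open>k\<close> gives
  \<open>l * (N \<bullet> k) = - 1\<close>, and \<open>N \<bullet> k\<close> lies between
  \<open>0\<close> and \<open>1\<close>.\<close>

lemma vertical_algebra:
  fixes k d A B N :: "real^3"
  assumes kd: "norm k = 1" "norm d = 1" "k \<bullet> d = 0" and e: "e = cross3 k d"
    and A: "e \<bullet> A = 1" "d \<bullet> A = 0" and B: "e \<bullet> B = 0" "d \<bullet> B = 1"
    and N: "N \<bullet> N = 1" "N \<bullet> A = 0" "N \<bullet> B = 0" "0 < N \<bullet> k"
  shows "A = e + (k \<bullet> A) *\<^sub>R k" "B = d + (k \<bullet> B) *\<^sub>R k" "N \<bullet> cross3 A B \<le> - 1"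
    "k \<bullet> B = (N \<bullet> cross3 A B) * (N \<bullet> d)" "d \<bullet> cross3 A B = k \<bullet> B" "d \<bullet> cross3 e k = 1"
proof -
  note fe = frame_expand[OF kd e]
  have kk: "k \<bullet> k = 1" "d \<bullet> d = 1" "d \<bullet> k = 0" using kd by (simp_all add: norm_eq_1 inner_commute)
  show Ae: "A = e + (k \<bullet> A) *\<^sub>R k" using fe(4)[of A] A by simp
  show Be: "B = d + (k \<bullet> B) *\<^sub>R k" using fe(4)[of B] B by simp
  define l where "l = N \<bullet> cross3 A B"
  have cl: "cross3 A B = l *\<^sub>R N" unfolding l_def by (rule cross_eq_normal[OF N(1-3)])
  have ed: "cross3 e d = - k" unfolding e by (rule frame_cross[OF kd(2,3)])
  have ek: "cross3 e k = d"
  proof -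
    have "cross3 e k = - cross3 k (cross3 k d)" unfolding e by (rule cross_skew)
    also have "\<dots> = - ((k \<bullet> d) *\<^sub>R k - (k \<bullet> k) *\<^sub>R d)" by (simp add: Lagrange)
    finally show ?thesis using kk kd by simp
  qed
  show dek: "d \<bullet> cross3 e k = 1" unfolding ek by (rule kk(2))
  have c: "cross3 A B = - k + (k \<bullet> B) *\<^sub>R d + (k \<bullet> A) *\<^sub>R e"
  proof -
    have "cross3 A B = cross3 (e + (k \<bullet> A) *\<^sub>R k) (d + (k \<bullet> B) *\<^sub>R k)" using Ae Be by metis
    also have "\<dots> = cross3 e d + (k \<bullet> B) *\<^sub>R cross3 e k + (k \<bullet> A) *\<^sub>R cross3 k d" by (simp add: cross_linear)
    finally show ?thesis unfolding ed ek e[symmetric] .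
  qed
  have "k \<bullet> cross3 A B = - 1" unfolding c using kk kd(3) fe(3) by (simp add: inner_add_right inner_diff_right inner_commute)
  then have lk: "l * (N \<bullet> k) = - 1" unfolding cl by (simp add: inner_commute)
  have "norm N = 1" using N(1) by (simp add: norm_eq_1)
  then have "N \<bullet> k \<le> 1" using norm_cauchy_schwarz[of N k] kd(1) by simp
  moreover have "l < 0" using lk N(4) by (metis less_numeral_extra(1) linorder_not_less mult_nonneg_nonneg neg_0_le_iff_le not_one_le_zero order_less_imp_le)
  ultimately have "l * (N \<bullet> k) \<ge> l * 1" by (intro mult_left_mono_neg) auto
  then show "N \<bullet> cross3 A B \<le> - 1" using lk by (simp add: l_def)
  show db: "d \<bullet> cross3 A B = k \<bullet> B" unfolding c using kk kd(3) fe(2) by (simp add: inner_add_right inner_diff_right inner_commute)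
  show "k \<bullet> B = (N \<bullet> cross3 A B) * (N \<bullet> d)" using db unfolding l_def[symmetric] unfolding cl by (simp add: inner_commute)
qed

lemma isCont_eventually:
  fixes f :: "'a::t2_space \<Rightarrow> real"
  assumes "isCont f x"
  shows "f x < a \<Longrightarrow> \<forall>\<^sub>F w in nhds x. f w < a" "a < f x \<Longrightarrow> \<forall>\<^sub>F w in nhds x. a < f w"
  using assms unfolding isCont_def tendsto_at_iff_tendsto_nhds by (auto dest: order_tendstoD)

context graph_cap begin

text \<open>At a point with horizontal normal, \<open>L\<close> is still a graph over its tangent plane. The constant \<open>K\<close> bounds
  all quantities that enter the divergence of the tilted field.\<close>

definition vertical_graph ::
    "real^3 \<Rightarrow> real \<Rightarrow> real \<Rightarrow> (real^2 \<Rightarrow> real^3) \<Rightarrow> (real^2 \<Rightarrow> real^2 \<Rightarrow> real^3) \<Rightarrow> (real^2 \<Rightarrow> real^2 \<Rightarrow> real^3) \<Rightarrow> bool" where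
  "vertical_graph p r K Y Y' N1 \<longleftrightarrow> (\<forall>w. \<bar>w $ 1 - cross3 (N p) d \<bullet> p\<bar> < r \<longrightarrow> \<bar>w $ 2 - d \<bullet> p\<bar> < r \<longrightarrow>
     Y w \<in> L - C \<and> (Y has_derivative Y' w) (at w) \<and> ((\<lambda>w. N (Y w)) has_derivative N1 w) (at w) \<and>
     (\<forall>x z. cross3 (N1 w x) (Y' w z) + cross3 (Y' w x) (N1 w z) = (- 2 * H) *\<^sub>R cross3 (Y' w x) (Y' w z)) \<and>
     (\<forall>z. N (Y w) \<bullet> Y' w z = 0) \<and> cross3 (N p) d \<bullet> Y w = w $ 1 \<and> d \<bullet> Y w = w $ 2 \<and>
     (\<forall>z. cross3 (N p) d \<bullet> Y' w z = z $ 1 \<and> d \<bullet> Y' w z = z $ 2) \<and> 0 < N (Y w) \<bullet> N p \<and>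
     norm (Y' w (axis 1 1)) \<le> K \<and> norm (N1 w (axis 1 1)) \<le> K \<and> 1 \<le> K * om (Y w) \<and> yv (Y w) - t \<le> K \<and>
     1 \<le> K * (1 - W (Y w) \<bullet> N (Y w)))"

text \<open>\<open>W p\<close> has a positive vertical component and \<open>N p\<close> has none, so
  \<open>W p \<noteq> N p\<close>. Hence \<open>1 - W \<bullet> N\<close> stays away from zero near
  \<open>p\<close>, as does \<open>om\<close>, and the remaining quantities are bounded by
  continuity.\<close>

lemma vertical_graph_exists:
  assumes p: "p \<in> L - C" and nu: "N p \<bullet> d = 0"
  shows "\<exists>r K Y Y' N1. r > 0 \<and> K > 0 \<and> Y (vector [cross3 (N p) d \<bullet> p, d \<bullet> p]) = p \<and> vertical_graph p r K Y Y' N1"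
proof -
  obtain X :: "real^2 \<Rightarrow> real^3" and w0 \<rho> N' U where X: "C2_chart S C U X" "X w0 = p" "\<rho> > 0" "ball w0 \<rho> \<subseteq> U"
    and Xw: "\<And>w. w \<in> ball w0 \<rho> \<Longrightarrow> X w \<in> L - C \<and> (X has_derivative frechet_derivative X (at w)) (at w) \<and>
      ((\<lambda>w. N (X w)) has_derivative N' w) (at w) \<and>
      (\<forall>a b. cross3 (N' w a) (frechet_derivative X (at w) b) + cross3 (frechet_derivative X (at w) a) (N' w b)
      = (- 2 * H) *\<^sub>R cross3 (frechet_derivative X (at w) a) (frechet_derivative X (at w) b)) \<and>
      (\<forall>z. N (X w) \<bullet> frechet_derivative X (at w) z = 0)"
    and cN: "\<And>i. continuous_on (ball w0 \<rho>) (\<lambda>w. N' w (axis i 1))"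
    by (rule sheet_chart[OF p], rule that; assumption)
  let ?X' = "\<lambda>w. frechet_derivative X (at w)"
  note cf = C2_chart_facts[OF X(1)]
  have w0: "w0 \<in> ball w0 \<rho>" using X(3) by simp
  have w0U: "w0 \<in> U" using X(4) w0 by blast
  have pL: "p \<in> L" using p by blast
  have PX: "norm (P (X w0)) < 1" using L_P[OF pL] X(2) by simp
  have NN: "N p \<bullet> N p = 1" using N_norm[OF L_S[OF pL]] by (simp add: norm_eq_1)
  have WW: "W p \<bullet> W p = 1" using W_norm[of p] L_P[OF pL] by simp
  have omp: "om p > 0" by (rule om_pos[OF L_P[OF pL]])
  have "W p \<noteq> N p" using nu omp by (metis W_d(1) less_irrefl)
  then have "0 < (W p - N p) \<bullet> (W p - N p)" by simp
  then have WN: "W p \<bullet> N p < 1" using NN WW by (simp add: inner_diff_left inner_diff_right inner_commute)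
  have cX: "isCont X w0" by (rule C2_on_partial_isCont(1)[OF cf(2) w0U])
  have cNX: "isCont (\<lambda>w. N (X w)) w0" using Xw[OF w0] has_derivative_continuous by blast
  have c1: "isCont (\<lambda>w. N (X w) \<bullet> N p) w0" by (intro continuous_intros cNX)
  have c2: "isCont (\<lambda>w. om (X w)) w0" and c3: "isCont (\<lambda>w. yv (X w)) w0" and c4: "isCont (\<lambda>w. W (X w)) w0"
    using isCont_o2[OF cX] isCont_cap[OF PX] by blast+
  have c5: "isCont (\<lambda>w. 1 - W (X w) \<bullet> N (X w)) w0" by (intro continuous_intros c4 cNX)
  have c6: "isCont (\<lambda>w. norm (partial i X w)) w0" for i by (intro continuous_intros C2_on_partial_isCont(2)[OF cf(2) w0U])
  have c7: "isCont (\<lambda>w. norm (N' w (axis i 1))) w0" for i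
    by (intro continuous_intros) (use cN[of i] w0 in \<open>simp add: continuous_on_eq_continuous_at\<close>)
  define a where "a = norm (partial 1 X w0) + norm (partial 2 X w0) + norm (N' w0 (axis 1 1)) + norm (N' w0 (axis 2 1)) + 1"
  have ev: "\<forall>\<^sub>F w in nhds w0. 0 < N (X w) \<bullet> N p" "\<forall>\<^sub>F w in nhds w0. om p / 2 < om (X w)" "\<forall>\<^sub>F w in nhds w0. yv (X w) < yv p + 1"
    "\<forall>\<^sub>F w in nhds w0. (1 - W p \<bullet> N p) / 2 < 1 - W (X w) \<bullet> N (X w)"
    "\<forall>\<^sub>F w in nhds w0. norm (partial 1 X w) < a" "\<forall>\<^sub>F w in nhds w0. norm (partial 2 X w) < a"
    "\<forall>\<^sub>F w in nhds w0. norm (N' w (axis 1 1)) < a" "\<forall>\<^sub>F w in nhds w0. norm (N' w (axis 2 1)) < a"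
    by (rule isCont_eventually(2)[OF c1], use X(2) NN in simp, rule isCont_eventually(2)[OF c2], use X(2) omp in simp,
      rule isCont_eventually(1)[OF c3], use X(2) in simp, rule isCont_eventually(2)[OF c5], use X(2) WN in simp,
      (rule isCont_eventually(1)[OF c6], simp add: a_def add_nonneg_pos)+, (rule isCont_eventually(1)[OF c7], simp add: a_def add_nonneg_pos)+)
  have "\<forall>\<^sub>F w in nhds w0. 0 < N (X w) \<bullet> N p \<and> om p / 2 < om (X w) \<and> yv (X w) < yv p + 1 \<and>
    (1 - W p \<bullet> N p) / 2 < 1 - W (X w) \<bullet> N (X w) \<and> norm (partial 1 X w) < a \<and> norm (partial 2 X w) < a \<and>
    norm (N' w (axis 1 1)) < a \<and> norm (N' w (axis 2 1)) < a"
    by (intro eventually_conj ev)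
  then obtain \<eta>1 where \<eta>1: "\<eta>1 > 0" "\<And>w. dist w w0 < \<eta>1 \<Longrightarrow> 0 < N (X w) \<bullet> N p \<and> om p / 2 < om (X w) \<and> yv (X w) < yv p + 1 \<and>
    (1 - W p \<bullet> N p) / 2 < 1 - W (X w) \<bullet> N (X w) \<and> norm (partial 1 X w) < a \<and> norm (partial 2 X w) < a \<and>
    norm (N' w (axis 1 1)) < a \<and> norm (N' w (axis 2 1)) < a"
    unfolding eventually_nhds_metric by blast
  define \<eta> where "\<eta> = min \<eta>1 \<rho>"
  have \<eta>: "\<eta> > 0" using \<eta>1(1) X(3) by (simp add: \<eta>_def)
  have orth: "N p \<bullet> ?X' w0 z = 0" for z using Xw[OF w0] X(2) by auto
  obtain r and \<Gamma> :: "real^2 \<Rightarrow> real^2" and \<Gamma>' :: "real^2 \<Rightarrow> real^2 \<Rightarrow> real^2" and Kg where \<Gamma>: "r > 0" "\<Gamma> (vector [cross3 (N p) d \<bullet> X w0, d \<bullet> X w0]) = w0"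
    and \<Gamma>w: "\<And>w. \<bar>w $ 1 - cross3 (N p) d \<bullet> X w0\<bar> < r \<Longrightarrow> \<bar>w $ 2 - d \<bullet> X w0\<bar> < r \<Longrightarrow>
      \<Gamma> w \<in> ball w0 \<eta> \<inter> U \<and> cross3 (N p) d \<bullet> X (\<Gamma> w) = w $ 1 \<and> d \<bullet> X (\<Gamma> w) = w $ 2 \<and> (\<Gamma> has_derivative \<Gamma>' w) (at w) \<and>
      (\<forall>z. cross3 (N p) d \<bullet> frechet_derivative X (at (\<Gamma> w)) (\<Gamma>' w z) = z $ 1 \<and> d \<bullet> frechet_derivative X (at (\<Gamma> w)) (\<Gamma>' w z) = z $ 2) \<and>
      norm (\<Gamma>' w (axis 1 1)) \<le> Kg"
    by (rule graph_coordinates[OF cf(1,2) w0U cf(3)[OF w0U] N_norm[OF L_S[OF pL]] d1 nu orth \<eta>], rule that; assumption)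
  \<comment> \<open>A sum of nonnegative terms, each large enough for one of the required
    bounds.\<close>
  define K where "K = 2 * \<bar>Kg\<bar> * a + 2 / om p + \<bar>yv p + 1 - t\<bar> + 2 / (1 - W p \<bullet> N p) + 1"
  have a0: "a > 0" by (simp add: a_def add_nonneg_pos)
  have Kt: "0 \<le> 2 * \<bar>Kg\<bar> * a" "0 \<le> 2 / om p" "0 \<le> 2 / (1 - W p \<bullet> N p)" using a0 omp WN by auto
  have K: "K > 0" "2 * \<bar>Kg\<bar> * a \<le> K" "2 / om p \<le> K" "yv p + 1 - t \<le> K" "2 / (1 - W p \<bullet> N p) \<le> K"
    using Kt unfolding K_def by linarith+
  have "vertical_graph p r K (\<lambda>w. X (\<Gamma> w)) (\<lambda>w z. ?X' (\<Gamma> w) (\<Gamma>' w z)) (\<lambda>w z. N' (\<Gamma> w) (\<Gamma>' w z))"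
    unfolding vertical_graph_def
  proof (intro allI impI)
    fix w :: "real^2" assume w: "\<bar>w $ 1 - cross3 (N p) d \<bullet> p\<bar> < r" "\<bar>w $ 2 - d \<bullet> p\<bar> < r"
    have G: "\<Gamma> w \<in> ball w0 \<eta>" "\<Gamma> w \<in> U" "cross3 (N p) d \<bullet> X (\<Gamma> w) = w $ 1" "d \<bullet> X (\<Gamma> w) = w $ 2" "(\<Gamma> has_derivative \<Gamma>' w) (at w)"
      "\<And>z. cross3 (N p) d \<bullet> ?X' (\<Gamma> w) (\<Gamma>' w z) = z $ 1 \<and> d \<bullet> ?X' (\<Gamma> w) (\<Gamma>' w z) = z $ 2" "norm (\<Gamma>' w (axis 1 1)) \<le> Kg"
      using \<Gamma>w[of w] w X(2) by auto
    have Gb: "\<Gamma> w \<in> ball w0 \<rho>" using G(1) by (simp add: \<eta>_def)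
    have Gd: "dist (\<Gamma> w) w0 < \<eta>1" using G(1) by (simp add: \<eta>_def dist_commute)
    note B = \<eta>1(2)[OF Gd] and XG = Xw[OF Gb]
    let ?z = "\<Gamma>' w (axis 1 1)"
    have zc: "\<bar>?z $ i\<bar> \<le> \<bar>Kg\<bar>" for i using component_le_norm_cart[of ?z i] G(7) by linarith
    have bd: "norm ((?z $ 1) *\<^sub>R u + (?z $ 2) *\<^sub>R v) \<le> K" if "norm u < a" "norm v < a" for u v :: "real^3"
    proof -
      have "norm ((?z $ 1) *\<^sub>R u + (?z $ 2) *\<^sub>R v) \<le> \<bar>?z $ 1\<bar> * norm u + \<bar>?z $ 2\<bar> * norm v"
        by (rule order_trans[OF norm_triangle_ineq]) simp
      also have "\<dots> \<le> \<bar>Kg\<bar> * a + \<bar>Kg\<bar> * a" by (intro add_mono mult_mono zc) (use that in auto)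
      finally show ?thesis using K(2) by (simp add: mult_ac)
    qed
    have lN: "linear (N' (\<Gamma> w))" using XG has_derivative_linear by blast
    have N'z: "N' (\<Gamma> w) ?z = (?z $ 1) *\<^sub>R N' (\<Gamma> w) (axis 1 1) + (?z $ 2) *\<^sub>R N' (\<Gamma> w) (axis 2 1)"
      by (subst vec2_eq[of ?z]) (simp add: linear_add[OF lN] linear_cmul[OF lN])
    have dY: "((\<lambda>w. X (\<Gamma> w)) has_derivative (\<lambda>z. ?X' (\<Gamma> w) (\<Gamma>' w z))) (at w)"
      by (rule has_derivative_compose[OF G(5)]) (use XG in blast)
    have dN: "((\<lambda>w. N (X (\<Gamma> w))) has_derivative (\<lambda>z. N' (\<Gamma> w) (\<Gamma>' w z))) (at w)"
      using has_derivative_compose[OF G(5), of "\<lambda>w. N (X w)"] XG by blast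
    have omb: "1 \<le> K * om (X (\<Gamma> w))"
    proof -
      have "1 = (2 / om p) * (om p / 2)" using omp by simp
      also have "\<dots> \<le> K * om (X (\<Gamma> w))" using B K omp by (intro mult_mono) auto
      finally show ?thesis .
    qed
    have WNb: "1 \<le> K * (1 - W (X (\<Gamma> w)) \<bullet> N (X (\<Gamma> w)))"
    proof -
      have "1 = (2 / (1 - W p \<bullet> N p)) * ((1 - W p \<bullet> N p) / 2)" using WN by simp
      also have "\<dots> \<le> K * (1 - W (X (\<Gamma> w)) \<bullet> N (X (\<Gamma> w)))" using B K WN by (intro mult_mono) auto
      finally show ?thesis .
    qed
    have Yb: "norm (?X' (\<Gamma> w) ?z) \<le> K" unfolding frechet_derivative_partial[OF cf(2) G(2)] using bd B by blast
    have Nb: "norm (N' (\<Gamma> w) ?z) \<le> K" unfolding N'z using bd B by blast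
    have yb: "yv (X (\<Gamma> w)) - t \<le> K" using B K(4) by linarith
    show "X (\<Gamma> w) \<in> L - C \<and> ((\<lambda>w. X (\<Gamma> w)) has_derivative (\<lambda>z. ?X' (\<Gamma> w) (\<Gamma>' w z))) (at w) \<and>
      ((\<lambda>w. N (X (\<Gamma> w))) has_derivative (\<lambda>z. N' (\<Gamma> w) (\<Gamma>' w z))) (at w) \<and>
     (\<forall>x z. cross3 (N' (\<Gamma> w) (\<Gamma>' w x)) (?X' (\<Gamma> w) (\<Gamma>' w z)) + cross3 (?X' (\<Gamma> w) (\<Gamma>' w x)) (N' (\<Gamma> w) (\<Gamma>' w z)) = (- 2 * H) *\<^sub>R cross3 (?X' (\<Gamma> w) (\<Gamma>' w x)) (?X' (\<Gamma> w) (\<Gamma>' w z))) \<and>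
     (\<forall>z. N (X (\<Gamma> w)) \<bullet> ?X' (\<Gamma> w) (\<Gamma>' w z) = 0) \<and> cross3 (N p) d \<bullet> X (\<Gamma> w) = w $ 1 \<and> d \<bullet> X (\<Gamma> w) = w $ 2 \<and>
     (\<forall>z. cross3 (N p) d \<bullet> ?X' (\<Gamma> w) (\<Gamma>' w z) = z $ 1 \<and> d \<bullet> ?X' (\<Gamma> w) (\<Gamma>' w z) = z $ 2) \<and> 0 < N (X (\<Gamma> w)) \<bullet> N p \<and>
     norm (?X' (\<Gamma> w) (\<Gamma>' w (axis 1 1))) \<le> K \<and> norm (N' (\<Gamma> w) (\<Gamma>' w (axis 1 1))) \<le> K \<and> 1 \<le> K * om (X (\<Gamma> w)) \<and> yv (X (\<Gamma> w)) - t \<le> K \<and>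
     1 \<le> K * (1 - W (X (\<Gamma> w)) \<bullet> N (X (\<Gamma> w)))"
      using XG G dY dN Yb Nb omb WNb yb B by blast
  qed
  moreover have "X (\<Gamma> (vector [cross3 (N p) d \<bullet> p, d \<bullet> p])) = p" using \<Gamma>(2) X(2) by simp
  ultimately show ?thesis using \<Gamma>(1) K(1)
    by (intro exI[of _ r] exI[of _ K] exI[of _ "\<lambda>w. X (\<Gamma> w)"] exI[of _ "\<lambda>w z. ?X' (\<Gamma> w) (\<Gamma>' w z)"]
        exI[of _ "\<lambda>w z. N' (\<Gamma> w) (\<Gamma>' w z)"] conjI)
qed

text \<open>The slope in the vertical coordinate is a factor at most \<open>- 1\<close> times
  \<open>N \<bullet> d\<close>, which is nonnegative on \<open>L\<close>. It cannot vanish at the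
  mean value point: the two endpoints would be points of \<open>L\<close> on one vertical line. The
  point of negative slope in the last claim serves \<open>vertical_not_isolated\<close>.\<close>

lemma vertical_graph_decreasing:
  assumes p: "p \<in> L - C" and nu: "N p \<bullet> d = 0" and vg: "vertical_graph p r K Y Y' N1"
  defines "Q \<equiv> {w. \<bar>w $ 1 - cross3 (N p) d \<bullet> p\<bar> < r \<and> \<bar>w $ 2 - d \<bullet> p\<bar> < r}"
  shows "w \<in> Q \<Longrightarrow> N p \<bullet> Y' w (axis 2 1) = (N (Y w) \<bullet> cross3 (Y' w (axis 1 1)) (Y' w (axis 2 1))) * (N (Y w) \<bullet> d)"
    and "w \<in> Q \<Longrightarrow> N (Y w) \<bullet> cross3 (Y' w (axis 1 1)) (Y' w (axis 2 1)) \<le> - 1"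
    and "w \<in> Q \<Longrightarrow> N p \<bullet> Y' w (axis 2 1) \<le> 0"
    and "w \<in> Q \<Longrightarrow> w' \<in> Q \<Longrightarrow> w $ 1 = w' $ 1 \<Longrightarrow> w $ 2 < w' $ 2 \<Longrightarrow>
      N p \<bullet> Y w' < N p \<bullet> Y w \<and> (\<exists>x\<in>Q. x $ 1 = w $ 1 \<and> w $ 2 < x $ 2 \<and> x $ 2 < w' $ 2 \<and> N p \<bullet> Y' x (axis 2 1) < 0)"
proof -
  have pL: "p \<in> L" using p by blast
  have kd: "norm (N p) = 1" "norm d = 1" "N p \<bullet> d = 0" using N_norm[OF L_S[OF pL]] d1 nu by auto
  have ax: "axis 1 1 $ (1::2) = (1::real)" "axis 1 1 $ (2::2) = (0::real)" "axis 2 1 $ (1::2) = (0::real)" "axis 2 1 $ (2::2) = (1::real)"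
    by (simp_all add: axis_def)
  have alg: "N (Y w) \<bullet> cross3 (Y' w (axis 1 1)) (Y' w (axis 2 1)) \<le> - 1 \<and>
    N p \<bullet> Y' w (axis 2 1) = (N (Y w) \<bullet> cross3 (Y' w (axis 1 1)) (Y' w (axis 2 1))) * (N (Y w) \<bullet> d)" if w: "w \<in> Q" for w
  proof -
    have v: "Y w \<in> L" "\<And>z. N (Y w) \<bullet> Y' w z = 0" "\<And>z. cross3 (N p) d \<bullet> Y' w z = z $ 1 \<and> d \<bullet> Y' w z = z $ 2" "0 < N (Y w) \<bullet> N p"
      using vg w unfolding vertical_graph_def Q_def by blast+
    have NN: "N (Y w) \<bullet> N (Y w) = 1" using N_norm[OF L_S[OF v(1)]] by (simp add: norm_eq_1)
    show ?thesis
      using vertical_algebra(3,4)[OF kd refl, of "Y' w (axis 1 1)" "Y' w (axis 2 1)" "N (Y w)"] v NN ax by simp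
  qed
  show 1: "w \<in> Q \<Longrightarrow> N p \<bullet> Y' w (axis 2 1) = (N (Y w) \<bullet> cross3 (Y' w (axis 1 1)) (Y' w (axis 2 1))) * (N (Y w) \<bullet> d)"
    and 2: "w \<in> Q \<Longrightarrow> N (Y w) \<bullet> cross3 (Y' w (axis 1 1)) (Y' w (axis 2 1)) \<le> - 1" for w using alg by blast+
  show 3: "N p \<bullet> Y' w (axis 2 1) \<le> 0" if w: "w \<in> Q" for w
  proof -
    have "Y w \<in> L - C" using vg w unfolding vertical_graph_def Q_def by blast
    then have "0 \<le> N (Y w) \<bullet> d" using upward[of "Y w"] by (auto simp: L_def)
    then show ?thesis unfolding 1[OF w] using 2[OF w] by (intro mult_nonpos_nonneg) auto
  qed
  assume w: "w \<in> Q" "w' \<in> Q" "w $ 1 = w' $ 1" "w $ 2 < w' $ 2"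
  define c where "c = (\<lambda>s. w + (s - w $ 2) *\<^sub>R axis 2 (1::real))"
  have cc: "c s $ 1 = w $ 1" "c s $ 2 = s" for s by (simp_all add: c_def ax)
  have cQ: "c s \<in> Q" if "w $ 2 \<le> s" "s \<le> w' $ 2" for s using w that by (auto simp: Q_def cc)
  have cw: "c (w $ 2) = w" "c (w' $ 2) = w'" using w(3) by (auto simp: vec_eq_iff forall_2 cc)
  have D: "DERIV (\<lambda>s. N p \<bullet> Y (c s)) s :> N p \<bullet> Y' (c s) (axis 2 1)" if "w $ 2 \<le> s" "s \<le> w' $ 2" for s
  proof -
    have dY: "(Y has_derivative Y' (c s)) (at (c s))" using vg cQ[OF that] unfolding vertical_graph_def Q_def by blast
    have dc: "(c has_derivative (\<lambda>h. h *\<^sub>R axis 2 1)) (at s)" unfolding c_def by (auto intro!: derivative_eq_intros)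
    have "((\<lambda>s. N p \<bullet> Y (c s)) has_derivative (\<lambda>h. N p \<bullet> Y' (c s) (h *\<^sub>R axis 2 1))) (at s)"
      by (intro has_derivative_inner_right has_derivative_compose[OF dc dY])
    moreover have "(\<lambda>h. N p \<bullet> Y' (c s) (h *\<^sub>R axis 2 1)) = times (N p \<bullet> Y' (c s) (axis 2 1))"
      using linear_cmul[OF has_derivative_linear[OF dY]] by (simp add: fun_eq_iff mult.commute)
    ultimately show ?thesis by (simp add: has_field_derivative_def)
  qed
  obtain s where s: "w $ 2 < s" "s < w' $ 2" "N p \<bullet> Y (c (w' $ 2)) - N p \<bullet> Y (c (w $ 2)) = (w' $ 2 - w $ 2) * (N p \<bullet> Y' (c s) (axis 2 1))"
    using MVT2[OF w(4), of "\<lambda>s. N p \<bullet> Y (c s)" "\<lambda>s. N p \<bullet> Y' (c s) (axis 2 1)"] D by blast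
  have sQ: "c s \<in> Q" using cQ s by simp
  have le: "N p \<bullet> Y' (c s) (axis 2 1) \<le> 0" by (rule 3[OF sQ])
  have vY: "Y w \<in> L" "Y w' \<in> L" "cross3 (N p) d \<bullet> Y w = w $ 1" "d \<bullet> Y w = w $ 2" "cross3 (N p) d \<bullet> Y w' = w' $ 1" "d \<bullet> Y w' = w' $ 2"
    using vg w(1,2) unfolding vertical_graph_def Q_def by blast+
  have "N p \<bullet> Y' (c s) (axis 2 1) \<noteq> 0"
  proof
    assume "N p \<bullet> Y' (c s) (axis 2 1) = 0"
    then have "N p \<bullet> Y w' = N p \<bullet> Y w" using s(3) unfolding cw by simp
    then have "Y w' - Y w = (d \<bullet> (Y w' - Y w)) *\<^sub>R d"
      using frame_expand(4)[OF kd refl, of "Y w' - Y w"] vY w(3) by (simp add: inner_diff_right dd)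
    then have "hor (Y w' - Y w) = 0" by (simp add: hor_def)
    then have "hor (Y w) = hor (Y w')" by (simp add: hor_simps)
    then have "Y w = Y w'" using L_inj vY by blast
    then show False using vY(4,6) w(4) by simp
  qed
  then have neg: "N p \<bullet> Y' (c s) (axis 2 1) < 0" using le by simp
  then have "(w' $ 2 - w $ 2) * (N p \<bullet> Y' (c s) (axis 2 1)) < 0" using w(4) by (intro mult_pos_neg) auto
  then have "N p \<bullet> Y w' < N p \<bullet> Y w" using s(3) unfolding cw by simp
  then show "N p \<bullet> Y w' < N p \<bullet> Y w \<and> (\<exists>x\<in>Q. x $ 1 = w $ 1 \<and> w $ 2 < x $ 2 \<and> x $ 2 < w' $ 2 \<and> N p \<bullet> Y' x (axis 2 1) < 0)"
    using neg sQ s(1,2) by (intro conjI bexI[of _ "c s"]) (simp_all add: cc)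
qed

section \<open>Monotonicity and rigidity\<close>

text \<open>Both summands are bounded by a constant times the derivative of the cutoff, the second
  one through \<open>cutoff_le\<close>. The main term of the divergence carries the same factor, so
  the two can be compared even where the cutoff is small.\<close>

lemma val_derivative_bound:
  assumes p: "p \<in> S" and K: "0 < K" "norm A \<le> K" "norm B \<le> K" "1 \<le> K * om p" "yv p - t \<le> K"
  shows "norm ((cutoff' (yv p - t) * ((W p \<bullet> A) / om p)) *\<^sub>R (W p - N p) + (cutoff (yv p - t) * sg) *\<^sub>R (dW p A - B))
    \<le> cutoff' (yv p - t) * (2 * K * K + K * (1 + K\<^sup>2) * (\<bar>H0\<bar> * K + \<bar>H0\<bar> * (K * K) + K))"
proof -
  have P1: "norm (P p) < 1" by (rule P_S[OF p])
  have omp: "om p > 0" by (rule om_pos[OF P1])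
  have inv: "inverse (om p) \<le> K" using K(4) omp by (simp add: inverse_eq_divide divide_le_eq)
  have n: "norm (W p) = 1" "norm (N p) = 1" using W_norm[of p] P1 N_norm[OF p] by (simp_all add: norm_eq_1)
  have WN: "norm (W p - N p) \<le> 2" using norm_triangle_ineq4[of "W p" "N p"] n by simp
  have WA: "\<bar>(W p \<bullet> A) / om p\<bar> \<le> K * K"
  proof -
    have "\<bar>W p \<bullet> A\<bar> \<le> K" using Cauchy_Schwarz_ineq2[of "W p" A] n K(2) by simp
    then have "\<bar>W p \<bullet> A\<bar> * inverse (om p) \<le> K * K" using inv omp K(1) by (intro mult_mono) auto
    then show ?thesis using omp by (simp add: divide_inverse abs_mult)
  qed
  have PA: "\<bar>(P p \<bullet> A) / om p\<bar> \<le> K * K"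
  proof -
    have "\<bar>P p \<bullet> A\<bar> \<le> norm (P p) * norm A" by (rule Cauchy_Schwarz_ineq2)
    also have "\<dots> \<le> 1 * K" using P1 K(2) by (intro mult_mono) auto
    finally have "\<bar>P p \<bullet> A\<bar> * inverse (om p) \<le> K * K" using inv omp K(1) by (intro mult_mono) auto
    then show ?thesis using omp by (simp add: divide_inverse abs_mult)
  qed
  have dWA: "norm (dW p A) \<le> \<bar>H0\<bar> * K + \<bar>H0\<bar> * (K * K)"
  proof -
    have "norm (dW p A) \<le> norm (- (H0 *\<^sub>R hor A)) + norm ((H0 * (P p \<bullet> A) / om p) *\<^sub>R d)"
      unfolding dW_def by (rule norm_triangle_ineq)
    also have "\<dots> = \<bar>H0\<bar> * norm (hor A) + \<bar>H0\<bar> * \<bar>(P p \<bullet> A) / om p\<bar>" by (simp add: d1 abs_mult)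
    also have "\<dots> \<le> \<bar>H0\<bar> * K + \<bar>H0\<bar> * (K * K)"
      using norm_hor_le[of A] K(2) PA by (intro add_mono mult_left_mono) auto
    finally show ?thesis .
  qed
  define M where "M = \<bar>H0\<bar> * K + \<bar>H0\<bar> * (K * K) + K"
  have M0: "0 \<le> M" using K(1) by (simp add: M_def)
  have dB: "norm (dW p A - B) \<le> M" using norm_triangle_ineq4[of "dW p A" B] dWA K(3) by (simp add: M_def)
  have h: "0 \<le> cutoff' (yv p - t)" "0 \<le> cutoff (yv p - t)" by (rule cutoff_bounds)+
  have hs: "\<bar>sg\<bar> = 1" using sg(2) by auto
  have "norm ((cutoff' (yv p - t) * ((W p \<bullet> A) / om p)) *\<^sub>R (W p - N p)) = cutoff' (yv p - t) * (\<bar>(W p \<bullet> A) / om p\<bar> * norm (W p - N p))"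
    using h by (simp add: abs_mult)
  also have "\<dots> \<le> cutoff' (yv p - t) * (K * K * 2)"
    using h WA WN K(1) by (intro mult_left_mono mult_mono) auto
  finally have 1: "norm ((cutoff' (yv p - t) * ((W p \<bullet> A) / om p)) *\<^sub>R (W p - N p)) \<le> cutoff' (yv p - t) * (K * K * 2)" .
  have "norm ((cutoff (yv p - t) * sg) *\<^sub>R (dW p A - B)) = cutoff (yv p - t) * norm (dW p A - B)"
    using h hs by (simp add: abs_mult)
  also have "\<dots> \<le> (cutoff' (yv p - t) * (K * (1 + K\<^sup>2))) * M"
    using h dB M0 cutoff_le[OF K(5)] by (intro mult_mono) auto
  finally have 2: "norm ((cutoff (yv p - t) * sg) *\<^sub>R (dW p A - B)) \<le> (cutoff' (yv p - t) * (K * (1 + K\<^sup>2))) * M" .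
  have "norm ((cutoff' (yv p - t) * ((W p \<bullet> A) / om p)) *\<^sub>R (W p - N p) + (cutoff (yv p - t) * sg) *\<^sub>R (dW p A - B))
    \<le> cutoff' (yv p - t) * (K * K * 2) + (cutoff' (yv p - t) * (K * (1 + K\<^sup>2))) * M"
    by (rule norm_triangle_mono[OF 1 2])
  also have "\<dots> = cutoff' (yv p - t) * (2 * K * K + K * (1 + K\<^sup>2) * M)" by (simp add: algebra_simps)
  finally show ?thesis unfolding M_def .
qed

text \<open>Tilting adds \<open>\<epsilon> * - (d \<bullet> cross3 (\<xi>' w (axis 1 1)) k)\<close>
  to the numerator of the divergence, at most \<open>\<epsilon> * K2\<close> times the derivative of
  the cutoff. The main term is at most \<open>- 1 / K\<close> times the same factor, because
  \<open>1 - W \<bullet> N\<close> is bounded below near \<open>p\<close>. So numerator and Jacobian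
  of the tilted graph have compatible signs for small \<open>\<epsilon>\<close>.\<close>

lemma vertical_outward:
  assumes p: "p \<in> L - C" and nu: "N p \<bullet> d = 0" and x: "hor p = hor x" and D: "D = \<tau> *\<^sub>R d"
  shows "outward_at D field x"
proof -
  obtain r K Y Y' N1 where rK: "r > 0" "K > 0" and Yp: "Y (vector [cross3 (N p) d \<bullet> p, d \<bullet> p]) = p"
    and vg: "vertical_graph p r K Y Y' N1"
    using vertical_graph_exists[OF p nu] by blast
  note dec = vertical_graph_decreasing[OF p nu vg]
  define k where "k = N p"
  define e where "e = cross3 k d"
  have pL: "p \<in> L" using p by blast
  have kd: "norm k = 1" "norm d = 1" "k \<bullet> d = 0" using N_norm[OF L_S[OF pL]] d1 nu by (auto simp: k_def)
  note fe = frame_expand[OF kd e_def]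
  have e1: "norm e = 1" using fe(1) by (simp add: norm_eq_1)
  define Q where "Q = {w :: real^2. \<bar>w $ 1 - e \<bullet> p\<bar> < r \<and> \<bar>w $ 2 - d \<bullet> p\<bar> < r}"
  have Qd: "w \<in> Q \<longleftrightarrow> w \<in> {w. \<bar>w $ 1 - cross3 (N p) d \<bullet> p\<bar> < r \<and> \<bar>w $ 2 - d \<bullet> p\<bar> < r}" for w
    by (simp add: Q_def e_def k_def)
  define \<xi>' where "\<xi>' = (\<lambda>w z. (cutoff' (yv (Y w) - t) * ((W (Y w) \<bullet> Y' w z) / om (Y w))) *\<^sub>R (W (Y w) - N (Y w))
      + (cutoff (yv (Y w) - t) * sg) *\<^sub>R (dW (Y w) (Y' w z) - N1 w z))"
  define K2 where "K2 = 2 * K * K + K * (1 + K\<^sup>2) * (\<bar>H0\<bar> * K + \<bar>H0\<bar> * (K * K) + K)"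
  have K20: "K2 \<ge> 0" using rK(2) by (simp add: K2_def)
  \<comment> \<open>Makes the tilt error at most the main term,
    \<open>\<epsilon>0 * K2 \<le> 1 / K\<close>; the summand \<open>1\<close> covers
    \<open>K2 = 0\<close>.\<close>
  define \<epsilon>0 where "\<epsilon>0 = 1 / (K * (K2 + 1))"
  have \<epsilon>0: "\<epsilon>0 > 0" using rK(2) K20 by (simp add: \<epsilon>0_def)
  have ax: "axis 1 1 $ (1::2) = (1::real)" "axis 1 1 $ (2::2) = (0::real)" "axis 2 1 $ (1::2) = (0::real)" "axis 2 1 $ (2::2) = (1::real)"
    by (simp_all add: axis_def)
  have v: "Y w \<in> L" "Y w \<in> L - C" "(Y has_derivative Y' w) (at w)" "((\<lambda>w. N (Y w)) has_derivative N1 w) (at w)"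
    "\<And>x z. cross3 (N1 w x) (Y' w z) + cross3 (Y' w x) (N1 w z) = (- 2 * H) *\<^sub>R cross3 (Y' w x) (Y' w z)"
    "\<And>z. N (Y w) \<bullet> Y' w z = 0" "e \<bullet> Y w = w $ 1" "d \<bullet> Y w = w $ 2" "\<And>z. e \<bullet> Y' w z = z $ 1" "\<And>z. d \<bullet> Y' w z = z $ 2"
    "0 < N (Y w) \<bullet> k" "norm (Y' w (axis 1 1)) \<le> K" "norm (N1 w (axis 1 1)) \<le> K" "1 \<le> K * om (Y w)" "yv (Y w) - t \<le> K"
    "1 \<le> K * (1 - W (Y w) \<bullet> N (Y w))" if "w \<in> Q" for w
    using vg that unfolding vertical_graph_def Q_def e_def k_def by blast+
  have "\<exists>\<delta>>0. \<forall>A B C. {A, B, C} \<subseteq> {x. \<bar>e \<bullet> x - e \<bullet> p\<bar> < \<delta> \<and> \<bar>k \<bullet> x - k \<bullet> Y (vector [e \<bullet> p, d \<bullet> p])\<bar> < \<delta>} \<longrightarrow>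
     0 \<le> orient D A B C \<longrightarrow> 0 \<le> tri_flux D field A B C"
  proof (rule tilt_tri_flux_nonneg[OF e1 kd(2,1) fe(2,3) kd(3) _ rK(1) Q_def _ _ _ \<epsilon>0 _ _ _ D,
        where \<psi> = "\<lambda>w. k \<bullet> Y w" and \<psi>' = "\<lambda>w z. k \<bullet> Y' w z" and \<xi> = "\<lambda>w. val (Y w)" and \<xi>' = \<xi>'])
    show "e \<bullet> cross3 k d \<noteq> 0" using fe(1) unfolding e_def[symmetric] by simp
    show "((\<lambda>w. k \<bullet> Y w) has_derivative (\<lambda>z. k \<bullet> Y' w z)) (at w)" if "w \<in> Q" for w
      by (intro has_derivative_inner_right v(3)[OF that])
    show "((\<lambda>w. val (Y w)) has_derivative \<xi>' w) (at w)" if "w \<in> Q" for w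
      unfolding \<xi>'_def by (rule val_has_derivative[OF v(3,4)[OF that] L_P[OF v(1)[OF that]]])
    show "k \<bullet> Y w' < k \<bullet> Y w" if "w \<in> Q" "w' \<in> Q" "w $ 1 = w' $ 1" "w $ 2 < w' $ 2" for w w'
      using dec(4)[of w w'] that unfolding Qd k_def by blast
    show "k \<bullet> Y' w (axis 2 1) \<le> 0" if "w \<in> Q" for w
      using dec(3)[of w] that unfolding Qd k_def by blast
    show "field ((w $ 1) *\<^sub>R e + (w $ 2) *\<^sub>R d + (k \<bullet> Y w - 0 * w $ 2) *\<^sub>R k + s *\<^sub>R d) = val (Y w)" if "w \<in> Q" for w s
    proof -
      have "(w $ 1) *\<^sub>R e + (w $ 2) *\<^sub>R d + (k \<bullet> Y w - 0 * w $ 2) *\<^sub>R k = Y w"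
        using fe(4)[of "Y w"] unfolding v(7)[OF that] v(8)[OF that] by simp
      then show ?thesis using field_over[OF v(1)[OF that], of "Y w + s *\<^sub>R d"] by (simp add: hor_simps)
    qed
    fix w \<epsilon> assume w: "w \<in> Q" and \<epsilon>: "0 < \<epsilon>" "\<epsilon> < \<epsilon>0"
    define A where "A = Y' w (axis 1 1)"
    define B where "B = Y' w (axis 2 1)"
    define l where "l = N (Y w) \<bullet> cross3 A B"
    define h1 where "h1 = cutoff' (yv (Y w) - t)"
    define h where "h = cutoff (yv (Y w) - t)"
    \<comment> \<open>The main term is \<open>l * (h1 * X)\<close> with \<open>l \<le> - 1\<close>,
      and \<open>X\<close> will turn out to be at least \<open>1 / K\<close>.\<close>
    define X where "X = (1 - W (Y w) \<bullet> N (Y w)) * ((om (Y w) + N (Y w) \<bullet> d) / om (Y w))"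
    have NN: "N (Y w) \<bullet> N (Y w) = 1" using N_norm[OF L_S[OF v(1)[OF w]]] by (simp add: norm_eq_1)
    have va: "A = e + (k \<bullet> A) *\<^sub>R k" "B = d + (k \<bullet> B) *\<^sub>R k" "l \<le> - 1" "d \<bullet> cross3 A B = k \<bullet> B" "d \<bullet> cross3 e k = 1"
      using vertical_algebra[OF kd e_def, of A B "N (Y w)"] v(6,9,10,11)[OF w] NN unfolding A_def B_def l_def by (simp_all add: ax)
    have kB: "k \<bullet> B \<le> 0" using dec(3)[of w] w unfolding Qd k_def B_def by blast
    have nu0: "0 \<le> N (Y w) \<bullet> d" using upward[of "Y w"] v(2)[OF w] by (auto simp: L_def)
    have omw: "om (Y w) > 0" by (rule om_pos[OF L_P[OF v(1)[OF w]]])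
    have h0: "0 \<le> h1" "0 \<le> h" unfolding h1_def h_def by (rule cutoff_bounds)+
    have "1 - W (Y w) \<bullet> N (Y w) > 0" using v(16)[OF w] rK(2) by (metis less_le_trans zero_less_mult_pos zero_less_one)
    then have "(1 - W (Y w) \<bullet> N (Y w)) * 1 \<le> X" unfolding X_def using nu0 omw by (intro mult_left_mono) auto
    then have "K * (1 - W (Y w) \<bullet> N (Y w)) \<le> K * X" using rK(2) by simp
    then have KX: "1 \<le> K * X" using v(16)[OF w] by linarith
    then have X: "1 / K \<le> X" using rK(2) by (simp add: divide_le_eq mult.commute)
    have X0: "0 \<le> X" using X rK(2) by (metis less_imp_le order_trans zero_le_divide_1_iff)
    have "h1 / om (Y w) * l * (1 - W (Y w) \<bullet> N (Y w)) * (om (Y w) + N (Y w) \<bullet> d) = l * (h1 * X)" by (simp add: X_def)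
    also have "\<dots> \<le> (- 1) * (h1 * X)" using va(3) h0 X0 by (intro mult_right_mono) auto
    also have "\<dots> \<le> - (h1 * (1 / K))" using mult_left_mono[OF X h0(1)] by simp
    finally have T1: "h1 / om (Y w) * l * (1 - W (Y w) \<bullet> N (Y w)) * (om (Y w) + N (Y w) \<bullet> d) \<le> - (h1 * (1 / K))" .
    have "(sg * (H - H0)) * (h * (k \<bullet> B)) \<le> 0"
      by (rule mult_nonneg_nonpos[OF sg(3) mult_nonneg_nonpos[OF h0(2) kB]])
    moreover have "2 * sg * (H - H0) * h * (k \<bullet> B) = 2 * ((sg * (H - H0)) * (h * (k \<bullet> B)))" by (simp only: mult.assoc)
    ultimately have T2: "2 * sg * (H - H0) * h * (k \<bullet> B) \<le> 0" by linarith
    have "norm (\<xi>' w (axis 1 1)) \<le> h1 * K2"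
      unfolding \<xi>'_def h1_def K2_def
      by (rule val_derivative_bound[OF L_S[OF v(1)[OF w]] rK(2) v(12,13,14,15)[OF w]])
    moreover have "\<bar>d \<bullet> cross3 (\<xi>' w (axis 1 1)) k\<bar> \<le> norm (\<xi>' w (axis 1 1))"
      using abs_triple_le[of d "\<xi>' w (axis 1 1)" k] kd by simp
    ultimately have "- (d \<bullet> cross3 (\<xi>' w (axis 1 1)) k) \<le> h1 * K2" by linarith
    then have "\<epsilon> * - (d \<bullet> cross3 (\<xi>' w (axis 1 1)) k) \<le> \<epsilon> * (h1 * K2)" using \<epsilon>(1) by (intro mult_left_mono) auto
    also have "\<dots> = h1 * (\<epsilon> * K2)" by simp
    also have "\<epsilon> * K2 \<le> \<epsilon>0 * (K2 + 1)" using \<epsilon> K20 by (intro mult_mono) auto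
    also have "\<epsilon>0 * (K2 + 1) = 1 / K" using K20 by (simp add: \<epsilon>0_def)
    finally have T3: "\<epsilon> * - (d \<bullet> cross3 (\<xi>' w (axis 1 1)) k) \<le> h1 * (1 / K)" using h0(1) by (simp add: mult_left_mono)
    have "d \<bullet> cross3 (\<xi>' w (axis 1 1)) B + d \<bullet> cross3 A (\<xi>' w (axis 2 1)) =
      h1 / om (Y w) * l * (1 - W (Y w) \<bullet> N (Y w)) * (om (Y w) + N (Y w) \<bullet> d) + 2 * sg * (H - H0) * h * (d \<bullet> cross3 A B)"
      unfolding A_def B_def l_def h1_def h_def
      by (rule cap_divergence[where Y' = "Y' w" and Nd = "N1 w" and \<xi> = "\<xi>' w", OF v(1)[OF w] v(6)[OF w] v(5)[OF w]]) (simp add: \<xi>'_def)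
    then have div: "d \<bullet> cross3 (\<xi>' w (axis 1 1)) B + d \<bullet> cross3 A (\<xi>' w (axis 2 1)) =
      h1 / om (Y w) * l * (1 - W (Y w) \<bullet> N (Y w)) * (om (Y w) + N (Y w) \<bullet> d) + 2 * sg * (H - H0) * h * (k \<bullet> B)"
      unfolding va(4) .
    have dk: "d + (k \<bullet> B - \<epsilon>) *\<^sub>R k = B - \<epsilon> *\<^sub>R k" by (subst (2) va(2)) (simp add: algebra_simps)
    have "d \<bullet> cross3 (\<xi>' w (axis 1 1)) (B - \<epsilon> *\<^sub>R k) + d \<bullet> cross3 A (\<xi>' w (axis 2 1)) =
      (d \<bullet> cross3 (\<xi>' w (axis 1 1)) B + d \<bullet> cross3 A (\<xi>' w (axis 2 1))) + \<epsilon> * - (d \<bullet> cross3 (\<xi>' w (axis 1 1)) k)"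
      by (simp add: Cross3.right_diff_distrib cross_mult_right inner_diff_right)
    also have "\<dots> \<le> 0" unfolding div using T1 T2 T3 by linarith
    finally have "d \<bullet> cross3 (\<xi>' w (axis 1 1)) (B - \<epsilon> *\<^sub>R k) + d \<bullet> cross3 A (\<xi>' w (axis 2 1)) \<le> 0" .
    then have "0 \<le> (d \<bullet> cross3 (\<xi>' w (axis 1 1)) (d + (k \<bullet> B - \<epsilon>) *\<^sub>R k) + d \<bullet> cross3 (e + (k \<bullet> A) *\<^sub>R k) (\<xi>' w (axis 2 1))) / ((k \<bullet> B - \<epsilon>) * (d \<bullet> cross3 e k))"
      unfolding dk va(1)[symmetric] va(5) using kB \<epsilon>(1) by (intro divide_nonpos_neg) auto
    then show "0 \<le> (d \<bullet> cross3 (\<xi>' w (axis 1 1)) (d + (k \<bullet> Y' w (axis 2 1) - \<epsilon>) *\<^sub>R k) + d \<bullet> cross3 (e + (k \<bullet> Y' w (axis 1 1)) *\<^sub>R k) (\<xi>' w (axis 2 1))) / ((k \<bullet> Y' w (axis 2 1) - \<epsilon>) * (d \<bullet> cross3 e k))"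
      unfolding A_def B_def .
  qed
  moreover have "Y (vector [e \<bullet> p, d \<bullet> p]) = p" using Yp unfolding e_def k_def .
  ultimately have "\<exists>\<delta>>0. \<forall>A B C. {A, B, C} \<subseteq> {x. \<bar>e \<bullet> x - e \<bullet> p\<bar> < \<delta> \<and> \<bar>k \<bullet> x - k \<bullet> p\<bar> < \<delta>} \<longrightarrow>
     0 \<le> orient D A B C \<longrightarrow> 0 \<le> tri_flux D field A B C" by simp
  then obtain \<delta> where \<delta>: "\<delta> > 0" "\<And>A B C. {A, B, C} \<subseteq> {x. \<bar>e \<bullet> x - e \<bullet> p\<bar> < \<delta> \<and> \<bar>k \<bullet> x - k \<bullet> p\<bar> < \<delta>} \<Longrightarrow>
     0 \<le> orient D A B C \<Longrightarrow> 0 \<le> tri_flux D field A B C"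
    by blast
  obtain s where s: "x = p + s *\<^sub>R d" using hor_eq_iff[of x p] x by auto
  have ex: "e \<bullet> x = e \<bullet> p" "k \<bullet> x = k \<bullet> p" using fe(2) kd(3) by (simp_all add: s inner_add_right)
  have ball: "ball x \<delta> \<subseteq> {x. \<bar>e \<bullet> x - e \<bullet> p\<bar> < \<delta> \<and> \<bar>k \<bullet> x - k \<bullet> p\<bar> < \<delta>}"
  proof
    fix y assume "y \<in> ball x \<delta>"
    then have "norm (y - x) < \<delta>" by (simp add: dist_norm norm_minus_commute)
    moreover have "\<bar>e \<bullet> (y - x)\<bar> \<le> norm (y - x)" "\<bar>k \<bullet> (y - x)\<bar> \<le> norm (y - x)"
      using Cauchy_Schwarz_ineq2[of e "y - x"] Cauchy_Schwarz_ineq2[of k "y - x"] e1 kd(1) by simp_all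
    ultimately show "y \<in> {x. \<bar>e \<bullet> x - e \<bullet> p\<bar> < \<delta> \<and> \<bar>k \<bullet> x - k \<bullet> p\<bar> < \<delta>}"
      unfolding inner_diff_right ex by simp
  qed
  show ?thesis unfolding outward_at_def
  proof (intro allI impI)
    fix \<epsilon> :: real assume \<epsilon>: "\<epsilon> > 0"
    have "- \<epsilon> * M\<^sup>2 \<le> tri_flux D field A B C" if "{A, B, C} \<subseteq> ball x \<delta>" "0 \<le> orient D A B C" for A B C M
    proof -
      have "{A, B, C} \<subseteq> {x. \<bar>e \<bullet> x - e \<bullet> p\<bar> < \<delta> \<and> \<bar>k \<bullet> x - k \<bullet> p\<bar> < \<delta>}" using that(1) ball by (rule order_trans)
      then have "0 \<le> tri_flux D field A B C" using that(2) by (rule \<delta>(2))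
      moreover have "0 \<le> \<epsilon> * M\<^sup>2" using \<epsilon> by simp
      ultimately show ?thesis by linarith
    qed
    then show "\<exists>\<delta>>0. \<forall>A B C L. {A, B, C} \<subseteq> ball x \<delta> \<longrightarrow> x \<in> convex hull {A, B, C} \<longrightarrow>
     0 \<le> orient D A B C \<longrightarrow> dist A B \<le> L \<longrightarrow> dist B C \<le> L \<longrightarrow> dist C A \<le> L \<longrightarrow>
     - \<epsilon> * L\<^sup>2 \<le> tri_flux D field A B C"
      using \<delta>(1) by blast
  qed
qed

section \<open>Sign of the flux and its consequences\<close>

lemma prism_over:
  assumes "p \<in> S" "hor p = hor x" "\<And>j. n j \<bullet> x < c j"
  shows "p \<in> S - C"
proof -
  have "n j \<bullet> p < c j" for j using assms(3)[of j] hor_simps(6)[of j p] hor_simps(6)[of j x] assms(2) by simp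
  then have "p \<notin> C" using C_wall[of p] by (metis less_irrefl)
  then show ?thesis using assms(1) by blast
qed

lemma field_outward:
  assumes x: "\<And>j. n j \<bullet> x < c j" and D: "D = \<tau> *\<^sub>R d"
  shows "outward_at D field x"
proof -
  obtain r where r: "r > 0" "continuous_on (ball x r) field" by (rule prism_ball[of x]) (use x in auto)
  show ?thesis
  proof (cases "\<exists>p\<in>L. hor p = hor x")
    case False
    obtain r' where r': "r' > 0" "\<And>x'. dist x' x < r' \<Longrightarrow> field x' = 0"
      using field_zero_near[OF _ False] prism_K0[OF x] by blast
    have "((\<lambda>_. 0) has_derivative (\<lambda>_. 0)) (at x)" by simp
    then have dz: "(field has_derivative (\<lambda>_. 0)) (at x)"
      by (rule has_derivative_transform_within_open[of _ _ _ _ "ball x r'"]) (use r' in \<open>auto simp: dist_commute\<close>)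
    show ?thesis by (rule outward_at_differentiable[OF dz r(2,1), where q = 0]) auto
  next
    case True
    then obtain p where p: "p \<in> L" "hor p = hor x" by blast
    have pC: "p \<in> S - C" by (rule prism_over[OF L_S[OF p(1)] p(2) x])
    then have pLC: "p \<in> L - C" using p by blast
    have nu: "0 \<le> N p \<bullet> d" using upward[OF pC] p(1) by (simp add: L_def)
    show ?thesis
    proof (cases "N p \<bullet> d = 0")
      case True
      then show ?thesis by (rule vertical_outward[OF pLC _ p(2) D])
    next
      case False
      then have nu': "0 < N p \<bullet> d" using nu by simp
      obtain f where f: "(field has_derivative f) (at x)"
        "\<And>a b. D \<bullet> cross3 (f a) b + D \<bullet> cross3 a (f b) = growth p * (D \<bullet> cross3 a b)"
        using field_derivative[OF pLC nu' p(2) D] by blast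
      show ?thesis by (rule outward_at_differentiable[OF f(1) r(2,1) f(2) growth_nonneg[OF p(1) nu']])
    qed
  qed
qed

lemma field_flux_nonneg:
  assumes "convex hull {x, y, z} \<subseteq> {x. \<forall>j. n j \<bullet> x < c j}" "0 \<le> orient D x y z" "D = \<tau> *\<^sub>R d"
  shows "0 \<le> tri_flux D field x y z"
proof (rule tri_flux_nonneg)
  have "convex hull {x, y, z} \<subseteq> K0" using assms(1) prism_K0 by blast
  then show "continuous_on (convex hull {x, y, z}) field" using field_cont continuous_on_subset by blast
  show "0 \<le> orient D x y z" by (rule assms(2))
  show "outward_at D field x'" if "x' \<in> convex hull {x, y, z}" for x'
    by (rule field_outward[OF _ assms(3)]) (use assms(1) that in blast)
qed

text \<open>On a short coordinate segment starting at \<open>p\<close>,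
  \<open>vertical_graph_decreasing\<close> provides a point of negative slope, and there
  \<open>N \<bullet> d\<close> is not zero.\<close>

lemma vertical_not_isolated:
  assumes p: "p \<in> L - C" and nu: "N p \<bullet> d = 0" and \<delta>: "\<delta> > 0"
  shows "\<exists>p'\<in>L - C. dist p' p < \<delta> \<and> 0 < N p' \<bullet> d"
proof -
  obtain r K Y Y' N1 where rK: "r > 0" and Yp: "Y (vector [cross3 (N p) d \<bullet> p, d \<bullet> p]) = p"
    and vg: "vertical_graph p r K Y Y' N1"
    using vertical_graph_exists[OF p nu] by blast
  note dec = vertical_graph_decreasing[OF p nu vg]
  define w0 where "w0 = (vector [cross3 (N p) d \<bullet> p, d \<bullet> p] :: real^2)"
  have w0c: "w0 $ 1 = cross3 (N p) d \<bullet> p" "w0 $ 2 = d \<bullet> p" by (simp_all add: w0_def)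
  have "(Y has_derivative Y' w0) (at w0)" using vg rK w0c unfolding vertical_graph_def by simp
  then have cY: "isCont Y w0" by (rule has_derivative_continuous)
  have Y0: "Y w0 = p" using Yp unfolding w0_def .
  obtain \<eta> where \<eta>: "\<eta> > 0" "\<And>w. dist w w0 < \<eta> \<Longrightarrow> dist (Y w) p < \<delta>"
    using isCont_near[OF cY \<delta>, unfolded Y0 eventually_nhds_metric] by blast
  define s where "s = min \<eta> r / 2"
  have s: "s > 0" "s < r" "s < \<eta>" using \<eta>(1) rK by (auto simp: s_def min_def)
  define w1 where "w1 = w0 + s *\<^sub>R axis 2 1"
  have w1c: "w1 $ 1 = w0 $ 1" "w1 $ 2 = w0 $ 2 + s" by (simp_all add: w1_def axis_def)
  let ?Q = "{w. \<bar>w $ 1 - cross3 (N p) d \<bullet> p\<bar> < r \<and> \<bar>w $ 2 - d \<bullet> p\<bar> < r}"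
  have wQ: "w0 \<in> ?Q" "w1 \<in> ?Q" using w0c w1c rK s by auto
  have lt: "w0 $ 2 < w1 $ 2" using w1c(2) s(1) by simp
  obtain x where x: "x \<in> ?Q" "x $ 1 = w0 $ 1" "w0 $ 2 < x $ 2" "x $ 2 < w1 $ 2" "N p \<bullet> Y' x (axis 2 1) < 0"
    using dec(4)[OF wQ w1c(1)[symmetric] lt] by blast
  have Yx: "Y x \<in> L - C" using vg x(1) unfolding vertical_graph_def by blast
  have "x - w0 = (x $ 2 - w0 $ 2) *\<^sub>R axis 2 1" using x(2) by (simp add: vec_eq_iff forall_2 axis_def)
  then have "dist x w0 = \<bar>x $ 2 - w0 $ 2\<bar>" by (simp add: dist_norm norm_axis_1)
  then have "dist x w0 < \<eta>" using x(3,4) w1c s by simp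
  then have "dist (Y x) p < \<delta>" by (rule \<eta>(2))
  moreover have "0 \<le> N (Y x) \<bullet> d" using upward[of "Y x"] Yx by (auto simp: L_def)
  moreover have "N (Y x) \<bullet> d \<noteq> 0" using dec(1)[OF x(1)] x(5) by auto
  ultimately show ?thesis using Yx by force
qed

text \<open>Copies of the whole cross section, shrunk towards a point on the vertical line through
  \<open>p\<close>, have nonpositive flux by \<open>tri_flux_homothetic_nonpos\<close>. For small
  copies the flux is \<open>growth p / 2\<close> times the orientation up to an error of smaller
  order.\<close>

lemma growth_nonpos:
  assumes p: "p \<in> L - C" and nu: "0 < N p \<bullet> d"
  shows "growth p \<le> 0"
proof -
  fix i :: 3
  have pL: "p \<in> L" using p by blast
  have pI: "n j \<bullet> p < c j" for j using S_not_C[of p] p L_S I_iff by blast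
  define D where "D = side_sign *\<^sub>R d"
  \<comment> \<open>The point of the vertical line through \<open>p\<close> in the plane of the
    three corners, which need not have equal heights; with nonnegative weights it is in their convex
    hull.\<close>
  define o' where "o' = (\<Sum>j\<in>UNIV. bary j p *\<^sub>R q j)"
  obtain s where s: "p = o' + s *\<^sub>R d" using bary_expansion[of p] unfolding o'_def by blast
  have ho: "hor p = hor o'" unfolding s by (simp add: hor_simps)
  have no: "n j \<bullet> o' < c j" for j using pI[of j] unfolding s by (simp add: inner_add_right nd)
  let ?K = "{x. \<forall>j. n j \<bullet> x < c j}"
  have nq: "n j \<bullet> q l \<le> c j" for j l by (simp add: q_plane less_imp_le[OF gap_pos])
  have m3: "i + 2 + 1 = i" "i + 1 + 1 = i + 2" by (simp_all add: mod3_simps)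
  define tri where "tri = (\<lambda>r j. o' + r *\<^sub>R (q j - o'))"
  have inK: "tri r j \<in> ?K" if "0 < r" "r < 1" for r j
  proof -
    have "n l \<bullet> tri r j < c l" for l
    proof -
      have "n l \<bullet> tri r j = (1 - r) * (n l \<bullet> o') + r * (n l \<bullet> q j)" by (simp add: tri_def inner_add_right inner_diff_right algebra_simps)
      also have "\<dots> < (1 - r) * c l + r * c l" using that no[of l] nq[of l j] by (intro add_less_le_mono mult_strict_left_mono mult_left_mono) auto
      finally show ?thesis by (simp add: algebra_simps)
    qed
    then show ?thesis by simp
  qed
  have le0: "tri_flux D field (tri r i) (tri r (i + 1)) (tri r (i + 2)) \<le> 0" if r: "0 < r" "r < 1" for r
    unfolding tri_def
  proof (rule tri_flux_homothetic_nonpos[where K = ?K and M = 2])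
    show "continuous_on ?K field" by (rule continuous_on_subset[OF field_cont]) (use prism_K0 in blast)
    show "norm (field x) \<le> 2" for x by (rule field_bound)
    show "0 \<le> tri_flux D field A B C" if "convex hull {A, B, C} \<subseteq> ?K" "0 \<le> orient D A B C" for A B C
      by (rule field_flux_nonneg[OF that D_def])
    show "convex ?K" by (rule prism_convex)
    show "o' \<in> ?K" using no by simp
    show "o' + r *\<^sub>R (u - o') \<in> ?K" if "u \<in> {q i, q (i + 1), q (i + 2)}" "0 < r" "r < 1" for r u
      using inK[OF that(2,3)] that(1) unfolding tri_def by blast
    show "0 \<le> orient D o' (q i) (q (i + 1))" unfolding D_def using orient_side[OF no, of i] by simp
    show "0 \<le> orient D o' (q (i + 1)) (q (i + 2))" unfolding D_def using orient_side[OF no, of "i + 1"] m3 by simp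
    show "0 \<le> orient D o' (q (i + 2)) (q i)" unfolding D_def using orient_side[OF no, of "i + 2"] m3 by simp
    show "0 < r" "r < 1" by (fact r)+
    fix u v and z :: real assume uv: "(u, v) \<in> {(q i, q (i + 1)), (q (i + 1), q (i + 2)), (q (i + 2), q i)}" and z: "z \<in> {0<..<1}"
    from uv have "u = q i \<and> v = q (i + 1) \<or> u = q (i + 1) \<and> v = q (i + 1 + 1) \<or> u = q (i + 2) \<and> v = q (i + 2 + 1)"
      unfolding m3 by auto
    then obtain j where j: "u = q j" "v = q (j + 1)" by blast
    define x1 where "x1 = q j + z *\<^sub>R (q (j + 1) - q j)"
    have nx: "n l \<bullet> x1 = (1 - z) * (n l \<bullet> q j) + z * (n l \<bullet> q (j + 1))" for l by (simp add: x1_def inner_add_right inner_diff_right algebra_simps)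
    have nx1: "n (j + 1) \<bullet> x1 = c (j + 1)" unfolding nx using q_on(2)[of j] q_on(1)[of "j + 1"] by (simp add: algebra_simps)
    have nx2: "n l \<bullet> x1 < c l" if "l \<noteq> j + 1" for l
    proof -
      have "n l \<bullet> q j < c l \<or> n l \<bullet> q (j + 1) < c l"
        using that gap_pos[of l] by (cases rule: cases_3_shift[of l j]) (auto simp: q_plane mod3_simps)
      then have "(1 - z) * (n l \<bullet> q j) + z * (n l \<bullet> q (j + 1)) < (1 - z) * c l + z * c l"
      proof
        assume "n l \<bullet> q j < c l"
        then show ?thesis using z nq[of l "j + 1"] by (intro add_less_le_mono mult_strict_left_mono mult_left_mono) auto
      next
        assume "n l \<bullet> q (j + 1) < c l"
        then show ?thesis using z nq[of l j] by (intro add_le_less_mono mult_strict_left_mono mult_left_mono) auto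
      qed
      then show ?thesis unfolding nx by (simp add: algebra_simps)
    qed
    have x1K: "x1 \<in> K0"
    proof -
      have "n l \<bullet> x1 \<le> c l" for l using nx1 nx2[of l] by (cases "l = j + 1") auto
      moreover have "hor x1 \<noteq> hor (q l)" for l
      proof
        assume h: "hor x1 = hor (q l)"
        have "n a \<bullet> x1 = n a \<bullet> q l" for a using hor_simps(6)[of a x1] hor_simps(6)[of a "q l"] h by simp
        then have "n l \<bullet> x1 = c l" "n (l + 1) \<bullet> x1 = c (l + 1)" using q_on[of l] by simp_all
        then have "l = j + 1" "l + 1 = j + 1" using nx2 by (metis less_irrefl)+
        then show False using mod3_simps(5)[of l] by simp
      qed
      ultimately show ?thesis by blast
    qed
    define xr where "xr = (\<lambda>r. o' + r *\<^sub>R (x1 - o'))"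
    have "(xr \<longlongrightarrow> o' + 1 *\<^sub>R (x1 - o')) (at_left 1)" unfolding xr_def by (intro tendsto_intros)
    then have lim: "(xr \<longlongrightarrow> x1) (at_left 1)" by simp
    have xrK: "xr r \<in> K0" if "0 < r" "r < 1" for r
    proof (rule prism_K0)
      fix l
      have "n l \<bullet> xr r = (1 - r) * (n l \<bullet> o') + r * (n l \<bullet> x1)" by (simp add: xr_def inner_add_right inner_diff_right algebra_simps)
      also have "\<dots> < (1 - r) * c l + r * c l" using that no[of l] x1K by (intro add_less_le_mono mult_strict_left_mono mult_left_mono) auto
      finally show "n l \<bullet> xr r < c l" by (simp add: algebra_simps)
    qed
    have ev: "\<forall>\<^sub>F r in at_left 1. xr r \<in> K0"
      unfolding eventually_at_left_field using xrK by (intro exI[of _ 0]) auto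
    have "((\<lambda>r. field (xr r)) \<longlongrightarrow> field x1) (at_left 1)"
      by (rule continuous_on_tendsto_compose[OF field_cont lim x1K ev])
    \<comment> \<open>Towards a point of the open side the field is continuous, and its limit is
      tangential to the wall, so the flux density tends to zero.\<close>
    then have "((\<lambda>r. D \<bullet> cross3 (field (xr r)) (q (j + 1) - q j)) \<longlongrightarrow> \<bar>side_coeff j\<bar> * (n (j + 1) \<bullet> field x1)) (at_left 1)"
      unfolding D_def side_triple by (intro tendsto_intros)
    then show "((\<lambda>r. D \<bullet> cross3 (field (o' + r *\<^sub>R (u + z *\<^sub>R (v - u) - o'))) (v - u)) \<longlongrightarrow> 0) (at_left 1)"
      unfolding j x1_def[symmetric] xr_def using field_wall[OF x1K nx1] by simp
  qed
  obtain f where f: "(field has_derivative f) (at o')"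
    "\<And>a b. D \<bullet> cross3 (f a) b + D \<bullet> cross3 a (f b) = growth p * (D \<bullet> cross3 a b)"
    using field_derivative[OF p nu ho D_def] by blast
  obtain r0 where r0: "r0 > 0" "continuous_on (ball o' r0) field" by (rule prism_ball[of o']) (use no in auto)
  define Ar where "Ar = orient D (q i) (q (i + 1)) (q (i + 2))"
  have "Ar > 0"
  proof -
    have "Ar = D \<bullet> cross3 (q (i + 1) - q i) (q (i + 2) - q (i + 1))"
      unfolding Ar_def by (simp add: Cross3.right_diff_distrib Cross3.left_diff_distrib inner_diff_right inner_add_right cross_refl triple_swap[of D "q (i + 1)" "q i"])
    also have "\<dots> = \<bar>side_coeff (i + 1)\<bar> * (n (i + 2) \<bullet> (q (i + 1) - q i))"
      using side_triple[of "q (i + 1) - q i" "i + 1"] m3 by (simp add: D_def)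
    also have "\<dots> > 0"
      using side_coeff_nz[of "i + 1"] q_in[of i] q_on(2)[of "i + 1"] m3 by (simp add: inner_diff_right)
    finally show ?thesis .
  qed
  define M where "M = dist (q i) (q (i + 1)) + dist (q (i + 1)) (q (i + 2)) + dist (q (i + 2)) (q i) + 1"
  have M: "M > 0" by (simp add: M_def add_nonneg_pos)
  have main: "growth p / 2 * Ar \<le> \<epsilon> * M\<^sup>2" if \<epsilon>: "\<epsilon> > 0" for \<epsilon>
  proof -
    obtain \<delta> where \<delta>: "\<delta> > 0" "\<And>A B C L. {A, B, C} \<subseteq> ball o' \<delta> \<Longrightarrow> o' \<in> convex hull {A, B, C} \<Longrightarrow>
      dist A B \<le> L \<Longrightarrow> dist B C \<le> L \<Longrightarrow> dist C A \<le> L \<Longrightarrow> \<bar>tri_flux D field A B C - growth p / 2 * orient D A B C\<bar> \<le> \<epsilon> * L\<^sup>2"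
      using tri_flux_approx[OF f(1) r0(2,1) f(2) \<epsilon>] by blast
    define R where "R = norm (q i - o') + norm (q (i + 1) - o') + norm (q (i + 2) - o') + 1"
    have R: "R > 0" by (simp add: R_def add_nonneg_pos)
    have Rj: "norm (q l - o') < R" for l
      using norm_ge_zero[of "q i - o'"] norm_ge_zero[of "q (i + 1) - o'"] norm_ge_zero[of "q (i + 2) - o'"]
      by (cases rule: cases_3_shift[of l i]) (auto simp: R_def simp del: norm_ge_zero)
    define r where "r = min (\<delta> / R) (1 / 2)"
    have r: "0 < r" "r < 1" "r * R \<le> \<delta>" using \<delta>(1) R by (auto simp: r_def min_def field_simps)
    have inb: "tri r l \<in> ball o' \<delta>" for l
    proof -
      have "dist o' (tri r l) = r * norm (q l - o')" using r(1) by (simp add: tri_def dist_norm)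
      also have "\<dots> < r * R" using r(1) Rj by simp
      finally show ?thesis using r(3) by simp
    qed
    have dt: "dist (tri r a) (tri r b) = r * dist (q a) (q b)" for a b
    proof -
      have "tri r a - tri r b = r *\<^sub>R (q a - q b)" by (simp add: tri_def algebra_simps)
      then show ?thesis using r(1) by (simp add: dist_norm)
    qed
    have bs: "bary i p + bary (i + 1) p + bary (i + 2) p = 1" using bary_sum[of p] unfolding sum_3_shift[of _ i] .
    have bo: "o' = bary i p *\<^sub>R q i + bary (i + 1) p *\<^sub>R q (i + 1) + bary (i + 2) p *\<^sub>R q (i + 2)"
      unfolding o'_def sum_3_shift[of _ i] ..
    have "bary i p *\<^sub>R tri r i + bary (i + 1) p *\<^sub>R tri r (i + 1) + bary (i + 2) p *\<^sub>R tri r (i + 2)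
      = (1 - r) *\<^sub>R ((bary i p + bary (i + 1) p + bary (i + 2) p) *\<^sub>R o') + r *\<^sub>R (bary i p *\<^sub>R q i + bary (i + 1) p *\<^sub>R q (i + 1) + bary (i + 2) p *\<^sub>R q (i + 2))"
      by (simp add: tri_def algebra_simps)
    also have "\<dots> = o'" unfolding bs bo[symmetric] by (simp add: algebra_simps)
    finally have bsum: "bary i p *\<^sub>R tri r i + bary (i + 1) p *\<^sub>R tri r (i + 1) + bary (i + 2) p *\<^sub>R tri r (i + 2) = o'" .
    have b0: "0 \<le> bary l p" for l by (rule bary_nonneg) (rule less_imp_le[OF pI])
    have hull: "o' \<in> convex hull {tri r i, tri r (i + 1), tri r (i + 2)}"
      unfolding convex_hull_3 mem_Collect_eq
      by (intro exI[of _ "bary i p"] exI[of _ "bary (i + 1) p"] exI[of _ "bary (i + 2) p"]) (simp add: bs b0 bsum)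
    have rM: "dist (tri r i) (tri r (i + 1)) \<le> r * M" "dist (tri r (i + 1)) (tri r (i + 2)) \<le> r * M" "dist (tri r (i + 2)) (tri r i) \<le> r * M"
      unfolding dt using r(1) by (auto intro!: mult_left_mono simp: M_def add_nonneg_nonneg)
    have ab: "\<bar>tri_flux D field (tri r i) (tri r (i + 1)) (tri r (i + 2)) - growth p / 2 * orient D (tri r i) (tri r (i + 1)) (tri r (i + 2))\<bar> \<le> \<epsilon> * (r * M)\<^sup>2"
      by (rule \<delta>(2)[OF _ hull rM]) (use inb in blast)
    have "growth p / 2 * orient D (tri r i) (tri r (i + 1)) (tri r (i + 2)) \<le> \<epsilon> * (r * M)\<^sup>2"
      using ab[unfolded abs_le_iff] le0[OF r(1,2)] by linarith
    moreover have "orient D (tri r i) (tri r (i + 1)) (tri r (i + 2)) = r\<^sup>2 * Ar"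
    proof -
      have "tri r (i + 1) - tri r i = r *\<^sub>R (q (i + 1) - q i)" "tri r (i + 2) - tri r i = r *\<^sub>R (q (i + 2) - q i)"
        by (simp_all add: tri_def algebra_simps)
      then show ?thesis by (simp add: Ar_def cross_mult_left cross_mult_right power2_eq_square)
    qed
    ultimately have "growth p / 2 * (r\<^sup>2 * Ar) \<le> \<epsilon> * (r * M)\<^sup>2" by simp
    \<comment> \<open>Both sides scale with the square of \<open>r\<close>, so the estimate at one
      small ratio is already independent of \<open>r\<close>.\<close>
    then have "r\<^sup>2 * (growth p / 2 * Ar) \<le> r\<^sup>2 * (\<epsilon> * M\<^sup>2)" by (simp add: power_mult_distrib mult_ac)
    then show ?thesis using r(1) by simp
  qed
  show ?thesis
  proof (rule ccontr)
    assume "\<not> growth p \<le> 0"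
    then have g: "growth p / 2 * Ar > 0" using \<open>Ar > 0\<close> by simp
    \<comment> \<open>With this choice \<open>\<epsilon> * M\<^sup>2\<close> is half of
      \<open>growth p / 2 * Ar\<close>, contradicting \<open>main\<close>.\<close>
    define \<epsilon> where "\<epsilon> = growth p / 2 * Ar / (2 * M\<^sup>2)"
    have "\<epsilon> > 0" using g M by (simp add: \<epsilon>_def)
    from main[OF this] show False using g M by (simp add: \<epsilon>_def mult.commute)
  qed
qed

text \<open>\<open>growth p\<close> is a sum of two nonnegative terms and is nonpositive, so both
  vanish. Above the level \<open>t\<close> the factors of \<open>1 - W p \<bullet> N p\<close> and
  of \<open>sg * (H - H0)\<close> are positive.\<close>

lemma rigid_interior:
  assumes p: "p \<in> L - C" and y: "t < yv p" and nu: "0 < N p \<bullet> d"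
  shows "N p = W p" "H = H0"
proof -
  have pL: "p \<in> L" using p by blast
  have omp: "om p > 0" by (rule om_pos[OF L_P[OF pL]])
  have h: "0 < cutoff (yv p - t)" "0 < cutoff' (yv p - t)" using y by (simp_all add: cutoff_bounds)
  define a where "a = cutoff' (yv p - t) / om p * (om p + N p \<bullet> d) / (N p \<bullet> d)"
  have a: "a > 0" using h omp nu by (simp add: a_def)
  have 1: "growth p = a * (1 - W p \<bullet> N p) + (sg * (H - H0)) * (2 * cutoff (yv p - t))"
    by (simp add: growth_def a_def mult_ac)
  have 2: "0 \<le> a * (1 - W p \<bullet> N p)" using a W_N_le_1[OF L_S[OF pL]] by simp
  have 3: "0 \<le> (sg * (H - H0)) * (2 * cutoff (yv p - t))" by (rule mult_nonneg_nonneg[OF sg(3)]) (use h in simp)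
  have "a * (1 - W p \<bullet> N p) = 0" "(sg * (H - H0)) * (2 * cutoff (yv p - t)) = 0"
    using growth_nonpos[OF p nu] 1 2 3 by linarith+
  then have WN: "W p \<bullet> N p = 1" and "sg * (H - H0) = 0" using a h by auto
  then show "H = H0" using sg(2) by auto
  have "W p \<bullet> W p = 1" "N p \<bullet> N p = 1" using W_norm[of p] L_P[OF pL] N_norm[OF L_S[OF pL]] by (simp_all add: norm_eq_1)
  then have "(W p - N p) \<bullet> (W p - N p) = 0" using WN by (simp add: inner_diff_left inner_diff_right inner_commute)
  then show "N p = W p" by simp
qed

text \<open>A point with horizontal normal is a limit of points with \<open>N = W\<close>, where
  \<open>N \<bullet> d = om\<close>. By continuity \<open>N p \<bullet> d\<close> would equal
  \<open>om p\<close>, which is positive.\<close>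

lemma upward_strict:
  assumes p: "p \<in> L - C" and y: "t < yv p"
  shows "0 < N p \<bullet> d"
proof (rule ccontr)
  assume "\<not> 0 < N p \<bullet> d"
  moreover have "0 \<le> N p \<bullet> d" using upward[of p] p by (auto simp: L_def)
  ultimately have nu: "N p \<bullet> d = 0" by simp
  have pS: "p \<in> S" using p L_S by blast
  have omp: "om p > 0" by (rule om_pos[OF P_S[OF pS]])
  have "continuous_on S (\<lambda>p. N p \<bullet> d - om p)" using N_cont cap_continuous_on(3) by (intro continuous_intros)
  then obtain r1 where r1: "r1 > 0" "\<And>p'. p' \<in> S \<Longrightarrow> dist p' p < r1 \<Longrightarrow> dist (N p' \<bullet> d - om p') (N p \<bullet> d - om p) < om p"
    using S_near[OF _ pS omp] by blast
  have "yv p - t > 0" using y by simp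
  then obtain r2 where r2: "r2 > 0" "\<And>p'. p' \<in> S \<Longrightarrow> dist p' p < r2 \<Longrightarrow> dist (yv p') (yv p) < yv p - t"
    using S_near[OF cap_continuous_on(1) pS] by blast
  have "min r1 r2 > 0" using r1(1) r2(1) by simp
  then obtain p' where p': "p' \<in> L - C" "dist p' p < min r1 r2" "0 < N p' \<bullet> d"
    using vertical_not_isolated[OF p nu] by blast
  have pS': "p' \<in> S" using p' L_S by blast
  have "t < yv p'" using r2(2)[OF pS'] p'(2) by (simp add: dist_real_def abs_if split: if_splits)
  then have "N p' = W p'" by (rule rigid_interior(1)[OF p'(1) _ p'(3)])
  then have "N p' \<bullet> d - om p' = 0" by (simp add: W_d)
  then show False using r1(2)[OF pS'] p'(2) nu omp by (simp add: dist_real_def)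
qed

text \<open>Interior points are dense in \<open>S\<close>, and \<open>N\<close> and \<open>W\<close>
  are continuous up to the contact lines.\<close>

lemma rigid:
  assumes p: "p \<in> S" and y: "t < yv p"
  shows "N p = W p" "H = H0"
proof -
  have near: "\<exists>p'\<in>L - C. dist p' p < r \<and> N p' = W p' \<and> H = H0" if r: "r > 0" for r
  proof -
    have "yv p - t > 0" using y by simp
    then obtain r2 where r2: "r2 > 0" "\<And>p'. p' \<in> S \<Longrightarrow> dist p' p < r2 \<Longrightarrow> dist (yv p') (yv p) < yv p - t"
      using S_near[OF cap_continuous_on(1) p] by blast
    have "min r r2 > 0" using r r2(1) by simp
    then obtain p' where p': "p' \<in> S - C" "dist p' p < min r r2" using interior_dense[OF p] by blast
    have "t < yv p'" using r2(2)[of p'] p' by (simp add: dist_real_def abs_if split: if_splits)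
    moreover have "p' \<in> L - C" using p' calculation t't by (auto simp: L_def)
    ultimately show ?thesis using rigid_interior[of p'] upward_strict[of p'] p'(2) by (intro bexI[of _ p']) auto
  qed
  show "H = H0" using near[of 1] by auto
  show "N p = W p"
  proof (rule ccontr)
    assume "N p \<noteq> W p"
    then have e: "norm (N p - W p) > 0" by simp
    have "continuous_on S (\<lambda>p. norm (N p - W p))" using N_cont cap_continuous_on(2) by (intro continuous_intros)
    then obtain r where r: "r > 0" "\<And>p'. p' \<in> S \<Longrightarrow> dist p' p < r \<Longrightarrow> dist (norm (N p' - W p')) (norm (N p - W p)) < norm (N p - W p)"
      using S_near[OF _ p e] by blast
    obtain p' where p': "p' \<in> L - C" "dist p' p < r" "N p' = W p'" using near[OF r(1)] by blast
    have "p' \<in> S" using p'(1) L_S by blast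
    from r(2)[OF this p'(2)] show False by (simp add: p'(3) dist_real_def)
  qed
qed

text \<open>The derivative of \<open>yv\<close> along the surface is a multiple of the component
  along \<open>W\<close>, which vanishes on tangent vectors since \<open>W = N\<close>. The half
  ball of parameters is convex, so points of the contact lines are covered as well.\<close>

lemma level_locally_constant:
  assumes p: "p \<in> S" and y: "t < yv p"
  shows "\<exists>\<rho>>0. \<forall>p'\<in>S. dist p' p < \<rho> \<longrightarrow> yv p' = yv p"
proof -
  obtain U X w0 where ch: "C2_chart S C U X" "w0 \<in> U" "0 \<le> w0 $ 2" "X w0 = p" by (rule chart_at[OF p])
  note cf = C2_chart_facts[OF ch(1)]
  have "isCont yv (X w0)" using isCont_cap(1)[OF P_S[OF p]] ch(4) by simp
  then have "isCont (\<lambda>w. yv (X w)) w0" by (rule isCont_o2[OF C2_on_partial_isCont(1)[OF cf(2) ch(2)]])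
  then have ev: "\<forall>\<^sub>F w in nhds w0. t < yv (X w)" by (rule isCont_eventually(2)) (use y ch(4) in simp)
  have "\<forall>\<^sub>F w in nhds w0. w \<in> U" using cf(1) ch(2) eventually_nhds by blast
  from eventually_conj[OF ev this] obtain \<delta> where \<delta>: "\<delta> > 0" "\<And>w. dist w w0 < \<delta> \<Longrightarrow> t < yv (X w) \<and> w \<in> U"
    unfolding eventually_nhds_metric by blast
  define B where "B = ball w0 \<delta> \<inter> {w. 0 \<le> w $ 2}"
  have "{w :: real^2. 0 \<le> w $ 2} = {w. axis 2 1 \<bullet> w \<ge> 0}" by (simp add: inner_axis' )
  then have conv: "convex B" unfolding B_def by (simp add: convex_Int convex_halfspace_ge)
  have dz: "((\<lambda>w. yv (X w)) has_derivative (\<lambda>h. 0)) (at w within B)" if w: "w \<in> B" for w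
  proof -
    have wU: "w \<in> U" "0 \<le> w $ 2" "t < yv (X w)" using \<delta>(2)[of w] w by (auto simp: B_def dist_commute)
    have XS: "X w \<in> S" by (rule cf(4)[OF wU(1,2)])
    have NW: "N (X w) = W (X w)" by (rule rigid(1)[OF XS wU(3)])
    have "((\<lambda>w. yv (X w)) has_derivative (\<lambda>z. sg * ((W (X w) \<bullet> frechet_derivative X (at w) z) / om (X w)))) (at w)"
      by (rule has_derivative_compose[OF partial_has_derivative(1)[OF cf(2) wU(1)] yv_has_derivative[OF P_S[OF XS]]])
    then have "((\<lambda>w. yv (X w)) has_derivative (\<lambda>z. 0)) (at w)"
      using N_orth[OF ch(1) wU(1,2)] unfolding NW by simp
    then show ?thesis by (rule has_derivative_at_withinI)
  qed
  have "\<exists>k. \<forall>w\<in>B. yv (X w) = k" by (rule has_derivative_zero_constant[OF conv dz])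
  then obtain k where k: "\<And>w. w \<in> B \<Longrightarrow> yv (X w) = k" by blast
  have "w0 \<in> B" using \<delta>(1) ch(3) by (simp add: B_def)
  then have kp: "k = yv p" using k ch(4) by metis
  obtain \<rho> where \<rho>: "\<rho> > 0" "\<And>p'. p' \<in> S \<Longrightarrow> dist p' p < \<rho> \<Longrightarrow> \<exists>w\<in>U. 0 \<le> w $ 2 \<and> dist w w0 < \<delta> \<and> X w = p'"
    using chart_near[OF ch(1-3) \<delta>(1)] unfolding ch(4) by blast
  have "yv p' = yv p" if p': "p' \<in> S" "dist p' p < \<rho>" for p'
  proof -
    obtain w where w: "0 \<le> w $ 2" "dist w w0 < \<delta>" "X w = p'" using \<rho>(2)[OF p'] by blast
    then have "w \<in> B" by (simp add: B_def dist_commute)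
    then show ?thesis using k w(3) kp by metis
  qed
  then show ?thesis using \<rho>(1) by blast
qed

lemma S_connected: "connected S"
proof -
  have "ball 0 1 \<subseteq> D0" using disk_facts(2) by auto
  moreover have "D0 \<subseteq> closure (ball 0 1)" by auto
  ultimately have "connected D0" by (intro connected_intermediate_closure[OF connected_ball])
  then show ?thesis unfolding S by (rule connected_continuous_image[OF phi_cont])
qed

lemma spherical:
  assumes p: "p \<in> S" and y: "t < yv p"
  shows "(H \<noteq> 0 \<longrightarrow> portion_of_sphere S) \<and> (H = 0 \<longrightarrow> portion_of_plane S)"
proof -
  define T where "T = {p' \<in> S. yv p' = yv p}"
  have "closedin (top_of_set S) T"
    unfolding T_def by (rule continuous_closedin_preimage_constant[OF cap_continuous_on(1)])
  moreover have "openin (top_of_set S) T"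
    unfolding openin_contains_ball
  proof (intro conjI ballI)
    show "T \<subseteq> S" by (auto simp: T_def)
    fix a assume "a \<in> T"
    then have a: "a \<in> S" "yv a = yv p" by (auto simp: T_def)
    then obtain \<rho> where "\<rho> > 0" "\<And>p'. p' \<in> S \<Longrightarrow> dist p' a < \<rho> \<Longrightarrow> yv p' = yv a"
      using level_locally_constant[of a] y by auto
    then show "\<exists>e>0. ball a e \<inter> S \<subseteq> T" using a(2) by (intro exI[of _ \<rho>]) (auto simp: T_def dist_commute)
  qed
  ultimately have "T = {} \<or> T = S" using S_connected unfolding connected_clopen by blast
  then have TS: "T = S" using p by (auto simp: T_def)
  have "height p' = sg * yv p" if "p' \<in> S" for p'
  proof -
    have "sg * height p' = yv p" using that TS by (auto simp: T_def yv_def)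
    then have "sg * (sg * height p') = sg * yv p" by simp
    then show ?thesis using sg(1) by (simp add: mult.assoc[symmetric])
  qed
  then have "(H0 \<noteq> 0 \<longrightarrow> portion_of_sphere S) \<and> (H0 = 0 \<longrightarrow> portion_of_plane S)"
    by (intro height_level_set P_S) auto
  then show ?thesis using rigid(2)[OF p y] by simp
qed

end

lemma (in capillary_drop) metrically_spherical:
  "(H \<noteq> 0 \<longrightarrow> portion_of_sphere S) \<and> (H = 0 \<longrightarrow> portion_of_plane S)"
proof -
  obtain t' where ex: "\<exists>p\<in>S. t' < yv p"
    and sheet: "\<And>p p'. p \<in> S \<Longrightarrow> p' \<in> S \<Longrightarrow> hor p = hor p' \<Longrightarrow> t' < yv p \<Longrightarrow> t' < yv p' \<Longrightarrow> p = p'"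
    and up: "\<And>p. p \<in> S - C \<Longrightarrow> t' < yv p \<Longrightarrow> 0 \<le> N p \<bullet> d"
    by (rule good_level, rule that; assumption)
  obtain p where p: "p \<in> S" "t' < yv p" using ex by blast
  \<comment> \<open>The midpoint lies strictly above \<open>t'\<close>, as the cutoff requires, and
    strictly below \<open>yv p\<close>.\<close>
  interpret graph_cap n c d q \<gamma> H0 y0 m b V v \<phi> I S C \<Omega> N H t' "(t' + yv p) / 2"
    by unfold_locales (use p sheet up in \<open>auto simp: field_simps\<close>)
  show ?thesis by (rule spherical[OF p(1)]) (use p(2) in \<open>simp add: field_simps\<close>)
qed

theorem theorem4:
  fixes n :: "3 \<Rightarrow> real^3" and c :: "3 \<Rightarrow> real" and d m :: "real^3" and b :: real
    and V :: "(real^2) set" and v :: "3 \<Rightarrow> real^2" and \<phi> :: "real^2 \<Rightarrow> real^3"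
    and I S C \<Omega> :: "(real^3) set" and N :: "real^3 \<Rightarrow> real^3"
    and H :: real and \<gamma> :: "3 \<Rightarrow> real"
  assumes container: "cylindrical_container n c d m b"
    and I: "I = container n c m b"
    and S: "S = \<phi> ` (cball 0 1 - V)"
    and C: "C = \<phi> ` (sphere 0 1 - V)"
    and disk: "embedded_disk_type (container_planes n c m b) I V \<phi>"
    and three_vertices: "V = range v" "inj v"
    and vertex: "vertex_condition (container_planes n c m b) I V \<phi>"
    and one_on_each_edge: "\<And>i. vertex_on_edge I V \<phi> (v i) (plane (n i) (c i)) (plane (n (i + 1)) (c (i + 1)))"
    and drop: "drop_region I S (plane m b) \<Omega>"
    and normal: "outward_unit_normal S C \<Omega> N"
    and cmc: "constant_mean_curvature S C N H"
    and contact_range: "\<And>j. 0 < \<gamma> j \<and> \<gamma> j < pi"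
    and contact_angle: "\<And>j p. p \<in> C \<inter> plane (n j) (c j) \<Longrightarrow> N p \<bullet> n j = - cos (\<gamma> j)"
    and data: "\<And>j k. j \<noteq> k \<Longrightarrow>
      (\<gamma> j, \<gamma> k) \<in> interior (data_Q (dihedral_angle (n j) (n k) / 2))
                 \<union> data_Q_D1_segments (dihedral_angle (n j) (n k) / 2)"
  shows "(H \<noteq> 0 \<longrightarrow> portion_of_sphere S) \<and> (H = 0 \<longrightarrow> portion_of_plane S)"
proof -
  \<comment> \<open>The generating direction is reversed if necessary, so that it points away from
    the base.\<close>
  define d' where "d' = (if m \<bullet> d < 0 then d else - d)"
  have d': "norm d' = 1" "\<And>j. n j \<bullet> d' = 0" "m \<bullet> d' < 0"
    using container by (auto simp: d'_def cylindrical_container_def)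
  have n1: "\<And>j. norm (n j) = 1" and cr: "\<And>j k. j \<noteq> k \<Longrightarrow> cross3 (n j) (n k) \<noteq> 0"
    using container by (auto simp: cylindrical_container_def)
  have "\<forall>i. \<exists>q. \<exists>e h u. local_graph I V \<phi> (v i) (plane (n i) (c i)) (plane (n (i + 1)) (c (i + 1))) e h q u"
    using one_on_each_edge unfolding vertex_on_edge_def by blast
  \<comment> \<open>The corners are the feet of the local graphs, so their heights depend on the
    vertices.\<close>
  then obtain q where q: "\<And>i. \<exists>e h u. local_graph I V \<phi> (v i) (plane (n i) (c i)) (plane (n (i + 1)) (c (i + 1))) e h (q i) u"
    by metis
  have q_on: "n i \<bullet> q i = c i" "n (i + 1) \<bullet> q i = c (i + 1)" and q_cl: "q i \<in> closure I" for i
  proof -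
    obtain e h u where lg: "local_graph I V \<phi> (v i) (plane (n i) (c i)) (plane (n (i + 1)) (c (i + 1))) e h (q i) u"
      using q by blast
    then have "plane (n i) (c i) \<inter> plane (n (i + 1)) (c (i + 1)) \<inter> plane e h = {q i}" unfolding local_graph_def by blast
    then have "q i \<in> plane (n i) (c i)" "q i \<in> plane (n (i + 1)) (c (i + 1))" by blast+
    then show "n i \<bullet> q i = c i" "n (i + 1) \<bullet> q i = c (i + 1)" by (simp_all add: plane_def)
    obtain A where "nbhd_in (plane e h \<inter> closure I) (q i) A" using lg unfolding local_graph_def by blast
    then show "q i \<in> closure I" unfolding nbhd_in_def by blast
  qed
  \<comment> \<open>A foot on the third wall would be common to all three walls, which a nonempty
    bounded cross section excludes.\<close>
  have q_in: "n (i + 2) \<bullet> q i < c (i + 2)" for i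
  proof -
    have "I \<subseteq> {x. n (i + 2) \<bullet> x \<le> c (i + 2)}" unfolding I by (auto simp: container_def prism_def less_imp_le)
    then have "closure I \<subseteq> {x. n (i + 2) \<bullet> x \<le> c (i + 2)}" by (rule closure_minimal) (rule closed_halfspace_le)
    then have le: "n (i + 2) \<bullet> q i \<le> c (i + 2)" using q_cl[of i] by blast
    have "n (i + 2) \<bullet> q i \<noteq> c (i + 2)"
    proof
      assume h: "n (i + 2) \<bullet> q i = c (i + 2)"
      have "q i \<in> plane (n j) (c j)" for j
        using q_on[of i] h by (cases rule: cases_3_shift[of j i]) (auto simp: plane_def)
      then show False using no_common_point_of_walls[OF container] by blast
    qed
    then show ?thesis using le by simp
  qed
  interpret prism: triangular_prism n c d' q
    by unfold_locales (use n1 d' cr q_on q_in in auto)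
  obtain H0 y0 where cap: "y0 \<bullet> d' = 0" "\<And>j. n j \<bullet> y0 - H0 * c j = - cos (\<gamma> j)"
    by (rule prism.cap_exists[of "\<lambda>j. - cos (\<gamma> j)"], rule that; assumption)
  interpret capillary_drop n c d' q \<gamma> H0 y0 m b V v \<phi> I S C \<Omega> N H
  proof unfold_locales
    show "p \<in> C \<inter> plane (n j) (c j) \<Longrightarrow> N p \<bullet> n j = - cos (\<gamma> j)" for p j by (rule contact_angle)
    show "j \<noteq> k \<Longrightarrow> (\<gamma> j, \<gamma> k) \<in> interior (data_Q (dihedral_angle (n j) (n k) / 2))
                 \<union> data_Q_D1_segments (dihedral_angle (n j) (n k) / 2)" for j k by (rule data)
  qed (use cap contact_range d' I S C disk three_vertices q drop normal cmc in blast)+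
  show ?thesis by (rule metrically_spherical)
qed

end
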